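(* Let $d\ge 1$, $\alpha\in(0,2)$, and let $K$, $\mathcal L_\varepsilon$, $\bar{\mathcal L}$ be as in the context. Suppose that $D$ is a bounded $C^{1,1}$ domain in $\mathbb R^d$, and let $h\in C^{\beta}_{(\alpha/2)}(D)$ with $\alpha+\beta>4$, where neither $\beta$ nor $\alpha+\beta$ is an integer. For $\varepsilon\in(0,1)$ let $u_\varepsilon$ be the unique solution of $$\mathcal L_\varepsilon u_\varepsilon=h \ \text{ on } D,\qquad u_\varepsilon=0\ \text{ on } D^c,$$ and let $\bar u$ be the unique solution of $$\bar{\mathcal L}\bar u=h\ \text{ on } D,\qquad \bar u=0\ \text{ on } D^c.$$ Then there exists a constant $C_1>0$ (independent of $\varepsilon$) such that for all $\varepsilon\in(0,1)$, $$\|u_\varepsilon-\bar u\|_{L^1(D;dx)}\le C_1\begin{cases}\varepsilon^{\alpha/2}, & \alpha\in(0,1),\\ \varepsilon^{1/2}(1+|\log\varepsilon|^2), & \alpha=1,\\ \varepsilon^{(2-\alpha)/2}, & \alpha\in(1,2).\end{cases}$$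
   Context: Coefficient. $K\in C^2(\mathbb R^d\times\mathbb R^d)$ is multivariate 1-periodic, i.e. $K(x+k,y+l)=K(x,y)$ for all $k,l\in\mathbb Z^d$, symmetric, $K(x,y)=K(y,x)$, and satisfies $\Lambda^{-1}\le K(x,y)\le\Lambda$ for all $x,y$, for some constant $\Lambda\ge1$. Put $\bar K:=\iint_{\mathbb T^d\times\mathbb T^d}K(x,y)\,dx\,dy$, with $\mathbb T^d=\mathbb R^d/\mathbb Z^d$. Operators. For $f\in C_c^2(\mathbb R^d)$, $$\mathcal L_\varepsilon f(x)=\mathrm{p.v.}\int_{\mathbb R^d}(f(y)-f(x))\frac{K(x/\varepsilon,y/\varepsilon)}{|x-y|^{d+\alpha}}\,dy,\qquad \bar{\mathcal L}f(x)=\mathrm{p.v.}\int_{\mathbb R^d}(f(y)-f(x))\frac{\bar K}{|x-y|^{d+\alpha}}\,dy .$$ The associated Dirichlet form is $\mathcal E^\varepsilon(u,v)=\frac12\iint_{\mathbb R^d\times\mathbb R^d}(u(x)-u(y))(v(x)-v(y))\frac{K(x/\varepsilon,y/\varepsilon)}{|x-y|^{d+\alpha}}\,dx\,dy$. Let $W^{\alpha/2,2}_0(D)$ be the closure of $C_c^2(D)$ in the norm $\|u\|_{\alpha/2,2}=\big(\iint\frac{(u(x)-u(y))^2}{|x-y|^{d+\alpha}}dx\,dy+\int u^2dx\big)^{1/2}$ (functions vanish on $D^c$). $\mathrm{Dom}(\mathcal L_\varepsilon^D)$ is the domain of the $L^2(D;dx)$-generator of $(\mathcal E^\varepsilon,W_0^{\alpha/2,2}(D))$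 (the operator $\mathcal L_\varepsilon$ with zero Dirichlet condition on $D^c$). Solutions. $u_\varepsilon$ is the unique element of $\mathrm{Dom}(\mathcal L_\varepsilon^D)$ with $\mathcal L_\varepsilon u_\varepsilon=h$ on $D$; equivalently $u_\varepsilon\in W_0^{\alpha/2,2}(D)$ and $\mathcal E^\varepsilon(u_\varepsilon,g)=-\int_D hg\,dx$ for all $g\in W_0^{\alpha/2,2}(D)$. The solution $\bar u$ is the unique solution in $C^{\alpha+\beta}_{(-\alpha/2)}(D)\cap C(\bar D)$. Weighted Hölder spaces. Let $\delta_D(x)=\mathrm{dist}(x,\partial D)$ for $x\in D$. For $\theta\in\mathbb R$, $k$ a nonnegative integer, and $0<\gamma\notin\mathbb N$ with integer part $[\gamma]$, $$[f]^{(\theta)}_{k;D}=\sup_{x\in D}\delta_D(x)^{k+\theta}|\nabla^kf(x)|,\qquad [f]^{(\theta)}_{\gamma;D}=\sup_{x,y\in D}\min(\delta_D(x),\delta_D(y))^{\gamma+\theta}\frac{|\nabla^{[\gamma]}f(x)-\nabla^{[\gamma]}f(y)|}{|x-y|^{\gamma-[\gamma]}},$$ and $C^\gamma_{(\theta)}(D)$ is the set of $f\in C(\mathbb R^d)$ with $f=0$ on $D^c$ and $\|f\|^{(\theta)}_{\gamma;D}:=[f]^{(\theta)}_{0;D}+[f]^{(\theta)}_{\gamma;D}<\infty$. *)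

theory Defs
  imports "HOL-Analysis.Analysis"
begin

fun partial_deriv :: "'a list \<Rightarrow> ('a::euclidean_space \<Rightarrow> real) \<Rightarrow> 'a \<Rightarrow> real" where
  "partial_deriv [] f = f"
| "partial_deriv (b # bs) f = (\<lambda>x. frechet_derivative (partial_deriv bs f) (at x) b)"

text \<open>Multi-indices of order \<open>k\<close>, as the lists of coordinate directions \<open>(i\<^sub>1, \<dots>, i\<^sub>k)\<close>.\<close>

definition directions :: "nat \<Rightarrow> 'a::euclidean_space list set" where
  "directions k = {bs. set bs \<subseteq> Basis \<and> length bs = k}"

text \<open>\<open>C\<^sup>k(S)\<close> for open \<open>S\<close>. Differentiability is demanded separately, because
  \<^const>\<open>frechet_derivative\<close> is unspecified where the function is not differentiable.\<close>

definition C_k :: "nat \<Rightarrow> 'a::euclidean_space set \<Rightarrow> ('a \<Rightarrow> real) \<Rightarrow> bool" where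
  "C_k k S f \<longleftrightarrow>
     (\<forall>j<k. \<forall>bs\<in>directions j. \<forall>x\<in>S. partial_deriv bs f differentiable (at x)) \<and>
     (\<forall>j\<le>k. \<forall>bs\<in>directions j. continuous_on S (partial_deriv bs f))"

definition Cc2 :: "'a::euclidean_space set \<Rightarrow> ('a \<Rightarrow> real) set" where
  "Cc2 D = {f. C_k 2 UNIV f \<and> compact (closure {x. f x \<noteq> 0}) \<and> closure {x. f x \<noteq> 0} \<subseteq> D}"

definition int_lattice :: "'a::euclidean_space set" where
  "int_lattice = {k. \<forall>b\<in>Basis. k \<bullet> b \<in> \<int>}"

text \<open>The torus is identified with the unit cube; its boundary is a null set.\<close>

definition torus_mean :: "('a::euclidean_space \<Rightarrow> 'a \<Rightarrow> real) \<Rightarrow> real" where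
  "torus_mean K =
     (\<integral>(x, y)\<in>cbox 0 One \<times> cbox 0 One. K x y \<partial>(lborel \<Otimes>\<^sub>M lborel))"

text \<open>The operators and forms below take a coefficient \<open>\<kappa>(x,y)\<close>; the oscillating one
  is \<open>osc \<epsilon> K\<close> and the homogenized one is the constant \<open>torus_mean K\<close>.
  On the diagonal the kernel has the value \<open>0\<close>, since division by \<open>0\<close> gives \<open>0\<close>.\<close>

definition osc :: "real \<Rightarrow> ('a::euclidean_space \<Rightarrow> 'a \<Rightarrow> real) \<Rightarrow> 'a \<Rightarrow> 'a \<Rightarrow> real" where
  "osc \<epsilon> K x y = K (x /\<^sub>R \<epsilon>) (y /\<^sub>R \<epsilon>)"

definition jump_kernel ::
    "real \<Rightarrow> ('a::euclidean_space \<Rightarrow> 'a \<Rightarrow> real) \<Rightarrow> 'a \<Rightarrow> 'a \<Rightarrow> real" where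
  "jump_kernel \<alpha> \<kappa> x y = \<kappa> x y / norm (x - y) powr (real DIM('a) + \<alpha>)"

text \<open>The principal value
  \<open>p.v. \<integral> (f(y) - f(x)) \<kappa>(x,y) / |x - y|\<^bsup>d+\<alpha>\<^esup> dy\<close> exists and equals \<open>l\<close>.\<close>

definition has_nonlocal_op ::
    "real \<Rightarrow> ('a::euclidean_space \<Rightarrow> 'a \<Rightarrow> real) \<Rightarrow> ('a \<Rightarrow> real) \<Rightarrow> 'a \<Rightarrow> real \<Rightarrow> bool" where
  "has_nonlocal_op \<alpha> \<kappa> f x l \<longleftrightarrow>
     (\<forall>r>0. set_integrable lborel {y. r < norm (x - y)} (\<lambda>y. (f y - f x) * jump_kernel \<alpha> \<kappa> x y)) \<and>
     ((\<lambda>r. \<integral>y\<in>{y. r < norm (x - y)}. (f y - f x) * jump_kernel \<alpha> \<kappa> x y \<partial>lborel)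
        \<longlongrightarrow> l) (at_right 0)"

definition dirichlet_form ::
    "real \<Rightarrow> ('a::euclidean_space \<Rightarrow> 'a \<Rightarrow> real) \<Rightarrow> ('a \<Rightarrow> real) \<Rightarrow> ('a \<Rightarrow> real) \<Rightarrow> real" where
  "dirichlet_form \<alpha> \<kappa> u v =
     1/2 * (\<integral>(x, y). (u x - u y) * (v x - v y) * jump_kernel \<alpha> \<kappa> x y \<partial>(lborel \<Otimes>\<^sub>M lborel))"

definition frac_norm_sq :: "real \<Rightarrow> ('a::euclidean_space \<Rightarrow> real) \<Rightarrow> ennreal" where
  "frac_norm_sq \<alpha> u =
     (\<integral>\<^sup>+(x, y). ennreal ((u x - u y)\<^sup>2 / norm (x - y) powr (real DIM('a) + \<alpha>))
        \<partial>(lborel \<Otimes>\<^sub>M lborel))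
     + (\<integral>\<^sup>+x. ennreal ((u x)\<^sup>2) \<partial>lborel)"

text \<open>\<open>W\<^sub>0\<^bsup>\<alpha>/2,2\<^esup>(D)\<close>, by Borel representatives on the whole space. Its members vanish
  almost everywhere off \<open>D\<close>, as limits of functions supported in \<open>D\<close>.\<close>

definition W0 :: "real \<Rightarrow> 'a::euclidean_space set \<Rightarrow> ('a \<Rightarrow> real) set" where
  "W0 \<alpha> D = {u \<in> borel_measurable borel.
     \<exists>\<phi>. (\<forall>n::nat. \<phi> n \<in> Cc2 D) \<and> (\<lambda>n. frac_norm_sq \<alpha> (\<lambda>x. \<phi> n x - u x)) \<longlonglongrightarrow> 0}"

definition L2_on :: "'a::euclidean_space set \<Rightarrow> ('a \<Rightarrow> real) set" where
  "L2_on D = {f. set_borel_measurable borel D f \<and> set_integrable lborel D (\<lambda>x. (f x)\<^sup>2)}"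

text \<open>The graph of the \<open>L\<^sup>2(D)\<close>-generator of the form on \<open>W0 \<alpha> D\<close>; its \<^const>\<open>Domain\<close> is the
  domain of the generator.\<close>

definition dirichlet_generator ::
    "real \<Rightarrow> ('a::euclidean_space \<Rightarrow> 'a \<Rightarrow> real) \<Rightarrow> 'a set \<Rightarrow> (('a \<Rightarrow> real) \<times> ('a \<Rightarrow> real)) set" where
  "dirichlet_generator \<alpha> \<kappa> D = {(u, f). u \<in> W0 \<alpha> D \<and> f \<in> L2_on D \<and>
     (\<forall>g\<in>W0 \<alpha> D. dirichlet_form \<alpha> \<kappa> u g = - (\<integral>x\<in>D. f x * g x \<partial>lborel))}"

definition bdist :: "'a::euclidean_space set \<Rightarrow> 'a \<Rightarrow> real" where
  "bdist D x = infdist x (frontier D)"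

text \<open>The tensors \<open>\<nabla>\<^sup>kf(x)\<close> are measured in the Euclidean norm of their components.\<close>

definition weighted_sup ::
    "'a::euclidean_space set \<Rightarrow> nat \<Rightarrow> real \<Rightarrow> ('a \<Rightarrow> real) \<Rightarrow> ennreal" where
  "weighted_sup D k \<theta> f =
     (SUP x\<in>D. ennreal (bdist D x powr (real k + \<theta>)
        * sqrt (\<Sum>bs\<in>directions k. (partial_deriv bs f x)\<^sup>2)))"

definition weighted_hoelder_seminorm ::
    "'a::euclidean_space set \<Rightarrow> real \<Rightarrow> real \<Rightarrow> ('a \<Rightarrow> real) \<Rightarrow> ennreal" where
  "weighted_hoelder_seminorm D \<gamma> \<theta> f =
     (SUP (x, y)\<in>{(x, y). x \<in> D \<and> y \<in> D \<and> x \<noteq> y}.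
        ennreal (min (bdist D x) (bdist D y) powr (\<gamma> + \<theta>)
          * (sqrt (\<Sum>bs\<in>directions (nat \<lfloor>\<gamma>\<rfloor>). (partial_deriv bs f x - partial_deriv bs f y)\<^sup>2)
             / norm (x - y) powr (\<gamma> - of_int \<lfloor>\<gamma>\<rfloor>))))"

definition weighted_hoelder ::
    "'a::euclidean_space set \<Rightarrow> real \<Rightarrow> real \<Rightarrow> ('a \<Rightarrow> real) set" where
  "weighted_hoelder D \<gamma> \<theta> = {f. continuous_on UNIV f \<and> (\<forall>x. x \<notin> D \<longrightarrow> f x = 0) \<and>
     C_k (nat \<lfloor>\<gamma>\<rfloor>) D f \<and>
     weighted_sup D 0 \<theta> f + weighted_hoelder_seminorm D \<gamma> \<theta> f < \<infinity>}"

text \<open>Near each boundary point \<open>z\<close>, in an orthonormal coordinate system with origin \<open>z\<close> and last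
  axis \<open>e\<close>, the set is the region above the graph of a \<open>C\<^bsup>1,1\<^esup>\<close> function \<open>\<phi>\<close> with gradient \<open>G\<close>.
  The first \<open>d - 1\<close> coordinates are represented by the hyperplane \<open>H\<close> orthogonal to \<open>e\<close>; for
  \<open>d = 1\<close> it is a point, and the set is locally a half-line.\<close>

definition C11_domain :: "'a::euclidean_space set \<Rightarrow> bool" where
  "C11_domain D \<longleftrightarrow> open D \<and> connected D \<and> D \<noteq> {} \<and>
     (\<exists>R>0. \<exists>M>0. \<forall>z\<in>frontier D. \<exists>e \<phi> G. norm e = 1 \<and>
        (let H = {v. v \<bullet> e = 0} in
          \<phi> 0 = 0 \<and> G 0 = 0 \<and>
          (\<forall>v\<in>H. G v \<in> H \<and> norm (G v) \<le> M \<and>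
             (\<phi> has_derivative (\<lambda>w. G v \<bullet> w)) (at v within H)) \<and>
          (\<forall>v\<in>H. \<forall>w\<in>H. norm (G v - G w) \<le> M * norm (v - w)) \<and>
          D \<inter> ball z R =
            {x \<in> ball z R. \<phi> ((x - z) - ((x - z) \<bullet> e) *\<^sub>R e) < (x - z) \<bullet> e}))"

end

theory Submission
  imports Defs
begin

text \<open>
  The energy of the error is compared directly with the energy of the limit \<open>U\<close>, without correctors.
  Both weak formulations have the same right-hand side, so the energy of \<open>w = u\<^sub>\<epsilon> - U\<close> equals
  the form of \<open>(U, w)\<close> whose coefficient \<open>K(x/\<epsilon>, y/\<epsilon>) - k\<close>, with \<open>k\<close> the mean of \<open>K\<close>, has mean zero over the period cell.
  Averaging over translations by \<open>\<epsilon> q\<close> replaces the remaining factors by their increments at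
  scale \<open>\<epsilon>\<close>. By weighted arithmetic-geometric means these are absorbed into the energy of
  \<open>w\<close>, up to the part of the energy of \<open>U\<close> at scale \<open>\<epsilon>\<close> and a weighted square norm of a
  truncated operator applied to \<open>U\<close>. Both are of the square of the claimed order, because
  \<open>|U(x) - U(y)| \<le> C |x - y|\<^bsup>\<alpha>/2 + \<theta>\<^esup> \<delta>(x)\<^bsup>-\<theta>\<^esup>\<close> for \<open>0 \<le> \<theta> \<le> 1 - \<alpha>/2\<close>, and \<open>\<delta>\<^bsup>-s\<^esup>\<close> with
  \<open>s = 2\<theta> < 1\<close> is integrable with norm of order \<open>1/(1 - s)\<close>: one takes \<open>s = 2 - \<alpha>\<close> if \<open>\<alpha> > 1\<close>,
  \<open>s = (1 + \<alpha>)/2\<close> if \<open>\<alpha> < 1\<close>, and \<open>s = 1 - 1/(2 + |ln \<epsilon>|)\<close> if \<open>\<alpha> = 1\<close>.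
\<close>

section \<open>Integrals of powers\<close>

text \<open>The solution for \<epsilon> is known only through its energy; pointwise information
  exists for the limit alone. Hence increments of the error may enter only through its energy, and
  all weights and powers of the boundary distance have to fall on the limit. The two arguments of
  the coefficient oscillate independently, so the translations run over a cube of dimension 2d and
  change x - y. Near the diagonal the kernel |x - y|^(-d-\<alpha>) is not comparable to its
  translates. It is therefore first replaced by (\<epsilon> + |x - y|)^(-d-\<alpha>), which is
  comparable to its translates by multiples of \<epsilon>; the replacement costs the same factor
  \<epsilon> / (\<epsilon> + |x - y|) as a translation does. The new kernel has mass of order
  \<epsilon>^(-\<alpha>), the mean square increment at scale \<epsilon> is \<epsilon>^\<alpha> times
  an energy, and these powers cancel. The truncated operator is bounded in square mean uniformly in
  \<epsilon> for \<alpha> < 1, while for \<alpha> \<ge> 1 its bound grows; there the rate turns. A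
  Poincare inequality leads from the energy to the L^1 norm.\<close>

lemma nn_integral_powr_atLeast:
  fixes c p :: real
  assumes "c > 0" "p > 0"
  shows "(\<integral>\<^sup>+r\<in>{c..}. ennreal (p * r powr (-p-1)) \<partial>lborel) = ennreal (c powr -p)"
proof -
  have lim: "((\<lambda>r. - (r powr -p)) \<longlongrightarrow> - 0) at_top"
    by (intro tendsto_minus tendsto_neg_powr filterlim_ident) (use assms in auto)
  have "(\<integral>\<^sup>+r\<in>{c..}. ennreal (p * r powr (-p-1)) \<partial>lborel) = - 0 - (- (c powr -p))"
    by (rule nn_integral_FTC_atLeast[OF _ _ _ lim])
       (use assms in \<open>auto intro!: derivative_eq_intros\<close>)
  then show ?thesis by simp
qed

lemma nn_integral_powr_0:
  fixes a R :: real
  assumes "a > 0" "R > 0"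
  shows "(\<integral>\<^sup>+r\<in>{0..R}. ennreal (r powr (a-1)) \<partial>lborel) = ennreal (R powr a / a)"
proof -
  have "((\<lambda>x. x powr (a-1)) has_integral (R powr ((a-1)+1) / ((a-1)+1))) {0..R}"
    by (rule has_integral_powr_from_0) (use assms in auto)
  then have "((\<lambda>x. x powr (a-1)) has_integral (R powr a / a)) {0..R}" by simp
  from nn_integral_has_integral_lebesgue[OF _ this] show ?thesis
    by (simp add: ennreal_mult' ennreal_indicator mult.commute)
qed

text \<open>Layer cake formula: \<rho>^(-p) is the integral of p r^(-p-1) over r \<ge> \<rho>, and
  exchanging the integrals leaves the volumes of the sublevel sets. It serves both for balls, where
  \<rho> is the norm, and for boundary layers, where \<rho> is the distance to the boundary.\<close>

lemma nn_integral_neg_powr_layers: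
  fixes \<rho> :: "'a::euclidean_space \<Rightarrow> real"
  assumes [measurable]: "\<rho> \<in> borel_measurable borel" "S \<in> sets borel"
    and pos: "\<And>x. x \<in> S \<Longrightarrow> \<rho> x > 0" and p: "p > 0"
  shows "(\<integral>\<^sup>+x\<in>S. ennreal (\<rho> x powr -p) \<partial>lborel)
    = (\<integral>\<^sup>+r\<in>{0<..}. ennreal (p * r powr (-p-1)) * emeasure lborel {x\<in>S. \<rho> x \<le> r} \<partial>lborel)"
proof -
  have "(\<integral>\<^sup>+x\<in>S. ennreal (\<rho> x powr -p) \<partial>lborel)
     = (\<integral>\<^sup>+x. (\<integral>\<^sup>+r. indicator {x\<in>S. \<rho> x \<le> r} x * (ennreal (p * r powr (-p-1)) * indicator {0<..} r) \<partial>lborel) \<partial>lborel)"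
  proof (rule nn_integral_cong)
    fix x :: 'a
    show "ennreal (\<rho> x powr -p) * indicator S x =
       (\<integral>\<^sup>+r. indicator {x\<in>S. \<rho> x \<le> r} x * (ennreal (p * r powr (-p-1)) * indicator {0<..} r) \<partial>lborel)"
    proof (cases "x \<in> S")
      case True
      have "(\<integral>\<^sup>+r. indicator {x\<in>S. \<rho> x \<le> r} x * (ennreal (p * r powr (-p-1)) * indicator {0<..} r) \<partial>lborel)
         = (\<integral>\<^sup>+r\<in>{\<rho> x..}. ennreal (p * r powr (-p-1)) \<partial>lborel)"
        by (rule nn_integral_cong) (use pos[OF True] True in \<open>auto split: split_indicator\<close>)
      with nn_integral_powr_atLeast[OF pos[OF True] p] True show ?thesis by simp
    qed (auto simp: indicator_def)
  qed
  also have "\<dots> = (\<integral>\<^sup>+r. (\<integral>\<^sup>+x. indicator {x\<in>S. \<rho> x \<le> r} x * (ennreal (p * r powr (-p-1)) * indicator {0<..} r) \<partial>lborel) \<partial>lborel)"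
  proof (rule lborel_pair.Fubini'[symmetric])
    have "(\<lambda>(x, r). (if x \<in> S \<and> \<rho> x \<le> r then 1 else 0 :: ennreal) * (ennreal (p * r powr (-p-1)) * indicator {0<..} r))
      \<in> borel_measurable (lborel \<Otimes>\<^sub>M lborel)"
      by measurable
    then show "(\<lambda>(x, r). indicator {x\<in>S. \<rho> x \<le> r} x * (ennreal (p * r powr (-p-1)) * indicator {0<..} r)) \<in> borel_measurable (lborel \<Otimes>\<^sub>M lborel)"
      by (simp add: indicator_def)
  qed
  also have "\<dots> = (\<integral>\<^sup>+r\<in>{0<..}. ennreal (p * r powr (-p-1)) * emeasure lborel {x\<in>S. \<rho> x \<le> r} \<partial>lborel)"
    by (rule nn_integral_cong)
       (subst nn_integral_multc, auto simp: mult_ac)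
  finally show ?thesis .
qed

text \<open>The layers below R are measured by their growth C r^n, those above R by the total volume
  A. The exponent n is an effective dimension: d for balls about the origin, 1 for layers along the
  boundary. The factor 1 / (n - p) is kept explicit because p is later allowed to approach
  n.\<close>

lemma nn_integral_neg_powr_le:
  fixes \<rho> :: "'a::euclidean_space \<Rightarrow> real"
  assumes [measurable]: "\<rho> \<in> borel_measurable borel" "S \<in> sets borel"
    and pos: "\<And>x. x \<in> S \<Longrightarrow> \<rho> x > 0" and p: "0 < p" "p < n" and R: "R > 0"
    and C: "C \<ge> 0" "A \<ge> 0" "emeasure lborel S \<le> ennreal A"
      "\<And>r. 0 < r \<Longrightarrow> r \<le> R \<Longrightarrow> emeasure lborel {x\<in>S. \<rho> x \<le> r} \<le> ennreal (C * r powr n)"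
  shows "(\<integral>\<^sup>+x\<in>S. ennreal (\<rho> x powr -p) \<partial>lborel)
     \<le> ennreal (C * p / (n - p) * R powr (n - p) + A * R powr -p)"
proof -
  have "(\<integral>\<^sup>+r\<in>{0<..}. ennreal (p * r powr (-p-1)) * emeasure lborel {x\<in>S. \<rho> x \<le> r} \<partial>lborel)
    \<le> (\<integral>\<^sup>+r. ennreal (C * p) * (ennreal (r powr (n-p-1)) * indicator {0..R} r)
          + ennreal A * (ennreal (p * r powr (-p-1)) * indicator {R..} r) \<partial>lborel)"
  proof (rule nn_integral_mono)
    fix r :: real
    consider "r \<le> 0" | "0 < r" "r \<le> R" | "r > R" by linarith
    then show "ennreal (p * r powr (-p-1)) * emeasure lborel {x\<in>S. \<rho> x \<le> r} * indicator {0<..} r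
      \<le> ennreal (C * p) * (ennreal (r powr (n-p-1)) * indicator {0..R} r)
          + ennreal A * (ennreal (p * r powr (-p-1)) * indicator {R..} r)"
    proof cases
      case 2
      have "ennreal (p * r powr (-p-1)) * emeasure lborel {x\<in>S. \<rho> x \<le> r}
         \<le> ennreal (p * r powr (-p-1)) * ennreal (C * r powr n)"
        by (intro mult_left_mono C(4) 2) auto
      also have "\<dots> = ennreal (C * p) * ennreal (r powr (n-p-1))"
      proof -
        have "r powr (-p-1) * r powr n = r powr (n-p-1)"
          using 2 by (simp add: powr_add[symmetric] algebra_simps)
        then show ?thesis using p C by (simp add: ennreal_mult[symmetric] mult_ac)
      qed
      finally show ?thesis using 2 by (auto intro: add_increasing2)
    next
      case 3
      have "emeasure lborel {x\<in>S. \<rho> x \<le> r} \<le> ennreal A"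
        by (rule order_trans[OF emeasure_mono C(3)]) auto
      then have "ennreal (p * r powr (-p-1)) * emeasure lborel {x\<in>S. \<rho> x \<le> r} \<le> ennreal (p * r powr (-p-1)) * ennreal A"
        by (intro mult_left_mono) auto
      then show ?thesis using 3 R by (simp add: mult.commute)
    qed auto
  qed
  also have "\<dots> = ennreal (C * p) * ennreal (R powr (n-p) / (n-p)) + ennreal A * ennreal (R powr -p)"
    using nn_integral_powr_0[of "n-p" R] nn_integral_powr_atLeast[OF R p(1)] p R
    by (subst nn_integral_add, (simp; fail), (simp; fail)) (simp add: nn_integral_cmult)
  also have "\<dots> = ennreal (C * p / (n - p) * R powr (n - p) + A * R powr -p)"
    using p C by (simp add: ennreal_mult[symmetric] ennreal_plus[symmetric] del: ennreal_plus)
  finally show ?thesis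
    by (simp only: nn_integral_neg_powr_layers[OF assms(1,2) pos p(1)])
qed

text \<open>Counterpart for p > n: sublevel sets below c are empty, so the layer integral starts at
  c and converges at infinity, and \<open>S\<close> may have infinite volume.\<close>

lemma nn_integral_neg_powr_tail_le:
  fixes \<rho> :: "'a::euclidean_space \<Rightarrow> real"
  assumes [measurable]: "\<rho> \<in> borel_measurable borel" "S \<in> sets borel"
    and c: "c > 0" "\<And>x. x \<in> S \<Longrightarrow> \<rho> x > c" and p: "0 < p" "n < p"
    and C: "C \<ge> 0"
      "\<And>r. c < r \<Longrightarrow> emeasure lborel {x\<in>S. \<rho> x \<le> r} \<le> ennreal (C * r powr n)"
  shows "(\<integral>\<^sup>+x\<in>S. ennreal (\<rho> x powr -p) \<partial>lborel) \<le> ennreal (C * p / (p - n) * c powr (n - p))"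
proof -
  have e: "{x\<in>S. \<rho> x \<le> r} = {}" if "r \<le> c" for r using c(2) that by force
  have "(\<integral>\<^sup>+r\<in>{0<..}. ennreal (p * r powr (-p-1)) * emeasure lborel {x\<in>S. \<rho> x \<le> r} \<partial>lborel)
    \<le> (\<integral>\<^sup>+r. ennreal (C * p / (p - n)) * (ennreal ((p-n) * r powr (-(p-n)-1)) * indicator {c..} r) \<partial>lborel)"
  proof (rule nn_integral_mono)
    fix r :: real
    consider "r \<le> c" | "c < r" by linarith
    then show "ennreal (p * r powr (-p-1)) * emeasure lborel {x\<in>S. \<rho> x \<le> r} * indicator {0<..} r
      \<le> ennreal (C * p / (p - n)) * (ennreal ((p-n) * r powr (-(p-n)-1)) * indicator {c..} r)"
    proof cases
      case 2
      have "ennreal (p * r powr (-p-1)) * emeasure lborel {x\<in>S. \<rho> x \<le> r}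
         \<le> ennreal (p * r powr (-p-1)) * ennreal (C * r powr n)"
        by (intro mult_left_mono C(2) 2) auto
      also have "\<dots> = ennreal (C * p / (p - n)) * ennreal ((p-n) * r powr (-(p-n)-1))"
      proof -
        have "r powr (-p-1) * r powr n = r powr (-(p-n)-1)"
          using 2 c by (simp add: powr_add[symmetric] algebra_simps)
        then show ?thesis using p C by (simp add: ennreal_mult[symmetric] mult_ac)
      qed
      finally show ?thesis using 2 c by auto
    qed (auto simp: e)
  qed
  also have "\<dots> = ennreal (C * p / (p - n)) * ennreal (c powr - (p - n))"
    using nn_integral_powr_atLeast[OF c(1), of "p-n"] p by (simp add: nn_integral_cmult)
  also have "\<dots> = ennreal (C * p / (p - n) * c powr (n - p))"
    using p C by (simp add: ennreal_mult[symmetric])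
  finally show ?thesis
    by (subst nn_integral_neg_powr_layers[OF assms(1,2) _ p(1)])
       (use c in \<open>auto intro: less_trans\<close>)
qed

lemma emeasure_lborel_cball_powr:
  fixes c :: "'a::euclidean_space"
  assumes "r > 0"
  shows "emeasure lborel (cball c r) = ennreal (unit_ball_vol DIM('a) * r powr DIM('a))"
  using assms by (simp add: emeasure_cball powr_realpow)

lemma nn_integral_norm_powr_near:
  fixes s e :: real
  assumes s: "0 < s" "s < 1" and e: "e > 0"
  shows "(\<integral>\<^sup>+z\<in>cball 0 e. ennreal (norm (z::'a::euclidean_space) powr (s - DIM('a))) \<partial>lborel)
    \<le> ennreal (unit_ball_vol DIM('a) * DIM('a) / s * e powr s)"
proof -
  let ?V = "unit_ball_vol DIM('a)" and ?d = "real DIM('a)"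
  have d: "?d \<ge> 1" using DIM_positive[where 'a='a] by linarith
  have sd: "s < ?d" using s d by linarith
  \<comment> \<open>The layer formula wants a positive radius. Removing the origin changes nothing,
    since the integrand has the value \<open>0 powr _ = 0\<close> there.\<close>
  have "(\<integral>\<^sup>+z\<in>cball 0 e. ennreal (norm (z::'a) powr (s - ?d)) \<partial>lborel)
     = (\<integral>\<^sup>+z\<in>cball 0 e - {0}. ennreal (norm (z::'a) powr - (?d - s)) \<partial>lborel)"
    by (rule nn_integral_cong) (auto split: split_indicator)
  also have "\<dots> \<le> ennreal (?V * (?d - s) / (?d - (?d - s)) * e powr (?d - (?d - s)) + ?V * e powr ?d * e powr - (?d - s))"
  proof (rule nn_integral_neg_powr_le)
    show "emeasure lborel (cball (0::'a) e - {0}) \<le> ennreal (?V * e powr ?d)"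
      by (rule order_trans[OF emeasure_mono[of _ "cball 0 e"]]) (use e in \<open>auto simp: emeasure_lborel_cball_powr\<close>)
    fix r :: real assume r: "0 < r" "r \<le> e"
    show "emeasure lborel {x \<in> cball (0::'a) e - {0}. norm x \<le> r} \<le> ennreal (?V * r powr ?d)"
      by (rule order_trans[OF emeasure_mono[of _ "cball 0 r"]]) (use r in \<open>auto simp: emeasure_lborel_cball_powr\<close>)
  qed (use s sd e in auto)
  also have "?V * (?d - s) / (?d - (?d - s)) * e powr (?d - (?d - s)) + ?V * e powr ?d * e powr - (?d - s)
     = ?V * ?d / s * e powr s"
  proof -
    have "e powr ?d * e powr - (?d - s) = e powr s" using e by (simp add: powr_add[symmetric])
    then show ?thesis using s by (simp add: field_simps)
  qed
  finally show ?thesis .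
qed

lemma nn_integral_norm_powr_far:
  fixes q e :: real
  assumes q: "0 < q" and e: "e > 0"
  shows "(\<integral>\<^sup>+z\<in>- cball 0 e. ennreal (norm (z::'a::euclidean_space) powr (- q - DIM('a))) \<partial>lborel)
    \<le> ennreal (unit_ball_vol DIM('a) * (DIM('a) + q) / q * e powr -q)"
proof -
  let ?V = "unit_ball_vol DIM('a)" and ?d = "real DIM('a)"
  have "(\<integral>\<^sup>+z\<in>- cball 0 e. ennreal (norm (z::'a) powr - (?d + q)) \<partial>lborel)
     \<le> ennreal (?V * (?d + q) / (?d + q - ?d) * e powr (?d - (?d + q)))"
  proof (rule nn_integral_neg_powr_tail_le)
    fix r :: real assume r: "e < r"
    show "emeasure lborel {x \<in> - cball (0::'a) e. norm x \<le> r} \<le> ennreal (?V * r powr ?d)"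
      by (rule order_trans[OF emeasure_mono[of _ "cball 0 r"]]) (use r e in \<open>auto simp: emeasure_lborel_cball_powr\<close>)
  qed (use q e in \<open>auto simp: add_nonneg_pos\<close>)
  then show ?thesis by (simp add: algebra_simps)
qed

section \<open>Interior gradient bounds and the boundary modulus\<close>

lemma real_derivative_oscillation:
  fixes f f' :: "real \<Rightarrow> real"
  assumes "a < b" "\<And>t. a \<le> t \<Longrightarrow> t \<le> b \<Longrightarrow> (f has_real_derivative f' t) (at t)"
    and "\<And>t. a \<le> t \<Longrightarrow> t \<le> b \<Longrightarrow> \<bar>f t\<bar> \<le> A"
    and "\<And>s t. a \<le> s \<Longrightarrow> s \<le> t \<Longrightarrow> t \<le> b \<Longrightarrow> \<bar>f' t - f' s\<bar> \<le> B"
    and t: "a \<le> t" "t \<le> b"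
  shows "\<bar>f' t\<bar> \<le> 2 * A / (b - a) + B"
proof -
  \<comment> \<open>At one interior point the derivative is a difference quotient, hence at most 2A
    / (b - a); the oscillation bound carries this to every other point.\<close>
  obtain z where z: "a < z" "z < b" "f b - f a = (b - a) * f' z"
    using MVT2[OF assms(1,2)] by blast
  have "\<bar>(b - a) * f' z\<bar> \<le> 2 * A"
    using assms(3)[of a] assms(3)[of b] \<open>a < b\<close> unfolding z(3)[symmetric] by linarith
  then have "\<bar>f' z\<bar> \<le> 2 * A / (b - a)"
    using \<open>a < b\<close> by (simp add: abs_mult field_simps)
  moreover have "\<bar>f' t - f' z\<bar> \<le> B"
    using assms(4)[of t z] assms(4)[of z t] z t by (cases "t \<le> z") (auto simp: abs_minus_commute)
  ultimately show ?thesis by linarith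
qed

text \<open>Induction on the order: the increments \<open>F (\<cdot> + h) - F\<close> satisfy the hypothesis of one order
  less, so the first derivative has bounded oscillation.\<close>

lemma derivative_interpolation:
  assumes "m \<ge> 1"
  shows "0 < l \<Longrightarrow> \<exists>C\<ge>0. \<forall>(F :: nat \<Rightarrow> real \<Rightarrow> real) a A.
     (\<forall>k<m. \<forall>t\<in>{a..a+l}. (F k has_real_derivative F (Suc k) t) (at t)) \<longrightarrow>
     (\<forall>t\<in>{a..a+l}. \<bar>F 0 t\<bar> \<le> A) \<longrightarrow>
     (\<forall>s\<in>{a..a+l}. \<forall>t\<in>{a..a+l}. \<bar>F m s - F m t\<bar> \<le> A) \<longrightarrow>
     (\<forall>t\<in>{a..a+l}. \<bar>F 1 t\<bar> \<le> C * A)"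
  using assms
proof (induction m arbitrary: l rule: nat_induct_at_least)
  case base
  show ?case
  proof (intro exI[of _ "2 / l + 1"] conjI allI impI ballI)
    show "0 \<le> 2 / l + 1" using base by simp
  next
    fix F :: "nat \<Rightarrow> real \<Rightarrow> real" and a A t
    assume F: "\<forall>k<1. \<forall>t\<in>{a..a + l}. (F k has_real_derivative F (Suc k) t) (at t)"
      "\<forall>t\<in>{a..a + l}. \<bar>F 0 t\<bar> \<le> A"
      "\<forall>s\<in>{a..a + l}. \<forall>t\<in>{a..a + l}. \<bar>F 1 s - F 1 t\<bar> \<le> A" and t: "t \<in> {a..a+l}"
    have "\<bar>F 1 t\<bar> \<le> 2 * A / (a + l - a) + A"
      by (rule real_derivative_oscillation[of a "a+l" "F 0" "F 1" A A]) (use F t base in auto)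
    then show "\<bar>F 1 t\<bar> \<le> (2 / l + 1) * A" by (simp add: algebra_simps)
  qed
next
  case (Suc m)
  from Suc.prems have "0 < l / 2" by simp
  from Suc.IH[OF this] obtain C where C: "C \<ge> 0" and IH0:
    "\<forall>(F :: nat \<Rightarrow> real \<Rightarrow> real) a A.
     (\<forall>k<m. \<forall>t\<in>{a..a+l/2}. (F k has_real_derivative F (Suc k) t) (at t)) \<longrightarrow>
     (\<forall>t\<in>{a..a+l/2}. \<bar>F 0 t\<bar> \<le> A) \<longrightarrow>
     (\<forall>s\<in>{a..a+l/2}. \<forall>t\<in>{a..a+l/2}. \<bar>F m s - F m t\<bar> \<le> A) \<longrightarrow>
     (\<forall>t\<in>{a..a+l/2}. \<bar>F 1 t\<bar> \<le> C * A)" by (elim exE conjE)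
  \<comment> \<open>An increment by h \<le> l/2 has size at most 2A, and its m-th derivative
    oscillates by at most (l/2) A. The sum of the two is a common bound for the induction
    hypothesis.\<close>
  define B where "B = C * (2 + l/2)"
  show ?case
  proof (intro exI[of _ "2 / l + 2 * B"] conjI allI impI ballI)
    show "0 \<le> 2 / l + 2 * B" using Suc.prems C by (simp add: B_def)
  next
    fix F :: "nat \<Rightarrow> real \<Rightarrow> real" and a A t
    assume F: "\<forall>k<Suc m. \<forall>t\<in>{a..a + l}. (F k has_real_derivative F (Suc k) t) (at t)"
      "\<forall>t\<in>{a..a + l}. \<bar>F 0 t\<bar> \<le> A"
      "\<forall>s\<in>{a..a + l}. \<forall>t\<in>{a..a + l}. \<bar>F (Suc m) s - F (Suc m) t\<bar> \<le> A" and t: "t \<in> {a..a+l}"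
    have A: "A \<ge> 0" using F(2) t by force
    have inc: "\<bar>F 1 (t + h) - F 1 t\<bar> \<le> B * A" if h: "0 < h" "h \<le> l/2" "a \<le> t" "t + h \<le> a + l" for h t
    proof -
      \<comment> \<open>The window [c, c + l/2] contains t, and its translate by h stays inside
        [a, a + l]; if t is too far to the right, the window is moved to the left.\<close>
      define c where "c = min t (a + l/2 - h)"
      define G where "G k t = F k (t + h) - F k t" for k t
      have c: "a \<le> c" "c + l/2 + h \<le> a + l" "c \<le> t" "t \<le> c + l/2"
        using h Suc.prems by (auto simp: c_def min_def)
      have dm: "\<exists>\<xi>\<in>{a..a+l}. G m s = h * F (Suc m) \<xi>" if s: "s \<in> {c..c+l/2}" for s
      proof -
        have "\<exists>z>s. z < s + h \<and> F m (s + h) - F m s = (s + h - s) * F (Suc m) z"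
          by (rule MVT2) (use F(1) s c h in auto)
        then show ?thesis using s c h unfolding G_def by force
      qed
      have "\<bar>G 1 t\<bar> \<le> C * ((2 + l/2) * A)"
      proof (rule IH0[THEN spec[of _ G], THEN spec[of _ c], THEN spec[of _ "(2 + l/2) * A"], THEN mp, THEN mp, THEN mp, THEN bspec])
        show "\<forall>k<m. \<forall>t\<in>{c..c + l / 2}. (G k has_real_derivative G (Suc k) t) (at t)"
        proof (intro allI impI ballI)
          fix k t assume k: "k < m" and t: "t \<in> {c..c+l/2}"
          have 1: "(F k has_real_derivative F (Suc k) t) (at t)" using F(1) k t c h by auto
          have 2: "(F k has_real_derivative F (Suc k) (t + h)) (at (t + h))" using F(1) k t c h by auto
          show "(G k has_real_derivative G (Suc k) t) (at t)"
            using 1 2 unfolding G_def by (auto intro!: derivative_eq_intros simp: DERIV_shift)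
        qed
        show "\<forall>t\<in>{c..c + l / 2}. \<bar>G 0 t\<bar> \<le> (2 + l/2) * A"
        proof
          fix t assume t: "t \<in> {c..c+l/2}"
          have "\<bar>F 0 (t + h)\<bar> \<le> A" "\<bar>F 0 t\<bar> \<le> A" using F(2) t c h by auto
          then have "\<bar>G 0 t\<bar> \<le> 2 * A" unfolding G_def by linarith
          moreover have "0 \<le> l/2 * A" using Suc.prems A by simp
          ultimately show "\<bar>G 0 t\<bar> \<le> (2 + l/2) * A" by (simp add: algebra_simps)
        qed
        show "\<forall>s\<in>{c..c + l / 2}. \<forall>t\<in>{c..c + l / 2}. \<bar>G m s - G m t\<bar> \<le> (2 + l/2) * A"
        proof (intro ballI)
          fix s t assume st: "s \<in> {c..c+l/2}" "t \<in> {c..c+l/2}"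
          obtain x y where "x \<in> {a..a+l}" "G m s = h * F (Suc m) x" "y \<in> {a..a+l}" "G m t = h * F (Suc m) y"
            using dm[OF st(1)] dm[OF st(2)] by blast
          then have "\<bar>G m s - G m t\<bar> = h * \<bar>F (Suc m) x - F (Suc m) y\<bar>" "\<bar>F (Suc m) x - F (Suc m) y\<bar> \<le> A"
            using h F(3) by (auto simp: abs_mult right_diff_distrib[symmetric])
          then have "\<bar>G m s - G m t\<bar> \<le> l/2 * A" using mult_mono[of h "l/2" "\<bar>F (Suc m) x - F (Suc m) y\<bar>" A] h A by simp
          then show "\<bar>G m s - G m t\<bar> \<le> (2 + l/2) * A" using A by (simp add: algebra_simps)
        qed
      qed (use c in auto)
      then show ?thesis by (simp add: G_def B_def mult_ac)
    qed
    have BA: "B * A \<ge> 0" using A C Suc.prems by (simp add: B_def)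
    \<comment> \<open>Two points of an interval of length l are joined by two steps of length at
      most l/2, so the increment bound is used twice.\<close>
    have osc: "\<bar>F 1 t - F 1 s\<bar> \<le> 2 * B * A" if "a \<le> s" "s \<le> t" "t \<le> a + l" for s t
    proof (cases "s = t")
      case False
      define h where "h = (t - s) / 2"
      have h: "t = s + h + h" "0 < h" "h \<le> l/2" using that False by (auto simp: h_def field_simps)
      show ?thesis using inc[of h s] inc[of h "s+h"] h that by simp
    qed (use BA in \<open>simp add: mult.commute\<close>)
    have "\<bar>F 1 t\<bar> \<le> 2 * A / (a + l - a) + 2 * B * A"
      by (rule real_derivative_oscillation[of a "a+l" "F 0" "F 1" A "2 * B * A"])
        (use F t Suc.prems osc in auto)
    then show "\<bar>F 1 t\<bar> \<le> (2 / l + 2 * B) * A" by (simp add: algebra_simps)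
  qed
qed

section \<open>Distance to the boundary and weighted Hoelder norms\<close>

lemma ball_bdist_cases:
  assumes "open (D :: 'a::euclidean_space set)"
  shows "ball x (bdist D x) \<subseteq> D \<or> ball x (bdist D x) \<inter> D = {}"
proof (rule ccontr)
  assume "\<not> ?thesis"
  then obtain y z where "y \<in> ball x (bdist D x)" "y \<notin> D" "z \<in> ball x (bdist D x)" "z \<in> D" by blast
  \<comment> \<open>A ball is connected, so if it met both the set and its complement it would
    contain a boundary point nearer to the centre than the boundary is.\<close>
  then have "ball x (bdist D x) \<inter> frontier D \<noteq> {}"
    by (intro connected_Int_frontier) auto
  then obtain p where "p \<in> frontier D" "dist x p < bdist D x" by auto
  then show False using infdist_le[of p "frontier D" x] by (simp add: bdist_def)
qed

lemma bdist_pos_iff: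
  assumes "frontier D \<noteq> {}"
  shows "0 < bdist D x \<longleftrightarrow> x \<notin> frontier D"
  using in_closed_iff_infdist_zero[OF frontier_closed assms, of x] infdist_nonneg[of x "frontier D"]
  unfolding bdist_def by auto

lemma bdist_lipschitz: "\<bar>bdist D x - bdist D y\<bar> \<le> norm (x - y)"
  using infdist_triangle[of x "frontier D" y] infdist_triangle[of y "frontier D" x]
  by (simp add: bdist_def dist_norm norm_minus_commute abs_le_iff)

text \<open>Turns finiteness of the extended norm into real bounds; a single partial derivative is
  dominated by the Euclidean norm of the tensor.\<close>

lemma weighted_hoelder_bounds:
  fixes u :: "'a::euclidean_space \<Rightarrow> real"
  assumes "u \<in> weighted_hoelder D \<gamma> \<theta>"
  obtains C where "C \<ge> 0" "\<And>x. x \<in> D \<Longrightarrow> bdist D x powr \<theta> * \<bar>u x\<bar> \<le> C"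
    "\<And>x y bs. x \<in> D \<Longrightarrow> y \<in> D \<Longrightarrow> x \<noteq> y \<Longrightarrow> bs \<in> directions (nat \<lfloor>\<gamma>\<rfloor>) \<Longrightarrow>
       min (bdist D x) (bdist D y) powr (\<gamma> + \<theta>) * (\<bar>partial_deriv bs u x - partial_deriv bs u y\<bar>
          / norm (x - y) powr (\<gamma> - of_int \<lfloor>\<gamma>\<rfloor>)) \<le> C"
proof -
  let ?S = "weighted_sup D 0 \<theta> u + weighted_hoelder_seminorm D \<gamma> \<theta> u"
  have S: "?S < \<infinity>" using assms by (simp add: weighted_hoelder_def)
  define C where "C = enn2real ?S"
  have C: "?S = ennreal C" "C \<ge> 0" using S by (auto simp: C_def less_top)
  have le: "t \<le> C" if "ennreal t \<le> weighted_sup D 0 \<theta> u \<or> ennreal t \<le> weighted_hoelder_seminorm D \<gamma> \<theta> u" for t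
  proof -
    have "ennreal t \<le> ?S" using that by (auto intro: add_increasing2 add_increasing)
    then show ?thesis using C by (simp add: ennreal_le_iff)
  qed
  have d0: "directions 0 = {[] :: 'a list}" by (auto simp: directions_def)
  have fin: "finite (directions k :: 'a list set)" for k
    unfolding directions_def by (rule finite_lists_length_eq) simp
  show ?thesis
  proof (rule that[of C])
    show "C \<ge> 0" by fact
    fix x assume x: "x \<in> D"
    show "bdist D x powr \<theta> * \<bar>u x\<bar> \<le> C"
      by (rule le, rule disjI1, unfold weighted_sup_def, rule SUP_upper2[OF x]) (simp add: d0)
    fix y :: 'a and bs :: "'a list" assume y: "y \<in> D" "x \<noteq> y" and bs: "bs \<in> directions (nat \<lfloor>\<gamma>\<rfloor>)"
    let ?s = "\<Sum>bs\<in>directions (nat \<lfloor>\<gamma>\<rfloor>). (partial_deriv bs u x - partial_deriv bs u y)\<^sup>2"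
    have "(partial_deriv bs u x - partial_deriv bs u y)\<^sup>2 \<le> ?s"
      by (rule member_le_sum[OF bs]) (use fin in auto)
    then have "\<bar>partial_deriv bs u x - partial_deriv bs u y\<bar> \<le> sqrt ?s"
      using real_le_rsqrt by (metis power2_abs)
    then have "min (bdist D x) (bdist D y) powr (\<gamma> + \<theta>) * (\<bar>partial_deriv bs u x - partial_deriv bs u y\<bar>
          / norm (x - y) powr (\<gamma> - of_int \<lfloor>\<gamma>\<rfloor>))
      \<le> min (bdist D x) (bdist D y) powr (\<gamma> + \<theta>) * (sqrt ?s / norm (x - y) powr (\<gamma> - of_int \<lfloor>\<gamma>\<rfloor>))"
      by (intro mult_left_mono divide_right_mono) auto
    also have "\<dots> \<le> C"
      by (rule le, rule disjI2, unfold weighted_hoelder_seminorm_def, rule SUP_upper2[of "(x,y)"])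
         (use x y in auto)
    finally show "min (bdist D x) (bdist D y) powr (\<gamma> + \<theta>) * (\<bar>partial_deriv bs u x - partial_deriv bs u y\<bar>
          / norm (x - y) powr (\<gamma> - of_int \<lfloor>\<gamma>\<rfloor>)) \<le> C" .
  qed
qed

lemma powr_unit_le:
  fixes t p :: real
  assumes "0 \<le> t" "t \<le> 1" "0 \<le> p"
  shows "t powr p \<le> 1"
  using powr_mono2[of p t 1] assms by simp

text \<open>Scaling argument: on a segment through x whose length is the distance r of x from the
  boundary, the k-th derivative in direction b is multiplied by r^(k-\<kappa>). The rescaled
  functions satisfy bounds independent of x on an interval of length 1, so interpolation bounds the
  first of them, and undoing the scaling gives r^(\<kappa>-1).\<close>

lemma weighted_hoelder_partial_bound:
  fixes u :: "'a::euclidean_space \<Rightarrow> real"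
  assumes D: "open D" and u: "u \<in> weighted_hoelder D \<gamma> (-\<kappa>)" and \<gamma>: "\<gamma> \<ge> 1" "\<kappa> \<le> \<gamma>" "0 \<le> \<kappa>" "\<kappa> \<le> 1"
  shows "\<exists>C\<ge>0. \<forall>x\<in>D. \<forall>b\<in>Basis. 0 < bdist D x \<longrightarrow>
    \<bar>partial_deriv [b] u x\<bar> \<le> C * bdist D x powr (\<kappa> - 1)"
proof -
  define m where "m = nat \<lfloor>\<gamma>\<rfloor>"
  have m: "m \<ge> 1" "real_of_int \<lfloor>\<gamma>\<rfloor> = real m" "real m \<le> \<gamma>" using \<gamma> by (auto simp: m_def le_nat_iff)
  from weighted_hoelder_bounds[OF u] obtain C1 where C1: "C1 \<ge> 0"
    "\<And>x. x \<in> D \<Longrightarrow> bdist D x powr (-\<kappa>) * \<bar>u x\<bar> \<le> C1"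
    "\<And>x y bs. x \<in> D \<Longrightarrow> y \<in> D \<Longrightarrow> x \<noteq> y \<Longrightarrow> bs \<in> directions m \<Longrightarrow>
       min (bdist D x) (bdist D y) powr (\<gamma> - \<kappa>) * (\<bar>partial_deriv bs u x - partial_deriv bs u y\<bar>
          / norm (x - y) powr (\<gamma> - m)) \<le> C1"
    unfolding m_def[symmetric] m(2) by (auto simp: algebra_simps)
  from derivative_interpolation[OF m(1) zero_less_one] obtain C where C: "C \<ge> 0" and ip0:
    "\<forall>(F :: nat \<Rightarrow> real \<Rightarrow> real) a A.
     (\<forall>k<m. \<forall>t\<in>{a..a+1}. (F k has_real_derivative F (Suc k) t) (at t)) \<longrightarrow>
     (\<forall>t\<in>{a..a+1}. \<bar>F 0 t\<bar> \<le> A) \<longrightarrow>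
     (\<forall>s\<in>{a..a+1}. \<forall>t\<in>{a..a+1}. \<bar>F m s - F m t\<bar> \<le> A) \<longrightarrow>
     (\<forall>t\<in>{a..a+1}. \<bar>F 1 t\<bar> \<le> C * A)" by (elim exE conjE)
  \<comment> \<open>On the segment the distance to the boundary lies between r/2 and 2r. Exchanging
    it for r costs at most 2^\<kappa> in the size and 2^(\<gamma>-\<kappa>) in the top seminorm;
    2^\<gamma> covers both.\<close>
  define A where "A = C1 * 2 powr \<gamma>"
  show ?thesis
  proof (intro exI[of _ "C * A"] conjI ballI impI)
    show "0 \<le> C * A" using C C1(1) by (simp add: A_def)
    fix x b :: 'a assume x: "x \<in> D" and b: "b \<in> Basis" and pos: "0 < bdist D x"
    define r where "r = bdist D x"
    have r: "r > 0" using pos by (simp add: r_def)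
    define F where "F k t = r powr (k - \<kappa>) * partial_deriv (replicate k b) u (x + (r * t) *\<^sub>R b)" for k :: nat and t
    let ?I = "{-1/2..-1/2+1::real}"
    have inD: "x + (r * t) *\<^sub>R b \<in> D" "r / 2 \<le> bdist D (x + (r * t) *\<^sub>R b)"
       "bdist D (x + (r * t) *\<^sub>R b) \<le> 2 * r" if "t \<in> ?I" for t
    proof -
      have n: "norm ((r * t) *\<^sub>R b) \<le> r / 2" using that r b by (auto simp: abs_mult abs_le_iff field_simps)
      have "ball x r \<subseteq> D" using ball_bdist_cases[OF D, of x] x r centre_in_ball[of x r] unfolding r_def by blast
      moreover have "x + (r * t) *\<^sub>R b \<in> ball x r" using n r by (simp add: dist_norm)
      ultimately show "x + (r * t) *\<^sub>R b \<in> D" by blast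
      show "r / 2 \<le> bdist D (x + (r * t) *\<^sub>R b)" "bdist D (x + (r * t) *\<^sub>R b) \<le> 2 * r"
        using bdist_lipschitz[of D "x + (r * t) *\<^sub>R b" x] n unfolding r_def by auto
    qed
    have dirs: "replicate k b \<in> directions k" for k using b by (auto simp: directions_def)
    have "\<bar>F 1 0\<bar> \<le> C * A"
    proof (rule ip0[THEN spec[of _ F], THEN spec[of _ "-1/2"], THEN spec[of _ A], THEN mp, THEN mp, THEN mp, THEN bspec])
      show "\<forall>k<m. \<forall>t\<in>?I. (F k has_real_derivative F (Suc k) t) (at t)"
      proof (intro allI impI ballI)
        fix k t assume k: "k < m" and t: "t \<in> ?I"
        let ?f = "partial_deriv (replicate k b) u" and ?y = "x + (r * t) *\<^sub>R b"
        have "?f differentiable (at ?y)"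
          using u k inD(1)[OF t] dirs[of k] unfolding weighted_hoelder_def C_k_def m_def by blast
        then have d: "(?f has_derivative frechet_derivative ?f (at ?y)) (at ?y)"
          by (simp add: frechet_derivative_works)
        then have lin: "linear (frechet_derivative ?f (at ?y))" by (rule has_derivative_linear)
        have "((\<lambda>t. ?f (x + (r * t) *\<^sub>R b)) has_derivative (\<lambda>s. frechet_derivative ?f (at ?y) ((r * s) *\<^sub>R b))) (at t)"
          by (rule has_derivative_compose[where g = ?f and f = "\<lambda>t. x + (r * t) *\<^sub>R b"])
             (use d in \<open>auto intro!: derivative_eq_intros\<close>)
        then have "((\<lambda>t. ?f (x + (r * t) *\<^sub>R b)) has_real_derivative r * frechet_derivative ?f (at ?y) b) (at t)"
          by (simp add: has_field_derivative_def linear_cmul[OF lin] mult_ac mult_commute_abs)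
        then have "(F k has_real_derivative r powr (k - \<kappa>) * (r * frechet_derivative ?f (at ?y) b)) (at t)"
          unfolding F_def by (rule DERIV_cmult)
        moreover have "r powr (k - \<kappa>) * (r * frechet_derivative ?f (at ?y) b) = F (Suc k) t"
        proof -
          have "r powr (k - \<kappa>) * r = r powr (Suc k - \<kappa>)" using r by (simp add: powr_mult_base mult.commute algebra_simps)
          then show ?thesis unfolding F_def by (simp add: mult.assoc[symmetric])
        qed
        ultimately show "(F k has_real_derivative F (Suc k) t) (at t)" by simp
      qed
      show "\<forall>t\<in>?I. \<bar>F 0 t\<bar> \<le> A"
      proof
        fix t assume t: "t \<in> ?I"
        let ?y = "x + (r * t) *\<^sub>R b"
        have "r powr - \<kappa> \<le> (bdist D ?y / 2) powr - \<kappa>"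
          by (rule powr_mono2') (use \<gamma> inD[OF t] r in auto)
        also have "\<dots> = 2 powr \<kappa> * bdist D ?y powr -\<kappa>"
          using inD[OF t] r by (simp add: powr_divide powr_minus field_simps)
        finally have "\<bar>F 0 t\<bar> \<le> 2 powr \<kappa> * (bdist D ?y powr -\<kappa> * \<bar>u ?y\<bar>)"
          unfolding F_def by (simp add: abs_mult mult_right_mono mult.assoc[symmetric])
        also have "\<dots> \<le> 2 powr \<gamma> * C1"
          by (intro mult_mono C1(2) inD t powr_mono) (use \<gamma> in auto)
        finally show "\<bar>F 0 t\<bar> \<le> A" by (simp add: A_def mult.commute)
      qed
      show "\<forall>s\<in>?I. \<forall>t\<in>?I. \<bar>F m s - F m t\<bar> \<le> A"
      proof (intro ballI)
        fix s t assume s: "s \<in> ?I" and t: "t \<in> ?I"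
        let ?y = "x + (r * t) *\<^sub>R b" and ?z = "x + (r * s) *\<^sub>R b"
        show "\<bar>F m s - F m t\<bar> \<le> A"
        proof (cases "s = t")
          case False
          let ?e = "\<bar>partial_deriv (replicate m b) u ?z - partial_deriv (replicate m b) u ?y\<bar>"
          let ?\<mu> = "min (bdist D ?z) (bdist D ?y)"
          have nz: "norm (?z - ?y) = r * \<bar>s - t\<bar>"
            using r b by (simp add: scaleR_left_diff_distrib[symmetric] right_diff_distrib[symmetric] abs_mult)
          have "?z \<noteq> ?y" using nz r False by auto
          from C1(3)[OF inD(1)[OF s] inD(1)[OF t] this dirs]
          have 1: "?\<mu> powr (\<gamma> - \<kappa>) * (?e / (r * \<bar>s - t\<bar>) powr (\<gamma> - m)) \<le> C1" unfolding nz .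
          have "\<bar>s - t\<bar> powr (\<gamma> - m) \<le> 1" using s t m(3) by (intro powr_unit_le) (auto simp: abs_le_iff)
          then have 2: "(r * \<bar>s - t\<bar>) powr (\<gamma> - m) \<le> r powr (\<gamma> - m)"
            using r by (simp add: powr_mult mult_left_le)
          have 3: "(r/2) powr (\<gamma> - \<kappa>) \<le> ?\<mu> powr (\<gamma> - \<kappa>)"
            by (intro powr_mono2) (use inD(2)[OF s] inD(2)[OF t] r \<gamma> in auto)
          have "(r/2) powr (\<gamma> - \<kappa>) * (?e / r powr (\<gamma> - m)) \<le> ?\<mu> powr (\<gamma> - \<kappa>) * (?e / (r * \<bar>s - t\<bar>) powr (\<gamma> - m))"
            by (intro mult_mono 3 divide_left_mono 2) (use r False in auto)
          with 1 have 4: "(r/2) powr (\<gamma> - \<kappa>) * (?e / r powr (\<gamma> - m)) \<le> C1" by linarith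
          have "r powr (m - \<kappa>) = r powr (\<gamma> - \<kappa>) / r powr (\<gamma> - m)"
            using r by (simp add: powr_diff[symmetric])
          then have "r powr (m - \<kappa>) * ?e = 2 powr (\<gamma> - \<kappa>) * ((r/2) powr (\<gamma> - \<kappa>) * (?e / r powr (\<gamma> - m)))"
            using r by (simp add: powr_divide)
          also have "\<dots> \<le> 2 powr (\<gamma> - \<kappa>) * C1" using 4 by (intro mult_left_mono) auto
          also have "\<dots> \<le> 2 powr \<gamma> * C1" using C1(1) \<gamma> by (intro mult_right_mono powr_mono) auto
          finally show ?thesis unfolding F_def A_def
            by (simp add: right_diff_distrib[symmetric] abs_mult mult.commute)
        qed (use C1(1) in \<open>simp add: A_def\<close>)
      qed
    qed auto
    then have "r powr (1 - \<kappa>) * \<bar>partial_deriv [b] u x\<bar> \<le> C * A"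
      by (simp add: F_def abs_mult)
    then have "r powr (\<kappa> - 1) * (r powr (1 - \<kappa>) * \<bar>partial_deriv [b] u x\<bar>) \<le> r powr (\<kappa> - 1) * (C * A)"
      by (intro mult_left_mono) auto
    then show "\<bar>partial_deriv [b] u x\<bar> \<le> C * A * bdist D x powr (\<kappa> - 1)"
      using r by (simp add: r_def[symmetric] mult.assoc[symmetric] powr_add[symmetric] mult.commute)
  qed
qed


lemma lipschitz_of_partial_bounds:
  fixes f :: "'a::euclidean_space \<Rightarrow> real" and B :: real
  assumes S: "convex S" and d: "\<And>x. x \<in> S \<Longrightarrow> (f has_derivative frechet_derivative f (at x)) (at x)"
    and B: "\<And>x b. x \<in> S \<Longrightarrow> b \<in> Basis \<Longrightarrow> \<bar>frechet_derivative f (at x) b\<bar> \<le> B" and xy: "x \<in> S" "y \<in> S"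
  shows "\<bar>f x - f y\<bar> \<le> DIM('a) * B * norm (x - y)"
proof -
  have "norm (f x - f y) \<le> DIM('a) * B * norm (x - y)"
  proof (rule differentiable_bound[OF S _ _ xy])
    fix z assume z: "z \<in> S"
    show "(f has_derivative frechet_derivative f (at z)) (at z within S)"
      by (rule has_derivative_at_withinI[OF d[OF z]])
    have lin: "linear (frechet_derivative f (at z))" using d[OF z] by (rule has_derivative_linear)
    show "onorm (frechet_derivative f (at z)) \<le> DIM('a) * B"
    proof (rule onorm_le)
      fix v :: 'a
      have "frechet_derivative f (at z) v = (\<Sum>b\<in>Basis. (v \<bullet> b) * frechet_derivative f (at z) b)"
        using linear_sum[OF lin, of "\<lambda>b. (v \<bullet> b) *\<^sub>R b" Basis]
        by (simp add: euclidean_representation linear_cmul[OF lin])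
      also have "norm \<dots> \<le> (\<Sum>b\<in>(Basis :: 'a set). norm v * B)"
        by (intro sum_norm_le) (auto simp: abs_mult intro!: mult_mono Basis_le_norm B z)
      finally show "norm (frechet_derivative f (at z) v) \<le> DIM('a) * B * norm v"
        by (simp add: mult_ac)
    qed
  qed
  then show ?thesis by simp
qed

text \<open>If |x - y| is at most half the distance of x from the boundary, the gradient bound
  applies on a ball. Otherwise both values are at most a multiple of |x - y|^\<kappa>, because u
  decays like the \<kappa>-th power of the distance. The constant does not depend on \<theta>, which
  matters where \<theta> is chosen as a function of \<epsilon>.\<close>

lemma weighted_hoelder_modulus:
  fixes u :: "'a::euclidean_space \<Rightarrow> real"
  assumes D: "open D" and u: "u \<in> weighted_hoelder D \<gamma> (-\<kappa>)" and \<gamma>: "\<gamma> \<ge> 1" "0 < \<kappa>" "\<kappa> < 1"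
    and ne: "frontier D \<noteq> {}"
  shows "\<exists>C>0. \<forall>x y \<theta>. 0 \<le> \<theta> \<longrightarrow> \<theta> \<le> 1 - \<kappa> \<longrightarrow> x \<notin> frontier D \<longrightarrow>
    \<bar>u x - u y\<bar> \<le> C * norm (x - y) powr (\<kappa> + \<theta>) * bdist D x powr -\<theta>"
proof -
  obtain C1 where C1: "C1 \<ge> 0" "\<And>x. x \<in> D \<Longrightarrow> bdist D x powr (-\<kappa>) * \<bar>u x\<bar> \<le> C1"
    using weighted_hoelder_bounds[OF u] by metis
  obtain C2 where C2: "C2 \<ge> 0" "\<And>x b. x \<in> D \<Longrightarrow> b \<in> Basis \<Longrightarrow> 0 < bdist D x \<Longrightarrow>
      \<bar>partial_deriv [b] u x\<bar> \<le> C2 * bdist D x powr (\<kappa> - 1)"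
    using weighted_hoelder_partial_bound[OF D u] \<gamma> by (meson le_less_trans less_imp_le order_trans)
  have u0: "u x = 0" if "x \<notin> D" for x using u that by (auto simp: weighted_hoelder_def)
  have udiff: "u differentiable (at x)" if "x \<in> D" for x
  proof -
    have "0 < nat \<lfloor>\<gamma>\<rfloor>" using \<gamma> by simp
    moreover have "[] \<in> (directions 0 :: 'a list set)" by (simp add: directions_def)
    ultimately have "partial_deriv [] u differentiable (at x)"
      using u that unfolding weighted_hoelder_def C_k_def by blast
    then show ?thesis by simp
  qed
  have pos: "0 < bdist D x \<longleftrightarrow> x \<notin> frontier D" for x by (rule bdist_pos_iff[OF ne])
  have Dfr: "x \<notin> frontier D" if "x \<in> D" for x
    using D that by (metis disjoint_iff frontier_disjoint_eq)
  have bd: "\<bar>u x\<bar> \<le> C1 * bdist D x powr \<kappa>" for x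
  proof (cases "x \<in> D")
    case True
    then have p: "0 < bdist D x" using pos Dfr by blast
    have "\<bar>u x\<bar> = bdist D x powr \<kappa> * (bdist D x powr (-\<kappa>) * \<bar>u x\<bar>)"
      using p by (simp add: mult.assoc[symmetric] powr_add[symmetric])
    also have "\<dots> \<le> bdist D x powr \<kappa> * C1" by (intro mult_left_mono C1 True) auto
    finally show ?thesis by (simp add: mult.commute)
  qed (use C1 u0 in auto)
  define L where "L = real DIM('a) * C2 * 2"
  have near: "\<bar>u x - u y\<bar> \<le> L * bdist D x powr (\<kappa> - 1) * norm (x - y)"
    if x: "x \<notin> frontier D" and xy: "norm (x - y) \<le> bdist D x / 2" for x y
  proof -
    define r where "r = bdist D x"
    have r: "r > 0" using x pos r_def by blast
    have y: "y \<in> cball x (r/2)" using xy by (simp add: dist_norm r_def)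
    have sub: "cball x (r/2) \<subseteq> ball x r" using r by auto
    show ?thesis
    proof (cases "x \<in> D")
      \<comment> \<open>Off the closure of the set the ball about x misses the set, and both values
        are 0.\<close>
      case False
      then have "ball x r \<inter> D = {}"
        using ball_bdist_cases[OF D, of x] r centre_in_ball[of x r] unfolding r_def by blast
      then have "y \<notin> D" using y sub by blast
      then show ?thesis using False u0 C2 by (simp add: L_def)
    next
      case True
      then have "ball x r \<subseteq> D"
        using ball_bdist_cases[OF D, of x] r centre_in_ball[of x r] unfolding r_def by blast
      then have inD: "cball x (r/2) \<subseteq> D" using sub by blast
      have "\<bar>u x - u y\<bar> \<le> DIM('a) * (C2 * (2 * r powr (\<kappa> - 1))) * norm (x - y)"
      proof (rule lipschitz_of_partial_bounds[OF convex_cball])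
        fix z assume z: "z \<in> cball x (r/2)"
        then have zD: "z \<in> D" using inD by blast
        then show "(u has_derivative frechet_derivative u (at z)) (at z)"
          using udiff frechet_derivative_works by blast
        have rz: "r / 2 \<le> bdist D z"
          using bdist_lipschitz[of D x z] z unfolding r_def by (auto simp: dist_norm)
        have "bdist D z powr (\<kappa> - 1) \<le> (r/2) powr (\<kappa> - 1)"
          by (rule powr_mono2') (use r rz \<gamma> in auto)
        also have "\<dots> = 2 powr (1 - \<kappa>) * r powr (\<kappa> - 1)"
          using r by (simp add: powr_divide powr_diff field_simps)
        also have "\<dots> \<le> 2 powr 1 * r powr (\<kappa> - 1)" using \<gamma> by (intro mult_right_mono powr_mono) auto
        finally have rz2: "bdist D z powr (\<kappa> - 1) \<le> 2 * r powr (\<kappa> - 1)" by simp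
        fix b :: 'a assume b: "b \<in> Basis"
        have "\<bar>frechet_derivative u (at z) b\<bar> \<le> C2 * bdist D z powr (\<kappa> - 1)"
          using C2(2)[OF zD b] pos Dfr zD by simp
        then show "\<bar>frechet_derivative u (at z) b\<bar> \<le> C2 * (2 * r powr (\<kappa> - 1))"
          using rz2 C2(1) by (meson mult_left_mono order_trans)
      qed (use y r in auto)
      then show ?thesis by (simp add: r_def L_def mult_ac)
    qed
  qed
  \<comment> \<open>L comes from the gradient case. In the other case each of the two values
    contributes 3 C1 n^\<kappa>, and 2^\<theta> \<le> 2 doubles the sum to 12 C1. The 1 makes the
    constant positive.\<close>
  define C where "C = L + 12 * C1 + 1"
  show ?thesis
  proof (intro exI[of _ C] conjI allI impI)
    show "C > 0" using C1 C2 by (simp add: C_def L_def add_nonneg_pos)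
    fix x y \<theta> assume \<theta>: "0 \<le> \<theta>" "\<theta> \<le> 1 - \<kappa>" and x: "x \<notin> frontier D"
    define r and n where "r = bdist D x" and "n = norm (x - y)"
    have r: "r > 0" using x pos r_def by blast
    show "\<bar>u x - u y\<bar> \<le> C * norm (x - y) powr (\<kappa> + \<theta>) * bdist D x powr -\<theta>"
    proof (cases "n = 0")
      case False
      then have n: "n > 0" by (simp add: n_def)
      show ?thesis
      proof (cases "n \<le> r / 2")
        case True
        \<comment> \<open>Passing from the exponent 1 to \<kappa> + \<theta> splits off a
          nonnegative power of n / r, which is at most 1 here.\<close>
        have "r powr (\<kappa> - 1) * n = (n / r) powr (1 - \<kappa> - \<theta>) * (n powr (\<kappa> + \<theta>) * r powr -\<theta>)"
        proof -
          have "n powr (1 - \<kappa> - \<theta>) * n powr (\<kappa> + \<theta>) = n" using n by (simp add: powr_add[symmetric])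
          moreover have "r powr -\<theta> / r powr (1 - \<kappa> - \<theta>) = r powr (\<kappa> - 1)"
            using r by (simp add: powr_diff[symmetric])
          ultimately show ?thesis using n r by (simp add: powr_divide mult_ac) (metis times_divide_eq_right mult.commute mult.left_commute)
        qed
        also have "\<dots> \<le> 1 * (n powr (\<kappa> + \<theta>) * r powr -\<theta>)"
          by (intro mult_right_mono powr_unit_le) (use True n r \<theta> in auto)
        finally have "L * (r powr (\<kappa> - 1) * n) \<le> L * (n powr (\<kappa> + \<theta>) * r powr -\<theta>)"
          using C2(1) by (intro mult_left_mono) (auto simp: L_def)
        moreover have "\<dots> \<le> C * (n powr (\<kappa> + \<theta>) * r powr -\<theta>)"
          using C1 by (intro mult_right_mono) (auto simp: C_def)
        ultimately show ?thesis using near[OF x, of y] True unfolding n_def r_def by (simp add: mult_ac)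
      next
        case False
        have "bdist D y \<le> 3 * n" "r \<le> 3 * n"
          using bdist_lipschitz[of D x y] False n unfolding r_def n_def by auto
        then have "bdist D y powr \<kappa> \<le> (3 * n) powr \<kappa>" "r powr \<kappa> \<le> (3 * n) powr \<kappa>"
          using r \<gamma> by (auto intro!: powr_mono2 simp: bdist_def infdist_nonneg)
        moreover have "(3 * n) powr \<kappa> \<le> 3 * n powr \<kappa>"
          using powr_mono[of \<kappa> 1 "3::real"] \<gamma> n by (simp add: powr_mult mult_right_mono)
        ultimately have "C1 * bdist D y powr \<kappa> + C1 * r powr \<kappa> \<le> C1 * (3 * n powr \<kappa>) + C1 * (3 * n powr \<kappa>)"
          using C1(1) by (intro add_mono mult_left_mono) auto
        then have 1: "\<bar>u x - u y\<bar> \<le> 6 * C1 * n powr \<kappa>"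
          using bd[of x] bd[of y] unfolding r_def by (simp add: abs_le_iff)
        \<comment> \<open>As r < 2n, the factor (n / r)^\<theta> may be inserted at the cost of
          2^\<theta>.\<close>
        have "1 \<le> (2 * n / r) powr \<theta>" using False r \<theta> by (intro ge_one_powr_ge_zero) (auto simp: field_simps)
        also have "\<dots> = 2 powr \<theta> * (n powr \<theta> * r powr -\<theta>)"
          using n r by (simp add: powr_divide powr_mult powr_minus field_simps)
        also have "\<dots> \<le> 2 powr 1 * (n powr \<theta> * r powr -\<theta>)" using \<theta> \<gamma> by (intro mult_right_mono powr_mono) auto
        finally have "6 * C1 * n powr \<kappa> * 1 \<le> 6 * C1 * n powr \<kappa> * (2 powr 1 * (n powr \<theta> * r powr -\<theta>))"
          using C1(1) by (intro mult_left_mono) auto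
        also have "\<dots> = 12 * C1 * (n powr (\<kappa> + \<theta>) * r powr -\<theta>)" by (simp add: powr_add mult_ac)
        also have "\<dots> \<le> C * (n powr (\<kappa> + \<theta>) * r powr -\<theta>)"
          using C2 by (intro mult_right_mono) (auto simp: C_def L_def)
        finally show ?thesis using 1 unfolding n_def r_def by (simp add: mult_ac)
      qed
    qed (simp add: n_def)
  qed
qed

section \<open>Volume of boundary layers\<close>

lemma emeasure_lborel_translate:
  fixes c :: "'a::euclidean_space"
  assumes [measurable]: "A \<in> sets borel"
  shows "emeasure lborel {x. c + x \<in> A} = emeasure lborel A"
proof -
  have "emeasure lborel A = emeasure (distr lborel borel ((+) c)) A" by (simp add: lborel_distr_plus)
  also have "\<dots> = emeasure lborel {x. c + x \<in> A}"
    by (subst emeasure_distr) (auto simp: vimage_def)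
  finally show ?thesis by simp
qed

text \<open>About \<open>\<rho> / t\<close> disjoint translates of the strip in direction \<open>e\<close> fit into a fixed ball.\<close>

lemma emeasure_strip_le:
  fixes e z :: "'a::euclidean_space"
  assumes [measurable]: "\<psi> \<in> borel_measurable borel" and e: "norm e = 1"
    and shift: "\<And>x \<tau>. \<psi> (x + \<tau> *\<^sub>R e) = \<psi> x + \<tau>" and \<rho>: "\<rho> > 0" and t: "t > 0"
  shows "emeasure lborel {x\<in>ball z \<rho>. \<bar>\<psi> x\<bar> \<le> t} \<le> ennreal (6 * measure lborel (ball z (2 * \<rho>)) / \<rho> * t)"
proof -
  let ?V = "measure lborel (ball z (2 * \<rho>))" and ?A = "{x\<in>ball z \<rho>. \<bar>\<psi> x\<bar> \<le> t}"
  have V: "emeasure lborel (ball z (2*\<rho>)) = ennreal ?V"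
    using emeasure_lborel_ball_finite[of z "2*\<rho>"] by (simp add: emeasure_eq_ennreal_measure less_top)
  have fin: "emeasure lborel ?A < \<infinity>"
    by (rule le_less_trans[OF emeasure_mono[of _ "ball z \<rho>"]]) (use emeasure_lborel_ball_finite in auto)
  show ?thesis
  proof (cases "3 * t > \<rho>")
    case True
    have "emeasure lborel ?A \<le> ennreal ?V" unfolding V[symmetric] using \<rho> by (intro emeasure_mono) auto
    also have "\<dots> \<le> ennreal (6 * ?V / \<rho> * t)"
    proof (rule ennreal_leI)
      have "?V * \<rho> \<le> ?V * (6 * t)" using True t by (intro mult_left_mono) auto
      then show "?V \<le> 6 * ?V / \<rho> * t" using \<rho> by (simp add: field_simps)
    qed
    finally show ?thesis .
  next
    case False
    \<comment> \<open>The translates are spaced 3t apart while the strip has width 2t, so they are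
      disjoint; the largest shift 3tN \<le> \<rho> keeps them in the ball of radius 2 \<rho>. As
      \<rho> / (3t) \<ge> 1, rounding down loses at most a factor 2, whence the 6 in the
      bound.\<close>
    define N where "N = nat \<lfloor>\<rho> / (3 * t)\<rfloor>"
    have q1: "1 \<le> \<rho> / (3 * t)" using False t by (simp add: field_simps)
    then have "1 \<le> \<lfloor>\<rho> / (3 * t)\<rfloor>" by simp
    then have N: "real N \<le> \<rho> / (3 * t)" "\<rho> / (3 * t) \<le> 2 * real N" unfolding N_def by linarith+
    define T where "T j = {x. - (3 * t * real j) *\<^sub>R e + x \<in> ?A}" for j
    have "?A \<in> sets borel" by measurable
    then have Tm[measurable]: "T j \<in> sets borel" for j
      using measurable_sets_borel[of "\<lambda>x. - (3 * t * real j) *\<^sub>R e + x" borel ?A]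
      by (simp add: T_def vimage_def)
    have psi: "\<bar>\<psi> x - 3 * t * real j\<bar> \<le> t" if "x \<in> T j" for x j
    proof -
      have "\<psi> x = \<psi> (- (3 * t * real j) *\<^sub>R e + x) + 3 * t * real j"
        using shift[of "- (3 * t * real j) *\<^sub>R e + x" "3 * t * real j"] by simp
      then show ?thesis using that by (simp add: T_def)
    qed
    have disj: "disjoint_family_on T {..<N}"
      unfolding disjoint_family_on_def
    proof (intro ballI impI)
      fix i j :: nat assume "i \<noteq> j"
      show "T i \<inter> T j = {}"
      proof (rule ccontr)
        assume "T i \<inter> T j \<noteq> {}"
        then obtain x where "x \<in> T i" "x \<in> T j" by auto
        from psi[OF this(1)] psi[OF this(2)]
        have "\<bar>3 * t * real i - 3 * t * real j\<bar> \<le> 2 * t" by linarith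
        then have "3 * t * \<bar>real i - real j\<bar> \<le> 2 * t"
          using t by (simp add: right_diff_distrib[symmetric] abs_mult)
        moreover have "1 \<le> \<bar>real i - real j\<bar>" using \<open>i \<noteq> j\<close> by linarith
        then have "3 * t * 1 \<le> 3 * t * \<bar>real i - real j\<bar>" using t by (intro mult_left_mono) auto
        ultimately show False using t by linarith
      qed
    qed
    have sub: "(\<Union>j\<in>{..<N}. T j) \<subseteq> ball z (2*\<rho>)"
    proof
      fix x assume "x \<in> (\<Union>j\<in>{..<N}. T j)"
      then obtain j where j: "j < N" "x \<in> T j" by auto
      have "3 * t * real j \<le> 3 * t * real N" using j t by (intro mult_left_mono) auto
      also have "\<dots> \<le> \<rho>" using N(1) t by (simp add: field_simps)
      finally have 1: "norm ((3 * t * real j) *\<^sub>R e) \<le> \<rho>" using e t by simp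
      have "dist z (- (3 * t * real j) *\<^sub>R e + x) < \<rho>" using j by (simp add: T_def)
      then have 2: "norm (z - x + (3 * t * real j) *\<^sub>R e) < \<rho>" by (simp add: dist_norm algebra_simps)
      have "norm (z - x) \<le> norm (z - x + (3 * t * real j) *\<^sub>R e) + norm ((3 * t * real j) *\<^sub>R e)"
        using norm_triangle_ineq4[of "z - x + (3 * t * real j) *\<^sub>R e" "(3 * t * real j) *\<^sub>R e"] by simp
      then show "x \<in> ball z (2*\<rho>)" using 1 2 by (simp add: dist_norm)
    qed
    have "emeasure lborel (T j) = emeasure lborel ?A" for j
      unfolding T_def by (rule emeasure_lborel_translate) measurable
    then have "real N * emeasure lborel ?A = (\<Sum>j<N. emeasure lborel (T j))"
      by (simp add: ennreal_of_nat_eq_real_of_nat)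
    also have "\<dots> = emeasure lborel (\<Union>j\<in>{..<N}. T j)"
      by (rule sum_emeasure) (use disj in auto)
    also have "\<dots> \<le> ennreal ?V" unfolding V[symmetric] using sub by (intro emeasure_mono) auto
    finally have le: "real N * emeasure lborel ?A \<le> ennreal ?V" .
    have "emeasure lborel ?A = ennreal (measure lborel ?A)"
      using fin by (simp add: emeasure_eq_ennreal_measure less_top)
    with le have "real N * measure lborel ?A \<le> ?V" by (simp add: ennreal_mult[symmetric])
    moreover have "\<rho> / (3 * t) * measure lborel ?A \<le> 2 * real N * measure lborel ?A"
      using N by (intro mult_right_mono) auto
    ultimately have "\<rho> / (3 * t) * measure lborel ?A \<le> 2 * ?V" by linarith
    then have "measure lborel ?A \<le> 6 * ?V / \<rho> * t" using t \<rho> by (simp add: field_simps)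
    then show ?thesis using \<open>emeasure lborel ?A = ennreal (measure lborel ?A)\<close> by (simp add: ennreal_leI)
  qed
qed

section \<open>Boundary layers of a domain with local graph coordinates\<close>

lemma frontier_ne:
  fixes D :: "'a::euclidean_space set"
  assumes "bounded D" "C11_domain D"
  shows "frontier D \<noteq> {}"
  using assms frontier_not_empty[of D] not_bounded_UNIV[where 'a='a] unfolding C11_domain_def by metis

lemma C11_domain_open: "C11_domain D \<Longrightarrow> open D"
  by (simp add: C11_domain_def)

lemma borel_measurable_bdist [measurable]: "bdist D \<in> borel_measurable borel"
  unfolding bdist_def[abs_def] by (intro borel_measurable_continuous_onI continuous_intros)

text \<open>The height \<psi> above the graph is Lipschitz with constant 1 + M and vanishes on the
  boundary, so the layer of width r is contained in the strip where |\<psi>| is at most (1 + M) r.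
  Moving along e raises \<psi> at unit speed, which is what the strip estimate asks for.\<close>

lemma emeasure_boundary_layer_local:
  fixes D :: "'a::euclidean_space set"
  assumes D: "open D" and ne: "frontier D \<noteq> {}" and R: "R > 0" and M: "M > 0"
    and e: "norm e = 1" and H: "H = {v. v \<bullet> e = 0}"
    and \<phi>: "\<And>v. v \<in> H \<Longrightarrow> G v \<in> H \<and> norm (G v) \<le> M \<and> (\<phi> has_derivative (\<lambda>w. G v \<bullet> w)) (at v within H)"
    and graph: "D \<inter> ball z R = {x \<in> ball z R. \<phi> ((x - z) - ((x - z) \<bullet> e) *\<^sub>R e) < (x - z) \<bullet> e}"
  shows "\<exists>C\<ge>0. \<forall>r. 0 < r \<longrightarrow> r < R/4 \<longrightarrow> emeasure lborel {x\<in>ball z (R/2). bdist D x \<le> r} \<le> ennreal (C * r)"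
proof -
  \<comment> \<open>Orthogonal projection onto the hyperplane \<open>H\<close>.\<close>
  define P where "P v = v - (v \<bullet> e) *\<^sub>R e" for v
  define \<psi> where "\<psi> x = (x - z) \<bullet> e - \<phi> (P (x - z))" for x
  have ee: "e \<bullet> e = 1" using e by (simp add: dot_square_norm)
  have PH: "P v \<in> H" for v by (simp add: H P_def inner_diff_left ee)
  have Pn: "norm (P v) \<le> norm v" for v
  proof -
    have "(norm (P v))\<^sup>2 = (norm v)\<^sup>2 - (v \<bullet> e)\<^sup>2"
      unfolding P_def power2_norm_eq_inner
      by (simp add: inner_diff_left inner_diff_right ee inner_commute power2_eq_square)
    then have "(norm (P v))\<^sup>2 \<le> (norm v)\<^sup>2" by simp
    then show ?thesis by (simp add: power_mono_iff)
  qed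
  have Pd: "P v - P w = P (v - w)" for v w by (simp add: P_def inner_diff_left algebra_simps)
  have convH: "convex H" unfolding H convex_def by (auto simp: inner_add_left)
  have lip\<phi>: "\<bar>\<phi> v - \<phi> w\<bar> \<le> M * norm (v - w)" if "v \<in> H" "w \<in> H" for v w
  proof -
    have "norm (\<phi> v - \<phi> w) \<le> M * norm (v - w)"
    proof (rule differentiable_bound[OF convH _ _ that])
      show "(\<phi> has_derivative (\<lambda>w. G v \<bullet> w)) (at v within H)" if "v \<in> H" for v using \<phi> that by blast
      show "onorm (\<lambda>w. G v \<bullet> w) \<le> M" if "v \<in> H" for v
      proof (rule onorm_le)
        fix w show "norm (G v \<bullet> w) \<le> M * norm w"
          using Cauchy_Schwarz_ineq2[of "G v" w] \<phi>[OF that] mult_right_mono[of "norm (G v)" M "norm w"] by fastforce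
      qed
    qed
    then show ?thesis by simp
  qed
  have lip: "\<bar>\<psi> x - \<psi> y\<bar> \<le> (1 + M) * norm (x - y)" for x y
  proof -
    have "\<bar>\<phi> (P (x - z)) - \<phi> (P (y - z))\<bar> \<le> M * norm (P (x - z) - P (y - z))" by (intro lip\<phi> PH)
    also have "\<dots> \<le> M * norm (x - y)" using M Pn[of "x - y"] unfolding Pd by (simp add: mult_left_mono)
    finally have 1: "\<bar>\<phi> (P (x - z)) - \<phi> (P (y - z))\<bar> \<le> M * norm (x - y)" .
    have 2: "\<bar>(x - z) \<bullet> e - (y - z) \<bullet> e\<bar> \<le> norm (x - y)"
      using Cauchy_Schwarz_ineq2[of "x - y" e] e by (simp add: inner_diff_left)
    show ?thesis using 1 2 unfolding \<psi>_def by (simp add: algebra_simps)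
  qed
  have cont: "continuous_on UNIV \<psi>"
    by (rule lipschitz_on_continuous_on[of "1 + M"], rule lipschitz_onI)
       (use lip M in \<open>auto simp: dist_norm\<close>)
  have [measurable]: "\<psi> \<in> borel_measurable borel" by (rule borel_measurable_continuous_onI[OF cont])
  have shift: "\<psi> (x + \<tau> *\<^sub>R e) = \<psi> x + \<tau>" for x \<tau>
  proof -
    have "P (x + \<tau> *\<^sub>R e - z) = P (x - z)" by (simp add: P_def inner_diff_left inner_add_left ee algebra_simps)
    then show ?thesis by (simp add: \<psi>_def inner_diff_left inner_add_left ee)
  qed
  have graph': "x \<in> D \<longleftrightarrow> 0 < \<psi> x" if "x \<in> ball z R" for x
  proof -
    have "x \<in> D \<longleftrightarrow> x \<in> D \<inter> ball z R" using that by blast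
    also have "\<dots> \<longleftrightarrow> 0 < \<psi> x" unfolding graph using that by (simp add: \<psi>_def P_def)
    finally show ?thesis .
  qed
  \<comment> \<open>Boundary points are not in the open set, so their height is not positive; near a
    point of negative height there are no points of the set.\<close>
  have zero: "\<psi> p = 0" if p: "p \<in> frontier D" "p \<in> ball z R" for p
  proof -
    have "p \<notin> D" using p D by (metis disjoint_iff frontier_disjoint_eq)
    then have le: "\<psi> p \<le> 0" using graph' p by force
    moreover have "\<not> \<psi> p < 0"
    proof
      assume neg: "\<psi> p < 0"
      let ?U = "{x. \<psi> x < 0} \<inter> ball z R"
      have "open ?U" by (intro open_Int open_Collect_less cont open_ball continuous_intros)
      moreover have "?U \<inter> D = {}" using graph' by force
      ultimately have "?U \<inter> closure D = {}" by (simp add: open_Int_closure_eq_empty)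
      then show False using p neg by (auto simp: frontier_def)
    qed
    ultimately show ?thesis by simp
  qed
  define C where "C = 6 * measure lborel (ball z (2 * (R/2))) / (R/2) * (1 + M)"
  show ?thesis
  proof (intro exI[of _ C] conjI allI impI)
    show "C \<ge> 0" using R M by (simp add: C_def)
    fix r :: real assume r: "0 < r" "r < R/4"
    have sub: "{x\<in>ball z (R/2). bdist D x \<le> r} \<subseteq> {x\<in>ball z (R/2). \<bar>\<psi> x\<bar> \<le> (1 + M) * r}"
    proof safe
      fix x assume x: "x \<in> ball z (R/2)" "bdist D x \<le> r"
      \<comment> \<open>As r < R/4, the boundary point nearest to x still lies in the ball of radius
        R, where the graph describes the set.\<close>
      obtain p where p: "p \<in> frontier D" "bdist D x = dist x p"
        using infdist_attains_inf[OF frontier_closed ne] unfolding bdist_def by metis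
      have "dist z p \<le> dist z x + dist x p" by (rule dist_triangle)
      then have "p \<in> ball z R" using x p r R by auto
      from zero[OF p(1) this] lip[of x p] have "\<bar>\<psi> x\<bar> \<le> (1 + M) * dist x p" by (simp add: dist_norm)
      also have "\<dots> \<le> (1 + M) * r" using x p M by (intro mult_left_mono) auto
      finally show "\<bar>\<psi> x\<bar> \<le> (1 + M) * r" .
    qed
    have "emeasure lborel {x\<in>ball z (R/2). bdist D x \<le> r} \<le> emeasure lborel {x\<in>ball z (R/2). \<bar>\<psi> x\<bar> \<le> (1 + M) * r}"
      by (rule emeasure_mono[OF sub]) measurable
    also have "\<dots> \<le> ennreal (6 * measure lborel (ball z (2 * (R/2))) / (R/2) * ((1 + M) * r))"
      by (rule emeasure_strip_le[OF _ e shift]) (use R r M in auto)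
    finally show "emeasure lborel {x\<in>ball z (R/2). bdist D x \<le> r} \<le> ennreal (C * r)"
      by (simp add: C_def mult_ac)
  qed
qed

text \<open>Finitely many balls of radius R/4 cover the compact boundary, and points at distance
  less than R/4 from it lie in the concentric balls of radius R/2, where the local estimate holds.
  \<open>B\<close> need not be the domain, because the truncated operator is integrated over a
  larger ball.\<close>

lemma emeasure_boundary_layer:
  fixes D B :: "'a::euclidean_space set"
  assumes D: "bounded D" "C11_domain D" and B: "B \<in> sets borel" "bounded B"
  shows "\<exists>C\<ge>0. \<forall>r>0. emeasure lborel {x\<in>B. bdist D x \<le> r} \<le> ennreal (C * r)"
proof -
  note op = C11_domain_open[OF D(2)] and ne = frontier_ne[OF D]
  from D(2) obtain R M where R: "R > 0" and M: "M > 0" and loc: "\<forall>z\<in>frontier D. \<exists>e \<phi> G. norm e = 1 \<and>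
        (let H = {v. v \<bullet> e = 0} in
          \<phi> 0 = 0 \<and> G 0 = 0 \<and>
          (\<forall>v\<in>H. G v \<in> H \<and> norm (G v) \<le> M \<and>
             (\<phi> has_derivative (\<lambda>w. G v \<bullet> w)) (at v within H)) \<and>
          (\<forall>v\<in>H. \<forall>w\<in>H. norm (G v - G w) \<le> M * norm (v - w)) \<and>
          D \<inter> ball z R =
            {x \<in> ball z R. \<phi> ((x - z) - ((x - z) \<bullet> e) *\<^sub>R e) < (x - z) \<bullet> e})"
    unfolding C11_domain_def by blast
  have "\<exists>C\<ge>0. \<forall>r. 0 < r \<longrightarrow> r < R/4 \<longrightarrow> emeasure lborel {x\<in>ball z (R/2). bdist D x \<le> r} \<le> ennreal (C * r)"
    if "z \<in> frontier D" for z
  proof -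
    from bspec[OF loc that] obtain e \<phi> G where e: "norm e = 1" and
       g: "\<And>v. v \<in> {v. v \<bullet> e = 0} \<Longrightarrow> G v \<in> {v. v \<bullet> e = 0} \<and> norm (G v) \<le> M \<and>
             (\<phi> has_derivative (\<lambda>w. G v \<bullet> w)) (at v within {v. v \<bullet> e = 0})"
       "D \<inter> ball z R =
            {x \<in> ball z R. \<phi> ((x - z) - ((x - z) \<bullet> e) *\<^sub>R e) < (x - z) \<bullet> e}"
      unfolding Let_def by (elim exE conjE) (erule_tac x = undefined in meta_allE | rule that | blast)+
    show ?thesis by (rule emeasure_boundary_layer_local[OF op ne R M e refl g])
  qed
  then obtain c where c: "\<And>z. z \<in> frontier D \<Longrightarrow> c z \<ge> 0"
    "\<And>z r. z \<in> frontier D \<Longrightarrow> 0 < r \<Longrightarrow> r < R/4 \<Longrightarrow> emeasure lborel {x\<in>ball z (R/2). bdist D x \<le> r} \<le> ennreal (c z * r)"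
    by metis
  have "compact (frontier D)" using D by (simp add: compact_frontier_bounded)
  then obtain Z where Z: "Z \<subseteq> frontier D" "finite Z" "frontier D \<subseteq> (\<Union>z\<in>Z. ball z (R/4))"
    by (rule compactE_image[of "frontier D" "frontier D" "\<lambda>z. ball z (R/4)"]) (use R in auto)
  have finB: "emeasure lborel B < \<infinity>" using emeasure_bounded_finite[OF B(2)] by simp
  define m where "m = measure lborel B"
  have m: "emeasure lborel B = ennreal m" using finB by (simp add: m_def emeasure_eq_ennreal_measure less_top)
  \<comment> \<open>The second summand serves the widths r \<ge> R/4, for which the whole volume m
    is at most (4m/R) r.\<close>
  define C where "C = (\<Sum>z\<in>Z. c z) + m * 4 / R"
  have cs: "0 \<le> (\<Sum>z\<in>Z. c z)" using c(1) Z(1) by (intro sum_nonneg) auto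
  have m0: "0 \<le> m" by (simp add: m_def)
  have [measurable]: "B \<in> sets borel" by (rule B)
  show ?thesis
  proof (intro exI[of _ C] conjI allI impI)
    show "C \<ge> 0" using cs R m0 by (simp add: C_def)
    fix r :: real assume r: "r > 0"
    show "emeasure lborel {x\<in>B. bdist D x \<le> r} \<le> ennreal (C * r)"
    proof (cases "r < R/4")
      case True
      have "{x\<in>B. bdist D x \<le> r} \<subseteq> (\<Union>z\<in>Z. {x\<in>ball z (R/2). bdist D x \<le> r})"
      proof safe
        fix x assume x: "bdist D x \<le> r"
        obtain p where p: "p \<in> frontier D" "bdist D x = dist x p"
          using infdist_attains_inf[OF frontier_closed ne] unfolding bdist_def by metis
        obtain z where z: "z \<in> Z" "p \<in> ball z (R/4)" using Z(3) p by auto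
        have "dist z x \<le> dist z p + dist x p" by (metis dist_commute dist_triangle)
        then have "x \<in> ball z (R/2)" using x p z True by auto
        then show "x \<in> (\<Union>z\<in>Z. {x\<in>ball z (R/2). bdist D x \<le> r})" using z x by auto
      qed
      then have "emeasure lborel {x\<in>B. bdist D x \<le> r} \<le> emeasure lborel (\<Union>z\<in>Z. {x\<in>ball z (R/2). bdist D x \<le> r})"
        by (rule emeasure_mono) (rule sets.finite_UN[OF Z(2)], measurable)
      also have "\<dots> \<le> (\<Sum>z\<in>Z. emeasure lborel {x\<in>ball z (R/2). bdist D x \<le> r})"
        by (rule emeasure_subadditive_finite[OF Z(2)]) auto
      also have "\<dots> \<le> (\<Sum>z\<in>Z. ennreal (c z * r))"
        by (rule sum_mono) (use c(2) Z r True in auto)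
      also have "\<dots> = ennreal (\<Sum>z\<in>Z. c z * r)"
        using c(1) Z r by (intro sum_ennreal) auto
      also have "\<dots> \<le> ennreal (C * r)"
        using m0 R r by (intro ennreal_leI) (simp add: C_def sum_distrib_right distrib_right)
      finally show ?thesis .
    next
      case False
      have "emeasure lborel {x\<in>B. bdist D x \<le> r} \<le> ennreal m"
        unfolding m[symmetric] by (rule emeasure_mono) auto
      also have "\<dots> \<le> ennreal (C * r)"
      proof (rule ennreal_leI)
        have "m \<le> m * 4 / R * r" using False R mult_left_mono[of "R/4" r "m*4/R"] m0 by simp
        also have "\<dots> \<le> C * r" using cs r by (intro mult_right_mono) (auto simp: C_def)
        finally show "m \<le> C * r" .
      qed
      finally show ?thesis .
    qed
  qed
qed

section \<open>Averaging over a period\<close>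

lemma nn_integral_lborel_shift:
  fixes c :: "'a::euclidean_space"
  assumes "f \<in> borel_measurable borel"
  shows "(\<integral>\<^sup>+x. f (c + x) \<partial>lborel) = (\<integral>\<^sup>+x. f x \<partial>lborel)"
proof -
  have "(\<integral>\<^sup>+x. f x \<partial>lborel) = (\<integral>\<^sup>+x. f x \<partial>distr lborel borel ((+) c))" by (simp add: lborel_distr_plus)
  also have "\<dots> = (\<integral>\<^sup>+x. f (c + x) \<partial>lborel)" by (rule nn_integral_distr) (use assms in auto)
  finally show ?thesis by simp
qed

lemma integral_lborel_shift:
  fixes c :: "'a::euclidean_space" and f :: "'a \<Rightarrow> real"
  assumes "f \<in> borel_measurable borel"
  shows "(\<integral>x. f (c + x) \<partial>lborel) = (\<integral>x. f x \<partial>lborel)"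
proof -
  have "(\<integral>x. f x \<partial>lborel) = (\<integral>x. f x \<partial>distr lborel borel ((+) c))" by (simp add: lborel_distr_plus)
  also have "\<dots> = (\<integral>x. f (c + x) \<partial>lborel)" by (rule integral_distr) (use assms in auto)
  finally show ?thesis by simp
qed

lemma integrable_lborel_shift:
  fixes c :: "'a::euclidean_space" and f :: "'a \<Rightarrow> real"
  assumes "integrable lborel f"
  shows "integrable lborel (\<lambda>x. f (c + x))"
proof -
  have "integrable (distr lborel borel ((+) c)) f" using assms by (simp add: lborel_distr_plus)
  then show ?thesis by (subst (asm) integrable_distr_eq) (use assms in auto)
qed

lemma nn_integral_lborel_scale:
  fixes f :: "'a::euclidean_space \<Rightarrow> ennreal"
  assumes [measurable]: "f \<in> borel_measurable borel" and "c \<noteq> 0"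
  shows "(\<integral>\<^sup>+x. f x \<partial>lborel) = ennreal (\<bar>c\<bar> ^ DIM('a)) * (\<integral>\<^sup>+x. f (c *\<^sub>R x) \<partial>lborel)"
  using assms(2)
  by (subst lborel_affine[of c 0])
     (simp_all add: nn_integral_density nn_integral_distr nn_integral_cmult)

section \<open>Means of periodic functions over the unit cube\<close>

lemma AE_lborel_inner_neq:
  fixes e :: "'a::euclidean_space"
  assumes "e \<noteq> 0"
  shows "AE x in lborel. x \<bullet> e \<noteq> c"
proof -
  have "negligible {x. e \<bullet> x = c}" using assms by (intro negligible_hyperplane) auto
  then have "{x. e \<bullet> x = c} \<in> null_sets lborel"
    unfolding negligible_iff_null_sets
    by (subst (asm) null_sets_completion_iff) auto
  then have "AE x in lborel. x \<notin> {x. e \<bullet> x = c}" by (rule AE_not_in)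
  then show ?thesis by (simp add: inner_commute)
qed

text \<open>The translated cube is cut by the hyperplane where the coordinate equals 1: one piece
  lies in the unit cube, the other is carried back by the period e, and together they fill
  it.\<close>

lemma integral_unit_cube_shift_coordinate:
  fixes f :: "'a::euclidean_space \<Rightarrow> real"
  assumes [measurable]: "f \<in> borel_measurable borel" and M: "\<And>x. \<bar>f x\<bar> \<le> M"
    and per: "\<And>x. f (x + e) = f x" and e: "e \<in> Basis" and t: "0 \<le> t" "t < 1"
  shows "(\<integral>x. indicator (cbox 0 One) x * f (x + t *\<^sub>R e) \<partial>lborel)
    = (\<integral>x. indicator (cbox 0 One) x * f x \<partial>lborel)"
proof -
  let ?Q = "cbox 0 One :: 'a set"
  define A B where "A = ?Q \<inter> {x. t \<le> x \<bullet> e}" and "B = ?Q \<inter> {x. x \<bullet> e < t}"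
  have [measurable]: "A \<in> sets borel" "B \<in> sets borel" unfolding A_def B_def by measurable
  have int: "integrable lborel (\<lambda>x. indicator S x * f x)" if "S \<subseteq> ?Q" "S \<in> sets borel" for S
  proof (rule Bochner_Integration.integrable_bound[of _ "\<lambda>x. M * indicator ?Q x"])
    show "integrable lborel (\<lambda>x. M * indicator ?Q x :: real)"
      by (intro integrable_mult_right integrable_real_indicator) (auto simp: emeasure_lborel_cbox_eq)
    have "0 \<le> M" using M[of 0] by linarith
    then show "AE x in lborel. norm (indicator S x * f x) \<le> norm (M * indicator ?Q x :: real)"
      using that M by (auto simp: indicator_def)
  qed (use that in measurable)
  have e0: "e \<noteq> 0" using e by auto
  have ee: "e \<bullet> b = (if b = e then 1 else 0)" if "b \<in> Basis" for b using e that by (simp add: inner_Basis)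
  have "(\<integral>x. indicator ?Q x * f (x + t *\<^sub>R e) \<partial>lborel)
      = (\<integral>x. indicator ?Q (x - t *\<^sub>R e) * f x \<partial>lborel)"
    using integral_lborel_shift[of "\<lambda>x. indicator ?Q x * f (x + t *\<^sub>R e)" "- t *\<^sub>R e"]
    by (simp add: algebra_simps)
  also have "\<dots> = (\<integral>x. indicator A x * f x + indicator B (x - e) * f x \<partial>lborel)"
  proof (rule integral_cong_AE)
    \<comment> \<open>On the first hyperplane the two pieces overlap, on the second the half-open
      piece misses a face of the closed cube; both are null sets.\<close>
    show "AE x in lborel. indicator ?Q (x - t *\<^sub>R e) * f x = indicator A x * f x + indicator B (x - e) * f x"
      using AE_lborel_inner_neq[OF e0, of 1] AE_lborel_inner_neq[OF e0, of "1 + t"]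
    proof eventually_elim
      case (elim x)
      have o: "(\<forall>b\<in>Basis. P b ((x - s *\<^sub>R e) \<bullet> b)) \<longleftrightarrow> P e (x \<bullet> e - s) \<and> (\<forall>b\<in>Basis - {e}. P b (x \<bullet> b))" for P s
      proof -
        have "(\<forall>b\<in>Basis. P b ((x - s *\<^sub>R e) \<bullet> b)) \<longleftrightarrow> P e ((x - s *\<^sub>R e) \<bullet> e) \<and> (\<forall>b\<in>Basis - {e}. P b ((x - s *\<^sub>R e) \<bullet> b))"
          using e by blast
        also have "\<dots> \<longleftrightarrow> P e (x \<bullet> e - s) \<and> (\<forall>b\<in>Basis - {e}. P b (x \<bullet> b))"
          using e by (auto simp: inner_diff_left ee)
        finally show ?thesis .
      qed
      have Q: "x - s *\<^sub>R e \<in> ?Q \<longleftrightarrow> 0 \<le> x \<bullet> e - s \<and> x \<bullet> e - s \<le> 1 \<and> (\<forall>b\<in>Basis - {e}. 0 \<le> x \<bullet> b \<and> x \<bullet> b \<le> 1)" for s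
        using o[of "\<lambda>b y. 0 \<le> y \<and> y \<le> 1" s] by (simp add: mem_box)
      have e2: "(x - e) \<bullet> e = x \<bullet> e - 1" using e by (simp add: inner_diff_left)
      show ?case using Q[of t] Q[of 0] Q[of 1] elim t e2
        by (auto simp: A_def B_def indicator_def)
    qed
  qed measurable
  also have "\<dots> = (\<integral>x. indicator A x * f x \<partial>lborel) + (\<integral>x. indicator B (x - e) * f x \<partial>lborel)"
  proof (rule Bochner_Integration.integral_add)
    show "integrable lborel (\<lambda>x. indicator A x * f x)" by (rule int) (auto simp: A_def)
    have "integrable lborel (\<lambda>x. indicator B x * f x)" by (rule int) (auto simp: B_def)
    from integrable_lborel_shift[OF this, of "- e"]
    show "integrable lborel (\<lambda>x. indicator B (x - e) * f x)"
      using per[of "x - e" for x] by (simp add: algebra_simps)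
  qed
  also have "(\<integral>x. indicator B (x - e) * f x \<partial>lborel) = (\<integral>x. indicator B x * f x \<partial>lborel)"
    using integral_lborel_shift[of "\<lambda>x. indicator B (x - e) * f x" e] per
    by (simp add: add.commute)
  also have "(\<integral>x. indicator A x * f x \<partial>lborel) + (\<integral>x. indicator B x * f x \<partial>lborel)
     = (\<integral>x. indicator A x * f x + indicator B x * f x \<partial>lborel)"
    by (rule Bochner_Integration.integral_add[symmetric]) (rule int, auto simp: A_def B_def)+
  also have "\<dots> = (\<integral>x. indicator ?Q x * f x \<partial>lborel)"
    by (rule Bochner_Integration.integral_cong) (auto simp: A_def B_def indicator_def)
  finally show ?thesis .
qed

text \<open>A translation is a composition of translations along the coordinate axes, and along each
  axis periodicity leaves only the fractional part.\<close>

lemma integral_unit_cube_periodic: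
  fixes f :: "'a::euclidean_space \<Rightarrow> real"
  assumes [measurable]: "f \<in> borel_measurable borel" and M: "\<And>x. \<bar>f x\<bar> \<le> M"
    and per: "\<And>x e. e \<in> Basis \<Longrightarrow> f (x + e) = f x"
  shows "(\<integral>x. indicator (cbox 0 One) x * f (x + p) \<partial>lborel)
    = (\<integral>x. indicator (cbox 0 One) x * f x \<partial>lborel)"
proof -
  define m where "m p = (\<integral>x. indicator (cbox 0 One) x * f (x + p) \<partial>lborel)" for p
  have step: "m (p + t *\<^sub>R e) = m p" if e: "e \<in> Basis" for p e t
  proof -
    have n: "f (x + real n *\<^sub>R e) = f x" for x n
    proof (induction n)
      case (Suc n)
      have "f (x + real (Suc n) *\<^sub>R e) = f ((x + real n *\<^sub>R e) + e)" by (simp add: algebra_simps)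
      then show ?case using per[OF e] Suc by simp
    qed simp
    have i: "f (x + of_int i *\<^sub>R e) = f x" for x i
    proof (cases "i \<ge> 0")
      case True then show ?thesis using n[of x "nat i"] by simp
    next
      case False then show ?thesis using n[of "x + of_int i *\<^sub>R e" "nat (-i)"] by simp
    qed
    have "f (x + (p + t *\<^sub>R e)) = f (x + frac t *\<^sub>R e + p)" for x
      using i[of "x + frac t *\<^sub>R e + p" "\<lfloor>t\<rfloor>"] by (simp add: frac_def algebra_simps)
    then have "m (p + t *\<^sub>R e) = (\<integral>x. indicator (cbox 0 One) x * f ((x + frac t *\<^sub>R e) + p) \<partial>lborel)"
      by (simp add: m_def)
    also have "\<dots> = m p" unfolding m_def
      by (rule integral_unit_cube_shift_coordinate[where M = M and f = "\<lambda>x. f (x + p)"])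
         (use M e per[OF e, of "x + p" for x] in \<open>auto simp: frac_lt_1 algebra_simps\<close>)
    finally show ?thesis .
  qed
  have "m (\<Sum>b\<in>S. (p \<bullet> b) *\<^sub>R b) = m 0" if "finite S" "S \<subseteq> Basis" for S
    using that
  proof (induction S rule: finite_induct)
    case (insert b S)
    then show ?case using step[of b "\<Sum>b\<in>S. (p \<bullet> b) *\<^sub>R b" "p \<bullet> b"] by (simp add: add.commute)
  qed simp
  from this[of Basis] show ?thesis by (simp add: euclidean_representation m_def)
qed

text \<open>Translating the integral by \<open>\<epsilon> q\<close> and averaging over \<open>q\<close> in the unit cube replaces \<open>G\<close> by its
  increments, because the oscillating factor has mean zero.\<close>

lemma oscillating_integral_le:
  fixes G F :: "'a::euclidean_space \<Rightarrow> real"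
  assumes G: "integrable lborel G" and F[measurable]: "F \<in> borel_measurable borel" and M: "\<And>x. \<bar>F x\<bar> \<le> M"
    and mean: "\<And>p. (\<integral>q. indicator (cbox 0 One) q * F (q + p) \<partial>lborel) = 0" and \<epsilon>: "\<epsilon> > 0"
  shows "ennreal \<bar>\<integral>p. G p * F (p /\<^sub>R \<epsilon>) \<partial>lborel\<bar>
    \<le> ennreal M * (\<integral>\<^sup>+q\<in>cbox 0 One. (\<integral>\<^sup>+p. ennreal \<bar>G (p + \<epsilon> *\<^sub>R q) - G p\<bar> \<partial>lborel) \<partial>lborel)"
proof -
  let ?Q = "cbox 0 One :: 'a set"
  have Gm[measurable]: "G \<in> borel_measurable borel" using G by auto
  have M0: "0 \<le> M" using M[of 0] by linarith
  define I where "I = (\<integral>p. G p * F (p /\<^sub>R \<epsilon>) \<partial>lborel)"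
  \<comment> \<open>Translating both factors leaves I unchanged, so I - J q is the integral of an
    increment of G for each q. In the average of J q over the cube the inner integral is a mean of F
    over a translated cube, which is 0.\<close>
  define J where "J q = (\<integral>p. G p * F (p /\<^sub>R \<epsilon> + q) \<partial>lborel)" for q
  have int: "integrable lborel (\<lambda>p. G' p * F (p /\<^sub>R \<epsilon> + q))" if "integrable lborel G'" for q G'
  proof (rule Bochner_Integration.integrable_bound[of _ "\<lambda>x. M * G' x"])
    show "integrable lborel (\<lambda>x. M * G' x)" using that by simp
    have [measurable]: "G' \<in> borel_measurable borel" using that by auto
    show "(\<lambda>p. G' p * F (p /\<^sub>R \<epsilon> + q)) \<in> borel_measurable lborel" by measurable
    show "AE x in lborel. norm (G' x * F (x /\<^sub>R \<epsilon> + q)) \<le> norm (M * G' x)"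
      by (intro AE_I2) (use M M0 in \<open>auto simp: abs_mult mult.commute[of M] intro!: mult_left_mono\<close>)
  qed
  have sh: "integrable lborel (\<lambda>p. G (p + \<epsilon> *\<^sub>R q))" for q
    using integrable_lborel_shift[OF G, of "\<epsilon> *\<^sub>R q"] by (simp add: add.commute)
  have Iq: "I = (\<integral>p. G (p + \<epsilon> *\<^sub>R q) * F (p /\<^sub>R \<epsilon> + q) \<partial>lborel)" for q
    using integral_lborel_shift[of "\<lambda>p. G p * F (p /\<^sub>R \<epsilon>)" "\<epsilon> *\<^sub>R q"] \<epsilon>
    by (simp add: I_def algebra_simps)
  have diff: "ennreal \<bar>I - J q\<bar> \<le> ennreal M * (\<integral>\<^sup>+p. ennreal \<bar>G (p + \<epsilon> *\<^sub>R q) - G p\<bar> \<partial>lborel)" for q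
  proof -
    have "I - J q = (\<integral>p. (G (p + \<epsilon> *\<^sub>R q) - G p) * F (p /\<^sub>R \<epsilon> + q) \<partial>lborel)"
      unfolding Iq[of q] J_def using int[OF sh[of q], of q] int[OF G, of q]
      by (simp add: left_diff_distrib)
    also have "ennreal (norm \<dots>) \<le> (\<integral>\<^sup>+p. ennreal (norm ((G (p + \<epsilon> *\<^sub>R q) - G p) * F (p /\<^sub>R \<epsilon> + q))) \<partial>lborel)"
      by (rule integral_norm_bound_ennreal, rule int) (use sh G in auto)
    also have "\<dots> \<le> (\<integral>\<^sup>+p. ennreal M * ennreal \<bar>G (p + \<epsilon> *\<^sub>R q) - G p\<bar> \<partial>lborel)"
      using M M0 by (intro nn_integral_mono) (auto simp: abs_mult ennreal_mult[symmetric] mult.commute intro!: ennreal_leI mult_right_mono)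
    also have "\<dots> = ennreal M * (\<integral>\<^sup>+p. ennreal \<bar>G (p + \<epsilon> *\<^sub>R q) - G p\<bar> \<partial>lborel)"
      by (rule nn_integral_cmult) measurable
    finally show ?thesis by simp
  qed
  have prod: "integrable (lborel \<Otimes>\<^sub>M lborel) (\<lambda>(q, p). indicator ?Q q * (G p * F (p /\<^sub>R \<epsilon> + q)))"
  proof (rule Bochner_Integration.integrable_bound[of _ "\<lambda>(q, p). indicator ?Q q * (M * G p)"])
    show "integrable (lborel \<Otimes>\<^sub>M lborel) (\<lambda>(q::'a, p::'a). indicator ?Q q * (M * G p))"
    proof (rule lborel_pair.Fubini_integrable)
      have *: "(\<lambda>x. LINT y|lborel. norm (indicator ?Q x * (M * G y))) = (\<lambda>x. indicator ?Q x * (LINT y|lborel. \<bar>M * G y\<bar>))"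
        by (auto simp: abs_mult)
      have "integrable lborel (\<lambda>x. (LINT y|lborel. \<bar>M * G y\<bar>) * indicator ?Q x)"
        by (intro integrable_mult_right integrable_real_indicator) (auto simp: emeasure_lborel_cbox_eq)
      then show "integrable lborel (\<lambda>x. LINT y|lborel. norm (case (x, y) of (q, p) \<Rightarrow> indicator ?Q q * (M * G p)))"
        using * by (simp add: mult.commute)
      show "AE x in lborel. integrable lborel (\<lambda>y. case (x, y) of (q, p) \<Rightarrow> indicator ?Q q * (M * G p))"
        using G by auto
    qed measurable
    show "AE x in lborel \<Otimes>\<^sub>M lborel. norm (case x of (q, p) \<Rightarrow> indicator ?Q q * (G p * F (p /\<^sub>R \<epsilon> + q)))
         \<le> norm (case x of (q, p) \<Rightarrow> indicator ?Q q * (M * G p))"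
      by (intro AE_I2) (use M M0 in \<open>auto simp: abs_mult mult.commute[of M] intro!: mult_left_mono\<close>)
  qed measurable
  have Jint: "integrable lborel (\<lambda>q. indicator ?Q q * J q)"
    using lborel_pair.integrable_fst'[OF prod] unfolding J_def by simp
  have "(\<integral>q. indicator ?Q q * J q \<partial>lborel) = (\<integral>q. \<integral>p. indicator ?Q q * (G p * F (p /\<^sub>R \<epsilon> + q)) \<partial>lborel \<partial>lborel)"
    by (simp add: J_def)
  also have "\<dots> = (\<integral>p. \<integral>q. indicator ?Q q * (G p * F (p /\<^sub>R \<epsilon> + q)) \<partial>lborel \<partial>lborel)"
    using lborel_pair.Fubini_integral[OF prod] by simp
  also have "\<dots> = (\<integral>p. G p * (\<integral>q. indicator ?Q q * F (q + p /\<^sub>R \<epsilon>) \<partial>lborel) \<partial>lborel)"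
    by (simp add: mult.left_commute[of "indicator _ _"] add.commute)
  also have "\<dots> = 0" by (simp add: mean)
  finally have J0: "(\<integral>q. indicator ?Q q * J q \<partial>lborel) = 0" .
  have mQ: "measure lborel ?Q = 1" "emeasure lborel ?Q < \<infinity>"
    by (auto simp: measure_lborel_cbox_eq emeasure_lborel_cbox_eq)
  have intI: "integrable lborel (\<lambda>q. indicator ?Q q * I)"
    using mQ by (intro integrable_mult_left integrable_real_indicator) auto
  have "I = (\<integral>q. indicator ?Q q * I - indicator ?Q q * J q \<partial>lborel)"
    using J0 mQ by (subst Bochner_Integration.integral_diff[OF intI Jint]) simp
  also have "ennreal (norm \<dots>) \<le> (\<integral>\<^sup>+q. ennreal (norm (indicator ?Q q * I - indicator ?Q q * J q)) \<partial>lborel)"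
    by (rule integral_norm_bound_ennreal, rule Bochner_Integration.integrable_diff) (fact intI Jint)+
  also have "\<dots> \<le> (\<integral>\<^sup>+q. ennreal M * ((\<integral>\<^sup>+p. ennreal \<bar>G (p + \<epsilon> *\<^sub>R q) - G p\<bar> \<partial>lborel) * indicator ?Q q) \<partial>lborel)"
    by (rule nn_integral_mono) (use diff in \<open>auto simp: indicator_def\<close>)
  also have "\<dots> = ennreal M * (\<integral>\<^sup>+q\<in>?Q. (\<integral>\<^sup>+p. ennreal \<bar>G (p + \<epsilon> *\<^sub>R q) - G p\<bar> \<partial>lborel) \<partial>lborel)"
    by (rule nn_integral_cmult) measurable
  finally show ?thesis by (simp add: I_def)
qed

section \<open>Kernels and energies\<close>

definition riesz_kernel :: "real \<Rightarrow> 'a::euclidean_space \<Rightarrow> real" where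
  "riesz_kernel \<alpha> z = norm z powr - (real DIM('a) + \<alpha>)"

text \<open>Replacing |z| by \<epsilon> + |z| removes the singularity at scale \<epsilon> and keeps
  the decay. Unlike a sharp truncation, this form changes under translations of size \<epsilon> only
  by a multiple of itself.\<close>

definition reg_kernel :: "real \<Rightarrow> real \<Rightarrow> 'a::euclidean_space \<Rightarrow> real" where
  "reg_kernel \<epsilon> \<alpha> z = (\<epsilon> + norm z) powr - (real DIM('a) + \<alpha>)"

text \<open>The relative change of the regularised kernel under a translation of size \<epsilon>: of
  order 1 for |z| \<le> \<epsilon>, of order \<epsilon> / |z| beyond.\<close>

definition cutoff :: "real \<Rightarrow> 'a::euclidean_space \<Rightarrow> real" where
  "cutoff \<epsilon> z = \<epsilon> / (\<epsilon> + norm z)"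

text \<open>Twice the Dirichlet form with coefficient 1, as an extended number so that no
  integrability has to be known beforehand.\<close>

definition energy :: "real \<Rightarrow> ('a::euclidean_space \<Rightarrow> real) \<Rightarrow> ennreal" where
  "energy \<alpha> u = (\<integral>\<^sup>+x. \<integral>\<^sup>+y. ennreal ((u x - u y)\<^sup>2 * riesz_kernel \<alpha> (x - y)) \<partial>lborel \<partial>lborel)"

text \<open>The part of the energy that comes from pairs at distance of order \<epsilon>, with a
  tail damped like (\<epsilon> / |z|)^2. The square arises from a weighted product of two increments
  in which the whole factor \<open>cutoff\<close> is given to the limit.\<close>

definition cut_energy :: "real \<Rightarrow> real \<Rightarrow> ('a::euclidean_space \<Rightarrow> real) \<Rightarrow> ennreal" where
  "cut_energy \<epsilon> \<alpha> u =
    (\<integral>\<^sup>+x. \<integral>\<^sup>+y. ennreal ((u x - u y)\<^sup>2 * riesz_kernel \<alpha> (x - y) * (cutoff \<epsilon> (x - y))\<^sup>2) \<partial>lborel \<partial>lborel)"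

text \<open>With the absolute value inside the integral this dominates the operator with regularised
  kernel, and no principal value is needed.\<close>

definition reg_op :: "real \<Rightarrow> real \<Rightarrow> ('a::euclidean_space \<Rightarrow> real) \<Rightarrow> 'a \<Rightarrow> ennreal" where
  "reg_op \<epsilon> \<alpha> u x = (\<integral>\<^sup>+y. ennreal (\<bar>u x - u y\<bar> * reg_kernel \<epsilon> \<alpha> (x - y)) \<partial>lborel)"

lemma borel_measurable_kernels [measurable]:
  "riesz_kernel \<alpha> \<in> borel_measurable borel" "reg_kernel \<epsilon> \<alpha> \<in> borel_measurable borel"
  "cutoff \<epsilon> \<in> borel_measurable borel"
  unfolding riesz_kernel_def[abs_def] reg_kernel_def[abs_def] cutoff_def[abs_def] by measurable

lemma kernel_nonneg [simp]: "riesz_kernel \<alpha> z \<ge> 0" "reg_kernel \<epsilon> \<alpha> z \<ge> 0"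
  by (simp_all add: riesz_kernel_def reg_kernel_def)

lemma kernel_minus [simp]: "riesz_kernel \<alpha> (- z) = riesz_kernel \<alpha> z" "reg_kernel \<epsilon> \<alpha> (- z) = reg_kernel \<epsilon> \<alpha> z"
  "cutoff \<epsilon> (- z) = cutoff \<epsilon> z"
  by (simp_all add: riesz_kernel_def reg_kernel_def cutoff_def)

lemma kernel_diff_commute:
  "riesz_kernel \<alpha> (y - x) = riesz_kernel \<alpha> (x - y)" "reg_kernel \<epsilon> \<alpha> (y - x) = reg_kernel \<epsilon> \<alpha> (x - y)"
  "cutoff \<epsilon> (y - x) = cutoff \<epsilon> (x - y)"
  by (simp_all add: riesz_kernel_def reg_kernel_def cutoff_def norm_minus_commute)

lemma cutoff_bounds:
  assumes "\<epsilon> > 0"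
  shows "0 < cutoff \<epsilon> z" "cutoff \<epsilon> z \<le> 1" "(cutoff \<epsilon> z)\<^sup>2 \<le> 1"
proof -
  show "0 < cutoff \<epsilon> z" "cutoff \<epsilon> z \<le> 1" using assms by (auto simp: cutoff_def add_pos_nonneg)
  then show "(cutoff \<epsilon> z)\<^sup>2 \<le> 1" by (simp add: power_le_one)
qed

text \<open>At z = 0 the inequality fails: \<open>riesz_kernel\<close> has the default value 0
  there, since \<open>0 powr _ = 0\<close>, while \<open>reg_kernel\<close> is positive. Later uses
  treat the diagonal apart, where increments vanish.\<close>

lemma reg_kernel_le_riesz:
  assumes "\<epsilon> > 0" "\<alpha> > 0" "z \<noteq> 0"
  shows "reg_kernel \<epsilon> \<alpha> z \<le> riesz_kernel \<alpha> z"
  unfolding riesz_kernel_def reg_kernel_def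
  by (rule powr_mono2') (use assms in auto)

text \<open>The quotient of the two kernels is t^p with t = |z| / (\<epsilon> + |z|) and p = d +
  \<alpha>; moreover 1 - t^p \<le> p (1 - t) for p \<ge> 1, and 1 - t is the cutoff.\<close>

lemma riesz_minus_reg_kernel_le:
  fixes z :: "'a::euclidean_space"
  assumes "\<epsilon> > 0" "\<alpha> > 0" "z \<noteq> 0"
  shows "riesz_kernel \<alpha> z - reg_kernel \<epsilon> \<alpha> z \<le> (real DIM('a) + \<alpha>) * riesz_kernel \<alpha> z * cutoff \<epsilon> z"
proof -
  define p where "p = real DIM('a) + \<alpha>"
  have p: "p \<ge> 1" using assms DIM_positive[where 'a='a] unfolding p_def by linarith
  define n where "n = norm z"
  have n: "n > 0" using assms by (simp add: n_def)
  define t where "t = n / (\<epsilon> + n)"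
  have t: "0 < t" "t < 1" "1 - t = cutoff \<epsilon> z"
    using n assms by (auto simp: t_def cutoff_def n_def[symmetric] field_simps)
  have "\<exists>\<xi>>t. \<xi> < 1 \<and> 1 powr p - t powr p = (1 - t) * (p * \<xi> powr (p - 1))"
    by (rule MVT2) (use t in \<open>auto intro!: derivative_eq_intros\<close>)
  then obtain \<xi> where \<xi>: "t < \<xi>" "\<xi> < 1" "1 - t powr p = (1 - t) * (p * \<xi> powr (p - 1))"
    by auto
  have "\<xi> powr (p - 1) \<le> 1" using \<xi> t p by (intro powr_unit_le) auto
  then have "1 - t powr p \<le> (1 - t) * (p * 1)"
    unfolding \<xi>(3) using t p by (intro mult_left_mono) auto
  then have "n powr -p * (1 - t powr p) \<le> n powr -p * ((1 - t) * p)" by (intro mult_left_mono) auto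
  moreover have "n powr -p * t powr p = (\<epsilon> + n) powr -p"
    using n assms by (simp add: t_def powr_divide powr_minus field_simps)
  ultimately show ?thesis
    unfolding riesz_kernel_def reg_kernel_def p_def[symmetric] n_def[symmetric] t(3)[symmetric]
    by (simp add: algebra_simps)
qed

text \<open>The length T = \<epsilon> + |z| changes by at most c \<epsilon>, and so shrinks at most
  by the factor 1 + c. The mean value theorem for T^(-p) then gives \<epsilon> T^(-p-1) up to
  constants, and \<epsilon> / T is the cutoff.\<close>

lemma reg_kernel_shift:
  fixes z z' :: "'a::euclidean_space"
  assumes \<epsilon>: "\<epsilon> > 0" and \<alpha>: "\<alpha> > 0" and c: "c \<ge> 0" and d: "norm (z' - z) \<le> c * \<epsilon>"
  defines "p \<equiv> real DIM('a) + \<alpha>"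
  shows "reg_kernel \<epsilon> \<alpha> z' \<le> (1 + c) powr p * reg_kernel \<epsilon> \<alpha> z"
    and "\<bar>reg_kernel \<epsilon> \<alpha> z' - reg_kernel \<epsilon> \<alpha> z\<bar> \<le> c * p * (1 + c) powr (p + 1) * reg_kernel \<epsilon> \<alpha> z * cutoff \<epsilon> z"
proof -
  have p: "p \<ge> 1" using \<alpha> DIM_positive[where 'a='a] unfolding p_def by linarith
  define T T' where "T = \<epsilon> + norm z" and "T' = \<epsilon> + norm z'"
  have T: "T > 0" "T' > 0" "\<epsilon> \<le> T'" using \<epsilon> by (auto simp: T_def T'_def add_pos_nonneg)
  have dT: "\<bar>T' - T\<bar> \<le> c * \<epsilon>" using norm_triangle_ineq3[of z' z] d by (simp add: T_def T'_def)
  have "c * \<epsilon> \<le> c * T'" using T c by (intro mult_left_mono) auto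
  then have "T \<le> (1 + c) * T'" using dT by (simp add: algebra_simps)
  then have TT: "T / (1 + c) \<le> T'" "T / (1 + c) \<le> T" using c T by (auto simp: field_simps)
  have T0: "T / (1 + c) > 0" using T c by simp
  have "T' powr -p \<le> (T / (1 + c)) powr -p" by (rule powr_mono2') (use TT T0 p in auto)
  also have "\<dots> = (1 + c) powr p * T powr -p" using T c by (simp add: powr_divide powr_minus field_simps)
  finally show "reg_kernel \<epsilon> \<alpha> z' \<le> (1 + c) powr p * reg_kernel \<epsilon> \<alpha> z"
    by (simp add: reg_kernel_def T_def T'_def p_def)
  have mv: "\<bar>v powr -p - u powr -p\<bar> \<le> \<bar>v - u\<bar> * (p * (T / (1 + c)) powr (-p-1))"
    if "T / (1 + c) \<le> u" "u < v" for u v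
  proof -
    have "\<exists>\<xi>>u. \<xi> < v \<and> v powr -p - u powr -p = (v - u) * (- p * \<xi> powr (-p - 1))"
      by (rule MVT2) (use that T0 in \<open>auto intro!: derivative_eq_intros\<close>)
    then obtain \<xi> where \<xi>: "u < \<xi>" "v powr -p - u powr -p = (v - u) * (- p * \<xi> powr (-p - 1))" by blast
    have "\<xi> powr (-p-1) \<le> (T / (1 + c)) powr (-p-1)" by (rule powr_mono2') (use \<xi> that T0 p in auto)
    then have "(v - u) * (p * \<xi> powr (-p - 1)) \<le> (v - u) * (p * (T / (1 + c)) powr (-p-1))"
      using that p by (intro mult_left_mono) auto
    then show ?thesis unfolding \<xi>(2) using that p by (simp add: abs_mult)
  qed
  have "\<bar>T' powr -p - T powr -p\<bar> \<le> \<bar>T' - T\<bar> * (p * (T / (1 + c)) powr (-p-1))"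
    using mv[of T T'] mv[of T' T] TT by (cases T T' rule: linorder_cases) (auto simp: abs_minus_commute)
  also have "\<dots> \<le> c * \<epsilon> * (p * (T / (1 + c)) powr (-p-1))"
    using p by (intro mult_right_mono dT) auto
  also have "(T / (1 + c)) powr (-p-1) = (1 + c) powr (p + 1) * (T powr -p * (1 / T))"
  proof -
    have "(T / (1 + c)) powr (-p-1) = (1 + c) powr (p + 1) * T powr (-p-1)"
      using T c by (simp add: powr_divide field_simps powr_add[symmetric])
    also have "T powr (-p-1) = T powr -p * (1 / T)" using T by (simp add: powr_diff)
    finally show ?thesis .
  qed
  finally show "\<bar>reg_kernel \<epsilon> \<alpha> z' - reg_kernel \<epsilon> \<alpha> z\<bar> \<le> c * p * (1 + c) powr (p + 1) * reg_kernel \<epsilon> \<alpha> z * cutoff \<epsilon> z"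
    by (simp add: reg_kernel_def T_def T'_def p_def cutoff_def mult_ac)
qed

lemma nn_integral_add_indicator:
  fixes f :: "'a::euclidean_space \<Rightarrow> ennreal"
  assumes [measurable]: "A \<in> sets borel" "N \<in> sets borel" "f \<in> borel_measurable borel"
  shows "(\<integral>\<^sup>+z. c * indicator A z + f z * indicator N z \<partial>lborel)
    = c * emeasure lborel A + (\<integral>\<^sup>+z\<in>N. f z \<partial>lborel)"
  using assms by (subst nn_integral_add, measurable) (simp add: nn_integral_cmult_indicator)

text \<open>Within |z| \<le> \<epsilon> the kernel is at most \<epsilon>^(-d-\<alpha>) on a volume
  of order \<epsilon>^d; beyond, it is below the tail of the singular kernel. Both parts are of
  order \<epsilon>^(-\<alpha>).\<close>

lemma nn_integral_reg_kernel_le: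
  assumes \<epsilon>: "\<epsilon> > 0" and \<alpha>: "\<alpha> > 0"
  shows "(\<integral>\<^sup>+z. ennreal (reg_kernel \<epsilon> \<alpha> (z::'a::euclidean_space)) \<partial>lborel)
    \<le> ennreal (unit_ball_vol DIM('a) * (1 + (real DIM('a) + \<alpha>) / \<alpha>) * \<epsilon> powr -\<alpha>)"
proof -
  let ?V = "unit_ball_vol DIM('a)" and ?d = "real DIM('a)"
  have "(\<integral>\<^sup>+z. ennreal (reg_kernel \<epsilon> \<alpha> (z::'a)) \<partial>lborel)
    \<le> (\<integral>\<^sup>+z. ennreal (\<epsilon> powr - (?d + \<alpha>)) * indicator (cball 0 \<epsilon>) z
         + ennreal (norm (z::'a) powr (- \<alpha> - ?d)) * indicator (- cball 0 \<epsilon>) z \<partial>lborel)"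
  proof (rule nn_integral_mono)
    fix z :: 'a
    have "reg_kernel \<epsilon> \<alpha> z \<le> \<epsilon> powr - (?d + \<alpha>)"
      unfolding reg_kernel_def by (rule powr_mono2') (use assms in auto)
    moreover have "reg_kernel \<epsilon> \<alpha> z \<le> norm z powr (- \<alpha> - ?d)" if "z \<notin> cball 0 \<epsilon>"
    proof -
      have "z \<noteq> 0" using that \<epsilon> by auto
      from reg_kernel_le_riesz[OF \<epsilon> \<alpha> this] show ?thesis by (simp add: riesz_kernel_def algebra_simps)
    qed
    ultimately show "ennreal (reg_kernel \<epsilon> \<alpha> z) \<le> ennreal (\<epsilon> powr - (?d + \<alpha>)) * indicator (cball 0 \<epsilon>) z
         + ennreal (norm z powr (- \<alpha> - ?d)) * indicator (- cball 0 \<epsilon>) z"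
      by (cases "z \<in> cball 0 \<epsilon>") (simp_all only: indicator_simps Compl_iff mult_1_right mult_zero_right add_0_right add_0_left ennreal_leI not_False_eq_True simp_thms)
  qed
  also have "\<dots> = ennreal (\<epsilon> powr - (?d + \<alpha>)) * emeasure lborel (cball (0::'a) \<epsilon>)
      + (\<integral>\<^sup>+z\<in>- cball 0 \<epsilon>. ennreal (norm (z::'a) powr (- \<alpha> - ?d)) \<partial>lborel)"
    by (rule nn_integral_add_indicator) (auto intro!: borel_open)
  also have "\<dots> \<le> ennreal (?V * \<epsilon> powr - \<alpha>) + ennreal (?V * (?d + \<alpha>) / \<alpha> * \<epsilon> powr -\<alpha>)"
  proof (intro add_mono nn_integral_norm_powr_far \<alpha> \<epsilon>)
    have "\<epsilon> powr - (?d + \<alpha>) * \<epsilon> powr ?d = \<epsilon> powr -\<alpha>" using \<epsilon> by (simp add: powr_add[symmetric])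
    then show "ennreal (\<epsilon> powr - (?d + \<alpha>)) * emeasure lborel (cball (0::'a) \<epsilon>) \<le> ennreal (?V * \<epsilon> powr - \<alpha>)"
      using \<epsilon> by (simp add: emeasure_lborel_cball_powr ennreal_mult[symmetric] mult_ac)
  qed
  also have "\<dots> = ennreal (?V * (1 + (real DIM('a) + \<alpha>) / \<alpha>) * \<epsilon> powr -\<alpha>)"
    using \<alpha> by (subst ennreal_plus[symmetric]) (auto simp: algebra_simps)
  finally show ?thesis .
qed

lemma nn_integral_lborel_reflect:
  fixes f :: "'a::euclidean_space \<Rightarrow> ennreal"
  assumes [measurable]: "f \<in> borel_measurable borel"
  shows "(\<integral>\<^sup>+y. f (x - y) \<partial>lborel) = (\<integral>\<^sup>+y. f y \<partial>lborel)"
proof -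
  have "(\<integral>\<^sup>+y. f y \<partial>lborel) = (\<integral>\<^sup>+y. f (x + y) \<partial>lborel)" by (rule nn_integral_lborel_shift[symmetric]) fact
  also have "\<dots> = (\<integral>\<^sup>+y. f (x - y) \<partial>lborel)" by (subst nn_integral_lborel_scale[of _ "-1"]) auto
  finally show ?thesis by simp
qed

lemma norm_unit_cube_le:
  assumes "q \<in> cbox 0 (One :: 'a::euclidean_space)"
  shows "norm q \<le> DIM('a)"
proof -
  have "norm q \<le> (\<Sum>b\<in>Basis. \<bar>q \<bullet> b\<bar>)" by (rule norm_le_l1)
  also have "\<dots> \<le> (\<Sum>b\<in>(Basis::'a set). 1)" by (rule sum_mono) (use assms in \<open>auto simp: mem_box\<close>)
  finally show ?thesis by simp
qed

text \<open>For q in the unit cube the points \<epsilon> q have norm at most d \<epsilon>, and there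
  \<epsilon>^(d+\<alpha>) times the kernel times the squared cutoff is bounded below. An average of
  square increments over the cube is therefore an energy at scale \<epsilon>.\<close>

lemma mean_square_increment_le:
  fixes u :: "'a::euclidean_space \<Rightarrow> real"
  assumes [measurable]: "u \<in> borel_measurable borel" and \<epsilon>: "\<epsilon> > 0" and \<alpha>: "\<alpha> > 0"
  shows "(\<integral>\<^sup>+q\<in>cbox 0 One. (\<integral>\<^sup>+x. ennreal ((u (x + \<epsilon> *\<^sub>R q) - u x)\<^sup>2) \<partial>lborel) \<partial>lborel)
    \<le> ennreal (real DIM('a) powr (real DIM('a) + \<alpha>) * (1 + DIM('a))\<^sup>2 * \<epsilon> powr \<alpha>) * cut_energy \<epsilon> \<alpha> u"
proof -
  let ?d = "real DIM('a)"
  \<comment> \<open>Inverse of the lower bound: the kernel at \<epsilon> q is at least (\<epsilon>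
    d)^(-d-\<alpha>), the cutoff at least 1 / (1 + d).\<close>
  define A where "A = ?d powr (?d + \<alpha>) * (1 + ?d)\<^sup>2"
  have d: "?d \<ge> 1" using DIM_positive[where 'a='a] by linarith
  have A: "A \<ge> 0" by (simp add: A_def)
  define f where "f z x = ennreal ((u (x + z) - u x)\<^sup>2 * riesz_kernel \<alpha> z * (cutoff \<epsilon> z)\<^sup>2)" for z x :: 'a
  have fm[measurable]: "(\<lambda>(z, x). f z x) \<in> borel_measurable (borel \<Otimes>\<^sub>M borel)" unfolding f_def by measurable
  have pt: "ennreal ((u (x + \<epsilon> *\<^sub>R q) - u x)\<^sup>2) \<le> ennreal (A * \<epsilon> powr (?d + \<alpha>)) * f (\<epsilon> *\<^sub>R q) x"
    if q: "q \<in> cbox 0 One" for q x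
  \<comment> \<open>At q = 0 the kernel has the default value 0, but the increment on the left is 0
    as well.\<close>
  proof (cases "q = 0")
    case False
    have n: "0 < norm q" "norm q \<le> ?d" using norm_unit_cube_le[OF q] False by auto
    have "(\<epsilon> * ?d) powr - (?d + \<alpha>) \<le> riesz_kernel \<alpha> (\<epsilon> *\<^sub>R q)"
      unfolding riesz_kernel_def by (rule powr_mono2') (use n \<epsilon> \<alpha> in auto)
    moreover have "1 / (1 + ?d) \<le> cutoff \<epsilon> (\<epsilon> *\<^sub>R q)"
    proof -
      have "cutoff \<epsilon> (\<epsilon> *\<^sub>R q) = 1 / (1 + norm q)" 
      proof -
        have "\<epsilon> + \<epsilon> * norm q = \<epsilon> * (1 + norm q)" by (simp add: algebra_simps)
        then show ?thesis using \<epsilon> by (simp add: cutoff_def)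
      qed
      then show ?thesis using n frac_le[of 1 1 "1 + norm q" "1 + ?d"] by (simp add: add_pos_nonneg)
    qed
    then have "(1 / (1 + ?d))\<^sup>2 \<le> (cutoff \<epsilon> (\<epsilon> *\<^sub>R q))\<^sup>2" by (rule power_mono) simp
    ultimately have "(\<epsilon> * ?d) powr - (?d + \<alpha>) * (1 / (1 + ?d))\<^sup>2 \<le> riesz_kernel \<alpha> (\<epsilon> *\<^sub>R q) * (cutoff \<epsilon> (\<epsilon> *\<^sub>R q))\<^sup>2"
      by (intro mult_mono) auto
    then have "A * \<epsilon> powr (?d + \<alpha>) * ((\<epsilon> * ?d) powr - (?d + \<alpha>) * (1 / (1 + ?d))\<^sup>2)
       \<le> A * \<epsilon> powr (?d + \<alpha>) * (riesz_kernel \<alpha> (\<epsilon> *\<^sub>R q) * (cutoff \<epsilon> (\<epsilon> *\<^sub>R q))\<^sup>2)"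
      using A by (intro mult_left_mono) auto
    moreover have "A * \<epsilon> powr (?d + \<alpha>) * ((\<epsilon> * ?d) powr - (?d + \<alpha>) * (1 / (1 + ?d))\<^sup>2) = 1"
    proof -
      have "(\<epsilon> * ?d) powr - (?d + \<alpha>) = 1 / (\<epsilon> powr (?d + \<alpha>) * ?d powr (?d + \<alpha>))"
        by (subst powr_minus_divide, subst powr_mult) (use \<epsilon> d in auto)
      moreover have "\<epsilon> powr (?d + \<alpha>) > 0" "?d powr (?d + \<alpha>) > 0" "1 + ?d > 0" using \<epsilon> d by auto
      ultimately show ?thesis unfolding A_def by (simp add: power_divide) 
    qed
    ultimately have "(u (x + \<epsilon> *\<^sub>R q) - u x)\<^sup>2 * 1 \<le> (u (x + \<epsilon> *\<^sub>R q) - u x)\<^sup>2 * (A * \<epsilon> powr (?d + \<alpha>) * (riesz_kernel \<alpha> (\<epsilon> *\<^sub>R q) * (cutoff \<epsilon> (\<epsilon> *\<^sub>R q))\<^sup>2))"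
      by (intro mult_left_mono) auto
    then show ?thesis unfolding f_def using A
      by (simp add: ennreal_mult[symmetric] mult_ac ennreal_leI)
  qed simp
  have "(\<integral>\<^sup>+q\<in>cbox 0 One. (\<integral>\<^sup>+x. ennreal ((u (x + \<epsilon> *\<^sub>R q) - u x)\<^sup>2) \<partial>lborel) \<partial>lborel)
    \<le> (\<integral>\<^sup>+q. (\<integral>\<^sup>+x. ennreal (A * \<epsilon> powr (?d + \<alpha>)) * f (\<epsilon> *\<^sub>R q) x \<partial>lborel) \<partial>lborel)"
    by (intro nn_integral_mono) (auto simp: indicator_def intro!: nn_integral_mono pt)
  also have "\<dots> = ennreal (A * \<epsilon> powr (?d + \<alpha>)) * (\<integral>\<^sup>+q. (\<integral>\<^sup>+x. f (\<epsilon> *\<^sub>R q) x \<partial>lborel) \<partial>lborel)"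
    by (simp add: nn_integral_cmult)
  \<comment> \<open>Of \<epsilon>^(d+\<alpha>) the part \<epsilon>^d is spent on the substitution z
    = \<epsilon> q.\<close>
  also have "ennreal (A * \<epsilon> powr (?d + \<alpha>)) = ennreal (A * \<epsilon> powr \<alpha>) * ennreal (\<bar>\<epsilon>\<bar> ^ DIM('a))"
    using \<epsilon> A by (simp add: ennreal_mult[symmetric] powr_add powr_realpow mult_ac)
  also have "\<dots> * (\<integral>\<^sup>+q. (\<integral>\<^sup>+x. f (\<epsilon> *\<^sub>R q) x \<partial>lborel) \<partial>lborel)
     = ennreal (A * \<epsilon> powr \<alpha>) * (\<integral>\<^sup>+z. (\<integral>\<^sup>+x. f z x \<partial>lborel) \<partial>lborel)"
    using \<epsilon> by (subst nn_integral_lborel_scale[of "\<lambda>z. \<integral>\<^sup>+x. f z x \<partial>lborel" \<epsilon>]) (auto simp: mult.assoc)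
  also have "(\<integral>\<^sup>+z. (\<integral>\<^sup>+x. f z x \<partial>lborel) \<partial>lborel) = (\<integral>\<^sup>+x. (\<integral>\<^sup>+z. f z x \<partial>lborel) \<partial>lborel)"
    by (rule lborel_pair.Fubini'[symmetric]) measurable
  also have "\<dots> = cut_energy \<epsilon> \<alpha> u"
    unfolding cut_energy_def
  proof (rule nn_integral_cong)
    fix x :: 'a
    show "(\<integral>\<^sup>+z. f z x \<partial>lborel) = (\<integral>\<^sup>+y. ennreal ((u x - u y)\<^sup>2 * riesz_kernel \<alpha> (x - y) * (cutoff \<epsilon> (x - y))\<^sup>2) \<partial>lborel)"
      unfolding f_def
      using nn_integral_lborel_shift[of "\<lambda>y. ennreal ((u x - u y)\<^sup>2 * riesz_kernel \<alpha> (x - y) * (cutoff \<epsilon> (x - y))\<^sup>2)" x]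
      by (simp add: power2_commute[of "u x"])
  qed
  finally show ?thesis by (simp add: A_def)
qed

lemma cut_energy_le_energy: "\<epsilon> > 0 \<Longrightarrow> cut_energy \<epsilon> \<alpha> u \<le> energy \<alpha> u"
  unfolding cut_energy_def energy_def
  by (intro nn_integral_mono ennreal_leI mult_left_le) (auto simp: cutoff_bounds)

section \<open>Products of increments against the kernels\<close>

lemma mult_le_weighted_squares:
  fixes a b \<eta> :: real
  assumes "\<eta> > 0"
  shows "\<bar>a\<bar> * \<bar>b\<bar> \<le> a\<^sup>2 / \<eta> + \<eta> * b\<^sup>2"
proof -
  have "0 \<le> (\<bar>a\<bar> - \<eta> * \<bar>b\<bar>)\<^sup>2" by simp
  then have "2 * \<eta> * (\<bar>a\<bar> * \<bar>b\<bar>) \<le> a\<^sup>2 + \<eta>\<^sup>2 * b\<^sup>2"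
    by (simp add: power2_diff power_mult_distrib algebra_simps)
  then have "2 * (\<bar>a\<bar> * \<bar>b\<bar>) \<le> a\<^sup>2 / \<eta> + \<eta> * b\<^sup>2"
    using assms by (simp add: field_simps power2_eq_square)
  moreover have "0 \<le> \<bar>a\<bar> * \<bar>b\<bar>" by simp
  ultimately show ?thesis by linarith
qed

text \<open>The factor a will be a value of \<open>reg_op\<close>, which may be infinite at some
  points; hence the version in the extended reals.\<close>

lemma ennreal_mult_le_weighted_squares:
  fixes a :: ennreal
  assumes "\<eta> > 0"
  shows "a * ennreal b \<le> ennreal (1 / \<eta>) * a\<^sup>2 + ennreal (\<eta> * b\<^sup>2)"
proof (cases a)
  case (real r)
  have "r * max b 0 \<le> r\<^sup>2 / \<eta> + \<eta> * b\<^sup>2"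
    using mult_le_weighted_squares[OF assms, of r b] real assms
    by (auto simp: max_def)
  moreover have "ennreal b = ennreal (max b 0)" by (simp add: max_def ennreal_neg)
  ultimately show ?thesis
    using real assms by (simp add: ennreal_mult[symmetric] ennreal_power ennreal_plus[symmetric] ennreal_leI del: ennreal_plus)
next
  case top
  then show ?thesis using assms by (simp add: ennreal_mult_top power2_eq_square ennreal_top_mult)
qed

lemma energy_pair:
  fixes u :: "'a::euclidean_space \<Rightarrow> real"
  assumes [measurable]: "u \<in> borel_measurable borel"
  shows "(\<integral>\<^sup>+p. ennreal ((u (fst p) - u (snd p))\<^sup>2 * riesz_kernel \<alpha> (fst p - snd p)) \<partial>(lborel \<Otimes>\<^sub>M lborel)) = energy \<alpha> u"
  unfolding energy_def by (subst lborel.nn_integral_fst[symmetric]) auto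

lemma cut_energy_pair:
  fixes u :: "'a::euclidean_space \<Rightarrow> real"
  assumes [measurable]: "u \<in> borel_measurable borel"
  shows "(\<integral>\<^sup>+p. ennreal ((u (fst p) - u (snd p))\<^sup>2 * riesz_kernel \<alpha> (fst p - snd p) * (cutoff \<epsilon> (fst p - snd p))\<^sup>2) \<partial>(lborel \<Otimes>\<^sub>M lborel)) = cut_energy \<epsilon> \<alpha> u"
  unfolding cut_energy_def by (subst lborel.nn_integral_fst[symmetric]) auto

lemma square_diff_le:
  fixes p q :: real
  shows "(p - q)\<^sup>2 \<le> 2 * p\<^sup>2 + 2 * q\<^sup>2"
  using zero_le_power2[of "p + q"] unfolding power2_sum power2_diff by linarith

text \<open>The whole cutoff is given to the increment of v, about which pointwise bounds are known;
  the increment of g keeps its full energy with the small weight \<eta>, ready to be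
  absorbed.\<close>

lemma weighted_product_le:
  fixes v g :: "'a::euclidean_space \<Rightarrow> real"
  assumes \<epsilon>: "\<epsilon> > 0" and \<alpha>: "\<alpha> > 0" and \<eta>: "\<eta> > 0"
  shows "\<bar>v x - v y\<bar> * \<bar>g x - g y\<bar> * riesz_kernel \<alpha> (x - y) * cutoff \<epsilon> (x - y)
    \<le> 1 / \<eta> * ((v x - v y)\<^sup>2 * riesz_kernel \<alpha> (x - y) * (cutoff \<epsilon> (x - y))\<^sup>2) + \<eta> * ((g x - g y)\<^sup>2 * riesz_kernel \<alpha> (x - y))"
proof -
  have *: "\<bar>a\<bar> * \<bar>b\<bar> * k * c \<le> 1 / \<eta> * (a\<^sup>2 * k * c\<^sup>2) + \<eta> * (b\<^sup>2 * k)" if "k \<ge> 0" "c > 0" for a b k c :: real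
  proof -
    have "\<bar>a * c\<bar> * \<bar>b\<bar> * k \<le> ((a * c)\<^sup>2 / \<eta> + \<eta> * b\<^sup>2) * k"
      using that by (intro mult_right_mono mult_le_weighted_squares[OF \<eta>])
    then show ?thesis using that by (simp add: abs_mult power_mult_distrib algebra_simps)
  qed
  show ?thesis using cutoff_bounds(1)[OF \<epsilon>] by (intro *) auto
qed

lemma nn_integral_weighted_product_le:
  fixes v g :: "'a::euclidean_space \<Rightarrow> real"
  assumes [measurable]: "v \<in> borel_measurable borel" "g \<in> borel_measurable borel"
    and pos: "\<epsilon> > 0" "\<alpha> > 0" "\<eta> > 0" and b: "cut_energy \<epsilon> \<alpha> v \<le> ennreal y" "energy \<alpha> g \<le> ennreal e" "0 \<le> y" "0 \<le> e"
  shows "(\<integral>\<^sup>+p. ennreal (\<bar>v (fst p) - v (snd p)\<bar> * \<bar>g (fst p) - g (snd p)\<bar> * riesz_kernel \<alpha> (fst p - snd p) * cutoff \<epsilon> (fst p - snd p)) \<partial>(lborel \<Otimes>\<^sub>M lborel))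
    \<le> ennreal (y / \<eta> + \<eta> * e)"
proof -
  have "(\<integral>\<^sup>+p. ennreal (\<bar>v (fst p) - v (snd p)\<bar> * \<bar>g (fst p) - g (snd p)\<bar> * riesz_kernel \<alpha> (fst p - snd p) * cutoff \<epsilon> (fst p - snd p)) \<partial>(lborel \<Otimes>\<^sub>M lborel))
    \<le> (\<integral>\<^sup>+p. ennreal (1/\<eta>) * ennreal ((v (fst p) - v (snd p))\<^sup>2 * riesz_kernel \<alpha> (fst p - snd p) * (cutoff \<epsilon> (fst p - snd p))\<^sup>2)
        + ennreal \<eta> * ennreal ((g (fst p) - g (snd p))\<^sup>2 * riesz_kernel \<alpha> (fst p - snd p)) \<partial>(lborel \<Otimes>\<^sub>M lborel))"
    using pos weighted_product_le[OF pos]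
    by (intro nn_integral_mono) (simp add: ennreal_mult[symmetric] ennreal_plus[symmetric] ennreal_leI del: ennreal_plus)
  also have "\<dots> = ennreal (1/\<eta>) * cut_energy \<epsilon> \<alpha> v + ennreal \<eta> * energy \<alpha> g"
    by (subst nn_integral_add, measurable)
       (simp add: nn_integral_cmult energy_pair cut_energy_pair)
  also have "\<dots> \<le> ennreal (1/\<eta>) * ennreal y + ennreal \<eta> * ennreal e"
    by (intro add_mono mult_left_mono b) auto
  also have "\<dots> = ennreal (y / \<eta> + \<eta> * e)"
    using pos b by (simp add: ennreal_mult[symmetric] ennreal_plus[symmetric] del: ennreal_plus)
  finally show ?thesis .
qed

text \<open>Off \<open>B\<close> both values of g vanish, so the square of the operator is needed
  over \<open>B\<close> only, where it is integrable; over the whole space no such bound is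
  available.\<close>

lemma nn_integral_reg_op_increment_le:
  fixes v g :: "'a::euclidean_space \<Rightarrow> real"
  assumes [measurable]: "v \<in> borel_measurable borel" "g \<in> borel_measurable borel" "B \<in> sets borel"
    and \<tau>: "\<tau> > 0" and x: "(\<integral>\<^sup>+x\<in>B. (reg_op \<epsilon> \<alpha> v x)\<^sup>2 \<partial>lborel) \<le> ennreal x"
    and B: "\<And>x. x \<notin> B \<Longrightarrow> g x = 0 \<and> g (x + h) = 0"
  shows "(\<integral>\<^sup>+x. reg_op \<epsilon> \<alpha> v x * ennreal \<bar>g (x + h) - g x\<bar> \<partial>lborel)
    \<le> ennreal (1 / \<tau>) * ennreal x + ennreal \<tau> * (\<integral>\<^sup>+x. ennreal ((g (x + h) - g x)\<^sup>2) \<partial>lborel)"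
proof -
  have [measurable]: "reg_op \<epsilon> \<alpha> v \<in> borel_measurable borel" unfolding reg_op_def[abs_def] by measurable
  have "(\<integral>\<^sup>+x. reg_op \<epsilon> \<alpha> v x * ennreal \<bar>g (x + h) - g x\<bar> \<partial>lborel)
    \<le> (\<integral>\<^sup>+x. ennreal (1 / \<tau>) * ((reg_op \<epsilon> \<alpha> v x)\<^sup>2 * indicator B x) + ennreal \<tau> * ennreal ((g (x + h) - g x)\<^sup>2) \<partial>lborel)"
  proof (rule nn_integral_mono)
    fix x
    show "reg_op \<epsilon> \<alpha> v x * ennreal \<bar>g (x + h) - g x\<bar>
       \<le> ennreal (1 / \<tau>) * ((reg_op \<epsilon> \<alpha> v x)\<^sup>2 * indicator B x) + ennreal \<tau> * ennreal ((g (x + h) - g x)\<^sup>2)"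
      using ennreal_mult_le_weighted_squares[OF \<tau>, of "reg_op \<epsilon> \<alpha> v x" "\<bar>g (x + h) - g x\<bar>"] B[of x] \<tau>
      by (cases "x \<in> B") (auto simp: ennreal_mult[symmetric])
  qed
  also have "\<dots> = ennreal (1 / \<tau>) * (\<integral>\<^sup>+x\<in>B. (reg_op \<epsilon> \<alpha> v x)\<^sup>2 \<partial>lborel) + ennreal \<tau> * (\<integral>\<^sup>+x. ennreal ((g (x + h) - g x)\<^sup>2) \<partial>lborel)"
    by (subst nn_integral_add, measurable) (simp add: nn_integral_cmult)
  also have "\<dots> \<le> ennreal (1 / \<tau>) * ennreal x + ennreal \<tau> * (\<integral>\<^sup>+x. ennreal ((g (x + h) - g x)\<^sup>2) \<partial>lborel)"
    by (intro add_mono mult_left_mono x) auto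
  finally show ?thesis .
qed

text \<open>With a, b the increments of v, g, with k the kernel and primes for translated points,
  the change of the product is telescoped as (a' - a) b' k' + a (b' - b) k' + a b (k' - k). The
  first term gives square increments of v against the mass of the kernel in the other variable, plus
  \<eta> times the energy of g. In the second, integrating one variable yields \<open>reg_op\<close>
  of v paired with an increment of g. The third carries the factor \<open>cutoff\<close>. The shifts
  of x and y are independent of each other.\<close>

lemma nn_integral_reg_product_increment_le:
  fixes v g :: "'a::euclidean_space \<Rightarrow> real" and \<epsilon> \<alpha> \<eta> x y e C :: real
  assumes [measurable]: "v \<in> borel_measurable borel" "g \<in> borel_measurable borel" "B \<in> sets borel"
    and pos: "\<epsilon> > 0" "\<alpha> > 0" "\<eta> > 0" and hk: "norm h \<le> \<epsilon> * DIM('a)" "norm k \<le> \<epsilon> * DIM('a)"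
    and en: "cut_energy \<epsilon> \<alpha> v \<le> ennreal y" "energy \<alpha> g \<le> ennreal e"
      "(\<integral>\<^sup>+x\<in>B. (reg_op \<epsilon> \<alpha> v x)\<^sup>2 \<partial>lborel) \<le> ennreal x" "0 \<le> y" "0 \<le> e" "0 \<le> x"
    and B: "\<And>x. x \<notin> B \<Longrightarrow> g x = 0 \<and> g (x + h) = 0 \<and> g (x + k) = 0"
    and C: "C \<ge> 0" "\<And>z z' :: 'a. norm (z' - z) \<le> 2 * DIM('a) * \<epsilon> \<Longrightarrow> reg_kernel \<epsilon> \<alpha> z' \<le> C * reg_kernel \<epsilon> \<alpha> z"
      "\<And>z z' :: 'a. norm (z' - z) \<le> 2 * DIM('a) * \<epsilon> \<Longrightarrow> \<bar>reg_kernel \<epsilon> \<alpha> z' - reg_kernel \<epsilon> \<alpha> z\<bar> \<le> C * reg_kernel \<epsilon> \<alpha> z * cutoff \<epsilon> z"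
      "(\<integral>\<^sup>+z. ennreal (reg_kernel \<epsilon> \<alpha> (z::'a)) \<partial>lborel) \<le> ennreal (C * \<epsilon> powr -\<alpha>)"
  defines "G \<equiv> (\<lambda>x y. (v x - v y) * (g x - g y) * reg_kernel \<epsilon> \<alpha> (x - y))"
  defines "I \<equiv> (\<lambda>u h. \<integral>\<^sup>+x. ennreal ((u (x + h) - u x)\<^sup>2) \<partial>lborel)"
  shows "(\<integral>\<^sup>+p. ennreal \<bar>G (fst p + h) (snd p + k) - G (fst p) (snd p)\<bar> \<partial>(lborel \<Otimes>\<^sub>M lborel))
    \<le> ennreal (2 * C * \<epsilon> powr -\<alpha> / \<eta>) * (I v h + I v k)
      + ennreal (C * \<eta> / \<epsilon> powr \<alpha>) * (I g h + I g k)
      + ennreal (\<eta> * e + 2 * C * \<epsilon> powr \<alpha> / \<eta> * x + C * (y / \<eta> + \<eta> * e))"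
proof -
  define z' where "z' x y = x + h - (y + k)" for x y
  let ?k = "\<lambda>x y. reg_kernel \<epsilon> \<alpha> (x - y)" and ?k' = "\<lambda>x y. reg_kernel \<epsilon> \<alpha> (x + h - (y + k))"
  have zz: "norm (x + h - (y + k) - (x - y)) \<le> 2 * DIM('a) * \<epsilon>" for x y
    using norm_triangle_ineq4[of h k] hk by (simp add: algebra_simps)
  have pt: "\<bar>G (x + h) (y + k) - G x y\<bar> \<le>
     2 / \<eta> * ((v (x + h) - v x)\<^sup>2 * ?k' x y) + 2 / \<eta> * ((v (y + k) - v y)\<^sup>2 * ?k' x y)
     + \<eta> * ((g (x + h) - g (y + k))\<^sup>2 * riesz_kernel \<alpha> (x + h - (y + k)))
     + C * (\<bar>v x - v y\<bar> * ?k x y * \<bar>g (x + h) - g x\<bar>) + C * (\<bar>v x - v y\<bar> * ?k x y * \<bar>g (y + k) - g y\<bar>)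
     + C * (\<bar>v x - v y\<bar> * \<bar>g x - g y\<bar> * riesz_kernel \<alpha> (x - y) * cutoff \<epsilon> (x - y))" for x y
  proof -
    define a a' b b' where "a = v x - v y" and "a' = v (x + h) - v (y + k)" and "b = g x - g y" and "b' = g (x + h) - g (y + k)"
    define k0 k1 where "k0 = ?k x y" and "k1 = ?k' x y"
    have k: "0 \<le> k0" "0 \<le> k1" "k1 \<le> C * k0" "\<bar>k1 - k0\<bar> \<le> C * k0 * cutoff \<epsilon> (x - y)"
      using C(2,3)[OF zz] by (auto simp: k0_def k1_def)
    have G: "G (x + h) (y + k) - G x y = (a' - a) * b' * k1 + a * (b' - b) * k1 + a * b * (k1 - k0)"
      unfolding G_def a_def a'_def b_def b'_def k0_def k1_def by (simp add: algebra_simps)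
    have t1: "\<bar>(a' - a) * b' * k1\<bar> \<le> 2 / \<eta> * ((v (x + h) - v x)\<^sup>2 * k1) + 2 / \<eta> * ((v (y + k) - v y)\<^sup>2 * k1)
       + \<eta> * (b'\<^sup>2 * riesz_kernel \<alpha> (x + h - (y + k)))"
    proof -
      have "\<bar>a' - a\<bar> * \<bar>b'\<bar> * k1 \<le> ((a' - a)\<^sup>2 / \<eta> + \<eta> * b'\<^sup>2) * k1"
        by (intro mult_right_mono mult_le_weighted_squares k pos)
      then have s1: "\<bar>a' - a\<bar> * \<bar>b'\<bar> * k1 \<le> (a' - a)\<^sup>2 / \<eta> * k1 + \<eta> * b'\<^sup>2 * k1" by (simp add: distrib_right)
      have "(a' - a)\<^sup>2 / \<eta> \<le> (2 * (v (x + h) - v x)\<^sup>2 + 2 * (v (y + k) - v y)\<^sup>2) / \<eta>"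
      proof (intro divide_right_mono)
        have "a' - a = (v (x + h) - v x) - (v (y + k) - v y)" by (simp add: a_def a'_def)
        then show "(a' - a)\<^sup>2 \<le> 2 * (v (x + h) - v x)\<^sup>2 + 2 * (v (y + k) - v y)\<^sup>2"
          by (simp only: square_diff_le)
      qed (use pos in simp)
      then have s2: "(a' - a)\<^sup>2 / \<eta> * k1 \<le> (2 * (v (x + h) - v x)\<^sup>2 + 2 * (v (y + k) - v y)\<^sup>2) / \<eta> * k1"
        by (rule mult_right_mono) (rule k)
      \<comment> \<open>Raised to the singular kernel so that a translation of the variables
        restores the energy of g. On the diagonal, where the comparison of the kernels fails, the
        increment is 0.\<close>
      have s3: "\<eta> * b'\<^sup>2 * k1 \<le> \<eta> * (b'\<^sup>2 * riesz_kernel \<alpha> (x + h - (y + k)))"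
      proof (cases "x + h - (y + k) = 0")
        case True then have "x + h = y + k" by simp
        then show ?thesis by (simp add: b'_def)
      next
        case False
        from reg_kernel_le_riesz[OF pos(1,2) this] show ?thesis
          unfolding k1_def using pos by (simp add: mult_left_mono mult.assoc)
      qed
      have "(2 * (v (x + h) - v x)\<^sup>2 + 2 * (v (y + k) - v y)\<^sup>2) / \<eta> * k1
        = 2 / \<eta> * ((v (x + h) - v x)\<^sup>2 * k1) + 2 / \<eta> * ((v (y + k) - v y)\<^sup>2 * k1)"
        by (simp add: add_divide_distrib distrib_right)
      moreover have "\<bar>(a' - a) * b' * k1\<bar> = \<bar>a' - a\<bar> * \<bar>b'\<bar> * k1" using k by (simp add: abs_mult)
      ultimately show ?thesis using s1 s2 s3 by linarith
    qed
    have t2: "\<bar>a * (b' - b) * k1\<bar> \<le> C * (\<bar>a\<bar> * k0 * \<bar>g (x + h) - g x\<bar>) + C * (\<bar>a\<bar> * k0 * \<bar>g (y + k) - g y\<bar>)"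
    proof -
      have "\<bar>b' - b\<bar> \<le> \<bar>g (x + h) - g x\<bar> + \<bar>g (y + k) - g y\<bar>" unfolding b_def b'_def by linarith
      then have "\<bar>a\<bar> * \<bar>b' - b\<bar> * k1 \<le> \<bar>a\<bar> * (\<bar>g (x + h) - g x\<bar> + \<bar>g (y + k) - g y\<bar>) * (C * k0)"
        using k C by (intro mult_mono) auto
      moreover have "\<bar>a * (b' - b) * k1\<bar> = \<bar>a\<bar> * \<bar>b' - b\<bar> * k1" using k by (simp add: abs_mult)
      moreover have "\<bar>a\<bar> * (\<bar>g (x + h) - g x\<bar> + \<bar>g (y + k) - g y\<bar>) * (C * k0)
        = C * (\<bar>a\<bar> * k0 * \<bar>g (x + h) - g x\<bar>) + C * (\<bar>a\<bar> * k0 * \<bar>g (y + k) - g y\<bar>)"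
        by (simp only: distrib_left distrib_right mult_ac)
      ultimately show ?thesis by linarith
    qed
    have t3: "\<bar>a * b * (k1 - k0)\<bar> \<le> C * (\<bar>a\<bar> * \<bar>b\<bar> * riesz_kernel \<alpha> (x - y) * cutoff \<epsilon> (x - y))"
    proof (cases "x - y = 0")
      case False
      have "\<bar>a\<bar> * \<bar>b\<bar> * \<bar>k1 - k0\<bar> \<le> \<bar>a\<bar> * \<bar>b\<bar> * (C * k0 * cutoff \<epsilon> (x - y))"
        by (intro mult_left_mono k) auto
      also have "\<dots> \<le> \<bar>a\<bar> * \<bar>b\<bar> * (C * riesz_kernel \<alpha> (x - y) * cutoff \<epsilon> (x - y))"
        unfolding k0_def using C(1) cutoff_bounds[OF pos(1), of "x - y"]
        by (intro mult_left_mono mult_right_mono reg_kernel_le_riesz[OF pos(1,2) False]) auto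
      finally show ?thesis by (simp add: abs_mult mult_ac)
    qed (simp add: a_def)
    show ?thesis unfolding G a_def[symmetric] b_def[symmetric] b'_def[symmetric] k0_def[symmetric] k1_def[symmetric]
      using t1 t2 t3 by linarith
  qed
  let ?K = "ennreal (C * \<epsilon> powr -\<alpha>)"
  \<comment> \<open>In one variable alone the kernel is a reflected translate, and in the other a
    translate, so only its total mass enters.\<close>
  have kx: "(\<integral>\<^sup>+y. ennreal (?k' x y) \<partial>lborel) \<le> ?K" for x
  proof -
    have "(\<integral>\<^sup>+y. ennreal (?k' x y) \<partial>lborel) = (\<integral>\<^sup>+y. ennreal (reg_kernel \<epsilon> \<alpha> (x + h - k - y)) \<partial>lborel)"
      by (simp add: algebra_simps)
    also have "\<dots> = (\<integral>\<^sup>+y. ennreal (reg_kernel \<epsilon> \<alpha> (y::'a)) \<partial>lborel)"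
      by (rule nn_integral_lborel_reflect) measurable
    finally show ?thesis using C(4) by simp
  qed
  have ky: "(\<integral>\<^sup>+x. ennreal (?k' x y) \<partial>lborel) \<le> ?K" for y
  proof -
    have "(\<integral>\<^sup>+x. ennreal (?k' x y) \<partial>lborel) = (\<integral>\<^sup>+x. ennreal (reg_kernel \<epsilon> \<alpha> (h - k - y + x)) \<partial>lborel)"
      by (simp add: algebra_simps)
    also have "\<dots> = (\<integral>\<^sup>+y. ennreal (reg_kernel \<epsilon> \<alpha> (y::'a)) \<partial>lborel)"
      by (rule nn_integral_lborel_shift) measurable
    finally show ?thesis using C(4) by simp
  qed
  let ?M = "(lborel \<Otimes>\<^sub>M lborel) :: ('a \<times> 'a) measure"
  have n1: "(\<integral>\<^sup>+p. ennreal ((v (fst p + h) - v (fst p))\<^sup>2 * ?k' (fst p) (snd p)) \<partial>?M) \<le> ?K * I v h"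
  proof -
    have "(\<integral>\<^sup>+p. ennreal ((v (fst p + h) - v (fst p))\<^sup>2 * ?k' (fst p) (snd p)) \<partial>?M)
       = (\<integral>\<^sup>+x. ennreal ((v (x + h) - v x)\<^sup>2) * (\<integral>\<^sup>+y. ennreal (?k' x y) \<partial>lborel) \<partial>lborel)"
      by (subst lborel.nn_integral_fst[symmetric]) (auto simp: ennreal_mult nn_integral_cmult)
    also have "\<dots> \<le> (\<integral>\<^sup>+x. ennreal ((v (x + h) - v x)\<^sup>2) * ?K \<partial>lborel)"
      by (intro nn_integral_mono mult_left_mono kx) auto
    also have "\<dots> = ?K * I v h" unfolding I_def by (subst nn_integral_multc) (auto simp: mult.commute)
    finally show ?thesis .
  qed
  have n2: "(\<integral>\<^sup>+p. ennreal ((v (snd p + k) - v (snd p))\<^sup>2 * ?k' (fst p) (snd p)) \<partial>?M) \<le> ?K * I v k"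
  proof -
    have "(\<integral>\<^sup>+p. ennreal ((v (snd p + k) - v (snd p))\<^sup>2 * ?k' (fst p) (snd p)) \<partial>?M)
       = (\<integral>\<^sup>+y. ennreal ((v (y + k) - v y)\<^sup>2) * (\<integral>\<^sup>+x. ennreal (?k' x y) \<partial>lborel) \<partial>lborel)"
      by (subst lborel_pair.nn_integral_snd[symmetric]) (auto simp: ennreal_mult nn_integral_cmult)
    also have "\<dots> \<le> (\<integral>\<^sup>+x. ennreal ((v (x + k) - v x)\<^sup>2) * ?K \<partial>lborel)"
      by (intro nn_integral_mono mult_left_mono ky) auto
    also have "\<dots> = ?K * I v k" unfolding I_def by (subst nn_integral_multc) (auto simp: mult.commute)
    finally show ?thesis .
  qed
  have n3: "(\<integral>\<^sup>+p. ennreal ((g (fst p + h) - g (snd p + k))\<^sup>2 * riesz_kernel \<alpha> (fst p + h - (snd p + k))) \<partial>?M) \<le> ennreal e"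
  proof -
    have "(\<integral>\<^sup>+p. ennreal ((g (fst p + h) - g (snd p + k))\<^sup>2 * riesz_kernel \<alpha> (fst p + h - (snd p + k))) \<partial>?M)
      = (\<integral>\<^sup>+x. \<integral>\<^sup>+y. ennreal ((g (h + x) - g (k + y))\<^sup>2 * riesz_kernel \<alpha> (h + x - (k + y))) \<partial>lborel \<partial>lborel)"
      by (subst lborel.nn_integral_fst[symmetric]) (auto simp: add.commute)
    also have "\<dots> = (\<integral>\<^sup>+x. \<integral>\<^sup>+y. ennreal ((g (h + x) - g y)\<^sup>2 * riesz_kernel \<alpha> (h + x - y)) \<partial>lborel \<partial>lborel)"
      by (intro nn_integral_cong nn_integral_lborel_shift) measurable
    also have "\<dots> = energy \<alpha> g" unfolding energy_def
      by (rule nn_integral_lborel_shift[where f = "\<lambda>x. \<integral>\<^sup>+y. ennreal ((g x - g y)\<^sup>2 * riesz_kernel \<alpha> (x - y)) \<partial>lborel"]) measurable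
    finally show ?thesis using en by simp
  qed
  have n4: "(\<integral>\<^sup>+p. ennreal (\<bar>v (fst p) - v (snd p)\<bar> * ?k (fst p) (snd p) * \<bar>g (fst p + h) - g (fst p)\<bar>) \<partial>?M)
     \<le> ennreal (\<epsilon> powr \<alpha> / \<eta>) * ennreal x + ennreal (\<eta> / \<epsilon> powr \<alpha>) * I g h"
  proof -
    have "(\<integral>\<^sup>+p. ennreal (\<bar>v (fst p) - v (snd p)\<bar> * ?k (fst p) (snd p) * \<bar>g (fst p + h) - g (fst p)\<bar>) \<partial>?M)
      = (\<integral>\<^sup>+x. reg_op \<epsilon> \<alpha> v x * ennreal \<bar>g (x + h) - g x\<bar> \<partial>lborel)"
      unfolding reg_op_def by (subst lborel.nn_integral_fst[symmetric]) (auto simp: ennreal_mult nn_integral_multc)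
    \<comment> \<open>The weight \<eta> / \<epsilon>^\<alpha> is chosen because the mean square
      increment of g will be of order \<epsilon>^\<alpha> times its energy; the product is then
      again \<eta> times the energy.\<close>
    also have "\<dots> \<le> ennreal (1 / (\<eta> / \<epsilon> powr \<alpha>)) * ennreal x + ennreal (\<eta> / \<epsilon> powr \<alpha>) * I g h"
      unfolding I_def by (rule nn_integral_reg_op_increment_le) (use pos en B in auto)
    finally show ?thesis by simp
  qed
  have n5: "(\<integral>\<^sup>+p. ennreal (\<bar>v (fst p) - v (snd p)\<bar> * ?k (fst p) (snd p) * \<bar>g (snd p + k) - g (snd p)\<bar>) \<partial>?M)
     \<le> ennreal (\<epsilon> powr \<alpha> / \<eta>) * ennreal x + ennreal (\<eta> / \<epsilon> powr \<alpha>) * I g k"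
  proof -
    have "(\<integral>\<^sup>+p. ennreal (\<bar>v (fst p) - v (snd p)\<bar> * ?k (fst p) (snd p) * \<bar>g (snd p + k) - g (snd p)\<bar>) \<partial>?M)
      = (\<integral>\<^sup>+y. reg_op \<epsilon> \<alpha> v y * ennreal \<bar>g (y + k) - g y\<bar> \<partial>lborel)"
      unfolding reg_op_def
      by (subst lborel_pair.nn_integral_snd[symmetric])
         (auto simp: ennreal_mult nn_integral_multc kernel_diff_commute(2) abs_minus_commute intro!: nn_integral_cong)
    also have "\<dots> \<le> ennreal (1 / (\<eta> / \<epsilon> powr \<alpha>)) * ennreal x + ennreal (\<eta> / \<epsilon> powr \<alpha>) * I g k"
      unfolding I_def by (rule nn_integral_reg_op_increment_le) (use pos en B in auto)
    finally show ?thesis by simp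
  qed
  have n6: "(\<integral>\<^sup>+p. ennreal (\<bar>v (fst p) - v (snd p)\<bar> * \<bar>g (fst p) - g (snd p)\<bar> * riesz_kernel \<alpha> (fst p - snd p) * cutoff \<epsilon> (fst p - snd p)) \<partial>?M)
    \<le> ennreal (y / \<eta> + \<eta> * e)"
    by (rule nn_integral_weighted_product_le) (use pos en in auto)
  have "(\<integral>\<^sup>+p. ennreal \<bar>G (fst p + h) (snd p + k) - G (fst p) (snd p)\<bar> \<partial>?M)
    \<le> (\<integral>\<^sup>+p. ennreal (2/\<eta>) * ennreal ((v (fst p + h) - v (fst p))\<^sup>2 * ?k' (fst p) (snd p))
        + ennreal (2/\<eta>) * ennreal ((v (snd p + k) - v (snd p))\<^sup>2 * ?k' (fst p) (snd p))
        + ennreal \<eta> * ennreal ((g (fst p + h) - g (snd p + k))\<^sup>2 * riesz_kernel \<alpha> (fst p + h - (snd p + k)))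
        + ennreal C * ennreal (\<bar>v (fst p) - v (snd p)\<bar> * ?k (fst p) (snd p) * \<bar>g (fst p + h) - g (fst p)\<bar>)
        + ennreal C * ennreal (\<bar>v (fst p) - v (snd p)\<bar> * ?k (fst p) (snd p) * \<bar>g (snd p + k) - g (snd p)\<bar>)
        + ennreal C * ennreal (\<bar>v (fst p) - v (snd p)\<bar> * \<bar>g (fst p) - g (snd p)\<bar> * riesz_kernel \<alpha> (fst p - snd p) * cutoff \<epsilon> (fst p - snd p)) \<partial>?M)"
    (is "_ \<le> (\<integral>\<^sup>+p. ?R p \<partial>?M)")
  proof (rule nn_integral_mono)
    fix p :: "'a \<times> 'a"
    have "0 \<le> \<bar>v (fst p) - v (snd p)\<bar> * \<bar>g (fst p) - g (snd p)\<bar> * riesz_kernel \<alpha> (fst p - snd p) * cutoff \<epsilon> (fst p - snd p)"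
      by (intro mult_nonneg_nonneg) (auto intro: less_imp_le cutoff_bounds pos)
    then show "ennreal \<bar>G (fst p + h) (snd p + k) - G (fst p) (snd p)\<bar> \<le> ?R p"
      using ennreal_leI[OF pt[of "fst p" "snd p"]] C(1) pos
      by (simp add: ennreal_mult[symmetric] ennreal_plus[symmetric] del: ennreal_plus)
  qed
  also have "\<dots> = ennreal (2/\<eta>) * (\<integral>\<^sup>+p. ennreal ((v (fst p + h) - v (fst p))\<^sup>2 * ?k' (fst p) (snd p)) \<partial>?M)
        + ennreal (2/\<eta>) * (\<integral>\<^sup>+p. ennreal ((v (snd p + k) - v (snd p))\<^sup>2 * ?k' (fst p) (snd p)) \<partial>?M)
        + ennreal \<eta> * (\<integral>\<^sup>+p. ennreal ((g (fst p + h) - g (snd p + k))\<^sup>2 * riesz_kernel \<alpha> (fst p + h - (snd p + k))) \<partial>?M)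
        + ennreal C * (\<integral>\<^sup>+p. ennreal (\<bar>v (fst p) - v (snd p)\<bar> * ?k (fst p) (snd p) * \<bar>g (fst p + h) - g (fst p)\<bar>) \<partial>?M)
        + ennreal C * (\<integral>\<^sup>+p. ennreal (\<bar>v (fst p) - v (snd p)\<bar> * ?k (fst p) (snd p) * \<bar>g (snd p + k) - g (snd p)\<bar>) \<partial>?M)
        + ennreal C * (\<integral>\<^sup>+p. ennreal (\<bar>v (fst p) - v (snd p)\<bar> * \<bar>g (fst p) - g (snd p)\<bar> * riesz_kernel \<alpha> (fst p - snd p) * cutoff \<epsilon> (fst p - snd p)) \<partial>?M)"
    by (simp add: nn_integral_add nn_integral_cmult)
  also have "\<dots> \<le> ennreal (2/\<eta>) * (?K * I v h) + ennreal (2/\<eta>) * (?K * I v k) + ennreal \<eta> * ennreal e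
     + ennreal C * (ennreal (\<epsilon> powr \<alpha> / \<eta>) * ennreal x + ennreal (\<eta> / \<epsilon> powr \<alpha>) * I g h)
     + ennreal C * (ennreal (\<epsilon> powr \<alpha> / \<eta>) * ennreal x + ennreal (\<eta> / \<epsilon> powr \<alpha>) * I g k)
     + ennreal C * ennreal (y / \<eta> + \<eta> * e)"
    by (intro add_mono mult_left_mono n1 n2 n3 n4 n5 n6) auto
  also have "\<dots> = ennreal (2 * C * \<epsilon> powr -\<alpha> / \<eta>) * (I v h + I v k)
      + ennreal (C * \<eta> / \<epsilon> powr \<alpha>) * (I g h + I g k)
      + ennreal (\<eta> * e + 2 * C * \<epsilon> powr \<alpha> / \<eta> * x + C * (y / \<eta> + \<eta> * e))"
  proof -
    have 1: "ennreal (2/\<eta>) * (?K * J) = ennreal (2 * C * \<epsilon> powr -\<alpha> / \<eta>) * J" for J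
      using pos C(1) by (simp add: mult.assoc[symmetric] ennreal_mult[symmetric])
    have 2: "ennreal C * (ennreal (\<epsilon> powr \<alpha> / \<eta>) * ennreal x + ennreal (\<eta> / \<epsilon> powr \<alpha>) * J)
       = ennreal (C * (\<epsilon> powr \<alpha> / \<eta> * x)) + ennreal (C * \<eta> / \<epsilon> powr \<alpha>) * J" for J
      using pos C(1) en by (simp add: distrib_left mult.assoc[symmetric] ennreal_mult[symmetric])
    have 3: "ennreal (\<eta> * e + 2 * C * \<epsilon> powr \<alpha> / \<eta> * x + C * (y / \<eta> + \<eta> * e))
       = ennreal \<eta> * ennreal e + ennreal (C * (\<epsilon> powr \<alpha> / \<eta> * x)) + ennreal (C * (\<epsilon> powr \<alpha> / \<eta> * x)) + ennreal C * ennreal (y / \<eta> + \<eta> * e)"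
      using pos C(1) en by (simp add: ennreal_mult[symmetric] ennreal_plus[symmetric] field_simps del: ennreal_plus)
    show ?thesis unfolding 1 2 3 by (simp add: distrib_left add_ac)
  qed
  finally show ?thesis .
qed

lemma integrable_energy_product:
  fixes v g :: "'a::euclidean_space \<Rightarrow> real"
  assumes [measurable]: "v \<in> borel_measurable borel" "g \<in> borel_measurable borel"
    and en: "energy \<alpha> v < \<infinity>" "energy \<alpha> g < \<infinity>"
  shows "integrable (lborel \<Otimes>\<^sub>M lborel) (\<lambda>p. (v (fst p) - v (snd p)) * (g (fst p) - g (snd p)) * riesz_kernel \<alpha> (fst p - snd p))"
proof (rule integrableI_bounded)
  let ?M = "(lborel \<Otimes>\<^sub>M lborel) :: ('a \<times> 'a) measure"
  have "(\<integral>\<^sup>+p. ennreal (norm ((v (fst p) - v (snd p)) * (g (fst p) - g (snd p)) * riesz_kernel \<alpha> (fst p - snd p))) \<partial>?M)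
    \<le> (\<integral>\<^sup>+p. ennreal ((v (fst p) - v (snd p))\<^sup>2 * riesz_kernel \<alpha> (fst p - snd p))
        + ennreal ((g (fst p) - g (snd p))\<^sup>2 * riesz_kernel \<alpha> (fst p - snd p)) \<partial>?M)"
  proof (rule nn_integral_mono)
    fix p :: "'a \<times> 'a"
    have "\<bar>v (fst p) - v (snd p)\<bar> * \<bar>g (fst p) - g (snd p)\<bar> * riesz_kernel \<alpha> (fst p - snd p)
      \<le> ((v (fst p) - v (snd p))\<^sup>2 + (g (fst p) - g (snd p))\<^sup>2) * riesz_kernel \<alpha> (fst p - snd p)"
      using mult_le_weighted_squares[of 1 "v (fst p) - v (snd p)" "g (fst p) - g (snd p)"]
      by (intro mult_right_mono) auto
    then show "ennreal (norm ((v (fst p) - v (snd p)) * (g (fst p) - g (snd p)) * riesz_kernel \<alpha> (fst p - snd p)))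
      \<le> ennreal ((v (fst p) - v (snd p))\<^sup>2 * riesz_kernel \<alpha> (fst p - snd p))
        + ennreal ((g (fst p) - g (snd p))\<^sup>2 * riesz_kernel \<alpha> (fst p - snd p))"
      by (simp add: abs_mult distrib_right ennreal_leI ennreal_plus[symmetric] del: ennreal_plus)
  qed
  also have "\<dots> = energy \<alpha> v + energy \<alpha> g"
    by (subst nn_integral_add, measurable) (simp add: energy_pair)
  also have "\<dots> < \<infinity>" using en by simp
  finally show "(\<integral>\<^sup>+p. ennreal (norm ((v (fst p) - v (snd p)) * (g (fst p) - g (snd p)) * riesz_kernel \<alpha> (fst p - snd p))) \<partial>?M) < \<infinity>" .
qed measurable

section \<open>The form with an oscillating coefficient\<close>

lemma cbox_pair_One:
  "cbox 0 (One :: 'a::euclidean_space \<times> 'b::euclidean_space) = cbox 0 One \<times> cbox 0 One"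
proof -
  have "(One :: 'a \<times> 'b) = (One, One)"
    by (simp add: sum_Basis_prod_eq fst_sum snd_sum prod_eq_iff)
  then show ?thesis by (metis cbox_Pair_eq zero_prod_def)
qed

lemma nn_integral_unit_square_fst_snd:
  fixes f :: "'a::euclidean_space \<Rightarrow> ennreal"
  assumes [measurable]: "f \<in> borel_measurable borel"
  shows "(\<integral>\<^sup>+q\<in>cbox 0 One. f (fst q) \<partial>(lborel \<Otimes>\<^sub>M lborel :: ('a \<times> 'a) measure)) = (\<integral>\<^sup>+x\<in>cbox 0 One. f x \<partial>lborel)"
    and "(\<integral>\<^sup>+q\<in>cbox 0 One. f (snd q) \<partial>(lborel \<Otimes>\<^sub>M lborel :: ('a \<times> 'a) measure)) = (\<integral>\<^sup>+x\<in>cbox 0 One. f x \<partial>lborel)"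
proof -
  let ?Q = "cbox 0 (One::'a)" and ?M = "(lborel \<Otimes>\<^sub>M lborel) :: ('a \<times> 'a) measure"
  have ind: "indicator (cbox 0 (One :: 'a \<times> 'a)) q = (indicator ?Q (fst q) * indicator ?Q (snd q) :: ennreal)" for q
    by (cases q) (auto simp: cbox_pair_One indicator_def)
  have e: "emeasure lborel ?Q = 1" by (simp add: emeasure_lborel_cbox_eq)
  have [measurable]: "?Q \<in> sets borel" by simp
  have "(\<integral>\<^sup>+q\<in>cbox 0 One. f (fst q) \<partial>?M) = (\<integral>\<^sup>+x. \<integral>\<^sup>+y. f x * indicator ?Q x * indicator ?Q y \<partial>lborel \<partial>lborel)"
    unfolding ind by (subst lborel.nn_integral_fst[symmetric]) (auto simp: mult_ac)
  also have "\<dots> = (\<integral>\<^sup>+x\<in>cbox 0 One. f x \<partial>lborel)"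
    by (simp add: nn_integral_cmult_indicator e)
  finally show "(\<integral>\<^sup>+q\<in>cbox 0 One. f (fst q) \<partial>?M) = (\<integral>\<^sup>+x\<in>cbox 0 One. f x \<partial>lborel)" .
  have "(\<integral>\<^sup>+q\<in>cbox 0 One. f (snd q) \<partial>?M) = (\<integral>\<^sup>+y. \<integral>\<^sup>+x. f y * indicator ?Q y * indicator ?Q x \<partial>lborel \<partial>lborel)"
    unfolding ind by (subst lborel_pair.nn_integral_snd[symmetric]) (auto simp: mult_ac)
  also have "\<dots> = (\<integral>\<^sup>+x\<in>cbox 0 One. f x \<partial>lborel)"
    by (simp add: nn_integral_cmult_indicator e)
  finally show "(\<integral>\<^sup>+q\<in>cbox 0 One. f (snd q) \<partial>?M) = (\<integral>\<^sup>+x\<in>cbox 0 One. f x \<partial>lborel)" .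
qed

text \<open>Only the regularised kernel can be averaged. Passing to it from the singular one costs a
  term with the factor \<open>cutoff\<close>, bounded in \<open>T1\<close>. In \<open>T2\<close> the
  increment estimate is averaged over the cube, which turns square increments into energies and
  cancels the powers of \<epsilon>. The constant is fixed before all other data, and the weight
  \<eta> stays free, so that the energy of g can be absorbed afterwards.\<close>

lemma oscillating_form_le:
  fixes \<alpha> :: real
  assumes \<alpha>: "\<alpha> > 0"
  shows "\<exists>C>0. \<forall>(\<epsilon>::real) (v :: 'a::euclidean_space \<Rightarrow> real) g F M B \<eta> x y e.
    0 < \<epsilon> \<longrightarrow> 0 < \<eta> \<longrightarrow> v \<in> borel_measurable borel \<longrightarrow> g \<in> borel_measurable borel \<longrightarrow>
    energy \<alpha> v < \<infinity> \<longrightarrow> cut_energy \<epsilon> \<alpha> v \<le> ennreal y \<longrightarrow> energy \<alpha> g \<le> ennreal e \<longrightarrow>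
    B \<in> sets borel \<longrightarrow> (\<integral>\<^sup>+x\<in>B. (reg_op \<epsilon> \<alpha> v x)\<^sup>2 \<partial>lborel) \<le> ennreal x \<longrightarrow> 0 \<le> y \<longrightarrow> 0 \<le> e \<longrightarrow> 0 \<le> x \<longrightarrow>
    (\<forall>x. x \<notin> B \<longrightarrow> g x = 0 \<and> (\<forall>q\<in>cbox 0 One. g (x + \<epsilon> *\<^sub>R q) = 0)) \<longrightarrow>
    F \<in> borel_measurable borel \<longrightarrow> (\<forall>p. \<bar>F p\<bar> \<le> M) \<longrightarrow>
    (\<forall>p. (\<integral>q. indicator (cbox 0 One) q * F (q + p) \<partial>lborel) = 0) \<longrightarrow>
    \<bar>\<integral>p. (v (fst p) - v (snd p)) * (g (fst p) - g (snd p)) * riesz_kernel \<alpha> (fst p - snd p) * F (p /\<^sub>R \<epsilon>) \<partial>(lborel \<Otimes>\<^sub>M lborel)\<bar>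
      \<le> C * M * ((y + \<epsilon> powr \<alpha> * x) / \<eta> + \<eta> * e)"
proof -
  let ?d = "real DIM('a)" and ?V = "unit_ball_vol DIM('a)"
  define p0 where "p0 = ?d + \<alpha>"
  have p0: "p0 > 0" using \<alpha> by (simp add: p0_def add_nonneg_pos)
  define A where "A = ?d powr p0 * (1 + ?d)\<^sup>2"
  \<comment> \<open>Collects the kernel constants for translations with c = 2d: each of x and y
    moves by at most d \<epsilon>, as vectors of the unit cube have norm at most d. The last summand
    is for the difference between singular and regularised kernel.\<close>
  define C1 where "C1 = (1 + 2 * ?d) powr p0 + 2 * ?d * p0 * (1 + 2 * ?d) powr (p0 + 1) + ?V * (1 + p0 / \<alpha>) + p0"
  have A0: "A \<ge> 0" by (simp add: A_def)
  have parts: "0 \<le> (1 + 2 * ?d) powr p0" "0 \<le> 2 * ?d * p0 * (1 + 2 * ?d) powr (p0 + 1)" "0 \<le> ?V * (1 + p0 / \<alpha>)"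
    using p0 \<alpha> by auto
  then have C1: "C1 > 0" "(1 + 2 * ?d) powr p0 \<le> C1" "2 * ?d * p0 * (1 + 2 * ?d) powr (p0 + 1) \<le> C1"
     "?V * (1 + p0 / \<alpha>) \<le> C1" "p0 \<le> C1"
    using p0 unfolding C1_def by linarith+
  define C where "C = 4 * C1 * A + 2 * C1 + C1 + 1 + C1"
  show ?thesis
  proof (intro exI[of _ C] conjI allI impI)
    show "C > 0" using C1 A0 by (simp add: C_def add_nonneg_pos)
    fix \<epsilon> M \<eta> x y e :: real and v g :: "'a \<Rightarrow> real" and F :: "'a \<times> 'a \<Rightarrow> real" and B :: "'a set"
    assume pos: "0 < \<epsilon>" "0 < \<eta>" and [measurable]: "v \<in> borel_measurable borel" "g \<in> borel_measurable borel"
      and env: "energy \<alpha> v < \<infinity>" and en: "cut_energy \<epsilon> \<alpha> v \<le> ennreal y" "energy \<alpha> g \<le> ennreal e"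
      and Bm[measurable]: "B \<in> sets borel" and X: "(\<integral>\<^sup>+x\<in>B. (reg_op \<epsilon> \<alpha> v x)\<^sup>2 \<partial>lborel) \<le> ennreal x"
      and nn: "0 \<le> y" "0 \<le> e" "0 \<le> x"
      and B: "\<forall>x. x \<notin> B \<longrightarrow> g x = 0 \<and> (\<forall>q\<in>cbox 0 One. g (x + \<epsilon> *\<^sub>R q) = 0)"
      and F[measurable]: "F \<in> borel_measurable borel" and M: "\<forall>p. \<bar>F p\<bar> \<le> M"
      and mean: "\<forall>p. (\<integral>q. indicator (cbox 0 One) q * F (q + p) \<partial>lborel) = 0"
    let ?M = "(lborel \<Otimes>\<^sub>M lborel) :: ('a \<times> 'a) measure"
    have M0: "0 \<le> M" using M[rule_format, of 0] by linarith
    have reg0: "0 \<le> reg_kernel \<epsilon> \<alpha> z * cutoff \<epsilon> z" for z :: 'a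
      using less_imp_le[OF cutoff_bounds(1)[OF pos(1)]] by (intro mult_nonneg_nonneg) auto
    have K2: "reg_kernel \<epsilon> \<alpha> z' \<le> C1 * reg_kernel \<epsilon> \<alpha> z" if "norm (z' - z) \<le> 2 * DIM('a) * \<epsilon>" for z z' :: 'a
    proof -
      have "reg_kernel \<epsilon> \<alpha> z' \<le> (1 + 2 * ?d) powr p0 * reg_kernel \<epsilon> \<alpha> z"
        unfolding p0_def by (rule reg_kernel_shift(1)) (use pos \<alpha> that in auto)
      also have "\<dots> \<le> C1 * reg_kernel \<epsilon> \<alpha> z" by (intro mult_right_mono C1) auto
      finally show ?thesis .
    qed
    have K3: "\<bar>reg_kernel \<epsilon> \<alpha> z' - reg_kernel \<epsilon> \<alpha> z\<bar> \<le> C1 * reg_kernel \<epsilon> \<alpha> z * cutoff \<epsilon> z"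
      if "norm (z' - z) \<le> 2 * DIM('a) * \<epsilon>" for z z' :: 'a
    proof -
      have "\<bar>reg_kernel \<epsilon> \<alpha> z' - reg_kernel \<epsilon> \<alpha> z\<bar> \<le> 2 * ?d * p0 * (1 + 2 * ?d) powr (p0 + 1) * reg_kernel \<epsilon> \<alpha> z * cutoff \<epsilon> z"
        unfolding p0_def by (rule reg_kernel_shift(2)) (use pos \<alpha> that in auto)
      also have "\<dots> \<le> C1 * (reg_kernel \<epsilon> \<alpha> z * cutoff \<epsilon> z)"
        unfolding mult.assoc[of _ "reg_kernel _ _ _"] by (intro mult_right_mono C1 reg0)
      finally show ?thesis by (simp add: mult.assoc)
    qed
    have K4: "(\<integral>\<^sup>+z. ennreal (reg_kernel \<epsilon> \<alpha> (z::'a)) \<partial>lborel) \<le> ennreal (C1 * \<epsilon> powr -\<alpha>)"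
      by (rule order_trans[OF nn_integral_reg_kernel_le[OF pos(1) \<alpha>]], rule ennreal_leI, rule mult_right_mono)
         (use C1(4) in \<open>auto simp: p0_def\<close>)
    define G0 where "G0 p = (v (fst p) - v (snd p)) * (g (fst p) - g (snd p)) * riesz_kernel \<alpha> (fst p - snd p)" for p
    define G where "G p = (v (fst p) - v (snd p)) * (g (fst p) - g (snd p)) * reg_kernel \<epsilon> \<alpha> (fst p - snd p)" for p
    have [measurable]: "G \<in> borel_measurable ?M" "G0 \<in> borel_measurable ?M" unfolding G_def G0_def by measurable
    have [measurable]: "(\<lambda>p. F (p /\<^sub>R \<epsilon>)) \<in> borel_measurable ?M" by (simp add: lborel_prod)
    have intG0: "integrable ?M G0" unfolding G0_def
      by (rule integrable_energy_product) (use env le_less_trans[OF en(2) ennreal_less_top] in auto)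
    have diffG: "\<bar>G0 p - G p\<bar> \<le> C1 * (\<bar>v (fst p) - v (snd p)\<bar> * \<bar>g (fst p) - g (snd p)\<bar> * riesz_kernel \<alpha> (fst p - snd p) * cutoff \<epsilon> (fst p - snd p))"
      and GG0: "\<bar>G p\<bar> \<le> \<bar>G0 p\<bar>" for p
    proof -
      let ?z = "fst p - snd p" and ?ab = "\<bar>v (fst p) - v (snd p)\<bar> * \<bar>g (fst p) - g (snd p)\<bar>"
      have "\<bar>G0 p - G p\<bar> \<le> C1 * (?ab * riesz_kernel \<alpha> ?z * cutoff \<epsilon> ?z) \<and> \<bar>G p\<bar> \<le> \<bar>G0 p\<bar>"
      proof (cases "?z = 0")
        case True
        then show ?thesis by (simp add: G0_def G_def)
      next
        case False
        note le = reg_kernel_le_riesz[OF pos(1) \<alpha> False]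
        have "G0 p - G p = (v (fst p) - v (snd p)) * (g (fst p) - g (snd p)) * (riesz_kernel \<alpha> ?z - reg_kernel \<epsilon> \<alpha> ?z)"
          by (simp add: G0_def G_def right_diff_distrib)
        then have "\<bar>G0 p - G p\<bar> = ?ab * (riesz_kernel \<alpha> ?z - reg_kernel \<epsilon> \<alpha> ?z)"
          using le by (simp add: abs_mult)
        also have "\<dots> \<le> ?ab * (C1 * (riesz_kernel \<alpha> ?z * cutoff \<epsilon> ?z))"
        proof (rule mult_left_mono)
          have "riesz_kernel \<alpha> ?z - reg_kernel \<epsilon> \<alpha> ?z \<le> p0 * (riesz_kernel \<alpha> ?z * cutoff \<epsilon> ?z)"
            using riesz_minus_reg_kernel_le[OF pos(1) \<alpha> False] by (simp add: p0_def mult.assoc)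
          also have "\<dots> \<le> C1 * (riesz_kernel \<alpha> ?z * cutoff \<epsilon> ?z)"
            using less_imp_le[OF cutoff_bounds(1)[OF pos(1)]] by (intro mult_right_mono C1 mult_nonneg_nonneg) auto
          finally show "riesz_kernel \<alpha> ?z - reg_kernel \<epsilon> \<alpha> ?z \<le> C1 * (riesz_kernel \<alpha> ?z * cutoff \<epsilon> ?z)" .
        qed simp
        finally have "\<bar>G0 p - G p\<bar> \<le> C1 * (?ab * riesz_kernel \<alpha> ?z * cutoff \<epsilon> ?z)" by (simp add: mult_ac)
        moreover have "\<bar>G p\<bar> \<le> \<bar>G0 p\<bar>" using le unfolding G_def G0_def by (simp add: abs_mult mult_left_mono)
        ultimately show ?thesis by blast
      qed
      then show "\<bar>G0 p - G p\<bar> \<le> C1 * (?ab * riesz_kernel \<alpha> ?z * cutoff \<epsilon> ?z)" "\<bar>G p\<bar> \<le> \<bar>G0 p\<bar>" by auto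
    qed
    have intG: "integrable ?M G"
      by (rule Bochner_Integration.integrable_bound[OF intG0]) (use GG0 in auto)
    have intF: "integrable ?M (\<lambda>p. H p * F (p /\<^sub>R \<epsilon>))" if H: "integrable ?M H" for H
    proof (rule Bochner_Integration.integrable_bound[of _ "\<lambda>x. M * H x"])
      show "integrable ?M (\<lambda>x. M * H x)" using H by simp
      have [measurable]: "H \<in> borel_measurable ?M" using H by simp
      show "(\<lambda>p. H p * F (p /\<^sub>R \<epsilon>)) \<in> borel_measurable ?M" by measurable
      show "AE x in ?M. norm (H x * F (x /\<^sub>R \<epsilon>)) \<le> norm (M * H x)"
        by (intro AE_I2) (use M M0 in \<open>auto simp: abs_mult mult.commute[of M] intro!: mult_left_mono\<close>)
    qed
    have T1: "\<bar>\<integral>p. (G0 p - G p) * F (p /\<^sub>R \<epsilon>) \<partial>?M\<bar> \<le> M * (C1 * (y / \<eta> + \<eta> * e))"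
    proof -
      have "ennreal (norm (\<integral>p. (G0 p - G p) * F (p /\<^sub>R \<epsilon>) \<partial>?M)) \<le> (\<integral>\<^sup>+p. ennreal (norm ((G0 p - G p) * F (p /\<^sub>R \<epsilon>))) \<partial>?M)"
        by (intro integral_norm_bound_ennreal intF Bochner_Integration.integrable_diff intG intG0)
      also have "\<dots> \<le> (\<integral>\<^sup>+p. ennreal (M * C1) * ennreal (\<bar>v (fst p) - v (snd p)\<bar> * \<bar>g (fst p) - g (snd p)\<bar> * riesz_kernel \<alpha> (fst p - snd p) * cutoff \<epsilon> (fst p - snd p)) \<partial>?M)"
      proof (rule nn_integral_mono)
        fix p :: "'a \<times> 'a"
        have "norm ((G0 p - G p) * F (p /\<^sub>R \<epsilon>)) \<le> (C1 * (\<bar>v (fst p) - v (snd p)\<bar> * \<bar>g (fst p) - g (snd p)\<bar> * riesz_kernel \<alpha> (fst p - snd p) * cutoff \<epsilon> (fst p - snd p))) * M"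
          unfolding real_norm_def abs_mult by (rule mult_mono[OF diffG M[rule_format] order_trans[OF abs_ge_zero diffG] abs_ge_zero])
        also have "\<dots> = (M * C1) * (\<bar>v (fst p) - v (snd p)\<bar> * \<bar>g (fst p) - g (snd p)\<bar> * riesz_kernel \<alpha> (fst p - snd p) * cutoff \<epsilon> (fst p - snd p))"
          by (simp add: mult_ac)
        finally show "ennreal (norm ((G0 p - G p) * F (p /\<^sub>R \<epsilon>))) \<le> ennreal (M * C1) * ennreal (\<bar>v (fst p) - v (snd p)\<bar> * \<bar>g (fst p) - g (snd p)\<bar> * riesz_kernel \<alpha> (fst p - snd p) * cutoff \<epsilon> (fst p - snd p))"
          using M0 C1(1) by (subst ennreal_mult'[symmetric]) (auto intro: ennreal_leI)
      qed
      also have "\<dots> = ennreal (M * C1) * (\<integral>\<^sup>+p. ennreal (\<bar>v (fst p) - v (snd p)\<bar> * \<bar>g (fst p) - g (snd p)\<bar> * riesz_kernel \<alpha> (fst p - snd p) * cutoff \<epsilon> (fst p - snd p)) \<partial>?M)"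
        by (rule nn_integral_cmult) measurable
      also have "\<dots> \<le> ennreal (M * C1) * ennreal (y / \<eta> + \<eta> * e)"
        by (intro mult_left_mono nn_integral_weighted_product_le) (use pos \<alpha> en nn in auto)
      also have "\<dots> = ennreal (M * (C1 * (y / \<eta> + \<eta> * e)))"
        using M0 C1(1) by (simp add: ennreal_mult'[symmetric] mult.assoc)
      finally show ?thesis using M0 C1(1) nn pos by (subst (asm) ennreal_le_iff) auto
    qed
    define I where "I u h = (\<integral>\<^sup>+x. ennreal ((u (x + h) - u x)\<^sup>2) \<partial>lborel)" for u :: "'a \<Rightarrow> real" and h
    have Im[measurable]: "(\<lambda>h. I u (\<epsilon> *\<^sub>R h)) \<in> borel_measurable borel" if [measurable]: "u \<in> borel_measurable borel" for u
      unfolding I_def by measurable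
    have osc: "(\<integral>\<^sup>+q\<in>cbox 0 One. I u (\<epsilon> *\<^sub>R q) \<partial>lborel) \<le> ennreal (A * \<epsilon> powr \<alpha> * c)"
      if [measurable]: "u \<in> borel_measurable borel" and c: "cut_energy \<epsilon> \<alpha> u \<le> ennreal c" "0 \<le> c" for u c
    proof -
      have "(\<integral>\<^sup>+q\<in>cbox 0 One. I u (\<epsilon> *\<^sub>R q) \<partial>lborel) \<le> ennreal (A * \<epsilon> powr \<alpha>) * cut_energy \<epsilon> \<alpha> u"
        using mean_square_increment_le[OF that(1) pos(1) \<alpha>] by (simp add: I_def A_def p0_def)
      also have "\<dots> \<le> ennreal (A * \<epsilon> powr \<alpha>) * ennreal c" by (intro mult_left_mono c) auto
      also have "\<dots> = ennreal (A * \<epsilon> powr \<alpha> * c)" using A0 c by (simp add: ennreal_mult)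
      finally show ?thesis .
    qed
    \<comment> \<open>Coefficients of the increment estimate. Averaged increments contribute A
      \<epsilon>^\<alpha> times an energy, which cancels the \<epsilon>^(-\<alpha>) in c1 and in
      c2.\<close>
    define c1 where "c1 = 2 * C1 * \<epsilon> powr -\<alpha> / \<eta>"
    define c2 where "c2 = C1 * \<eta> / \<epsilon> powr \<alpha>"
    define c3 where "c3 = \<eta> * e + 2 * C1 * \<epsilon> powr \<alpha> / \<eta> * x + C1 * (y / \<eta> + \<eta> * e)"
    have c: "0 \<le> c1" "0 \<le> c2" "0 \<le> c3" using pos C1(1) nn by (auto simp: c1_def c2_def c3_def)
    have inner: "(\<integral>\<^sup>+p. ennreal \<bar>G (p + \<epsilon> *\<^sub>R q) - G p\<bar> \<partial>?M)
      \<le> ennreal c1 * (I v (\<epsilon> *\<^sub>R fst q) + I v (\<epsilon> *\<^sub>R snd q)) + ennreal c2 * (I g (\<epsilon> *\<^sub>R fst q) + I g (\<epsilon> *\<^sub>R snd q)) + ennreal c3"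
      if q: "q \<in> cbox 0 One" for q :: "'a \<times> 'a"
    proof -
      have q': "fst q \<in> cbox 0 One" "snd q \<in> cbox 0 One" using q by (auto simp: cbox_pair_One mem_Times_iff)
      have "(\<integral>\<^sup>+p. ennreal \<bar>(v (fst p + \<epsilon> *\<^sub>R fst q) - v (snd p + \<epsilon> *\<^sub>R snd q)) * (g (fst p + \<epsilon> *\<^sub>R fst q) - g (snd p + \<epsilon> *\<^sub>R snd q)) * reg_kernel \<epsilon> \<alpha> (fst p + \<epsilon> *\<^sub>R fst q - (snd p + \<epsilon> *\<^sub>R snd q))
            - (v (fst p) - v (snd p)) * (g (fst p) - g (snd p)) * reg_kernel \<epsilon> \<alpha> (fst p - snd p)\<bar> \<partial>?M)
        \<le> ennreal c1 * (I v (\<epsilon> *\<^sub>R fst q) + I v (\<epsilon> *\<^sub>R snd q)) + ennreal c2 * (I g (\<epsilon> *\<^sub>R fst q) + I g (\<epsilon> *\<^sub>R snd q)) + ennreal c3"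
        unfolding I_def c1_def c2_def c3_def
      proof (rule nn_integral_reg_product_increment_le[where B = B])
        show "norm (\<epsilon> *\<^sub>R fst q) \<le> \<epsilon> * ?d" "norm (\<epsilon> *\<^sub>R snd q) \<le> \<epsilon> * ?d"
          using norm_unit_cube_le[OF q'(1)] norm_unit_cube_le[OF q'(2)] pos by auto
        show "\<And>x. x \<notin> B \<Longrightarrow> g x = 0 \<and> g (x + \<epsilon> *\<^sub>R fst q) = 0 \<and> g (x + \<epsilon> *\<^sub>R snd q) = 0" using B q' by blast
      qed (use pos \<alpha> en X nn C1(1) K2 K3 K4 in auto)
      then show ?thesis by (simp add: G_def)
    qed
    have T2: "\<bar>\<integral>p. G p * F (p /\<^sub>R \<epsilon>) \<partial>?M\<bar> \<le> M * (2 * c1 * (A * \<epsilon> powr \<alpha> * y) + 2 * c2 * (A * \<epsilon> powr \<alpha> * e) + c3)"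
    proof -
      have "ennreal \<bar>\<integral>p. G p * F (p /\<^sub>R \<epsilon>) \<partial>?M\<bar>
        \<le> ennreal M * (\<integral>\<^sup>+q\<in>cbox 0 One. (\<integral>\<^sup>+p. ennreal \<bar>G (p + \<epsilon> *\<^sub>R q) - G p\<bar> \<partial>?M) \<partial>?M)"
        using oscillating_integral_le[of G F M \<epsilon>] intG M mean pos unfolding lborel_prod by auto
      also have "(\<integral>\<^sup>+q\<in>cbox 0 One. (\<integral>\<^sup>+p. ennreal \<bar>G (p + \<epsilon> *\<^sub>R q) - G p\<bar> \<partial>?M) \<partial>?M)
        \<le> (\<integral>\<^sup>+q. ennreal c1 * (I v (\<epsilon> *\<^sub>R fst q) * indicator (cbox 0 One) q) + ennreal c1 * (I v (\<epsilon> *\<^sub>R snd q) * indicator (cbox 0 One) q)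
            + ennreal c2 * (I g (\<epsilon> *\<^sub>R fst q) * indicator (cbox 0 One) q) + ennreal c2 * (I g (\<epsilon> *\<^sub>R snd q) * indicator (cbox 0 One) q)
            + ennreal c3 * (1 * indicator (cbox 0 One) q) \<partial>?M)"
        by (rule nn_integral_mono) (use inner in \<open>auto simp: indicator_def distrib_left add.assoc\<close>)
      also have "\<dots> = ennreal c1 * (\<integral>\<^sup>+q\<in>cbox 0 One. I v (\<epsilon> *\<^sub>R fst q) \<partial>?M) + ennreal c1 * (\<integral>\<^sup>+q\<in>cbox 0 One. I v (\<epsilon> *\<^sub>R snd q) \<partial>?M)
         + ennreal c2 * (\<integral>\<^sup>+q\<in>cbox 0 One. I g (\<epsilon> *\<^sub>R fst q) \<partial>?M) + ennreal c2 * (\<integral>\<^sup>+q\<in>cbox 0 One. I g (\<epsilon> *\<^sub>R snd q) \<partial>?M)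
         + ennreal c3 * (\<integral>\<^sup>+q\<in>cbox 0 One. 1 \<partial>?M)"
      proof -
        have [measurable]: "cbox 0 (One :: 'a \<times> 'a) \<in> sets ?M"
          using borel_closed[OF closed_cbox] by (simp only: lborel_prod sets_lborel)
        have [measurable]: "(\<lambda>q. I u (\<epsilon> *\<^sub>R fst q)) \<in> borel_measurable ?M" "(\<lambda>q. I u (\<epsilon> *\<^sub>R snd q)) \<in> borel_measurable ?M"
          if [measurable]: "u \<in> borel_measurable borel" for u
          using measurable_compose[OF measurable_fst, of "\<lambda>h. I u (\<epsilon> *\<^sub>R h)" lborel borel lborel] measurable_compose[OF measurable_snd, of "\<lambda>h. I u (\<epsilon> *\<^sub>R h)" lborel borel lborel] Im[OF that] by simp_all
        show ?thesis by (simp add: nn_integral_add nn_integral_cmult)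
      qed
      also have "\<dots> = ennreal c1 * (\<integral>\<^sup>+q\<in>cbox 0 One. I v (\<epsilon> *\<^sub>R q) \<partial>lborel) + ennreal c1 * (\<integral>\<^sup>+q\<in>cbox 0 One. I v (\<epsilon> *\<^sub>R q) \<partial>lborel)
         + ennreal c2 * (\<integral>\<^sup>+q\<in>cbox 0 One. I g (\<epsilon> *\<^sub>R q) \<partial>lborel) + ennreal c2 * (\<integral>\<^sup>+q\<in>cbox 0 One. I g (\<epsilon> *\<^sub>R q) \<partial>lborel)
         + ennreal c3"
      proof -
        have "(\<integral>\<^sup>+q. indicator (cbox 0 One) q \<partial>?M) = 1"
          using nn_integral_unit_square_fst_snd(1)[of "\<lambda>_::'a. 1"] by (simp add: emeasure_lborel_cbox_eq)
        then show ?thesis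
          by (simp add: nn_integral_unit_square_fst_snd[where f = "\<lambda>q. I _ (\<epsilon> *\<^sub>R q)"])
      qed
      \<comment> \<open>For v the small energy at scale \<epsilon> is used; for g it is replaced by
        the full energy, the quantity to be absorbed.\<close>
      also have "\<dots> \<le> ennreal c1 * ennreal (A * \<epsilon> powr \<alpha> * y) + ennreal c1 * ennreal (A * \<epsilon> powr \<alpha> * y)
         + ennreal c2 * ennreal (A * \<epsilon> powr \<alpha> * e) + ennreal c2 * ennreal (A * \<epsilon> powr \<alpha> * e) + ennreal c3"
        by (intro add_mono mult_left_mono osc en nn order_trans[OF cut_energy_le_energy en(2)]) (use pos in auto)
      also have "\<dots> = ennreal (2 * c1 * (A * \<epsilon> powr \<alpha> * y) + 2 * c2 * (A * \<epsilon> powr \<alpha> * e) + c3)"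
        using c A0 nn by (simp add: ennreal_mult[symmetric] ennreal_plus[symmetric] del: ennreal_plus)
      finally have "ennreal \<bar>\<integral>p. G p * F (p /\<^sub>R \<epsilon>) \<partial>?M\<bar> \<le> ennreal M * ennreal (2 * c1 * (A * \<epsilon> powr \<alpha> * y) + 2 * c2 * (A * \<epsilon> powr \<alpha> * e) + c3)"
        by (simp add: mult_left_mono)
      then show ?thesis using c A0 nn M0
        by (subst (asm) ennreal_mult[symmetric]) (auto simp: ennreal_le_iff)
    qed
    have "(\<integral>p. G0 p * F (p /\<^sub>R \<epsilon>) \<partial>?M) = (\<integral>p. (G0 p - G p) * F (p /\<^sub>R \<epsilon>) \<partial>?M) + (\<integral>p. G p * F (p /\<^sub>R \<epsilon>) \<partial>?M)"
      by (subst Bochner_Integration.integral_add[symmetric])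
         (auto intro!: intF Bochner_Integration.integrable_diff intG intG0 simp: left_diff_distrib)
    then have "\<bar>\<integral>p. G0 p * F (p /\<^sub>R \<epsilon>) \<partial>?M\<bar> \<le> M * (C1 * (y / \<eta> + \<eta> * e)) + M * (2 * c1 * (A * \<epsilon> powr \<alpha> * y) + 2 * c2 * (A * \<epsilon> powr \<alpha> * e) + c3)"
      using T1 T2 by linarith
    also have "\<dots> = M * (C1 * (y / \<eta> + \<eta> * e) + (4 * C1 * A * (y / \<eta>) + 2 * C1 * A * (\<eta> * e) + (\<eta> * e + 2 * C1 * (\<epsilon> powr \<alpha> * x / \<eta>) + C1 * (y / \<eta> + \<eta> * e))))"
    proof -
      have e12: "2 * c1 * (A * \<epsilon> powr \<alpha> * y) = 4 * C1 * A * (y / \<eta>)" "2 * c2 * (A * \<epsilon> powr \<alpha> * e) = 2 * C1 * A * (\<eta> * e)"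
        unfolding c1_def c2_def using pos by (auto simp: powr_minus field_simps)
      show ?thesis unfolding c3_def e12 by (simp add: distrib_left mult_ac)
    qed
    also have "\<dots> \<le> M * (C * ((y + \<epsilon> powr \<alpha> * x) / \<eta> + \<eta> * e))"
    proof (rule mult_left_mono[OF _ M0])
      define Y Z W where "Y = y / \<eta>" and "Z = \<epsilon> powr \<alpha> * x / \<eta>" and "W = \<eta> * e"
      have YZW: "0 \<le> Y" "0 \<le> Z" "0 \<le> W" using nn pos by (auto simp: Y_def Z_def W_def)
      have "0 \<le> C1 * Y" "0 \<le> C1 * Z" "0 \<le> C1 * W" "0 \<le> C1 * A * Z" "0 \<le> C1 * A * Y" "0 \<le> C1 * A * W"
        using YZW C1(1) A0 by auto
      then have "C1 * (Y + W) + (4 * C1 * A * Y + 2 * C1 * A * W + (W + 2 * C1 * Z + C1 * (Y + W))) \<le> C * ((Y + Z) + W)"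
        using YZW unfolding C_def by (simp add: algebra_simps)
      then show "C1 * (y / \<eta> + \<eta> * e) + (4 * C1 * A * (y / \<eta>) + 2 * C1 * A * (\<eta> * e) + (\<eta> * e + 2 * C1 * (\<epsilon> powr \<alpha> * x / \<eta>) + C1 * (y / \<eta> + \<eta> * e)))
        \<le> C * ((y + \<epsilon> powr \<alpha> * x) / \<eta> + \<eta> * e)"
        by (simp add: Y_def Z_def W_def add_divide_distrib)
    qed
    finally show "\<bar>\<integral>p. (v (fst p) - v (snd p)) * (g (fst p) - g (snd p)) * riesz_kernel \<alpha> (fst p - snd p) * F (p /\<^sub>R \<epsilon>) \<partial>?M\<bar>
      \<le> C * M * ((y + \<epsilon> powr \<alpha> * x) / \<eta> + \<eta> * e)"
      by (simp add: G0_def mult_ac)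
  qed
qed

section \<open>Estimates from the boundary modulus\<close>

text \<open>The bound on the increments of the solution from which all estimates follow; \<open>\<kappa> = \<alpha> / 2\<close>.\<close>

definition boundary_modulus :: "'a::euclidean_space set \<Rightarrow> real \<Rightarrow> ('a \<Rightarrow> real) \<Rightarrow> real \<Rightarrow> bool" where
  "boundary_modulus D \<kappa> v C \<longleftrightarrow> (\<forall>x y \<theta>. 0 \<le> \<theta> \<longrightarrow> \<theta> \<le> 1 - \<kappa> \<longrightarrow> x \<notin> frontier D \<longrightarrow>
    \<bar>v x - v y\<bar> \<le> C * norm (x - y) powr (\<kappa> + \<theta>) * bdist D x powr -\<theta>)"

text \<open>Boundary layers have volume of order r, so the distance behaves like a radius in
  effective dimension 1; the layer estimate is split at R = 1. The blow-up 1 / (1 - s) is recorded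
  because s tends to 1 with \<epsilon> when \<alpha> = 1.\<close>

lemma nn_integral_bdist_powr_le:
  fixes D B :: "'a::euclidean_space set"
  assumes D: "bounded D" "C11_domain D" and B: "B \<in> sets borel" "bounded B"
  shows "\<exists>C>0. \<forall>s. 0 < s \<longrightarrow> s < 1 \<longrightarrow>
    (\<integral>\<^sup>+x\<in>B - frontier D. ennreal (bdist D x powr -s) \<partial>lborel) \<le> ennreal (C / (1 - s))"
proof -
  obtain C1 where C1: "C1 \<ge> 0" "\<And>r. 0 < r \<Longrightarrow> emeasure lborel {x\<in>B. bdist D x \<le> r} \<le> ennreal (C1 * r)"
    using emeasure_boundary_layer[OF D B] by blast
  have finB: "emeasure lborel B < \<infinity>" using emeasure_bounded_finite[OF B(2)] by simp
  define m where "m = measure lborel B"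
  have m: "emeasure lborel B = ennreal m" "0 \<le> m" using finB by (auto simp: m_def emeasure_eq_ennreal_measure less_top)
  have [measurable]: "B \<in> sets borel" by (rule B)
  have fm: "B - frontier D \<in> sets borel" using B by auto
  show ?thesis
  proof (intro exI[of _ "C1 + m + 1"] conjI allI impI)
    show "C1 + m + 1 > 0" using C1 m by simp
    fix s :: real assume s: "0 < s" "s < 1"
    have "(\<integral>\<^sup>+x\<in>B - frontier D. ennreal (bdist D x powr -s) \<partial>lborel) \<le> ennreal (C1 * s / (1 - s) * 1 powr (1 - s) + m * 1 powr -s)"
    proof (rule nn_integral_neg_powr_le[OF borel_measurable_bdist fm])
      show "\<And>x. x \<in> B - frontier D \<Longrightarrow> 0 < bdist D x" using bdist_pos_iff[OF frontier_ne[OF D]] by blast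
      show "emeasure lborel (B - frontier D) \<le> ennreal m" unfolding m(1)[symmetric] by (rule emeasure_mono) (use B in auto)
      fix r :: real assume r: "0 < r"
      have "emeasure lborel {x \<in> B - frontier D. bdist D x \<le> r} \<le> emeasure lborel {x\<in>B. bdist D x \<le> r}"
        by (rule emeasure_mono) auto
      also have "\<dots> \<le> ennreal (C1 * r)" by (rule C1(2)[OF r])
      finally show "emeasure lborel {x \<in> B - frontier D. bdist D x \<le> r} \<le> ennreal (C1 * r powr 1)" using r by simp
    qed (use s C1 m in auto)
    also have "\<dots> \<le> ennreal ((C1 + m + 1) / (1 - s))"
    proof (rule ennreal_leI)
      have "C1 * s / (1 - s) \<le> C1 * 1 / (1 - s)" using s C1 by (intro divide_right_mono mult_left_mono) auto
      moreover have "m \<le> m / (1 - s)" using s m by (auto simp: field_simps mult_left_le)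
      moreover have "0 \<le> 1 / (1 - s)" using s by simp
      moreover have "C1 * s / (1 - s) * 1 powr (1 - s) + m * 1 powr -s = C1 * s / (1 - s) + m" by simp
      moreover have "(C1 + m + 1) / (1 - s) = C1 / (1 - s) + m / (1 - s) + 1 / (1 - s)" by (simp only: add_divide_distrib)
      ultimately show "C1 * s / (1 - s) * 1 powr (1 - s) + m * 1 powr -s \<le> (C1 + m + 1) / (1 - s)"
        by linarith
    qed
    finally show "(\<integral>\<^sup>+x\<in>B - frontier D. ennreal (bdist D x powr -s) \<partial>lborel) \<le> ennreal ((C1 + m + 1) / (1 - s))" .
  qed
qed

text \<open>The boundary lies in each of its own layers, and their volumes tend to 0.\<close>

lemma null_frontier:
  fixes D :: "'a::euclidean_space set"
  assumes D: "bounded D" "C11_domain D"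
  shows "AE x in lborel. x \<notin> frontier D"
proof -
  obtain C1 where C1: "C1 \<ge> 0" "\<And>r. 0 < r \<Longrightarrow> emeasure lborel {x\<in>frontier D. bdist D x \<le> r} \<le> ennreal (C1 * r)"
    using emeasure_boundary_layer[OF D, of "frontier D"] D compact_frontier_bounded[OF D(1)]
    by (auto simp: compact_imp_bounded borel_closed)
  have b0: "bdist D x = 0" if "x \<in> frontier D" for x
    using that by (simp add: bdist_def)
  have "emeasure lborel (frontier D) \<le> ennreal (C1 * r)" if "r > 0" for r
  proof -
    have "{x\<in>frontier D. bdist D x \<le> r} = frontier D" using b0 that by force
    then show ?thesis using C1(2)[OF that] by simp
  qed
  then have le: "emeasure lborel (frontier D) \<le> ennreal r" if "r > 0" for r
  proof -
    have "C1 * (r / (C1 + 1)) \<le> r" using C1(1) that by (simp add: field_simps)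
    then show ?thesis using \<open>\<And>r. r > 0 \<Longrightarrow> emeasure lborel (frontier D) \<le> ennreal (C1 * r)\<close>[of "r / (C1 + 1)"] C1(1) that
      by (meson add_nonneg_pos divide_pos_pos ennreal_leI order_trans zero_less_one)
  qed
  have "emeasure lborel (frontier D) \<le> 0" by (rule ennreal_le_epsilon) (use le in auto)
  then have "frontier D \<in> null_sets lborel" by (auto simp: borel_closed)
  then show ?thesis by (rule AE_not_in)
qed

lemma nn_integral_split_cball:
  fixes f :: "'a::euclidean_space \<Rightarrow> ennreal"
  assumes [measurable]: "f \<in> borel_measurable borel"
  shows "(\<integral>\<^sup>+z. f z \<partial>lborel) = (\<integral>\<^sup>+z\<in>cball 0 r. f z \<partial>lborel) + (\<integral>\<^sup>+z\<in>- cball 0 r. f z \<partial>lborel)"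
proof -
  have [measurable]: "cball (0::'a) r \<in> sets borel" by simp
  have "(\<integral>\<^sup>+z. f z \<partial>lborel) = (\<integral>\<^sup>+z. f z * indicator (cball 0 r) z + f z * indicator (- cball 0 r) z \<partial>lborel)"
    by (rule nn_integral_cong) (auto simp: indicator_def)
  also have "\<dots> = (\<integral>\<^sup>+z\<in>cball 0 r. f z \<partial>lborel) + (\<integral>\<^sup>+z\<in>- cball 0 r. f z \<partial>lborel)"
    by (rule nn_integral_add) (auto intro!: borel_measurable_times_ennreal borel_measurable_indicator)
  finally show ?thesis .
qed

text \<open>A pair that contributes has at least one member in \<open>D\<close>, and by symmetry
  this may be taken to be the first. Thus a bound for increments based at points of \<open>D\<close>
  is enough.\<close>

lemma nn_integral_symmetric_le:
  fixes f :: "'a::euclidean_space \<times> 'a \<Rightarrow> ennreal"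
  assumes f[measurable]: "f \<in> borel_measurable (lborel \<Otimes>\<^sub>M lborel)" and D[measurable]: "D \<in> sets borel"
    and sym: "\<And>x y. f (x, y) = f (y, x)" and zero: "\<And>x y. x \<notin> D \<Longrightarrow> y \<notin> D \<Longrightarrow> f (x, y) = 0"
  shows "(\<integral>\<^sup>+x. \<integral>\<^sup>+y. f (x, y) \<partial>lborel \<partial>lborel) \<le> 2 * (\<integral>\<^sup>+x\<in>D. (\<integral>\<^sup>+y. f (x, y) \<partial>lborel) \<partial>lborel)"
proof -
  let ?g = "\<lambda>x y. f (x, y) * indicator D x"
  have "(\<integral>\<^sup>+x. \<integral>\<^sup>+y. f (x, y) \<partial>lborel \<partial>lborel) \<le> (\<integral>\<^sup>+x. \<integral>\<^sup>+y. ?g x y + ?g y x \<partial>lborel \<partial>lborel)"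
  proof (intro nn_integral_mono)
    fix x y show "f (x, y) \<le> ?g x y + ?g y x"
      using sym[of x y] zero[of x y] by (cases "x \<in> D"; cases "y \<in> D") auto
  qed
  also have "\<dots> = (\<integral>\<^sup>+x. (\<integral>\<^sup>+y. ?g x y \<partial>lborel) + (\<integral>\<^sup>+y. ?g y x \<partial>lborel) \<partial>lborel)"
    by (intro nn_integral_cong nn_integral_add) measurable
  also have "\<dots> = (\<integral>\<^sup>+x. \<integral>\<^sup>+y. ?g x y \<partial>lborel \<partial>lborel) + (\<integral>\<^sup>+x. \<integral>\<^sup>+y. ?g y x \<partial>lborel \<partial>lborel)"
    by (rule nn_integral_add) measurable
  also have "(\<integral>\<^sup>+x. \<integral>\<^sup>+y. ?g y x \<partial>lborel \<partial>lborel) = (\<integral>\<^sup>+x. \<integral>\<^sup>+y. ?g x y \<partial>lborel \<partial>lborel)"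
    by (rule lborel_pair.Fubini') measurable
  also have "(\<integral>\<^sup>+x. \<integral>\<^sup>+y. ?g x y \<partial>lborel \<partial>lborel) = (\<integral>\<^sup>+x\<in>D. (\<integral>\<^sup>+y. f (x, y) \<partial>lborel) \<partial>lborel)"
    by (intro nn_integral_cong nn_integral_multc) measurable
  finally show ?thesis by (simp add: mult_2)
qed

text \<open>The Hoelder bound reduces the inner integral to that of |z|^(s-d) times the squared
  cutoff. Within |z| \<le> \<epsilon> this is of order \<epsilon>^s / s; beyond, the two factors
  \<epsilon> / |z| make it converge with the same order. The weight w is left open: a power of the
  boundary distance for the limit, a constant for test functions.\<close>

lemma cut_energy_increment_le:
  fixes v w :: "'a::euclidean_space \<Rightarrow> real" and \<epsilon> \<alpha> s c :: real
  assumes D: "open D" and vm[measurable]: "v \<in> borel_measurable borel" and v0: "\<And>x. x \<notin> D \<Longrightarrow> v x = 0"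
    and inc: "\<And>x y. x \<in> D \<Longrightarrow> \<bar>v x - v y\<bar> \<le> w x * norm (x - y) powr ((\<alpha> + s) / 2)"
    and w[measurable]: "w \<in> borel_measurable borel" and \<epsilon>: "\<epsilon> > 0"
    and s: "0 < s" "s < 1"
    and c: "(\<integral>\<^sup>+x\<in>D. ennreal ((w x)\<^sup>2) \<partial>lborel) \<le> ennreal c" "0 \<le> c"
  shows "cut_energy \<epsilon> \<alpha> v \<le> ennreal (2 * unit_ball_vol DIM('a) * (DIM('a) / s + 2 + DIM('a)) * c * \<epsilon> powr s)"
proof -
  let ?d = "real DIM('a)" and ?V = "unit_ball_vol DIM('a)"
  have d: "?d \<ge> 1" using DIM_positive[where 'a='a] by linarith
  have [measurable]: "D \<in> sets borel" using D by auto
  define f where "f p = ennreal ((v (fst p) - v (snd p))\<^sup>2 * riesz_kernel \<alpha> (fst p - snd p) * (cutoff \<epsilon> (fst p - snd p))\<^sup>2)" for p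
  have fm: "f \<in> borel_measurable (lborel \<Otimes>\<^sub>M lborel)" unfolding f_def by measurable
  define W where "W z = norm z powr (s - ?d) * (cutoff \<epsilon> z)\<^sup>2" for z :: 'a
  have [measurable]: "W \<in> borel_measurable borel" unfolding W_def[abs_def] by measurable
  \<comment> \<open>d / s is the contribution of the ball; 2 + d bounds the constant (d + 2 - s) /
    (2 - s) of its complement.\<close>
  define K where "K = ?V * (?d / s + 2 + ?d) * \<epsilon> powr s"
  have K0: "K \<ge> 0" using s d by (simp add: K_def)
  have W: "(\<integral>\<^sup>+z. ennreal (W z) \<partial>lborel) \<le> ennreal K"
  proof -
    have "(\<integral>\<^sup>+z. ennreal (W z) \<partial>lborel) = (\<integral>\<^sup>+z\<in>cball 0 \<epsilon>. ennreal (W z) \<partial>lborel) + (\<integral>\<^sup>+z\<in>- cball 0 \<epsilon>. ennreal (W z) \<partial>lborel)"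
      by (rule nn_integral_split_cball) measurable
    also have "(\<integral>\<^sup>+z\<in>cball 0 \<epsilon>. ennreal (W z) \<partial>lborel) \<le> (\<integral>\<^sup>+z\<in>cball 0 \<epsilon>. ennreal (norm (z::'a) powr (s - ?d)) \<partial>lborel)"
      by (intro nn_integral_mono mult_right_mono ennreal_leI)
         (use cutoff_bounds[OF \<epsilon>] in \<open>auto simp: W_def intro!: mult_left_le\<close>)
    also have "\<dots> \<le> ennreal (?V * ?d / s * \<epsilon> powr s)" by (rule nn_integral_norm_powr_near) (use s \<epsilon> in auto)
    also have "(\<integral>\<^sup>+z\<in>- cball 0 \<epsilon>. ennreal (W z) \<partial>lborel)
      \<le> (\<integral>\<^sup>+z. ennreal (\<epsilon>\<^sup>2) * (ennreal (norm (z::'a) powr (- (2 - s) - ?d)) * indicator (- cball 0 \<epsilon>) z) \<partial>lborel)"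
    proof (rule nn_integral_mono)
      fix z :: 'a
      show "ennreal (W z) * indicator (- cball 0 \<epsilon>) z \<le> ennreal (\<epsilon>\<^sup>2) * (ennreal (norm z powr (- (2 - s) - ?d)) * indicator (- cball 0 \<epsilon>) z)"
      proof (cases "z \<in> cball 0 \<epsilon>")
        case False
        then have z: "norm z > 0" "norm z > \<epsilon>" using \<epsilon> by auto
        have "cutoff \<epsilon> z \<le> \<epsilon> / norm z" unfolding cutoff_def using z \<epsilon> by (intro divide_left_mono) auto
        then have "(cutoff \<epsilon> z)\<^sup>2 \<le> (\<epsilon> / norm z)\<^sup>2" using cutoff_bounds(1)[OF \<epsilon>, of z] by (intro power_mono) auto
        then have "W z \<le> norm z powr (s - ?d) * (\<epsilon> / norm z)\<^sup>2" unfolding W_def by (intro mult_left_mono) auto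
        also have "\<dots> = \<epsilon>\<^sup>2 * norm z powr (- (2 - s) - ?d)"
        proof -
          have "(norm z)\<^sup>2 = norm z powr 2" using z by simp
          then have "norm z powr (s - ?d) = norm z powr (- (2 - s) - ?d) * (norm z)\<^sup>2"
            by (simp only: powr_add[symmetric]) (simp add: algebra_simps)
          then show ?thesis using z by (simp add: power_divide)
        qed
        finally show ?thesis using False by (auto simp: ennreal_mult[symmetric] intro: ennreal_leI)
      qed simp
    qed
    also have "\<dots> = ennreal (\<epsilon>\<^sup>2) * (\<integral>\<^sup>+z\<in>- cball 0 \<epsilon>. ennreal (norm (z::'a) powr (- (2 - s) - ?d)) \<partial>lborel)"
      by (rule nn_integral_cmult) (auto intro!: borel_measurable_times_ennreal borel_measurable_indicator)
    also have "\<dots> \<le> ennreal (\<epsilon>\<^sup>2) * ennreal (?V * (?d + (2 - s)) / (2 - s) * \<epsilon> powr - (2 - s))"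
      by (intro mult_left_mono nn_integral_norm_powr_far) (use s \<epsilon> in auto)
    also have "\<dots> = ennreal (?V * (?d + (2 - s)) / (2 - s) * \<epsilon> powr s)"
    proof -
      have "\<epsilon>\<^sup>2 = \<epsilon> powr 2" using \<epsilon> by simp
      then have "\<epsilon>\<^sup>2 * \<epsilon> powr - (2 - s) = \<epsilon> powr s"
        by (simp only: powr_add[symmetric]) simp
      then show ?thesis using s by (simp add: ennreal_mult[symmetric] mult_ac)
    qed
    also have "ennreal (?V * ?d / s * \<epsilon> powr s) + \<dots> = ennreal (?V * ?d / s * \<epsilon> powr s + ?V * (?d + (2 - s)) / (2 - s) * \<epsilon> powr s)"
      using s d by (intro ennreal_plus[symmetric]) auto
    also have "\<dots> \<le> ennreal K"
    proof (rule ennreal_leI)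
      have "(?d + (2 - s)) / (2 - s) \<le> ?d + 2"
      proof -
        have "?d / (2 - s) \<le> ?d / 1" using s d by (intro divide_left_mono) auto
        moreover have "(?d + (2 - s)) / (2 - s) = ?d / (2 - s) + 1" using s by (simp add: add_divide_distrib)
        ultimately show ?thesis by simp
      qed
      then have "?V * \<epsilon> powr s * ((?d + (2 - s)) / (2 - s)) \<le> ?V * \<epsilon> powr s * (?d + 2)"
        by (intro mult_left_mono) auto
      then show "?V * ?d / s * \<epsilon> powr s + ?V * (?d + (2 - s)) / (2 - s) * \<epsilon> powr s \<le> K"
        unfolding K_def by (simp add: algebra_simps)
    qed
    finally show ?thesis by (simp add: add_mono)
  qed
  have inner: "(\<integral>\<^sup>+y. f (x, y) \<partial>lborel) \<le> ennreal ((w x)\<^sup>2) * ennreal K" if x: "x \<in> D" for x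
  proof -
    have "(\<integral>\<^sup>+y. f (x, y) \<partial>lborel) \<le> (\<integral>\<^sup>+y. ennreal ((w x)\<^sup>2) * ennreal (W (x - y)) \<partial>lborel)"
    proof (rule nn_integral_mono)
      fix y
      have "\<bar>v x - v y\<bar>\<^sup>2 \<le> (w x * norm (x - y) powr ((\<alpha> + s) / 2))\<^sup>2"
        by (intro power_mono inc x) auto
      also have "\<dots> = (w x)\<^sup>2 * norm (x - y) powr (\<alpha> + s)"
        by (simp add: power_mult_distrib power2_eq_square powr_add[symmetric])
      finally have "(v x - v y)\<^sup>2 * riesz_kernel \<alpha> (x - y) \<le> (w x)\<^sup>2 * norm (x - y) powr (\<alpha> + s) * riesz_kernel \<alpha> (x - y)"
        by (intro mult_right_mono) auto
      also have "\<dots> = (w x)\<^sup>2 * norm (x - y) powr (s - ?d)"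
        unfolding riesz_kernel_def by (simp add: powr_add[symmetric] mult_ac)
      finally have "(v x - v y)\<^sup>2 * riesz_kernel \<alpha> (x - y) * (cutoff \<epsilon> (x - y))\<^sup>2 \<le> (w x)\<^sup>2 * W (x - y)"
        unfolding W_def mult.assoc[symmetric] by (intro mult_right_mono) auto
      then show "f (x, y) \<le> ennreal ((w x)\<^sup>2) * ennreal (W (x - y))"
        by (simp add: f_def ennreal_mult[symmetric] W_def ennreal_leI)
    qed
    also have "\<dots> = ennreal ((w x)\<^sup>2) * (\<integral>\<^sup>+y. ennreal (W (x - y)) \<partial>lborel)"
      by (rule nn_integral_cmult) measurable
    also have "(\<integral>\<^sup>+y. ennreal (W (x - y)) \<partial>lborel) = (\<integral>\<^sup>+y. ennreal (W y) \<partial>lborel)"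
      by (rule nn_integral_lborel_reflect) measurable
    finally show ?thesis using W by (meson mult_left_mono order_trans zero_le)
  qed
  have "cut_energy \<epsilon> \<alpha> v = (\<integral>\<^sup>+x. \<integral>\<^sup>+y. f (x, y) \<partial>lborel \<partial>lborel)" by (simp add: cut_energy_def f_def)
  also have "\<dots> \<le> 2 * (\<integral>\<^sup>+x\<in>D. (\<integral>\<^sup>+y. f (x, y) \<partial>lborel) \<partial>lborel)"
    by (rule nn_integral_symmetric_le[OF fm]) (auto simp: f_def kernel_diff_commute power2_commute v0)
  also have "\<dots> \<le> 2 * (\<integral>\<^sup>+x. ennreal (K) * (ennreal ((w x)\<^sup>2) * indicator D x) \<partial>lborel)"
    by (intro mult_left_mono nn_integral_mono)
       (use inner K0 in \<open>auto simp: indicator_def ennreal_mult[symmetric] mult_ac\<close>)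
  also have "\<dots> = 2 * (ennreal (K) * (\<integral>\<^sup>+x\<in>D. ennreal ((w x)\<^sup>2) \<partial>lborel))"
    by (subst nn_integral_cmult) auto
  also have "\<dots> \<le> 2 * (ennreal (K) * ennreal c)" by (intro mult_left_mono c) auto
  also have "\<dots> = ennreal (2 * (K * c))"
    using K0 c by (simp add: ennreal_mult'[symmetric] ennreal_mult''[symmetric] flip: ennreal_numeral)
  finally show ?thesis by (simp add: K_def mult_ac)
qed

text \<open>At \<epsilon> = 1 the cutoff is at least 1/2 within distance 1, so four times the cut
  energy bounds the near part. The far part is finite because v is bounded with bounded support and
  the kernel is integrable away from the diagonal.\<close>

lemma energy_increment_finite:
  fixes v w :: "'a::euclidean_space \<Rightarrow> real" and \<alpha> s c :: real
  assumes D: "open D" "bounded D" and vm[measurable]: "v \<in> borel_measurable borel" and v0: "\<And>x. x \<notin> D \<Longrightarrow> v x = 0"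
    and inc: "\<And>x y. x \<in> D \<Longrightarrow> \<bar>v x - v y\<bar> \<le> w x * norm (x - y) powr ((\<alpha> + s) / 2)"
    and w[measurable]: "w \<in> borel_measurable borel" and \<alpha>: "0 < \<alpha>" and bd: "\<And>x. \<bar>v x\<bar> \<le> Mv"
    and s: "0 < s" "s < 1"
    and c: "(\<integral>\<^sup>+x\<in>D. ennreal ((w x)\<^sup>2) \<partial>lborel) \<le> ennreal c" "0 \<le> c"
  shows "energy \<alpha> v < \<infinity>"
proof -
  let ?d = "real DIM('a)"
  have [measurable]: "D \<in> sets borel" using D by auto
  define f where "f p = ennreal ((v (fst p) - v (snd p))\<^sup>2 * riesz_kernel \<alpha> (fst p - snd p))" for p
  have fm: "f \<in> borel_measurable (lborel \<Otimes>\<^sub>M lborel)" unfolding f_def by measurable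
  have Mv: "0 \<le> Mv" using bd[of 0] by linarith
  have E1: "cut_energy 1 \<alpha> v < \<infinity>"
    by (rule le_less_trans[OF cut_energy_increment_le[OF D(1) vm v0 inc w zero_less_one s c]]) simp_all
  have far: "(\<integral>\<^sup>+y\<in>- cball 0 1. ennreal (norm (y::'a) powr (- \<alpha> - ?d)) \<partial>lborel) < \<infinity>" (is "?far < _")
    by (rule le_less_trans[OF nn_integral_norm_powr_far[OF \<alpha> zero_less_one]]) simp
  have inner: "(\<integral>\<^sup>+y. f (x, y) \<partial>lborel) \<le> ennreal 4 * (\<integral>\<^sup>+y. ennreal ((v x - v y)\<^sup>2 * riesz_kernel \<alpha> (x - y) * (cutoff 1 (x - y))\<^sup>2) \<partial>lborel) + ennreal (4 * Mv\<^sup>2) * ?far" for x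
  proof -
    define g where "g z = ennreal (norm (z::'a) powr (- \<alpha> - ?d)) * indicator (- cball 0 1) z" for z
    have [measurable]: "g \<in> borel_measurable borel" unfolding g_def[abs_def]
      by (auto intro!: borel_measurable_times_ennreal borel_measurable_indicator)
    have "f (x, y) \<le> ennreal 4 * ennreal ((v x - v y)\<^sup>2 * riesz_kernel \<alpha> (x - y) * (cutoff 1 (x - y))\<^sup>2) + ennreal (4 * Mv\<^sup>2) * g (x - y)" for y
    proof (cases "norm (x - y) \<le> 1")
      case True
      have "1/2 \<le> cutoff 1 (x - y)" unfolding cutoff_def
        by (rule frac_le) (use True in \<open>auto simp: add_pos_nonneg\<close>)
      then have "(1/2)\<^sup>2 \<le> (cutoff 1 (x - y))\<^sup>2" by (intro power_mono) auto
      then have "1 \<le> 4 * (cutoff 1 (x - y))\<^sup>2" by (simp add: power2_eq_square)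
      then have "(v x - v y)\<^sup>2 * riesz_kernel \<alpha> (x - y) * 1 \<le> (v x - v y)\<^sup>2 * riesz_kernel \<alpha> (x - y) * (4 * (cutoff 1 (x - y))\<^sup>2)"
        by (intro mult_left_mono) auto
      then have "f (x, y) \<le> ennreal 4 * ennreal ((v x - v y)\<^sup>2 * riesz_kernel \<alpha> (x - y) * (cutoff 1 (x - y))\<^sup>2)"
        unfolding f_def by (subst ennreal_mult[symmetric]) (auto intro!: ennreal_leI simp: mult_ac)
      then show ?thesis by (rule add_increasing2[rotated]) simp
    next
      case False
      have "\<bar>v x - v y\<bar> \<le> 2 * Mv" using bd[of x] bd[of y] by linarith
      then have "\<bar>v x - v y\<bar>\<^sup>2 \<le> (2 * Mv)\<^sup>2" by (intro power_mono) auto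
      then have "(v x - v y)\<^sup>2 * riesz_kernel \<alpha> (x - y) \<le> 4 * Mv\<^sup>2 * riesz_kernel \<alpha> (x - y)"
        by (intro mult_right_mono) (auto simp: power_mult_distrib)
      moreover have "riesz_kernel \<alpha> (x - y) = norm (x - y) powr (- \<alpha> - ?d)" by (simp add: riesz_kernel_def algebra_simps)
      ultimately have "f (x, y) \<le> ennreal (4 * Mv\<^sup>2) * g (x - y)"
      proof -
        have "x - y \<in> - cball 0 1" using False by simp
        then show ?thesis using \<open>(v x - v y)\<^sup>2 * riesz_kernel \<alpha> (x - y) \<le> 4 * Mv\<^sup>2 * riesz_kernel \<alpha> (x - y)\<close>
            \<open>riesz_kernel \<alpha> (x - y) = norm (x - y) powr (- \<alpha> - ?d)\<close>
          unfolding f_def g_def by (simp add: ennreal_mult[symmetric] ennreal_leI del: Compl_iff)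
      qed
      then show ?thesis by (rule add_increasing[rotated]) simp
    qed
    then have "(\<integral>\<^sup>+y. f (x, y) \<partial>lborel) \<le> (\<integral>\<^sup>+y. ennreal 4 * ennreal ((v x - v y)\<^sup>2 * riesz_kernel \<alpha> (x - y) * (cutoff 1 (x - y))\<^sup>2) + ennreal (4 * Mv\<^sup>2) * g (x - y) \<partial>lborel)"
      by (intro nn_integral_mono)
    also have "\<dots> = ennreal 4 * (\<integral>\<^sup>+y. ennreal ((v x - v y)\<^sup>2 * riesz_kernel \<alpha> (x - y) * (cutoff 1 (x - y))\<^sup>2) \<partial>lborel) + ennreal (4 * Mv\<^sup>2) * (\<integral>\<^sup>+y. g (x - y) \<partial>lborel)"
      by (subst nn_integral_add, measurable) (simp add: nn_integral_cmult del: ennreal_numeral)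
    also have "(\<integral>\<^sup>+y. g (x - y) \<partial>lborel) = ?far" unfolding g_def[symmetric]
      by (rule nn_integral_lborel_reflect) measurable
    finally show ?thesis .
  qed
  have "energy \<alpha> v = (\<integral>\<^sup>+x. \<integral>\<^sup>+y. f (x, y) \<partial>lborel \<partial>lborel)" by (simp add: energy_def f_def)
  also have "\<dots> \<le> 2 * (\<integral>\<^sup>+x\<in>D. (\<integral>\<^sup>+y. f (x, y) \<partial>lborel) \<partial>lborel)"
    by (rule nn_integral_symmetric_le[OF fm]) (auto simp: f_def kernel_diff_commute power2_commute v0)
  also have "\<dots> \<le> 2 * (\<integral>\<^sup>+x. ennreal 4 * (\<integral>\<^sup>+y. ennreal ((v x - v y)\<^sup>2 * riesz_kernel \<alpha> (x - y) * (cutoff 1 (x - y))\<^sup>2) \<partial>lborel) + (ennreal (4 * Mv\<^sup>2) * ?far) * indicator D x \<partial>lborel)"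
    using inner by (intro mult_left_mono nn_integral_mono) (auto simp: indicator_def)
  also have "\<dots> = 2 * (ennreal 4 * cut_energy 1 \<alpha> v + (ennreal (4 * Mv\<^sup>2) * ?far) * emeasure lborel D)"
    unfolding cut_energy_def
    by (subst nn_integral_add, measurable) (simp add: nn_integral_cmult nn_integral_cmult_indicator del: ennreal_numeral)
  also have "\<dots> < \<infinity>"
    using E1 far emeasure_bounded_finite[OF D(2)] by (auto simp: ennreal_mult_less_top)
  finally show ?thesis .
qed


lemma nn_integral_diff_frontier:
  fixes D B :: "'a::euclidean_space set"
  assumes D: "bounded D" "C11_domain D"
  shows "(\<integral>\<^sup>+x\<in>B. f x \<partial>lborel) = (\<integral>\<^sup>+x\<in>B - frontier D. f x \<partial>lborel)"
  by (rule nn_integral_cong_AE, use null_frontier[OF D] in eventually_elim) (auto simp: indicator_def)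

text \<open>For s < \<alpha> the increment bound falls short of integrability by the power q =
  (\<alpha> - s) / 2; the regularisation stops the divergence at \<epsilon>^(-q), whose square is
  \<epsilon>^(s-\<alpha>). The dependence on 1/q is explicit, since q tends to 0 with \<epsilon>
  when \<alpha> = 1.\<close>

lemma square_integral_reg_op_le:
  fixes v :: "'a::euclidean_space \<Rightarrow> real" and \<epsilon> \<alpha> s C0 c q :: real
  assumes D: "bounded D" "C11_domain D" and vm[measurable]: "v \<in> borel_measurable borel"
    and mod: "boundary_modulus D (\<alpha>/2) v C0" "C0 \<ge> 0" and \<epsilon>: "\<epsilon> > 0"
    and s: "0 < s" "s < \<alpha>" "s \<le> 2 - \<alpha>" and B: "B \<in> sets borel"
    and c: "(\<integral>\<^sup>+x\<in>B - frontier D. ennreal (bdist D x powr -s) \<partial>lborel) \<le> ennreal c" "0 \<le> c"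
  defines "q \<equiv> (\<alpha> - s) / 2"
  shows "(\<integral>\<^sup>+x\<in>B. (reg_op \<epsilon> \<alpha> v x)\<^sup>2 \<partial>lborel)
    \<le> ennreal ((C0 * (unit_ball_vol DIM('a) * (1 + (DIM('a) + q) / q)))\<^sup>2 * \<epsilon> powr (s - \<alpha>) * c)"
proof -
  let ?d = "real DIM('a)" and ?V = "unit_ball_vol DIM('a)"
  have q: "q > 0" using s by (simp add: q_def)
  have [measurable]: "B \<in> sets borel" by (rule B)
  define K where "K = ?V * (1 + (?d + q) / q) * \<epsilon> powr -q"
  have K0: "K \<ge> 0" using q by (simp add: K_def)
  define W where "W z = norm z powr ((\<alpha> + s) / 2) * reg_kernel \<epsilon> \<alpha> z" for z :: 'a
  have [measurable]: "W \<in> borel_measurable borel" unfolding W_def[abs_def] by measurable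
  have W: "(\<integral>\<^sup>+z. ennreal (W z) \<partial>lborel) \<le> ennreal K"
  proof -
    have "(\<integral>\<^sup>+z. ennreal (W z) \<partial>lborel)
      \<le> (\<integral>\<^sup>+z. ennreal (\<epsilon> powr (- q - ?d)) * indicator (cball 0 \<epsilon>) z
         + ennreal (norm (z::'a) powr (- q - ?d)) * indicator (- cball 0 \<epsilon>) z \<partial>lborel)"
    proof (rule nn_integral_mono)
      fix z :: 'a
      have "W z \<le> \<epsilon> powr (- q - ?d)" if "z \<in> cball 0 \<epsilon>"
      proof -
        have "norm z powr ((\<alpha> + s) / 2) \<le> \<epsilon> powr ((\<alpha> + s) / 2)"
          using that s by (intro powr_mono2) auto
        moreover have "reg_kernel \<epsilon> \<alpha> z \<le> \<epsilon> powr - (?d + \<alpha>)"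
          unfolding reg_kernel_def by (rule powr_mono2') (use s \<epsilon> in auto)
        ultimately have "W z \<le> \<epsilon> powr ((\<alpha> + s) / 2) * \<epsilon> powr - (?d + \<alpha>)"
          unfolding W_def by (intro mult_mono) auto
        also have "\<dots> = \<epsilon> powr (- q - ?d)" by (simp add: powr_add[symmetric] q_def field_simps)
        finally show ?thesis .
      qed
      moreover have "W z \<le> norm z powr (- q - ?d)" if "z \<notin> cball 0 \<epsilon>"
      proof -
        have "z \<noteq> 0" using that \<epsilon> by auto
        then have "W z \<le> norm z powr ((\<alpha> + s) / 2) * riesz_kernel \<alpha> z"
          unfolding W_def using s by (intro mult_left_mono reg_kernel_le_riesz \<epsilon>) auto
        also have "\<dots> = norm z powr (- q - ?d)" by (simp add: riesz_kernel_def powr_add[symmetric] q_def field_simps)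
        finally show ?thesis .
      qed
      ultimately show "ennreal (W z) \<le> ennreal (\<epsilon> powr (- q - ?d)) * indicator (cball 0 \<epsilon>) z
         + ennreal (norm z powr (- q - ?d)) * indicator (- cball 0 \<epsilon>) z"
        by (cases "z \<in> cball 0 \<epsilon>") (simp_all only: indicator_simps Compl_iff mult_1_right mult_zero_right add_0_right add_0_left ennreal_leI not_False_eq_True simp_thms)
    qed
    also have "\<dots> = ennreal (\<epsilon> powr (- q - ?d)) * emeasure lborel (cball (0::'a) \<epsilon>)
        + (\<integral>\<^sup>+z\<in>- cball 0 \<epsilon>. ennreal (norm (z::'a) powr (- q - ?d)) \<partial>lborel)"
      by (rule nn_integral_add_indicator) (auto intro!: borel_open)
    also have "\<dots> \<le> ennreal (?V * \<epsilon> powr -q) + ennreal (?V * (?d + q) / q * \<epsilon> powr -q)"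
    proof (intro add_mono nn_integral_norm_powr_far q \<epsilon>)
      have "\<epsilon> powr (- q - ?d) * \<epsilon> powr ?d = \<epsilon> powr -q" using \<epsilon> by (simp add: powr_add[symmetric])
      then show "ennreal (\<epsilon> powr (- q - ?d)) * emeasure lborel (cball (0::'a) \<epsilon>) \<le> ennreal (?V * \<epsilon> powr -q)"
        using \<epsilon> by (simp add: emeasure_lborel_cball_powr ennreal_mult[symmetric] mult_ac)
    qed
    also have "\<dots> = ennreal K"
      unfolding K_def using q by (subst ennreal_plus[symmetric]) (auto simp: algebra_simps)
    finally show ?thesis .
  qed
  have pt: "reg_op \<epsilon> \<alpha> v x \<le> ennreal (C0 * bdist D x powr -(s/2) * K)" if x: "x \<notin> frontier D" for x
  proof -
    have "reg_op \<epsilon> \<alpha> v x \<le> (\<integral>\<^sup>+y. ennreal (C0 * bdist D x powr -(s/2)) * ennreal (W (x - y)) \<partial>lborel)"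
      unfolding reg_op_def
    proof (rule nn_integral_mono)
      fix y
      have "\<bar>v x - v y\<bar> \<le> C0 * norm (x - y) powr (\<alpha>/2 + s/2) * bdist D x powr -(s/2)"
        using mod(1) x s unfolding boundary_modulus_def by (elim allE[of _ x] allE[of _ y] allE[of _ "s/2"]) auto
      then have "\<bar>v x - v y\<bar> * reg_kernel \<epsilon> \<alpha> (x - y) \<le> C0 * norm (x - y) powr (\<alpha>/2 + s/2) * bdist D x powr -(s/2) * reg_kernel \<epsilon> \<alpha> (x - y)"
        by (intro mult_right_mono) auto
      also have "\<dots> = C0 * bdist D x powr -(s/2) * W (x - y)" by (simp add: W_def add_divide_distrib mult_ac)
      finally show "ennreal (\<bar>v x - v y\<bar> * reg_kernel \<epsilon> \<alpha> (x - y)) \<le> ennreal (C0 * bdist D x powr -(s/2)) * ennreal (W (x - y))"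
        using mod(2) by (simp add: ennreal_mult[symmetric] W_def ennreal_leI)
    qed
    also have "\<dots> = ennreal (C0 * bdist D x powr -(s/2)) * (\<integral>\<^sup>+y. ennreal (W (x - y)) \<partial>lborel)"
      by (rule nn_integral_cmult) measurable
    also have "(\<integral>\<^sup>+y. ennreal (W (x - y)) \<partial>lborel) = (\<integral>\<^sup>+y. ennreal (W y) \<partial>lborel)"
      by (rule nn_integral_lborel_reflect) measurable
    also have "ennreal (C0 * bdist D x powr -(s/2)) * \<dots> \<le> ennreal (C0 * bdist D x powr -(s/2)) * ennreal K"
      by (intro mult_left_mono W) auto
    also have "\<dots> = ennreal (C0 * bdist D x powr -(s/2) * K)" using mod(2) K0 by (simp add: ennreal_mult[symmetric])
    finally show ?thesis .
  qed
  have sq: "(z powr a)\<^sup>2 = z powr (2 * a)" for z a :: real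
    by (simp add: power2_eq_square powr_add[symmetric])
  \<comment> \<open>The pointwise bound is available off the boundary only, which is a null
    set.\<close>
  have "(\<integral>\<^sup>+x\<in>B. (reg_op \<epsilon> \<alpha> v x)\<^sup>2 \<partial>lborel) = (\<integral>\<^sup>+x\<in>B - frontier D. (reg_op \<epsilon> \<alpha> v x)\<^sup>2 \<partial>lborel)"
    by (rule nn_integral_diff_frontier[OF D])
  also have "\<dots> \<le> (\<integral>\<^sup>+x. ennreal (C0\<^sup>2 * K\<^sup>2) * (ennreal (bdist D x powr -s) * indicator (B - frontier D) x) \<partial>lborel)"
  proof (rule nn_integral_mono)
    fix x
    have "(reg_op \<epsilon> \<alpha> v x)\<^sup>2 \<le> ennreal (C0\<^sup>2 * K\<^sup>2) * ennreal (bdist D x powr -s)" if "x \<notin> frontier D"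
    proof -
      have "(reg_op \<epsilon> \<alpha> v x)\<^sup>2 \<le> (ennreal (C0 * bdist D x powr -(s/2) * K))\<^sup>2"
        by (intro power_mono pt that) auto
      also have "\<dots> = ennreal (C0\<^sup>2 * K\<^sup>2) * ennreal (bdist D x powr -s)"
        using mod(2) K0 by (simp add: ennreal_power ennreal_mult[symmetric] power_mult_distrib sq mult_ac)
      finally show ?thesis .
    qed
    then show "(reg_op \<epsilon> \<alpha> v x)\<^sup>2 * indicator (B - frontier D) x \<le> ennreal (C0\<^sup>2 * K\<^sup>2) * (ennreal (bdist D x powr -s) * indicator (B - frontier D) x)"
      by (auto simp: indicator_def)
  qed
  also have "\<dots> = ennreal (C0\<^sup>2 * K\<^sup>2) * (\<integral>\<^sup>+x\<in>B - frontier D. ennreal (bdist D x powr -s) \<partial>lborel)"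
    by (rule nn_integral_cmult) (auto intro!: borel_measurable_times_ennreal borel_measurable_indicator B)
  also have "\<dots> \<le> ennreal (C0\<^sup>2 * K\<^sup>2) * ennreal c" by (intro mult_left_mono c) auto
  also have "\<dots> = ennreal ((C0 * (?V * (1 + (?d + q) / q)))\<^sup>2 * \<epsilon> powr (s - \<alpha>) * c)"
  proof -
    have "(\<epsilon> powr -q)\<^sup>2 = \<epsilon> powr (s - \<alpha>)" 
    proof -
      have "2 * - q = s - \<alpha>" by (simp add: q_def field_simps)
      then show ?thesis by (simp only: sq)
    qed
    then show ?thesis using c by (simp add: ennreal_mult[symmetric] K_def power_mult_distrib mult_ac)
  qed
  finally show ?thesis .
qed

text \<open>For s > \<alpha> the increment bound beats the singularity: near the origin |z|^(r-d)
  with r = (s - \<alpha>) / 2 > 0 remains even for the singular kernel, and far away boundedness of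
  v suffices. Hence the bound does not depend on \<epsilon>. As s < 1, this case is open only to
  \<alpha> < 1.\<close>

lemma square_integral_reg_op_le_uniform:
  fixes v :: "'a::euclidean_space \<Rightarrow> real" and \<alpha> s C0 c :: real
  assumes D: "bounded D" "C11_domain D" and vm[measurable]: "v \<in> borel_measurable borel"
    and mod: "boundary_modulus D (\<alpha>/2) v C0" "C0 \<ge> 0" and \<alpha>: "0 < \<alpha>" and bd: "\<And>x. \<bar>v x\<bar> \<le> Mv"
    and s: "\<alpha> < s" "s < 1" "s \<le> 2 - \<alpha>" and B: "B \<in> sets borel" "bounded B"
    and c: "(\<integral>\<^sup>+x\<in>B - frontier D. ennreal (bdist D x powr -s) \<partial>lborel) \<le> ennreal c" "0 \<le> c"
  shows "\<exists>X\<ge>0. \<forall>\<epsilon>>0. (\<integral>\<^sup>+x\<in>B. (reg_op \<epsilon> \<alpha> v x)\<^sup>2 \<partial>lborel) \<le> ennreal X"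
proof -
  let ?d = "real DIM('a)" and ?V = "unit_ball_vol DIM('a)"
  define r where "r = (s - \<alpha>) / 2"
  have r: "0 < r" "r < 1" using s \<alpha> by (auto simp: r_def)
  have [measurable]: "B \<in> sets borel" by (rule B)
  have Mv: "0 \<le> Mv" using bd[of 0] by linarith
  define K1 where "K1 = C0 * (?V * ?d / r)"
  define K2 where "K2 = 2 * Mv * (?V * (?d + \<alpha>) / \<alpha>)"
  have K0: "K1 \<ge> 0" "K2 \<ge> 0" using r mod(2) Mv \<alpha> by (auto simp: K1_def K2_def)
  have pt: "reg_op \<epsilon> \<alpha> v x \<le> ennreal (bdist D x powr -(s/2) * K1 + K2)" if x: "x \<notin> frontier D" and \<epsilon>: "\<epsilon> > 0" for x \<epsilon>
  proof -
    define g1 where "g1 z = ennreal (norm (z::'a) powr (r - ?d)) * indicator (cball 0 1) z" for z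
    define g2 where "g2 z = ennreal (norm (z::'a) powr (- \<alpha> - ?d)) * indicator (- cball 0 1) z" for z
    have [measurable]: "g1 \<in> borel_measurable borel" "g2 \<in> borel_measurable borel"
      unfolding g1_def[abs_def] g2_def[abs_def]
      by (auto intro!: borel_measurable_times_ennreal borel_measurable_indicator)
    have "reg_op \<epsilon> \<alpha> v x \<le> (\<integral>\<^sup>+y. ennreal (C0 * bdist D x powr -(s/2)) * g1 (x - y) + ennreal (2 * Mv) * g2 (x - y) \<partial>lborel)"
      unfolding reg_op_def
    proof (rule nn_integral_mono)
      fix y
      show "ennreal (\<bar>v x - v y\<bar> * reg_kernel \<epsilon> \<alpha> (x - y)) \<le> ennreal (C0 * bdist D x powr -(s/2)) * g1 (x - y) + ennreal (2 * Mv) * g2 (x - y)"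
      proof (cases "x - y = 0")
        case False
        have le: "\<bar>v x - v y\<bar> * reg_kernel \<epsilon> \<alpha> (x - y) \<le> \<bar>v x - v y\<bar> * riesz_kernel \<alpha> (x - y)"
          by (intro mult_left_mono reg_kernel_le_riesz[OF \<epsilon> \<alpha> False]) auto
        show ?thesis
        proof (cases "x - y \<in> cball 0 1")
          case True
          have "\<bar>v x - v y\<bar> \<le> C0 * norm (x - y) powr (\<alpha>/2 + s/2) * bdist D x powr -(s/2)"
            using mod(1) x s \<alpha> unfolding boundary_modulus_def by (elim allE[of _ x] allE[of _ y] allE[of _ "s/2"]) auto
          then have "\<bar>v x - v y\<bar> * riesz_kernel \<alpha> (x - y) \<le> C0 * norm (x - y) powr (\<alpha>/2 + s/2) * bdist D x powr -(s/2) * riesz_kernel \<alpha> (x - y)"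
            by (intro mult_right_mono) auto
          also have "\<dots> = C0 * bdist D x powr -(s/2) * (norm (x - y) powr (\<alpha>/2 + s/2) * norm (x - y) powr - (?d + \<alpha>))"
            by (simp add: riesz_kernel_def mult_ac)
          also have "norm (x - y) powr (\<alpha>/2 + s/2) * norm (x - y) powr - (?d + \<alpha>) = norm (x - y) powr (r - ?d)"
            by (simp add: powr_add[symmetric] r_def field_simps)
          finally have "\<bar>v x - v y\<bar> * reg_kernel \<epsilon> \<alpha> (x - y) \<le> C0 * bdist D x powr -(s/2) * norm (x - y) powr (r - ?d)" using le by linarith
          then show ?thesis using True mod(2) unfolding g1_def g2_def by (simp add: ennreal_mult[symmetric] ennreal_leI)
        next
          case far: False
          have "\<bar>v x - v y\<bar> \<le> 2 * Mv" using bd[of x] bd[of y] by linarith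
          then have "\<bar>v x - v y\<bar> * riesz_kernel \<alpha> (x - y) \<le> 2 * Mv * riesz_kernel \<alpha> (x - y)"
            by (intro mult_right_mono) auto
          moreover have "riesz_kernel \<alpha> (x - y) = norm (x - y) powr (- \<alpha> - ?d)" by (simp add: riesz_kernel_def algebra_simps)
          ultimately have "\<bar>v x - v y\<bar> * reg_kernel \<epsilon> \<alpha> (x - y) \<le> 2 * Mv * norm (x - y) powr (- \<alpha> - ?d)" using le by simp
          then show ?thesis using far Mv unfolding g1_def g2_def by (simp add: ennreal_mult[symmetric] ennreal_leI)
        qed
      qed simp
    qed
    also have "\<dots> = ennreal (C0 * bdist D x powr -(s/2)) * (\<integral>\<^sup>+y. g1 (x - y) \<partial>lborel) + ennreal (2 * Mv) * (\<integral>\<^sup>+y. g2 (x - y) \<partial>lborel)"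
      by (subst nn_integral_add, measurable) (simp add: nn_integral_cmult)
    also have "(\<integral>\<^sup>+y. g1 (x - y) \<partial>lborel) = (\<integral>\<^sup>+y. g1 y \<partial>lborel)" by (rule nn_integral_lborel_reflect) measurable
    also have "(\<integral>\<^sup>+y. g2 (x - y) \<partial>lborel) = (\<integral>\<^sup>+y. g2 y \<partial>lborel)" by (rule nn_integral_lborel_reflect) measurable
    also have "ennreal (C0 * bdist D x powr -(s/2)) * (\<integral>\<^sup>+y. g1 y \<partial>lborel) + ennreal (2 * Mv) * (\<integral>\<^sup>+y. g2 y \<partial>lborel)
      \<le> ennreal (C0 * bdist D x powr -(s/2)) * ennreal (?V * ?d / r * 1 powr r) + ennreal (2 * Mv) * ennreal (?V * (?d + \<alpha>) / \<alpha> * 1 powr -\<alpha>)"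
      unfolding g1_def g2_def
      by (intro add_mono mult_left_mono nn_integral_norm_powr_near nn_integral_norm_powr_far) (use r \<alpha> in auto)
    also have "\<dots> = ennreal (bdist D x powr -(s/2) * K1 + K2)"
      using mod(2) r Mv \<alpha> unfolding K1_def K2_def
      by (simp add: ennreal_mult[symmetric] ennreal_plus[symmetric] mult_ac del: ennreal_plus)
    finally show ?thesis .
  qed
  have sq: "(z powr a)\<^sup>2 = z powr (2 * a)" for z a :: real
    by (simp add: power2_eq_square powr_add[symmetric])
  define m where "m = measure lborel B"
  have m: "emeasure lborel B = ennreal m" "0 \<le> m"
    using emeasure_bounded_finite[OF B(2)] by (auto simp: m_def emeasure_eq_ennreal_measure less_top)
  have Bf: "B - frontier D \<in> sets borel" using B by auto
  show ?thesis
  proof (intro exI[of _ "2 * K1\<^sup>2 * c + 2 * K2\<^sup>2 * m"] conjI allI impI)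
    show "0 \<le> 2 * K1\<^sup>2 * c + 2 * K2\<^sup>2 * m" using c m by simp
    fix \<epsilon> :: real assume \<epsilon>: "\<epsilon> > 0"
    have "(\<integral>\<^sup>+x\<in>B. (reg_op \<epsilon> \<alpha> v x)\<^sup>2 \<partial>lborel) = (\<integral>\<^sup>+x\<in>B - frontier D. (reg_op \<epsilon> \<alpha> v x)\<^sup>2 \<partial>lborel)"
      by (rule nn_integral_diff_frontier[OF D])
    also have "\<dots> \<le> (\<integral>\<^sup>+x. ennreal (2 * K1\<^sup>2) * (ennreal (bdist D x powr -s) * indicator (B - frontier D) x)
         + ennreal (2 * K2\<^sup>2) * indicator B x \<partial>lborel)"
    proof (rule nn_integral_mono)
      fix x
      have "(reg_op \<epsilon> \<alpha> v x)\<^sup>2 \<le> ennreal (2 * K1\<^sup>2) * ennreal (bdist D x powr -s) + ennreal (2 * K2\<^sup>2)" if "x \<notin> frontier D"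
      proof -
        have "(reg_op \<epsilon> \<alpha> v x)\<^sup>2 \<le> (ennreal (bdist D x powr -(s/2) * K1 + K2))\<^sup>2"
          by (intro power_mono pt that \<epsilon>) auto
        also have "\<dots> = ennreal ((bdist D x powr -(s/2) * K1 + K2)\<^sup>2)" using K0 by (subst ennreal_power) auto
        also have "\<dots> \<le> ennreal (2 * K1\<^sup>2 * bdist D x powr -s + 2 * K2\<^sup>2)"
          using square_diff_le[of "bdist D x powr -(s/2) * K1" "- K2"]
          by (intro ennreal_leI) (simp add: power_mult_distrib sq mult_ac)
        also have "\<dots> = ennreal (2 * K1\<^sup>2) * ennreal (bdist D x powr -s) + ennreal (2 * K2\<^sup>2)"
          by (simp add: ennreal_mult[symmetric] ennreal_plus[symmetric] del: ennreal_plus)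
        finally show ?thesis .
      qed
      then show "(reg_op \<epsilon> \<alpha> v x)\<^sup>2 * indicator (B - frontier D) x \<le> ennreal (2 * K1\<^sup>2) * (ennreal (bdist D x powr -s) * indicator (B - frontier D) x)
         + ennreal (2 * K2\<^sup>2) * indicator B x"
        by (auto simp: indicator_def)
    qed
    also have "\<dots> = ennreal (2 * K1\<^sup>2) * (\<integral>\<^sup>+x\<in>B - frontier D. ennreal (bdist D x powr -s) \<partial>lborel) + ennreal (2 * K2\<^sup>2) * emeasure lborel B"
    proof -
      have [measurable]: "(\<lambda>x. ennreal (bdist D x powr -s) * indicator (B - frontier D) x) \<in> borel_measurable borel"
        by (auto intro!: borel_measurable_times_ennreal borel_measurable_indicator Bf)
      show ?thesis by (subst nn_integral_add, measurable) (simp add: nn_integral_cmult nn_integral_cmult_indicator)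
    qed
    also have "\<dots> \<le> ennreal (2 * K1\<^sup>2) * ennreal c + ennreal (2 * K2\<^sup>2) * ennreal m"
      by (intro add_mono mult_left_mono c) (auto simp: m)
    also have "\<dots> = ennreal (2 * K1\<^sup>2 * c + 2 * K2\<^sup>2 * m)"
      using c m by (simp add: ennreal_mult[symmetric] ennreal_plus[symmetric] del: ennreal_plus)
    finally show "(\<integral>\<^sup>+x\<in>B. (reg_op \<epsilon> \<alpha> v x)\<^sup>2 \<partial>lborel) \<le> ennreal (2 * K1\<^sup>2 * c + 2 * K2\<^sup>2 * m)" .
  qed
qed

section \<open>Smooth truncation\<close>

text \<open>Only s = 0 needs care: there the difference quotients of the truncated function are
  dominated by those of G, which tend to 0.\<close>

lemma DERIV_truncate_at_0:
  fixes G G' :: "real \<Rightarrow> real"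
  assumes G: "\<And>s. (G has_real_derivative G' s) (at s)" and 0: "G 0 = 0" "G' 0 = 0"
  shows "((\<lambda>s. if s > 0 then G s else 0) has_real_derivative (if s > 0 then G' s else 0)) (at s)"
proof -
  consider "s > 0" | "s < 0" | "s = 0" by linarith
  then show ?thesis
  proof cases
    case 1
    then show ?thesis
      using has_field_derivative_transform_within_open[of G "G' s" s "{0<..}" "\<lambda>s. if s > 0 then G s else 0"] G[of s] by auto
  next
    case 2
    have "((\<lambda>s. 0) has_real_derivative 0) (at s)" by simp
    then show ?thesis
      using 2 has_field_derivative_transform_within_open[of "\<lambda>_. 0" 0 s "{..<0}" "\<lambda>s. if s > 0 then G s else 0"] by auto
  next
    case 3
    let ?f = "\<lambda>s. if s > 0 then G s else 0"
    have "(G has_real_derivative 0) (at 0)" using G[of 0] 0 by simp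
    then have "((\<lambda>y. G y / y) \<longlongrightarrow> 0) (at 0)"
      using 0 by (simp add: has_field_derivative_iff)
    then have lim: "((\<lambda>y. \<bar>G y / y\<bar>) \<longlongrightarrow> 0) (at 0)" by (rule tendsto_rabs_zero)
    have "((\<lambda>y. ?f y / y) \<longlongrightarrow> 0) (at 0)"
      by (rule Lim_null_comparison[OF _ lim]) (rule always_eventually, auto simp: divide_nonneg_nonpos)
    then show ?thesis using 3 by (simp add: has_field_derivative_iff)
  qed
qed

text \<open>Truncation by \<open>s - arctan s\<close> keeps \<open>C\<^sup>2\<close> regularity and vanishes where the function is small.\<close>

definition trunc0 :: "real \<Rightarrow> real" where
  "trunc0 s = (if s > 0 then s - arctan s else 0)"
definition trunc1 :: "real \<Rightarrow> real" where
  "trunc1 s = (if s > 0 then s\<^sup>2 / (1 + s\<^sup>2) else 0)"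
definition trunc2 :: "real \<Rightarrow> real" where
  "trunc2 s = (if s > 0 then 2 * s / (1 + s\<^sup>2)\<^sup>2 else 0)"

lemma one_plus_square_neq_0 [simp]: "1 + (s::real)\<^sup>2 \<noteq> 0" "1 + (s::real) * s \<noteq> 0"
proof -
  have "0 < 1 + s\<^sup>2" by (simp add: add_pos_nonneg)
  then show "1 + s\<^sup>2 \<noteq> 0" "1 + s * s \<noteq> 0" by (auto simp: power2_eq_square)
qed

lemma DERIV_trunc0: "(trunc0 has_real_derivative trunc1 s) (at s)"
  unfolding trunc0_def[abs_def] trunc1_def
  by (rule DERIV_truncate_at_0) (auto intro!: derivative_eq_intros simp: field_simps)

lemma DERIV_trunc1: "(trunc1 has_real_derivative trunc2 s) (at s)"
  unfolding trunc1_def[abs_def] trunc2_def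
  by (rule DERIV_truncate_at_0) (auto intro!: derivative_eq_intros simp: field_simps power2_eq_square)

lemma continuous_trunc2: "isCont trunc2 s"
proof -
  have eq: "trunc2 = (\<lambda>s. 2 * max 0 s / (1 + s\<^sup>2)\<^sup>2)" by (auto simp: trunc2_def max_def)
  show ?thesis by (subst eq) (intro continuous_intros, auto)
qed

lemma trunc1_bounds: "0 \<le> trunc1 s" "trunc1 s \<le> 1"
  by (auto simp: trunc1_def field_simps add_pos_nonneg)

text \<open>Two-sided and rescaled: odd, zero for |t| \<le> 1/k, with slope between 0 and 1. The
  slope of s - arctan s is s^2 / (1 + s^2), which vanishes at 0 together with its derivative; so
  cutting at 0 costs no regularity up to order 2.\<close>

definition trunc :: "real \<Rightarrow> real \<Rightarrow> real" where
  "trunc k t = (trunc0 (k * t - 1) - trunc0 (- k * t - 1)) / k"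
definition trunc' :: "real \<Rightarrow> real \<Rightarrow> real" where
  "trunc' k t = trunc1 (k * t - 1) + trunc1 (- k * t - 1)"
definition trunc'' :: "real \<Rightarrow> real \<Rightarrow> real" where
  "trunc'' k t = k * (trunc2 (k * t - 1) - trunc2 (- k * t - 1))"

lemma DERIV_trunc:
  assumes "k > 0"
  shows "(trunc k has_real_derivative trunc' k t) (at t)" "(trunc' k has_real_derivative trunc'' k t) (at t)"
proof -
  show "(trunc k has_real_derivative trunc' k t) (at t)"
    unfolding trunc_def[abs_def] trunc'_def using assms
    by (auto intro!: derivative_eq_intros DERIV_chain2[OF DERIV_trunc0] simp: field_simps)
  show "(trunc' k has_real_derivative trunc'' k t) (at t)"
    unfolding trunc'_def[abs_def] trunc''_def
    by (auto intro!: derivative_eq_intros DERIV_chain2[OF DERIV_trunc1] simp: field_simps)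
qed

lemma isCont_trunc'': "isCont (trunc'' k) t"
  unfolding trunc''_def[abs_def]
  by (intro continuous_intros isCont_o2[OF _ continuous_trunc2])

lemma trunc_small:
  assumes "k > 0" "\<bar>t\<bar> < 1 / k"
  shows "trunc k t = 0" "trunc' k t = 0" "trunc'' k t = 0"
proof -
  have "k * \<bar>t\<bar> < 1" using assms by (simp add: field_simps)
  then have "\<bar>k * t\<bar> < 1" using assms by (simp add: abs_mult)
  then have "k * t - 1 < 0" "- k * t - 1 < 0" by auto
  then show "trunc k t = 0" "trunc' k t = 0" "trunc'' k t = 0"
    by (auto simp: trunc_def trunc'_def trunc''_def trunc0_def trunc1_def trunc2_def)
qed

lemma trunc'_bounds: "0 \<le> trunc' k t" "trunc' k t \<le> 1"
proof -
  show "0 \<le> trunc' k t" using trunc1_bounds by (simp add: trunc'_def)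
  have "k * t - 1 \<le> 0 \<or> - k * t - 1 \<le> 0" by auto
  then show "trunc' k t \<le> 1"
    using trunc1_bounds[of "k * t - 1"] trunc1_bounds[of "- k * t - 1"] unfolding trunc'_def
    by (elim disjE) (auto simp: trunc1_def)
qed

text \<open>The slope of the truncation error lies between -1 and 0, so its increments never exceed
  those of the argument. This supplies the dominating function for convergence in energy.\<close>

lemma trunc_increment:
  assumes "k > 0"
  shows "\<bar>(trunc k t - t) - (trunc k s - s)\<bar> \<le> \<bar>t - s\<bar>"
proof -
  have "norm ((trunc k t - t) - (trunc k s - s)) \<le> 1 * norm (t - s)"
  proof (rule field_differentiable_bound[of UNIV])
    fix z show "((\<lambda>t. trunc k t - t) has_field_derivative trunc' k z - 1) (at z within UNIV)"
      by (auto intro!: derivative_eq_intros DERIV_trunc[OF assms])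
    show "norm (trunc' k z - 1) \<le> 1" using trunc'_bounds[of k z] by auto
  qed auto
  then show ?thesis by simp
qed

lemma trunc_0: "k > 0 \<Longrightarrow> trunc k 0 = 0"
  by (rule trunc_small) auto

text \<open>At most one of the two pieces is active; there arctan is below 2 and the shift of the
  argument adds 1.\<close>

lemma trunc_close:
  assumes "k > 0"
  shows "\<bar>trunc k t - t\<bar> \<le> 3 / k"
proof -
  have a: "\<bar>trunc0 s - s\<bar> \<le> 2" if "s > 0" for s
    using that arctan_bounded[of s] pi_less_4 by (auto simp: trunc0_def abs_le_iff)
  have "\<bar>k * trunc k t - k * t\<bar> \<le> 3"
  proof -
    consider "k * t > 1" | "k * t < -1" | "-1 \<le> k * t" "k * t \<le> 1" by linarith
    then show ?thesis
    proof cases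
      case 1 then show ?thesis using a[of "k * t - 1"] assms by (simp add: trunc_def trunc0_def[of "- _ - 1"])
    next
      case 2 then show ?thesis using a[of "- k * t - 1"] assms by (simp add: trunc_def trunc0_def[of "_ * _ - 1"])
    next
      case 3 then show ?thesis using assms by (auto simp: trunc_def trunc0_def)
    qed
  qed
  then have "k * \<bar>trunc k t - t\<bar> \<le> 3" using assms by (simp add: right_diff_distrib[symmetric] abs_mult)
  then show ?thesis using assms by (simp add: field_simps)
qed

section \<open>Functions of class C^2 and their truncations\<close>

lemma frechet_derivative_eq:
  assumes "(f has_derivative f') (at x)"
  shows "frechet_derivative f (at x) = f'"
  using frechet_derivative_at[OF assms] by simp

lemma C_k_D:
  assumes "C_k k S f" "set bs \<subseteq> Basis"
  shows "length bs < k \<Longrightarrow> x \<in> S \<Longrightarrow> (partial_deriv bs f has_derivative frechet_derivative (partial_deriv bs f) (at x)) (at x)"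
    and "length bs \<le> k \<Longrightarrow> continuous_on S (partial_deriv bs f)"
  using assms unfolding C_k_def directions_def by (auto simp: frechet_derivative_works)

lemma C_k_2_I:
  assumes "\<And>x. x \<in> S \<Longrightarrow> f differentiable (at x)"
    and "\<And>x b. b \<in> Basis \<Longrightarrow> x \<in> S \<Longrightarrow> partial_deriv [b] f differentiable (at x)"
    and "continuous_on S f" "\<And>b. b \<in> Basis \<Longrightarrow> continuous_on S (partial_deriv [b] f)"
    and "\<And>b c. b \<in> Basis \<Longrightarrow> c \<in> Basis \<Longrightarrow> continuous_on S (partial_deriv [c, b] f)"
  shows "C_k 2 S f"
proof -
  have l1: "length bs < 2 \<Longrightarrow> bs = [] \<or> (\<exists>b. bs = [b])" for bs :: "'a list"
    by (cases bs; cases "tl bs") auto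
  have l2: "length bs \<le> 2 \<Longrightarrow> bs = [] \<or> (\<exists>b. bs = [b]) \<or> (\<exists>b c. bs = [c, b])" for bs :: "'a list"
    by (cases bs; cases "tl bs"; cases "tl (tl bs)") auto
  show ?thesis unfolding C_k_def directions_def
  proof (intro conjI allI impI ballI)
    fix j x and bs :: "'a list" assume "j < 2" "bs \<in> {bs. set bs \<subseteq> Basis \<and> length bs = j}" "x \<in> S"
    then show "partial_deriv bs f differentiable (at x)"
      using assms(1,2) l1[of bs] by auto
  next
    fix j and bs :: "'a list" assume j: "j \<le> 2" "bs \<in> {bs. set bs \<subseteq> Basis \<and> length bs = j}"
    then have "bs = [] \<or> (\<exists>b\<in>Basis. bs = [b]) \<or> (\<exists>b\<in>Basis. \<exists>c\<in>Basis. bs = [c, b])"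
      using l2[of bs] by auto
    then show "continuous_on S (partial_deriv bs f)" using assms(3-5) by (metis partial_deriv.simps(1))
  qed
qed

lemma C_k_mono: "C_k k S f \<Longrightarrow> j \<le> k \<Longrightarrow> C_k j S f"
  unfolding C_k_def by (meson le_trans less_le_trans)

text \<open>The set \<open>U\<close> where |u| < 1/k is open, and with \<open>D\<close> it covers
  the space. On \<open>D\<close> the chain rule applies, on \<open>U\<close> the truncation is 0.
  The complement of \<open>U\<close> is a closed subset of the bounded set \<open>D\<close>, which
  gives the compact support. No regularity of u up to the boundary is needed beyond
  continuity.\<close>

lemma trunc_in_Cc2:
  fixes u :: "'a::euclidean_space \<Rightarrow> real"
  assumes D: "open D" "bounded D" and C2: "C_k 2 D u" and cont: "continuous_on UNIV u"
    and u0: "\<And>x. x \<notin> D \<Longrightarrow> u x = 0" and k: "k > 0"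
  shows "(\<lambda>x. trunc k (u x)) \<in> Cc2 D"
proof -
  let ?f = "\<lambda>x. trunc k (u x)"
  define U where "U = {x. \<bar>u x\<bar> < 1 / k}"
  have U: "open U" unfolding U_def by (intro open_Collect_less continuous_intros cont)
  have DU: "D \<union> U = UNIV" using u0 k by (auto simp: U_def)
  have f0: "?f x = 0" if "x \<in> U" for x using that trunc_small[OF k] by (simp add: U_def)
  have du: "(u has_derivative frechet_derivative u (at x)) (at x)" if "x \<in> D" for x
    using C_k_D(1)[OF C2, of "[]" x] that by simp
  have du1: "(partial_deriv [b] u has_derivative frechet_derivative (partial_deriv [b] u) (at x)) (at x)" if "x \<in> D" "b \<in> Basis" for x b
    using C_k_D(1)[OF C2, of "[b]" x] that by simp
  have chain: "((\<lambda>x. g (u x)) has_derivative (\<lambda>h. g' (u x) * frechet_derivative u (at x) h)) (at x)"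
    if "x \<in> D" "\<And>t. (g has_real_derivative g' t) (at t)" for g g' x
    using has_derivative_compose[OF du[OF that(1)], of g "(*) (g' (u x))"] that(2)[of "u x"]
    by (simp add: has_field_derivative_def)
  have derf: "(?f has_derivative (\<lambda>h. trunc' k (u x) * frechet_derivative u (at x) h)) (at x)" if "x \<in> D" for x
    by (rule chain[OF that DERIV_trunc(1)[OF k]])
  have zero: "(g has_derivative (\<lambda>_. 0)) (at x)" if "x \<in> U" "\<And>y. y \<in> U \<Longrightarrow> g y = 0" for g :: "'a \<Rightarrow> real" and x
    by (rule has_derivative_transform_within_open[of "\<lambda>_. 0", OF _ U that(1)]) (use that in auto)
  \<comment> \<open>The formula holds at every point of the space: where u may fail to be
    differentiable, and its derivative is unspecified, the factor \<open>trunc'\<close> is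
    0.\<close>
  have pd1: "partial_deriv [b] ?f x = trunc' k (u x) * partial_deriv [b] u x" for x b
  proof (cases "x \<in> U")
    case True
    then show ?thesis using frechet_derivative_eq[OF zero[where g = ?f, OF True f0]] trunc_small(2)[OF k, of "u x"] by (simp add: U_def)
  next
    case False
    then have "x \<in> D" using DU by blast
    then show ?thesis using frechet_derivative_eq[OF derf] by simp
  qed
  then have pd1': "partial_deriv [b] ?f = (\<lambda>x. trunc' k (u x) * partial_deriv [b] u x)" for b by blast
  have derf1: "(partial_deriv [b] ?f has_derivative
      (\<lambda>h. trunc' k (u x) * frechet_derivative (partial_deriv [b] u) (at x) h
         + (trunc'' k (u x) * frechet_derivative u (at x) h) * partial_deriv [b] u x)) (at x)" if "x \<in> D" "b \<in> Basis" for x b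
    unfolding pd1' by (rule has_derivative_mult[OF chain[OF that(1) DERIV_trunc(2)[OF k]] du1[OF that]])
  have g0: "partial_deriv [b] ?f x = 0" if "x \<in> U" for x b
    using that trunc_small(2)[OF k] by (simp add: pd1 U_def del: partial_deriv.simps)
  have pd2: "partial_deriv [c, b] ?f x = trunc' k (u x) * partial_deriv [c, b] u x
      + trunc'' k (u x) * partial_deriv [c] u x * partial_deriv [b] u x" if "b \<in> Basis" for x b c
  proof (cases "x \<in> U")
    case True
    have "partial_deriv [c, b] ?f x = frechet_derivative (partial_deriv [b] ?f) (at x) c" by simp
    also have "\<dots> = 0" using frechet_derivative_eq[OF zero[where g = "partial_deriv [b] ?f", OF True g0]] by simp
    finally show ?thesis using trunc_small(2,3)[OF k, of "u x"] True by (simp add: U_def)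
  next
    case False
    then have "x \<in> D" using DU by blast
    have "partial_deriv [c, b] ?f x = frechet_derivative (partial_deriv [b] ?f) (at x) c" by simp
    also have "\<dots> = trunc' k (u x) * partial_deriv [c, b] u x
      + trunc'' k (u x) * partial_deriv [c] u x * partial_deriv [b] u x"
      unfolding frechet_derivative_eq[OF derf1[OF \<open>x \<in> D\<close> that]] by simp
    finally show ?thesis .
  qed
  \<comment> \<open>Continuity has to be checked on \<open>D\<close> only, because \<open>D\<close>
    and \<open>U\<close> are open and cover the space.\<close>
  have glue: "continuous_on UNIV g" if "continuous_on D g" "\<And>x. x \<in> U \<Longrightarrow> g x = 0" for g :: "'a \<Rightarrow> real"
  proof -
    have "continuous_on U g" using that(2) by (metis continuous_on_cong continuous_on_const)
    then show ?thesis using continuous_on_open_Un[OF D(1) U that(1)] DU by simp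
  qed
  have contu: "continuous_on D u" using cont continuous_on_subset by blast
  have c1: "continuous_on D (\<lambda>x. trunc' k (u x))"
    by (intro continuous_on_compose2[OF DERIV_continuous_on[OF has_field_derivative_at_within[OF DERIV_trunc(2)[OF k]]] contu]) auto
  have c2: "continuous_on D (\<lambda>x. trunc'' k (u x))"
    by (intro continuous_on_compose2[of UNIV "trunc'' k", OF _ contu] continuous_at_imp_continuous_on) (auto simp: isCont_trunc'')
  have p1: "continuous_on D (partial_deriv [b] u)" if "b \<in> Basis" for b
    using C_k_D(2)[OF C2, of "[b]"] that by simp
  have p2: "continuous_on D (partial_deriv [c, b] u)" if "b \<in> Basis" "c \<in> Basis" for b c
    using C_k_D(2)[OF C2, of "[c, b]"] that by simp
  have "C_k 2 UNIV ?f"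
  proof (rule C_k_2_I)
    show "?f differentiable (at x)" for x
    proof (cases "x \<in> U")
      case True then show ?thesis using zero[where g = ?f, OF True f0] differentiableI by blast
    next
      case False then show ?thesis using derf differentiableI DU by blast
    qed
    show "partial_deriv [b] ?f differentiable (at x)" if "b \<in> Basis" for x b
    proof (cases "x \<in> U")
      case True then show ?thesis using zero[where g = "partial_deriv [b] ?f", OF True g0] differentiableI by blast
    next
      case False then show ?thesis using derf1[OF _ that] differentiableI DU by blast
    qed
    show "continuous_on UNIV ?f"
      by (intro continuous_on_compose2[OF DERIV_continuous_on[OF has_field_derivative_at_within[OF DERIV_trunc(1)[OF k]]] cont]) auto
    show "continuous_on UNIV (partial_deriv [b] ?f)" if "b \<in> Basis" for b
    proof (rule glue[OF _ g0])
      show "continuous_on D (partial_deriv [b] ?f)"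
        unfolding pd1' by (intro continuous_on_mult c1 p1 that)
    qed
    show "continuous_on UNIV (partial_deriv [c, b] ?f)" if "b \<in> Basis" "c \<in> Basis" for b c
    proof (rule glue)
      have "partial_deriv [c, b] ?f = (\<lambda>x. trunc' k (u x) * partial_deriv [c, b] u x
      + trunc'' k (u x) * partial_deriv [c] u x * partial_deriv [b] u x)" using pd2[OF that(1)] by blast
      then show "continuous_on D (partial_deriv [c, b] ?f)"
        by (simp only:) (intro continuous_on_add continuous_on_mult c1 c2 p1 p2 that)
      show "\<And>x. x \<in> U \<Longrightarrow> partial_deriv [c, b] ?f x = 0"
        unfolding pd2[OF that(1)] using trunc_small(2,3)[OF k] by (simp add: U_def)
    qed
  qed
  moreover have "closure {x. ?f x \<noteq> 0} \<subseteq> - U"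
    by (rule closure_minimal) (use f0 U in \<open>auto simp: closed_Compl\<close>)
  moreover have "- U \<subseteq> D" using DU by blast
  moreover have "compact (closure {x. ?f x \<noteq> 0})"
    using \<open>closure {x. ?f x \<noteq> 0} \<subseteq> - U\<close> \<open>- U \<subseteq> D\<close> D(2)
    by (meson bounded_subset compact_eq_bounded_closed closed_closure)
  ultimately show ?thesis unfolding Cc2_def by blast
qed

section \<open>The space \<open>W0\<close>\<close>

lemma Cc2_zero: "f \<in> Cc2 D \<Longrightarrow> x \<notin> D \<Longrightarrow> f x = 0"
  using closure_subset[of "{x. f x \<noteq> 0}"] unfolding Cc2_def by blast

lemma Cc2_continuous: "f \<in> Cc2 D \<Longrightarrow> continuous_on UNIV f"
  using C_k_D(2)[of 2 UNIV f "[]"] by (simp add: Cc2_def)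

lemma Cc2_borel: "f \<in> Cc2 D \<Longrightarrow> f \<in> borel_measurable borel"
  by (intro borel_measurable_continuous_onI Cc2_continuous)

lemma continuous_bounded_of_support:
  fixes f :: "'a::euclidean_space \<Rightarrow> real"
  assumes "compact S" "continuous_on UNIV f" "\<And>x. x \<notin> S \<Longrightarrow> f x = 0"
  obtains M where "M \<ge> 0" "\<And>x. \<bar>f x\<bar> \<le> M"
proof -
  have "bounded (f ` S)"
    by (intro compact_imp_bounded compact_continuous_image continuous_on_subset[OF assms(2)] assms(1)) auto
  then obtain M where M: "\<And>x. x \<in> S \<Longrightarrow> \<bar>f x\<bar> \<le> M" by (auto simp: bounded_iff)
  show ?thesis
  proof (rule that[of "max M 0"])
    show "\<bar>f x\<bar> \<le> max M 0" for x using M[of x] assms(3)[of x] by (cases "x \<in> S") auto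
  qed simp
qed

lemma Cc2_bounded:
  fixes f :: "'a::euclidean_space \<Rightarrow> real"
  assumes f: "f \<in> Cc2 D"
  obtains M where "M \<ge> 0" "\<And>x. \<bar>f x\<bar> \<le> M"
proof (rule continuous_bounded_of_support)
  show "compact (closure {x. f x \<noteq> 0})" using f by (simp add: Cc2_def)
  show "continuous_on UNIV f" by (rule Cc2_continuous[OF f])
  show "f x = 0" if "x \<notin> closure {x. f x \<noteq> 0}" for x using that closure_subset[of "{x. f x \<noteq> 0}"] by blast
qed (rule that)

lemma Cc2_lipschitz:
  fixes f :: "'a::euclidean_space \<Rightarrow> real"
  assumes f: "f \<in> Cc2 D"
  obtains L where "L \<ge> 0" "\<And>x y. \<bar>f x - f y\<bar> \<le> L * norm (x - y)"
proof -
  let ?S = "closure {x. f x \<noteq> 0}"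
  have C2: "C_k 2 UNIV f" and cS: "compact ?S" using f by (auto simp: Cc2_def)
  have d: "(f has_derivative frechet_derivative f (at x)) (at x)" for x
    using C_k_D(1)[OF C2, of "[]" x] by simp
  have "\<exists>M\<ge>0. \<forall>x. \<bar>partial_deriv [b] f x\<bar> \<le> M" if b: "b \<in> Basis" for b
  proof (rule continuous_bounded_of_support[OF cS, of "partial_deriv [b] f"])
    show "continuous_on UNIV (partial_deriv [b] f)" using C_k_D(2)[OF C2, of "[b]"] b by simp
    fix x assume x: "x \<notin> ?S"
    have "(f has_derivative (\<lambda>_. 0)) (at x)"
      by (rule has_derivative_transform_within_open[of "\<lambda>_. 0" _ x UNIV "- ?S"])
         (use x closure_subset[of "{x. f x \<noteq> 0}"] in auto)
    then show "partial_deriv [b] f x = 0" by (simp add: frechet_derivative_eq)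
  qed blast
  then obtain M where M: "\<And>b. b \<in> Basis \<Longrightarrow> 0 \<le> M b" "\<And>b x. b \<in> Basis \<Longrightarrow> \<bar>partial_deriv [b] f x\<bar> \<le> M b"
    by metis
  have B: "\<bar>frechet_derivative f (at x) b\<bar> \<le> (\<Sum>b\<in>Basis. M b)" if "b \<in> Basis" for x b
    using M(2)[OF that, of x] member_le_sum[of b Basis M] that M(1) by force
  show ?thesis
  proof (rule that[of "DIM('a) * (\<Sum>b\<in>Basis. M b)"])
    show "0 \<le> DIM('a) * (\<Sum>b\<in>Basis. M b)" using M(1) by (intro mult_nonneg_nonneg sum_nonneg) auto
    show "\<bar>f x - f y\<bar> \<le> DIM('a) * (\<Sum>b\<in>Basis. M b) * norm (x - y)" for x y
      by (rule lipschitz_of_partial_bounds[of UNIV f]) (use d B in auto)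
  qed
qed

lemma Cc2_energy_finite:
  fixes f :: "'a::euclidean_space \<Rightarrow> real"
  assumes D: "open D" "bounded D" and \<alpha>: "0 < \<alpha>" "\<alpha> < 2" and f: "f \<in> Cc2 D"
  shows "energy \<alpha> f < \<infinity>"
proof -
  obtain M where M: "M \<ge> 0" "\<And>x. \<bar>f x\<bar> \<le> M" by (rule Cc2_bounded[OF f]) (rule that)
  obtain L where L: "L \<ge> 0" "\<And>x y. \<bar>f x - f y\<bar> \<le> L * norm (x - y)" by (rule Cc2_lipschitz[OF f]) (rule that)
  \<comment> \<open>Any s with 0 < s < 1 and (\<alpha> + s) / 2 \<le> 1 would do: a bounded
    Lipschitz function is Hoelder continuous of every exponent up to 1.\<close>
  define s where "s = min (1/2) (2 - \<alpha>)"
  have s: "0 < s" "s < 1" "s \<le> 2 - \<alpha>" using \<alpha> by (auto simp: s_def)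
  \<comment> \<open>L serves |x - y| \<le> 1, where lowering the exponent from 1 only enlarges the
    power; 2M serves larger distances.\<close>
  define w where "w = L + 2 * M"
  have fin: "emeasure lborel D < \<infinity>" using emeasure_bounded_finite[OF D(2)] by simp
  show ?thesis
  proof (rule energy_increment_finite[OF D Cc2_borel[OF f] Cc2_zero[OF f], where w = "\<lambda>_. w" and c = "w\<^sup>2 * measure lborel D"])
    fix x y :: 'a
    let ?n = "norm (x - y)"
    show "\<bar>f x - f y\<bar> \<le> w * ?n powr ((\<alpha> + s) / 2)"
    proof (cases "?n \<le> 1")
      case True
      have "?n powr 1 \<le> ?n powr ((\<alpha> + s) / 2)" by (rule powr_mono') (use True s in auto)
      then have "L * ?n \<le> L * ?n powr ((\<alpha> + s) / 2)" using L(1) by (intro mult_left_mono) auto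
      also have "\<dots> \<le> w * ?n powr ((\<alpha> + s) / 2)" using M by (intro mult_right_mono) (auto simp: w_def)
      finally show ?thesis using L(2)[of x y] by linarith
    next
      case False
      have "\<bar>f x - f y\<bar> \<le> 2 * M" using M(2)[of x] M(2)[of y] by linarith
      also have "\<dots> \<le> w * 1" using L by (simp add: w_def)
      also have "\<dots> \<le> w * ?n powr ((\<alpha> + s) / 2)"
        using False \<alpha> s L M by (intro mult_left_mono ge_one_powr_ge_zero) (auto simp: w_def)
      finally show ?thesis .
    qed
  next
    have [measurable]: "D \<in> sets borel" using D by auto
    have "(\<integral>\<^sup>+x\<in>D. ennreal (w\<^sup>2) \<partial>lborel) = ennreal (w\<^sup>2) * ennreal (measure lborel D)"
      using fin by (simp add: nn_integral_cmult_indicator emeasure_eq_ennreal_measure less_top)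
    then show "(\<integral>\<^sup>+x\<in>D. ennreal (w\<^sup>2) \<partial>lborel) \<le> ennreal (w\<^sup>2 * measure lborel D)"
      by (simp add: ennreal_mult[symmetric])
  qed (use M \<alpha> s in auto)
qed

lemma frac_norm_sq_eq:
  fixes u :: "'a::euclidean_space \<Rightarrow> real"
  assumes [measurable]: "u \<in> borel_measurable borel"
  shows "frac_norm_sq \<alpha> u = energy \<alpha> u + (\<integral>\<^sup>+x. ennreal ((u x)\<^sup>2) \<partial>lborel)"
proof -
  have "t / norm z powr (real DIM('a) + \<alpha>) = t * riesz_kernel \<alpha> z" for t and z :: 'a
    by (simp only: riesz_kernel_def powr_minus divide_inverse)
  then show ?thesis
    unfolding frac_norm_sq_def energy_pair[symmetric, OF assms] by (simp only: case_prod_unfold)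
qed

lemma energy_diff_le:
  fixes f g :: "'a::euclidean_space \<Rightarrow> real"
  assumes [measurable]: "f \<in> borel_measurable borel" "g \<in> borel_measurable borel"
  shows "energy \<alpha> (\<lambda>x. f x - g x) \<le> 2 * energy \<alpha> f + 2 * energy \<alpha> g"
proof -
  have "energy \<alpha> (\<lambda>x. f x - g x) \<le> (\<integral>\<^sup>+p. ennreal 2 * ennreal ((f (fst p) - f (snd p))\<^sup>2 * riesz_kernel \<alpha> (fst p - snd p))
       + ennreal 2 * ennreal ((g (fst p) - g (snd p))\<^sup>2 * riesz_kernel \<alpha> (fst p - snd p)) \<partial>(lborel \<Otimes>\<^sub>M lborel :: ('a \<times> 'a) measure))"
    unfolding energy_pair[symmetric, of "\<lambda>x. f x - g x", simplified]
  proof (rule nn_integral_mono)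
    fix p :: "'a \<times> 'a"
    have "(f (fst p) - g (fst p) - (f (snd p) - g (snd p)))\<^sup>2 \<le> 2 * (f (fst p) - f (snd p))\<^sup>2 + 2 * (g (fst p) - g (snd p))\<^sup>2"
      using square_diff_le[of "f (fst p) - f (snd p)" "g (fst p) - g (snd p)"] by (simp add: algebra_simps)
    then have "(f (fst p) - g (fst p) - (f (snd p) - g (snd p)))\<^sup>2 * riesz_kernel \<alpha> (fst p - snd p)
      \<le> (2 * (f (fst p) - f (snd p))\<^sup>2 + 2 * (g (fst p) - g (snd p))\<^sup>2) * riesz_kernel \<alpha> (fst p - snd p)"
      by (rule mult_right_mono) simp
    then show "ennreal ((f (fst p) - g (fst p) - (f (snd p) - g (snd p)))\<^sup>2 * riesz_kernel \<alpha> (fst p - snd p))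
      \<le> ennreal 2 * ennreal ((f (fst p) - f (snd p))\<^sup>2 * riesz_kernel \<alpha> (fst p - snd p))
       + ennreal 2 * ennreal ((g (fst p) - g (snd p))\<^sup>2 * riesz_kernel \<alpha> (fst p - snd p))"
      by (simp add: ennreal_mult[symmetric] ennreal_plus[symmetric] distrib_right mult.assoc ennreal_leI del: ennreal_plus ennreal_numeral)
  qed
  also have "\<dots> = ennreal 2 * energy \<alpha> f + ennreal 2 * energy \<alpha> g"
    by (subst nn_integral_add, measurable) (simp add: nn_integral_cmult energy_pair del: ennreal_numeral)
  finally show ?thesis by simp
qed

lemma AE_pair_eq:
  fixes f g :: "'a::euclidean_space \<Rightarrow> real"
  assumes [measurable]: "f \<in> borel_measurable borel" "g \<in> borel_measurable borel" and eq: "AE x in lborel. f x = g x"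
  shows "AE p in (lborel \<Otimes>\<^sub>M lborel). f (fst p) = g (fst p) \<and> f (snd p) = g (snd p)"
proof (rule lborel_pair.AE_pair_measure)
  show "{x \<in> space (lborel \<Otimes>\<^sub>M lborel). f (fst x) = g (fst x) \<and> f (snd x) = g (snd x)} \<in> sets (lborel \<Otimes>\<^sub>M lborel)"
    by measurable
  show "AE x in lborel. AE y in lborel. f (fst (x, y)) = g (fst (x, y)) \<and> f (snd (x, y)) = g (snd (x, y))"
    using eq
  proof eventually_elim
    case (elim x)
    show ?case using eq by eventually_elim (use elim in auto)
  qed
qed

lemma energy_cong_AE:
  fixes f g :: "'a::euclidean_space \<Rightarrow> real"
  assumes [measurable]: "f \<in> borel_measurable borel" "g \<in> borel_measurable borel" and eq: "AE x in lborel. f x = g x"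
  shows "energy \<alpha> f = energy \<alpha> g"
  unfolding energy_pair[symmetric, OF assms(1)] energy_pair[symmetric, OF assms(2)]
  by (rule nn_integral_cong_AE) (use AE_pair_eq[OF assms] in eventually_elim, auto)

section \<open>Limits of test functions\<close>

lemma W0_borel: "u \<in> W0 \<alpha> D \<Longrightarrow> u \<in> borel_measurable borel"
  by (simp add: W0_def)

lemma W0_approx:
  assumes "u \<in> W0 \<alpha> D"
  obtains \<phi> where "\<And>n. \<phi> n \<in> Cc2 D"
    "(\<lambda>n. energy \<alpha> (\<lambda>x. \<phi> n x - u x)) \<longlonglongrightarrow> 0"
    "(\<lambda>n. \<integral>\<^sup>+x. ennreal ((\<phi> n x - u x)\<^sup>2) \<partial>lborel) \<longlonglongrightarrow> 0"
proof -
  obtain \<phi> where \<phi>: "\<And>n. \<phi> n \<in> Cc2 D" "(\<lambda>n. frac_norm_sq \<alpha> (\<lambda>x. \<phi> n x - u x)) \<longlonglongrightarrow> 0"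
    using assms by (auto simp: W0_def)
  have [measurable]: "u \<in> borel_measurable borel" "\<phi> n \<in> borel_measurable borel" for n
    using W0_borel[OF assms] Cc2_borel[OF \<phi>(1)] by auto
  have eq: "frac_norm_sq \<alpha> (\<lambda>x. \<phi> n x - u x) = energy \<alpha> (\<lambda>x. \<phi> n x - u x) + (\<integral>\<^sup>+x. ennreal ((\<phi> n x - u x)\<^sup>2) \<partial>lborel)" for n
    by (rule frac_norm_sq_eq) measurable
  show ?thesis
  proof (rule that[OF \<phi>(1)])
    show "(\<lambda>n. energy \<alpha> (\<lambda>x. \<phi> n x - u x)) \<longlonglongrightarrow> 0"
      by (rule tendsto_sandwich[OF _ _ tendsto_const \<phi>(2)]) (auto simp: eq)
    show "(\<lambda>n. \<integral>\<^sup>+x. ennreal ((\<phi> n x - u x)\<^sup>2) \<partial>lborel) \<longlonglongrightarrow> 0"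
      by (rule tendsto_sandwich[OF _ _ tendsto_const \<phi>(2)]) (auto simp: eq)
  qed
qed

lemma ennreal_tendsto_0_less:
  fixes f :: "nat \<Rightarrow> ennreal"
  assumes "f \<longlonglongrightarrow> 0" "e > 0"
  shows "\<forall>\<^sub>F n in sequentially. f n < e"
  using order_tendstoD(2)[OF assms] .

lemma W0_energy_finite:
  fixes u :: "'a::euclidean_space \<Rightarrow> real"
  assumes D: "open D" "bounded D" and \<alpha>: "0 < \<alpha>" "\<alpha> < 2" and u: "u \<in> W0 \<alpha> D"
  shows "energy \<alpha> u < \<infinity>"
proof -
  obtain \<phi> where \<phi>: "\<And>n. \<phi> n \<in> Cc2 D" "(\<lambda>n. energy \<alpha> (\<lambda>x. \<phi> n x - u x)) \<longlonglongrightarrow> 0"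
    by (rule W0_approx[OF u]) (rule that)
  have [measurable]: "u \<in> borel_measurable borel" "\<phi> n \<in> borel_measurable borel" for n
    using W0_borel[OF u] Cc2_borel[OF \<phi>(1)] by auto
  obtain n where n: "energy \<alpha> (\<lambda>x. \<phi> n x - u x) < 1"
    using eventually_happens[OF ennreal_tendsto_0_less[OF \<phi>(2), of 1]] by auto
  have "energy \<alpha> (\<lambda>x. \<phi> n x - (\<phi> n x - u x)) \<le> 2 * energy \<alpha> (\<phi> n) + 2 * energy \<alpha> (\<lambda>x. \<phi> n x - u x)"
    by (rule energy_diff_le) measurable
  also have "\<dots> < \<infinity>"
  proof -
    have "energy \<alpha> (\<lambda>x. \<phi> n x - u x) < top" using less_trans[OF n ennreal_one_less_top] .
    then show ?thesis using Cc2_energy_finite[OF D \<alpha> \<phi>(1)[of n]]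
      by (auto simp: ennreal_mult_less_top)
  qed
  finally show ?thesis by simp
qed

text \<open>The approximating functions vanish off \<open>D\<close>, so the square integral of u
  over the complement is below every approximation error. Convergence in mean cannot give more than
  almost everywhere.\<close>

lemma W0_zero_AE:
  fixes u :: "'a::euclidean_space \<Rightarrow> real"
  assumes D: "open D" and u: "u \<in> W0 \<alpha> D"
  shows "AE x in lborel. x \<notin> D \<longrightarrow> u x = 0"
proof -
  obtain \<phi> where \<phi>: "\<And>n. \<phi> n \<in> Cc2 D" "(\<lambda>n. \<integral>\<^sup>+x. ennreal ((\<phi> n x - u x)\<^sup>2) \<partial>lborel) \<longlonglongrightarrow> 0"
    by (rule W0_approx[OF u]) (rule that)
  have [measurable]: "u \<in> borel_measurable borel" "D \<in> sets borel" using W0_borel[OF u] D by auto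
  have "(\<integral>\<^sup>+x. ennreal ((u x)\<^sup>2) * indicator (- D) x \<partial>lborel) \<le> (\<integral>\<^sup>+x. ennreal ((\<phi> n x - u x)\<^sup>2) \<partial>lborel)" for n
    by (rule nn_integral_mono) (use Cc2_zero[OF \<phi>(1)] in \<open>auto simp: indicator_def\<close>)
  then have "(\<integral>\<^sup>+x. ennreal ((u x)\<^sup>2) * indicator (- D) x \<partial>lborel) \<le> 0"
    by (intro LIMSEQ_le_const[OF \<phi>(2)]) auto
  then have "(\<integral>\<^sup>+x. ennreal ((u x)\<^sup>2) * indicator (- D) x \<partial>lborel) = 0" by simp
  then have "AE x in lborel. ennreal ((u x)\<^sup>2) * indicator (- D) x = 0"
    by (subst (asm) nn_integral_0_iff_AE) measurable
  then show ?thesis by eventually_elim (auto simp: indicator_def split: if_splits)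
qed

text \<open>The truncations of u at height 1/k are test functions and converge to u pointwise. Since
  truncation errors have smaller increments than u, the energy of u dominates, and dominated
  convergence gives convergence in the norm of the space.\<close>

lemma truncated_in_W0:
  fixes u :: "'a::euclidean_space \<Rightarrow> real"
  assumes D: "open D" "bounded D" and C2: "C_k 2 D u" and cont: "continuous_on UNIV u"
    and u0: "\<And>x. x \<notin> D \<Longrightarrow> u x = 0" and M: "\<And>x. \<bar>u x\<bar> \<le> M" and en: "energy \<alpha> u < \<infinity>"
  shows "u \<in> W0 \<alpha> D"
proof -
  have um[measurable]: "u \<in> borel_measurable borel" by (rule borel_measurable_continuous_onI[OF cont])
  define \<phi> where "\<phi> n x = trunc (real (Suc n)) (u x)" for n x
  have \<phi>C: "\<phi> n \<in> Cc2 D" for n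
    unfolding \<phi>_def[abs_def] by (rule trunc_in_Cc2[OF D C2 cont u0]) auto
  have [measurable]: "\<phi> n \<in> borel_measurable borel" for n by (rule Cc2_borel[OF \<phi>C])
  have lim: "(\<lambda>n. \<phi> n x - u x) \<longlonglongrightarrow> 0" for x
  proof (rule Lim_null_comparison)
    show "\<forall>\<^sub>F n in sequentially. norm (\<phi> n x - u x) \<le> 3 / real (Suc n)"
      unfolding \<phi>_def using trunc_close by (intro always_eventually) auto
    show "(\<lambda>n. 3 / real (Suc n)) \<longlonglongrightarrow> 0" by (rule LIMSEQ_Suc[OF lim_const_over_n])
  qed
  have [measurable]: "D \<in> sets borel" using D by auto
  have "(\<lambda>n. energy \<alpha> (\<lambda>x. \<phi> n x - u x)) \<longlonglongrightarrow> (\<integral>\<^sup>+p. 0 \<partial>(lborel \<Otimes>\<^sub>M lborel :: ('a \<times> 'a) measure))"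
    unfolding energy_pair[symmetric, of "\<lambda>x. \<phi> _ x - u x", simplified]
  proof (rule nn_integral_dominated_convergence[where w = "\<lambda>p. ennreal ((u (fst p) - u (snd p))\<^sup>2 * riesz_kernel \<alpha> (fst p - snd p))"])
    show "(\<integral>\<^sup>+p. ennreal ((u (fst p) - u (snd p))\<^sup>2 * riesz_kernel \<alpha> (fst p - snd p)) \<partial>(lborel \<Otimes>\<^sub>M lborel)) < \<infinity>"
      using en by (simp add: energy_pair)
    show "AE p in lborel \<Otimes>\<^sub>M lborel. ennreal ((\<phi> n (fst p) - u (fst p) - (\<phi> n (snd p) - u (snd p)))\<^sup>2 * riesz_kernel \<alpha> (fst p - snd p))
        \<le> ennreal ((u (fst p) - u (snd p))\<^sup>2 * riesz_kernel \<alpha> (fst p - snd p))" for n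
    proof (intro AE_I2 ennreal_leI mult_right_mono)
      fix p :: "'a \<times> 'a"
      have "\<bar>\<phi> n (fst p) - u (fst p) - (\<phi> n (snd p) - u (snd p))\<bar> \<le> \<bar>u (fst p) - u (snd p)\<bar>"
        unfolding \<phi>_def by (rule trunc_increment) simp
      then show "(\<phi> n (fst p) - u (fst p) - (\<phi> n (snd p) - u (snd p)))\<^sup>2 \<le> (u (fst p) - u (snd p))\<^sup>2"
        by (rule abs_le_square_iff[THEN iffD1])
    qed simp
    show "AE p in lborel \<Otimes>\<^sub>M lborel. (\<lambda>n. ennreal ((\<phi> n (fst p) - u (fst p) - (\<phi> n (snd p) - u (snd p)))\<^sup>2 * riesz_kernel \<alpha> (fst p - snd p))) \<longlonglongrightarrow> 0"
    proof (rule AE_I2)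
      fix p :: "'a \<times> 'a"
      have "(\<lambda>n. (\<phi> n (fst p) - u (fst p) - (\<phi> n (snd p) - u (snd p)))\<^sup>2 * riesz_kernel \<alpha> (fst p - snd p)) \<longlonglongrightarrow> (0 - 0)\<^sup>2 * riesz_kernel \<alpha> (fst p - snd p)"
        by (intro tendsto_intros lim)
      then show "(\<lambda>n. ennreal ((\<phi> n (fst p) - u (fst p) - (\<phi> n (snd p) - u (snd p)))\<^sup>2 * riesz_kernel \<alpha> (fst p - snd p))) \<longlonglongrightarrow> 0"
        using tendsto_ennrealI by fastforce
    qed
  qed measurable
  moreover have "(\<lambda>n. \<integral>\<^sup>+x. ennreal ((\<phi> n x - u x)\<^sup>2) \<partial>lborel) \<longlonglongrightarrow> (\<integral>\<^sup>+x. 0 \<partial>(lborel :: 'a measure))"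
  proof (rule nn_integral_dominated_convergence[where w = "\<lambda>x. ennreal (M\<^sup>2) * indicator D x"])
    show "(\<integral>\<^sup>+x. ennreal (M\<^sup>2) * indicator D x \<partial>lborel) < \<infinity>"
      using emeasure_bounded_finite[OF D(2)] by (simp add: nn_integral_cmult_indicator ennreal_mult_less_top)
    show "AE x in lborel. ennreal ((\<phi> n x - u x)\<^sup>2) \<le> ennreal (M\<^sup>2) * indicator D x" for n
    proof (rule AE_I2)
      fix x
      have "\<bar>\<phi> n x - u x\<bar> \<le> \<bar>u x\<bar>"
        using trunc_increment[of "real (Suc n)" "u x" 0] trunc_0[of "real (Suc n)"] by (simp add: \<phi>_def)
      then have "(\<phi> n x - u x)\<^sup>2 \<le> (u x)\<^sup>2" by (rule abs_le_square_iff[THEN iffD1])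
      moreover have "(u x)\<^sup>2 \<le> M\<^sup>2" using M[of x] by (metis abs_ge_zero power2_abs power_mono)
      ultimately show "ennreal ((\<phi> n x - u x)\<^sup>2) \<le> ennreal (M\<^sup>2) * indicator D x"
        using u0[of x] by (cases "x \<in> D") (auto intro!: ennreal_leI simp: \<phi>_def trunc_0)
    qed
    show "AE x in lborel. (\<lambda>n. ennreal ((\<phi> n x - u x)\<^sup>2)) \<longlonglongrightarrow> 0"
    proof (rule AE_I2)
      fix x
      have "(\<lambda>n. (\<phi> n x - u x)\<^sup>2) \<longlonglongrightarrow> 0\<^sup>2" by (intro tendsto_intros lim)
      then show "(\<lambda>n. ennreal ((\<phi> n x - u x)\<^sup>2)) \<longlonglongrightarrow> 0" using tendsto_ennrealI by fastforce
    qed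
  qed measurable
  ultimately have "(\<lambda>n. energy \<alpha> (\<lambda>x. \<phi> n x - u x) + (\<integral>\<^sup>+x. ennreal ((\<phi> n x - u x)\<^sup>2) \<partial>lborel)) \<longlonglongrightarrow> 0 + 0"
    by (intro tendsto_add) auto
  then have "(\<lambda>n. frac_norm_sq \<alpha> (\<lambda>x. \<phi> n x - u x)) \<longlonglongrightarrow> 0"
    by (subst frac_norm_sq_eq) auto
  then show ?thesis unfolding W0_def using \<phi>C um by blast
qed

section \<open>The weak form of the limit equation\<close>

text \<open>As a function of t, u (x + t z) + u (x - t z) has as derivative a difference of first
  derivatives at two points at distance at most 2 |z|. Bounded second partial derivatives on a
  compact neighbourhood of \<open>S\<close> make this of order |z|^2, uniformly in x.\<close>

lemma second_difference_bound:
  fixes u :: "'a::euclidean_space \<Rightarrow> real"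
  assumes D: "open D" and C2: "C_k 2 D u" and S: "compact S" "S \<subseteq> D"
  shows "\<exists>\<rho> C. 0 < \<rho> \<and> \<rho> \<le> 1 \<and> 0 \<le> C \<and> (\<forall>x\<in>S. \<forall>z. norm z \<le> \<rho> \<longrightarrow> \<bar>u (x + z) + u (x - z) - 2 * u x\<bar> \<le> C * (norm z)\<^sup>2)"
proof (cases "S = {}")
  case True
  then show ?thesis by (auto intro!: exI[of _ 1])
next
  case False
  let ?d = "real DIM('a)"
  obtain e where e: "e > 0" "{x. infdist x S \<le> e} \<subseteq> D"
    using compact_in_open_separated[OF False S(1) D S(2)] by blast
  define \<rho> where "\<rho> = min e 1"
  have \<rho>: "0 < \<rho>" "\<rho> \<le> 1" using e by (auto simp: \<rho>_def)
  define S' where "S' = {x. infdist x S \<le> e}"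
  have S': "compact S'" "S' \<subseteq> D" using compact_infdist_le[OF False S(1) e(1)] e by (auto simp: S'_def)
  have cb: "cball x \<rho> \<subseteq> S'" if "x \<in> S" for x
  proof
    fix y assume "y \<in> cball x \<rho>"
    then have "infdist y S \<le> \<rho>" using infdist_le2[OF that, of y \<rho>] by (simp add: dist_commute)
    then show "y \<in> S'" by (simp add: S'_def \<rho>_def)
  qed
  have "\<exists>M\<ge>0. \<forall>x\<in>S'. \<bar>partial_deriv [c, b] u x\<bar> \<le> M" if "b \<in> Basis" "c \<in> Basis" for b c
  proof -
    have "continuous_on S' (partial_deriv [c, b] u)"
      using C_k_D(2)[OF C2, of "[c, b]"] that continuous_on_subset[OF _ S'(2)] by simp
    then have "bounded (partial_deriv [c, b] u ` S')" using S'(1) by (intro compact_imp_bounded compact_continuous_image)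
    then obtain M where "\<forall>x\<in>S'. \<bar>partial_deriv [c, b] u x\<bar> \<le> M" by (auto simp: bounded_iff)
    then show ?thesis by (intro exI[of _ "max M 0"]) (auto simp: le_max_iff_disj)
  qed
  then obtain M where M: "\<And>b c. b \<in> Basis \<Longrightarrow> c \<in> Basis \<Longrightarrow> 0 \<le> M b c"
    "\<And>b c x. b \<in> Basis \<Longrightarrow> c \<in> Basis \<Longrightarrow> x \<in> S' \<Longrightarrow> \<bar>partial_deriv [c, b] u x\<bar> \<le> M b c"
    by metis
  define B where "B = (\<Sum>b\<in>Basis. \<Sum>c\<in>Basis. M b c)"
  have B0: "0 \<le> B" unfolding B_def using M(1) by (intro sum_nonneg) auto
  have B: "\<bar>partial_deriv [c, b] u x\<bar> \<le> B" if "b \<in> Basis" "c \<in> Basis" "x \<in> S'" for b c x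
  proof -
    have "M b c \<le> (\<Sum>c\<in>Basis. M b c)" by (rule member_le_sum) (use that M(1) in auto)
    also have "\<dots> \<le> B" unfolding B_def by (rule member_le_sum) (use that M(1) in \<open>auto intro!: sum_nonneg\<close>)
    finally show ?thesis using M(2)[OF that] by linarith
  qed
  have du: "(u has_derivative frechet_derivative u (at x)) (at x)" if "x \<in> D" for x
    using C_k_D(1)[OF C2, of "[]" x] that by simp
  have du1: "(partial_deriv [b] u has_derivative frechet_derivative (partial_deriv [b] u) (at x)) (at x)" if "x \<in> D" "b \<in> Basis" for x b
    using C_k_D(1)[OF C2, of "[b]" x] that by simp
  \<comment> \<open>One factor d from the sum over the directions of z, one from the Lipschitz bound
    of a first partial derivative by second ones, and 2 from the distance 2 |z| of the two
    points.\<close>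
  define C where "C = 2 * ?d * ?d * B"
  have "\<bar>u (x + z) + u (x - z) - 2 * u x\<bar> \<le> C * (norm z)\<^sup>2" if x: "x \<in> S" and z: "norm z \<le> \<rho>" for x z
  proof -
    have inb: "x + t *\<^sub>R z \<in> cball x \<rho>" "x - t *\<^sub>R z \<in> cball x \<rho>" if "0 \<le> t" "t \<le> 1" for t
    proof -
      have "norm (t *\<^sub>R z) \<le> \<rho>" using that z mult_left_le_one_le[of "norm z" t] by simp
      then show "x + t *\<^sub>R z \<in> cball x \<rho>" "x - t *\<^sub>R z \<in> cball x \<rho>" by (auto simp: dist_norm)
    qed
    let ?D = "\<lambda>y. frechet_derivative u (at y)"
    have der: "((\<lambda>t. u (x + t *\<^sub>R z) + u (x - t *\<^sub>R z)) has_real_derivative (?D (x + t *\<^sub>R z) z - ?D (x - t *\<^sub>R z) z)) (at t)"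
      if t: "0 \<le> t" "t \<le> 1" for t
    proof -
      have inD: "x + t *\<^sub>R z \<in> D" "x - t *\<^sub>R z \<in> D" using inb[OF t] cb[OF x] S' by blast+
      have l: "linear (?D (x + t *\<^sub>R z))" "linear (?D (x - t *\<^sub>R z))"
        using has_derivative_linear[OF du[OF inD(1)]] has_derivative_linear[OF du[OF inD(2)]] by auto
      have 1: "((\<lambda>t. u (x + t *\<^sub>R z)) has_derivative (\<lambda>s. ?D (x + t *\<^sub>R z) (s *\<^sub>R z))) (at t)"
        by (rule has_derivative_compose[where g = u and f = "\<lambda>t. x + t *\<^sub>R z"])
           (use du[OF inD(1)] in \<open>auto intro!: derivative_eq_intros\<close>)
      have 2: "((\<lambda>t. u (x - t *\<^sub>R z)) has_derivative (\<lambda>s. ?D (x - t *\<^sub>R z) (- (s *\<^sub>R z)))) (at t)"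
        by (rule has_derivative_compose[where g = u and f = "\<lambda>t. x - t *\<^sub>R z"])
           (use du[OF inD(2)] in \<open>auto intro!: derivative_eq_intros\<close>)
      have eq: "(\<lambda>s. ?D (x + t *\<^sub>R z) (s *\<^sub>R z) + ?D (x - t *\<^sub>R z) (- (s *\<^sub>R z))) = (*) (?D (x + t *\<^sub>R z) z - ?D (x - t *\<^sub>R z) z)"
        using l by (auto simp: linear_cmul linear_neg algebra_simps)
      show ?thesis using has_derivative_add[OF 1 2] unfolding has_field_derivative_def eq .
    qed
    have "\<exists>t>0. t < 1 \<and> (u (x + 1 *\<^sub>R z) + u (x - 1 *\<^sub>R z)) - (u (x + 0 *\<^sub>R z) + u (x - 0 *\<^sub>R z))
       = (1 - 0) * (?D (x + t *\<^sub>R z) z - ?D (x - t *\<^sub>R z) z)"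
      by (rule MVT2) (use der in auto)
    then obtain t where t: "0 < t" "t < 1" "u (x + z) + u (x - z) - 2 * u x = ?D (x + t *\<^sub>R z) z - ?D (x - t *\<^sub>R z) z"
      by auto
    have Dz: "?D y z = (\<Sum>b\<in>Basis. (z \<bullet> b) * partial_deriv [b] u y)" if "y \<in> D" for y
      using linear_sum[OF has_derivative_linear[OF du[OF that]], of "\<lambda>b. (z \<bullet> b) *\<^sub>R b" Basis]
      by (simp add: euclidean_representation linear_cmul[OF has_derivative_linear[OF du[OF that]]])
    let ?p = "x + t *\<^sub>R z" and ?q = "x - t *\<^sub>R z"
    have pq: "?p \<in> cball x \<rho>" "?q \<in> cball x \<rho>" using inb[of t] t by auto
    have pqD: "?p \<in> D" "?q \<in> D" using pq cb[OF x] S' by blast+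
    have lip: "\<bar>partial_deriv [b] u ?p - partial_deriv [b] u ?q\<bar> \<le> ?d * B * (2 * norm z)" if b: "b \<in> Basis" for b
    proof -
      have "\<bar>partial_deriv [b] u ?p - partial_deriv [b] u ?q\<bar> \<le> ?d * B * norm (?p - ?q)"
      proof (rule lipschitz_of_partial_bounds[OF convex_cball _ _ pq])
        fix y assume "y \<in> cball x \<rho>"
        then have y: "y \<in> S'" using cb[OF x] by blast
        show "(partial_deriv [b] u has_derivative frechet_derivative (partial_deriv [b] u) (at y)) (at y)"
          using du1 y S' b by blast
        fix c :: 'a assume "c \<in> Basis"
        then show "\<bar>frechet_derivative (partial_deriv [b] u) (at y) c\<bar> \<le> B" using B[OF b _ y, of c] by simp
      qed
      also have "norm (?p - ?q) \<le> 2 * norm z"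
      proof -
        have "?p - ?q = t *\<^sub>R z + t *\<^sub>R z" by simp
        also have "\<dots> = (2 * t) *\<^sub>R z" by (simp only: mult_2 scaleR_add_left)
        finally have "?p - ?q = (2 * t) *\<^sub>R z" .
        then have "norm (?p - ?q) = 2 * (t * norm z)" using t by simp
        then show ?thesis using t by (simp add: mult_left_le_one_le)
      qed
      finally show ?thesis using B0 by (simp add: mult_left_mono)
    qed
    have "\<bar>u (x + z) + u (x - z) - 2 * u x\<bar> = \<bar>\<Sum>b\<in>Basis. (z \<bullet> b) * (partial_deriv [b] u ?p - partial_deriv [b] u ?q)\<bar>"
      unfolding t(3) Dz[OF pqD(1)] Dz[OF pqD(2)] by (simp only: sum_subtractf[symmetric] right_diff_distrib)
    also have "\<dots> \<le> (\<Sum>b\<in>(Basis::'a set). norm z * (?d * B * (2 * norm z)))"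
      unfolding real_norm_def[symmetric]
    proof (rule sum_norm_le)
      fix b :: 'a assume b: "b \<in> Basis"
      show "norm ((z \<bullet> b) * (partial_deriv [b] u ?p - partial_deriv [b] u ?q)) \<le> norm z * (?d * B * (2 * norm z))"
        unfolding real_norm_def abs_mult by (intro mult_mono Basis_le_norm lip b) auto
    qed
    also have "\<dots> = C * (norm z)\<^sup>2" by (simp add: C_def power2_eq_square)
    finally show ?thesis .
  qed
  moreover have "0 \<le> C" using B0 by (simp add: C_def)
  ultimately show ?thesis using \<rho> by blast
qed

text \<open>Integrals against this kernel are the approximants of the principal value.\<close>

definition far_kernel :: "real \<Rightarrow> real \<Rightarrow> 'a::euclidean_space \<Rightarrow> real" where
  "far_kernel r \<alpha> z = (if r < norm z then riesz_kernel \<alpha> z else 0)"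

lemma borel_measurable_far_kernel [measurable]: "far_kernel r \<alpha> \<in> borel_measurable borel"
  unfolding far_kernel_def[abs_def] by measurable

lemma far_kernel_bounds: "0 \<le> far_kernel r \<alpha> z" "far_kernel r \<alpha> z \<le> riesz_kernel \<alpha> z"
  by (auto simp: far_kernel_def)

lemma abs_far_kernel_le: "\<bar>far_kernel r \<alpha> z\<bar> \<le> \<bar>riesz_kernel \<alpha> z\<bar>"
  by (auto simp: far_kernel_def)

lemma far_kernel_commute: "far_kernel r \<alpha> (y - x) = far_kernel r \<alpha> (x - y)" "far_kernel r \<alpha> (- z) = far_kernel r \<alpha> z"
  by (auto simp: far_kernel_def norm_minus_commute kernel_diff_commute)

lemma integrable_far_kernel:
  assumes "r > 0" "\<alpha> > 0"
  shows "integrable lborel (far_kernel r \<alpha> :: 'a::euclidean_space \<Rightarrow> real)"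
proof (rule integrableI_bounded)
  have "(\<integral>\<^sup>+z. ennreal (norm (far_kernel r \<alpha> (z::'a))) \<partial>lborel) = (\<integral>\<^sup>+z\<in>- cball 0 r. ennreal (norm (z::'a) powr (- \<alpha> - DIM('a))) \<partial>lborel)"
  proof (rule nn_integral_cong)
    fix z :: 'a
    have "riesz_kernel \<alpha> z = norm z powr (- \<alpha> - DIM('a))" by (simp add: riesz_kernel_def algebra_simps)
    then show "ennreal (norm (far_kernel r \<alpha> z)) = ennreal (norm z powr (- \<alpha> - DIM('a))) * indicator (- cball 0 r) z"
      by (cases "r < norm z") (auto simp: far_kernel_def indicator_def)
  qed
  also have "\<dots> < \<infinity>"
    by (rule le_less_trans[OF nn_integral_norm_powr_far[OF assms(2,1)]]) simp
  finally show "(\<integral>\<^sup>+z. ennreal (norm (far_kernel r \<alpha> (z::'a))) \<partial>lborel) < \<infinity>" .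
qed measurable

lemma integrable_bounded_far_kernel:
  fixes f :: "'a::euclidean_space \<Rightarrow> real"
  assumes "r > 0" "\<alpha> > 0" and [measurable]: "f \<in> borel_measurable borel" and M: "\<And>x. \<bar>f x\<bar> \<le> M"
  shows "integrable lborel (\<lambda>z. f z * far_kernel r \<alpha> z)"
proof (rule Bochner_Integration.integrable_bound)
  show "integrable lborel (\<lambda>z::'a. M * far_kernel r \<alpha> z)" using integrable_far_kernel[OF assms(1,2), where 'a='a] by simp
  show "AE x in lborel. norm (f x * far_kernel r \<alpha> x) \<le> norm (M * far_kernel r \<alpha> x)"
    by (intro AE_I2) (use M far_kernel_bounds(1)[of r \<alpha>] in \<open>auto simp: abs_mult intro!: mult_right_mono intro: order_trans[OF _ abs_ge_self]\<close>)
qed measurable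

text \<open>The reflection of z preserves the kernel, so twice the integral has the second
  difference of u as integrand. Near 0 this is of order |z|^2, integrable against |z|^(-d-\<alpha>)
  because \<alpha> < 2, uniformly in the truncation radius. Such a bound is needed to take the
  principal value under an integral.\<close>

lemma truncated_op_bound:
  fixes u :: "'a::euclidean_space \<Rightarrow> real"
  assumes D: "open D" and C2: "C_k 2 D u" and S: "compact S" "S \<subseteq> D"
    and \<alpha>: "0 < \<alpha>" "\<alpha> < 2" and um[measurable]: "u \<in> borel_measurable borel" and M: "\<And>x. \<bar>u x\<bar> \<le> M"
  shows "\<exists>C. \<forall>x\<in>S. \<forall>r>0. \<bar>\<integral>y. (u y - u x) * far_kernel r \<alpha> (x - y) \<partial>lborel\<bar> \<le> C"
proof -
  let ?d = "real DIM('a)" and ?V = "unit_ball_vol DIM('a)"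
  have M0: "0 \<le> M" using M[of 0] by linarith
  obtain \<rho> C where \<rho>: "0 < \<rho>" "\<rho> \<le> 1" and C: "0 \<le> C"
    "\<And>x z. x \<in> S \<Longrightarrow> norm z \<le> \<rho> \<Longrightarrow> \<bar>u (x + z) + u (x - z) - 2 * u x\<bar> \<le> C * (norm z)\<^sup>2"
    using second_difference_bound[OF D C2 S] by blast
  \<comment> \<open>The estimate near the origin is for exponents below 1. Since s \<le> 2 -
    \<alpha> and \<rho> \<le> 1, the power |z|^(2-\<alpha>-d) is below |z|^(s-d) on the
    ball.\<close>
  define s where "s = min (1/2) (2 - \<alpha>)"
  have s: "0 < s" "s < 1" "s \<le> 2 - \<alpha>" using \<alpha> by (auto simp: s_def)
  define K where "K = C * (?V * ?d / s * \<rho> powr s) + 4 * M * (?V * (?d + \<alpha>) / \<alpha> * \<rho> powr -\<alpha>)"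
  have K0: "0 \<le> K" using C M0 s \<alpha> by (simp add: K_def)
  have "\<bar>\<integral>y. (u y - u x) * far_kernel r \<alpha> (x - y) \<partial>lborel\<bar> \<le> K / 2" if x: "x \<in> S" and r: "r > 0" for x r
  proof -
    define I where "I = (\<integral>y. (u y - u x) * far_kernel r \<alpha> (x - y) \<partial>lborel)"
    have I1: "I = (\<integral>z. (u (x + z) - u x) * far_kernel r \<alpha> z \<partial>lborel)"
      unfolding I_def using integral_lborel_shift[of "\<lambda>y. (u y - u x) * far_kernel r \<alpha> (x - y)" x]
      by (simp add: far_kernel_commute)
    have refl: "(\<integral>z. f (- z) \<partial>lborel) = (\<integral>z. f z \<partial>lborel)" if "f \<in> borel_measurable borel" for f :: "'a \<Rightarrow> real"
    proof -
      have "lborel = distr lborel borel (uminus :: 'a \<Rightarrow> 'a)"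
        using lborel_affine[of "-1" "0::'a"] by (simp add: density_1)
      then have "(\<integral>z. f z \<partial>lborel) = (\<integral>z. f z \<partial>distr lborel borel (uminus :: 'a \<Rightarrow> 'a))" by simp
      also have "\<dots> = (\<integral>z. f (- z) \<partial>lborel)" by (rule integral_distr) (use that in auto)
      finally show ?thesis by simp
    qed
    have I2: "I = (\<integral>z. (u (x - z) - u x) * far_kernel r \<alpha> z \<partial>lborel)"
      unfolding I1 using refl[of "\<lambda>z. (u (x + z) - u x) * far_kernel r \<alpha> z"] by (simp add: far_kernel_commute)
    have b: "\<bar>u y - u z\<bar> \<le> 2 * M" for y z using M[of y] M[of z] by linarith
    have int: "integrable lborel (\<lambda>z. (u (x + z) - u x) * far_kernel r \<alpha> z)" "integrable lborel (\<lambda>z. (u (x - z) - u x) * far_kernel r \<alpha> z)"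
      by (rule integrable_bounded_far_kernel[OF r \<alpha>(1) _ b], measurable)+
    \<comment> \<open>Sum of the two representations of I, by x + z and by x - z; neither first
      difference alone is small enough when \<alpha> \<ge> 1.\<close>
    have "2 * I = (\<integral>z. (u (x + z) + u (x - z) - 2 * u x) * far_kernel r \<alpha> z \<partial>lborel)"
    proof -
      have "2 * I = (\<integral>z. (u (x + z) - u x) * far_kernel r \<alpha> z + (u (x - z) - u x) * far_kernel r \<alpha> z \<partial>lborel)"
        using I1 I2 int by simp
      also have "\<dots> = (\<integral>z. (u (x + z) + u (x - z) - 2 * u x) * far_kernel r \<alpha> z \<partial>lborel)"
        by (rule Bochner_Integration.integral_cong) (auto simp: algebra_simps)
      finally show ?thesis .
    qed
    also have "ennreal (norm \<dots>) \<le> (\<integral>\<^sup>+z. ennreal (norm ((u (x + z) + u (x - z) - 2 * u x) * far_kernel r \<alpha> z)) \<partial>lborel)"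
    proof (rule integral_norm_bound_ennreal)
      have "integrable lborel (\<lambda>z. (u (x + z) - u x) * far_kernel r \<alpha> z + (u (x - z) - u x) * far_kernel r \<alpha> z)"
        using int by simp
      then show "integrable lborel (\<lambda>z. (u (x + z) + u (x - z) - 2 * u x) * far_kernel r \<alpha> z)"
        by (rule Bochner_Integration.integrable_cong[THEN iffD1, rotated -1]) (auto simp: algebra_simps)
    qed
    also have "\<dots> \<le> (\<integral>\<^sup>+z. ennreal C * (ennreal (norm (z::'a) powr (s - ?d)) * indicator (cball 0 \<rho>) z)
         + ennreal (4 * M) * (ennreal (norm z powr (- \<alpha> - ?d)) * indicator (- cball 0 \<rho>) z) \<partial>lborel)"
    proof (rule nn_integral_mono)
      fix z :: 'a
      have rk: "riesz_kernel \<alpha> z = norm z powr (- \<alpha> - ?d)" by (simp add: riesz_kernel_def algebra_simps)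
      have le: "norm ((u (x + z) + u (x - z) - 2 * u x) * far_kernel r \<alpha> z) \<le> \<bar>u (x + z) + u (x - z) - 2 * u x\<bar> * riesz_kernel \<alpha> z"
        using far_kernel_bounds[of r \<alpha> z] by (simp add: abs_mult mult_left_mono)
      show "ennreal (norm ((u (x + z) + u (x - z) - 2 * u x) * far_kernel r \<alpha> z))
        \<le> ennreal C * (ennreal (norm z powr (s - ?d)) * indicator (cball 0 \<rho>) z)
         + ennreal (4 * M) * (ennreal (norm z powr (- \<alpha> - ?d)) * indicator (- cball 0 \<rho>) z)"
      proof (cases "z \<in> cball 0 \<rho>")
        case True
        then have nz: "norm z \<le> \<rho>" by simp
        have "\<bar>u (x + z) + u (x - z) - 2 * u x\<bar> * riesz_kernel \<alpha> z \<le> C * (norm z)\<^sup>2 * riesz_kernel \<alpha> z"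
          by (intro mult_right_mono C x nz) simp
        also have "\<dots> \<le> C * norm z powr (s - ?d)"
        proof (cases "z = 0")
          case False
          have "(norm z)\<^sup>2 = norm z powr 2" using False by simp
          then have "(norm z)\<^sup>2 * riesz_kernel \<alpha> z = norm z powr (2 - \<alpha> - ?d)"
            unfolding rk by (simp only: powr_add[symmetric]) (simp add: algebra_simps)
          also have "\<dots> \<le> norm z powr (s - ?d)" by (rule powr_mono') (use nz \<rho> s in auto)
          finally show ?thesis using C(1) by (simp add: mult.assoc mult_left_mono)
        qed (use C in simp)
        finally have "norm ((u (x + z) + u (x - z) - 2 * u x) * far_kernel r \<alpha> z) \<le> C * norm z powr (s - ?d)" using le by linarith
        then have "ennreal (norm ((u (x + z) + u (x - z) - 2 * u x) * far_kernel r \<alpha> z)) \<le> ennreal C * ennreal (norm z powr (s - ?d))"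
          using C(1) by (subst ennreal_mult[symmetric]) (auto intro: ennreal_leI)
        then show ?thesis using True by simp
      next
        case False
        have "\<bar>u (x + z) + u (x - z) - 2 * u x\<bar> \<le> 4 * M" using M[of "x + z"] M[of "x - z"] M[of x] by linarith
        then have "\<bar>u (x + z) + u (x - z) - 2 * u x\<bar> * riesz_kernel \<alpha> z \<le> 4 * M * norm z powr (- \<alpha> - ?d)"
          unfolding rk by (intro mult_right_mono) auto
        then have "norm ((u (x + z) + u (x - z) - 2 * u x) * far_kernel r \<alpha> z) \<le> 4 * M * norm z powr (- \<alpha> - ?d)" using le by linarith
        then have "ennreal (norm ((u (x + z) + u (x - z) - 2 * u x) * far_kernel r \<alpha> z)) \<le> ennreal (4 * M) * ennreal (norm z powr (- \<alpha> - ?d))"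
          using M0 by (subst ennreal_mult[symmetric]) (auto intro: ennreal_leI)
        then show ?thesis using False by simp
      qed
    qed
    also have "\<dots> = ennreal C * (\<integral>\<^sup>+z\<in>cball 0 \<rho>. ennreal (norm (z::'a) powr (s - ?d)) \<partial>lborel)
         + ennreal (4 * M) * (\<integral>\<^sup>+z\<in>- cball 0 \<rho>. ennreal (norm (z::'a) powr (- \<alpha> - ?d)) \<partial>lborel)"
    proof -
      have [measurable]: "(\<lambda>z::'a. ennreal (norm z powr (s - ?d)) * indicator (cball 0 \<rho>) z) \<in> borel_measurable borel"
        "(\<lambda>z::'a. ennreal (norm z powr (- \<alpha> - ?d)) * indicator (- cball 0 \<rho>) z) \<in> borel_measurable borel"
        by (auto intro!: borel_measurable_times_ennreal borel_measurable_indicator)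
      show ?thesis by (subst nn_integral_add, measurable) (simp add: nn_integral_cmult)
    qed
    also have "\<dots> \<le> ennreal C * ennreal (?V * ?d / s * \<rho> powr s) + ennreal (4 * M) * ennreal (?V * (?d + \<alpha>) / \<alpha> * \<rho> powr -\<alpha>)"
      by (intro add_mono mult_left_mono nn_integral_norm_powr_near nn_integral_norm_powr_far) (use s \<rho> \<alpha> in auto)
    also have "\<dots> = ennreal K" unfolding K_def
      using C M0 s \<alpha> by (simp add: ennreal_mult[symmetric] ennreal_plus[symmetric] del: ennreal_plus)
    finally have "\<bar>2 * I\<bar> \<le> K" using K0 by (simp add: ennreal_le_iff)
    then show ?thesis unfolding I_def by linarith
  qed
  then show ?thesis by blast
qed

lemma has_nonlocal_op_far_kernel:
  assumes "has_nonlocal_op \<alpha> (\<lambda>_ _. \<kappa>) u x l"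
  shows "((\<lambda>r. \<kappa> * (\<integral>y. (u y - u x) * far_kernel r \<alpha> (x - y) \<partial>lborel)) \<longlongrightarrow> l) (at_right 0)"
proof -
  have "(\<integral>y\<in>{y. r < norm (x - y)}. (u y - u x) * jump_kernel \<alpha> (\<lambda>_ _. \<kappa>) x y \<partial>lborel)
    = \<kappa> * (\<integral>y. (u y - u x) * far_kernel r \<alpha> (x - y) \<partial>lborel)" for r
  proof -
    have jk: "jump_kernel \<alpha> (\<lambda>_ _. \<kappa>) x y = \<kappa> * riesz_kernel \<alpha> (x - y)" for y
      by (simp only: jump_kernel_def riesz_kernel_def powr_minus divide_inverse)
    have "(\<integral>y\<in>{y. r < norm (x - y)}. (u y - u x) * jump_kernel \<alpha> (\<lambda>_ _. \<kappa>) x y \<partial>lborel)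
      = (\<integral>y. \<kappa> * ((u y - u x) * far_kernel r \<alpha> (x - y)) \<partial>lborel)"
      unfolding set_lebesgue_integral_def
      by (rule Bochner_Integration.integral_cong)
         (auto simp: far_kernel_def jk indicator_def)
    then show ?thesis by simp
  qed
  then show ?thesis using assms unfolding has_nonlocal_op_def by simp
qed

text \<open>For the kernel truncated at radius r the double integral may be split and one half
  swapped onto the other. As r tends to 0, the left side converges because the product of the
  increments is integrable for functions of finite energy, the right side because the truncated
  operators are bounded uniformly on the support of g.\<close>

lemma weak_form_Cc2:
  fixes u g h :: "'a::euclidean_space \<Rightarrow> real"
  assumes D: "open D" "bounded D" and \<alpha>: "0 < \<alpha>" "\<alpha> < 2" and C2: "C_k 2 D u"
    and um[measurable]: "u \<in> borel_measurable borel" and M: "\<And>x. \<bar>u x\<bar> \<le> M" and en: "energy \<alpha> u < \<infinity>"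
    and g: "g \<in> Cc2 D" and hm[measurable]: "h \<in> borel_measurable borel"
    and eq: "\<And>x. x \<in> D \<Longrightarrow> has_nonlocal_op \<alpha> (\<lambda>_ _. \<kappa>) u x (h x)"
  shows "\<kappa> * (\<integral>p. (u (fst p) - u (snd p)) * (g (fst p) - g (snd p)) * riesz_kernel \<alpha> (fst p - snd p) \<partial>(lborel \<Otimes>\<^sub>M lborel))
    = - 2 * (\<integral>x. h x * g x \<partial>lborel)"
proof -
  let ?M = "(lborel \<Otimes>\<^sub>M lborel) :: ('a \<times> 'a) measure"
  have gm[measurable]: "g \<in> borel_measurable borel" by (rule Cc2_borel[OF g])
  have [measurable]: "D \<in> sets borel" using D by auto
  obtain N where N: "N \<ge> 0" "\<And>x. \<bar>g x\<bar> \<le> N" by (rule Cc2_bounded[OF g]) (rule that)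
  have M0: "0 \<le> M" using M[of 0] by linarith
  have g0: "g x = 0" if "x \<notin> D" for x using Cc2_zero[OF g that] .
  have finD: "emeasure lborel D < \<infinity>" using emeasure_bounded_finite[OF D(2)] by simp
  let ?S = "closure {x. g x \<noteq> 0}"
  have S: "compact ?S" "?S \<subseteq> D" using g by (auto simp: Cc2_def)
  define L where "L r x = (\<integral>y. (u y - u x) * far_kernel r \<alpha> (x - y) \<partial>lborel)" for r x
  \<comment> \<open>The bound is uniform in r on compact subsets of \<open>D\<close>; the support of
    g is such a subset.\<close>
  obtain C where C: "\<And>x r. x \<in> ?S \<Longrightarrow> 0 < r \<Longrightarrow> \<bar>L r x\<bar> \<le> C"
    using truncated_op_bound[OF D(1) C2 S \<alpha> um M] unfolding L_def by blast
  have Lm[measurable]: "L r \<in> borel_measurable borel" for r unfolding L_def[abs_def] by measurable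
  have intg: "integrable lborel (\<lambda>x. c * indicator D x :: real)" for c
    by (intro integrable_mult_right integrable_real_indicator) (use finD in auto)
  have T: "(\<integral>p. (u (fst p) - u (snd p)) * (g (fst p) - g (snd p)) * far_kernel r \<alpha> (fst p - snd p) \<partial>?M) = - 2 * (\<integral>x. g x * L r x \<partial>lborel)"
    if r: "r > 0" for r
  proof -
    define H where "H p = g (fst p) * ((u (fst p) - u (snd p)) * far_kernel r \<alpha> (fst p - snd p))" for p
    have Hm[measurable]: "H \<in> borel_measurable ?M" unfolding H_def by measurable
    \<comment> \<open>The truncated kernel has finite mass and g is bounded with support in a
      bounded set, so each half of the symmetric integrand is integrable on its own. For the
      singular kernel only their sum is under control.\<close>
    have intH: "integrable ?M H"
    proof (rule lborel_pair.Fubini_integrable)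
      define k where "k = (\<integral>z. far_kernel r \<alpha> (z::'a) \<partial>lborel)"
      have k0: "0 \<le> k" unfolding k_def by (intro integral_nonneg_AE) (auto simp: far_kernel_bounds)
      have iy: "integrable lborel (\<lambda>y. far_kernel r \<alpha> (x - y))" and ky: "(\<integral>y. far_kernel r \<alpha> (x - y) \<partial>lborel) = k" for x :: 'a
        using integrable_lborel_shift[OF integrable_far_kernel[OF r \<alpha>(1), where 'a='a], of "- x"]
          integral_lborel_shift[of "far_kernel r \<alpha>" "- x"] far_kernel_commute(1)[of r \<alpha> _ x]
        by (auto simp: k_def)
      have iu: "integrable lborel (\<lambda>y. (u x - u y) * far_kernel r \<alpha> (x - y))" for x
      proof (rule Bochner_Integration.integrable_bound)
        show "integrable lborel (\<lambda>y. (2 * M) * far_kernel r \<alpha> (x - y))" using iy by simp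
        show "AE y in lborel. norm ((u x - u y) * far_kernel r \<alpha> (x - y)) \<le> norm ((2 * M) * far_kernel r \<alpha> (x - y))"
        proof (rule AE_I2)
          fix y
          have "\<bar>u x - u y\<bar> \<le> \<bar>2 * M\<bar>" using M[of x] M[of y] by linarith
          then show "norm ((u x - u y) * far_kernel r \<alpha> (x - y)) \<le> norm ((2 * M) * far_kernel r \<alpha> (x - y))"
            unfolding real_norm_def abs_mult by (rule mult_right_mono) simp
        qed
      qed measurable
      show "AE x in lborel. integrable lborel (\<lambda>y. H (x, y))"
        unfolding H_def using iu by simp
      show "integrable lborel (\<lambda>x. \<integral>y. norm (H (x, y)) \<partial>lborel)"
      proof (rule Bochner_Integration.integrable_bound[OF intg[of "N * (2 * M * k)"]])
        show "AE x in lborel. norm (\<integral>y. norm (H (x, y)) \<partial>lborel) \<le> norm (N * (2 * M * k) * indicator D x :: real)"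
        proof (rule AE_I2)
          fix x
          have "(\<integral>y. norm (H (x, y)) \<partial>lborel) = \<bar>g x\<bar> * (\<integral>y. \<bar>(u x - u y) * far_kernel r \<alpha> (x - y)\<bar> \<partial>lborel)"
            by (simp add: H_def abs_mult)
          moreover have "(\<integral>y. \<bar>(u x - u y) * far_kernel r \<alpha> (x - y)\<bar> \<partial>lborel) \<le> (\<integral>y. (2 * M) * far_kernel r \<alpha> (x - y) \<partial>lborel)"
          proof (rule integral_mono)
            fix y
            have "\<bar>u x - u y\<bar> \<le> 2 * M" using M[of x] M[of y] by linarith
            then have "\<bar>u x - u y\<bar> * far_kernel r \<alpha> (x - y) \<le> 2 * M * far_kernel r \<alpha> (x - y)"
              by (rule mult_right_mono) (rule far_kernel_bounds)
            then show "\<bar>(u x - u y) * far_kernel r \<alpha> (x - y)\<bar> \<le> 2 * M * far_kernel r \<alpha> (x - y)"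
              using far_kernel_bounds(1)[of r \<alpha> "x - y"] by (simp add: abs_mult)
          qed (use iu iy in \<open>auto intro: integrable_abs\<close>)
          moreover have "(\<integral>y. (2 * M) * far_kernel r \<alpha> (x - y) \<partial>lborel) = 2 * M * k" using ky by simp
          moreover have "0 \<le> (\<integral>y. norm (H (x, y)) \<partial>lborel)" by (rule integral_nonneg_AE) simp
          moreover have "\<bar>g x\<bar> \<le> N * indicator D x" using N(2)[of x] g0[of x] by (auto simp: indicator_def)
          ultimately show "norm (\<integral>y. norm (H (x, y)) \<partial>lborel) \<le> norm (N * (2 * M * k) * indicator D x :: real)"
            using k0 M0 N(1) mult_mono[of "\<bar>g x\<bar>" "N * indicator D x" "\<integral>y. \<bar>(u x - u y) * far_kernel r \<alpha> (x - y)\<bar> \<partial>lborel" "2 * M * k"]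
            by (auto simp: mult_ac abs_mult)
        qed
      qed measurable
    qed measurable
    have sw: "integrable ?M (\<lambda>(x, y). H (y, x))" "(\<integral>(x, y). H (y, x) \<partial>?M) = (\<integral>p. H p \<partial>?M)"
      using lborel_pair.integrable_product_swap[OF intH] lborel_pair.integral_product_swap[OF Hm] by auto
    have "(\<integral>p. (u (fst p) - u (snd p)) * (g (fst p) - g (snd p)) * far_kernel r \<alpha> (fst p - snd p) \<partial>?M)
      = (\<integral>p. H p + (case p of (x, y) \<Rightarrow> H (y, x)) \<partial>?M)"
      by (rule Bochner_Integration.integral_cong) (auto simp: H_def far_kernel_commute(1) algebra_simps split: prod.split)
    also have "\<dots> = 2 * (\<integral>p. H p \<partial>?M)" using intH sw by simp
    also have "(\<integral>p. H p \<partial>?M) = (\<integral>x. \<integral>y. H (x, y) \<partial>lborel \<partial>lborel)"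
      using lborel_pair.integral_fst'[OF intH] by simp
    also have "\<dots> = (\<integral>x. - (g x * L r x) \<partial>lborel)"
    proof (rule Bochner_Integration.integral_cong[OF refl])
      fix x
      have "(\<integral>y. H (x, y) \<partial>lborel) = (\<integral>y. - (g x * ((u y - u x) * far_kernel r \<alpha> (x - y))) \<partial>lborel)"
        by (rule Bochner_Integration.integral_cong) (auto simp: H_def algebra_simps)
      then show "(\<integral>y. H (x, y) \<partial>lborel) = - (g x * L r x)" by (simp add: L_def)
    qed
    finally show ?thesis by simp
  qed
  \<comment> \<open>Dominated convergence is for sequences, so the radius runs through 1 / (n +
    1).\<close>
  define \<rho> where "\<rho> n = 1 / real (Suc n)" for n
  have \<rho>: "\<rho> n > 0" for n by (simp add: \<rho>_def)
  have \<rho>0: "\<rho> \<longlonglongrightarrow> 0" unfolding \<rho>_def[abs_def] by (rule LIMSEQ_Suc[OF lim_const_over_n])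
  have \<rho>r: "filterlim \<rho> (at_right 0) sequentially"
    using \<rho>0 \<rho> less_imp_neq[OF \<rho>] by (auto simp: filterlim_at intro!: always_eventually)
  let ?G = "\<lambda>p. (u (fst p) - u (snd p)) * (g (fst p) - g (snd p)) * riesz_kernel \<alpha> (fst p - snd p)"
  have lim1: "(\<lambda>n. \<integral>p. (u (fst p) - u (snd p)) * (g (fst p) - g (snd p)) * far_kernel (\<rho> n) \<alpha> (fst p - snd p) \<partial>?M) \<longlonglongrightarrow> (\<integral>p. ?G p \<partial>?M)"
  proof (rule integral_dominated_convergence[where w = "\<lambda>p. norm (?G p)"])
    show "integrable ?M (\<lambda>p. norm (?G p))"
      by (intro integrable_norm integrable_energy_product um gm en Cc2_energy_finite[OF D \<alpha> g])
    show "AE p in ?M. (\<lambda>n. (u (fst p) - u (snd p)) * (g (fst p) - g (snd p)) * far_kernel (\<rho> n) \<alpha> (fst p - snd p)) \<longlonglongrightarrow> ?G p"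
    proof (rule AE_I2)
      fix p :: "'a \<times> 'a"
      show "(\<lambda>n. (u (fst p) - u (snd p)) * (g (fst p) - g (snd p)) * far_kernel (\<rho> n) \<alpha> (fst p - snd p)) \<longlonglongrightarrow> ?G p"
      proof (cases "fst p = snd p")
        case False
        then have "0 < norm (fst p - snd p)" by simp
        then have "\<forall>\<^sub>F n in sequentially. \<rho> n < norm (fst p - snd p)" using \<rho>0 by (rule order_tendstoD(2)[rotated])
        then have "\<forall>\<^sub>F n in sequentially. (u (fst p) - u (snd p)) * (g (fst p) - g (snd p)) * far_kernel (\<rho> n) \<alpha> (fst p - snd p) = ?G p"
          by eventually_elim (simp add: far_kernel_def)
        then show ?thesis by (rule tendsto_eventually)
      qed simp
    qed
    show "AE p in ?M. norm ((u (fst p) - u (snd p)) * (g (fst p) - g (snd p)) * far_kernel (\<rho> n) \<alpha> (fst p - snd p)) \<le> norm (?G p)" for n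
      unfolding real_norm_def abs_mult by (intro AE_I2 mult_left_mono abs_far_kernel_le) auto
  qed measurable
  have lim2: "(\<lambda>n. \<integral>x. g x * (\<kappa> * L (\<rho> n) x) \<partial>lborel) \<longlonglongrightarrow> (\<integral>x. g x * h x \<partial>lborel)"
  proof (rule integral_dominated_convergence[where w = "\<lambda>x. (N * (\<bar>\<kappa>\<bar> * \<bar>C\<bar>)) * indicator D x"])
    show "integrable lborel (\<lambda>x. (N * (\<bar>\<kappa>\<bar> * \<bar>C\<bar>)) * indicator D x)" by (rule intg)
    show "AE x in lborel. (\<lambda>n. g x * (\<kappa> * L (\<rho> n) x)) \<longlonglongrightarrow> g x * h x"
    proof (rule AE_I2)
      fix x
      show "(\<lambda>n. g x * (\<kappa> * L (\<rho> n) x)) \<longlonglongrightarrow> g x * h x"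
      proof (cases "x \<in> D")
        case True
        have "(\<lambda>n. \<kappa> * L (\<rho> n) x) \<longlonglongrightarrow> h x"
          unfolding L_def by (rule filterlim_compose[OF has_nonlocal_op_far_kernel[OF eq[OF True]] \<rho>r])
        then show ?thesis by (rule tendsto_mult_left)
      qed (simp add: g0)
    qed
    show "AE x in lborel. norm (g x * (\<kappa> * L (\<rho> n) x)) \<le> (N * (\<bar>\<kappa>\<bar> * \<bar>C\<bar>)) * indicator D x" for n
    proof (rule AE_I2)
      fix x
      show "norm (g x * (\<kappa> * L (\<rho> n) x)) \<le> (N * (\<bar>\<kappa>\<bar> * \<bar>C\<bar>)) * indicator D x"
      proof (cases "g x = 0")
        case False
        then have "x \<in> ?S" using closure_subset[of "{x. g x \<noteq> 0}"] by blast
        then have "\<bar>L (\<rho> n) x\<bar> \<le> \<bar>C\<bar>" "x \<in> D" using C[OF _ \<rho>, of x n] S by force+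
        then show ?thesis using N by (auto simp: abs_mult intro!: mult_mono)
      qed (use N in auto)
    qed
  qed measurable
  have "(\<lambda>n. \<kappa> * (\<integral>p. (u (fst p) - u (snd p)) * (g (fst p) - g (snd p)) * far_kernel (\<rho> n) \<alpha> (fst p - snd p) \<partial>?M)) = (\<lambda>n. - 2 * (\<integral>x. g x * (\<kappa> * L (\<rho> n) x) \<partial>lborel))"
  proof
    fix n
    have "(\<integral>x. g x * (\<kappa> * L (\<rho> n) x) \<partial>lborel) = (\<integral>x. \<kappa> * (g x * L (\<rho> n) x) \<partial>lborel)"
      by (simp only: mult.left_commute)
    then show "\<kappa> * (\<integral>p. (u (fst p) - u (snd p)) * (g (fst p) - g (snd p)) * far_kernel (\<rho> n) \<alpha> (fst p - snd p) \<partial>?M) = - 2 * (\<integral>x. g x * (\<kappa> * L (\<rho> n) x) \<partial>lborel)"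
      unfolding T[OF \<rho>] by simp
  qed
  then have "(\<lambda>n. - 2 * (\<integral>x. g x * (\<kappa> * L (\<rho> n) x) \<partial>lborel)) \<longlonglongrightarrow> \<kappa> * (\<integral>p. ?G p \<partial>?M)"
    using tendsto_mult_left[OF lim1, of \<kappa>] by simp
  moreover have "(\<lambda>n. - 2 * (\<integral>x. g x * (\<kappa> * L (\<rho> n) x) \<partial>lborel)) \<longlonglongrightarrow> - 2 * (\<integral>x. g x * h x \<partial>lborel)"
    by (rule tendsto_mult_left[OF lim2])
  ultimately have "\<kappa> * (\<integral>p. ?G p \<partial>?M) = - 2 * (\<integral>x. g x * h x \<partial>lborel)" by (rule LIMSEQ_unique)
  then show ?thesis by (simp add: mult.commute)
qed

section \<open>From test functions to their limits\<close>

lemma abs_energy_product_le: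
  fixes v g :: "'a::euclidean_space \<Rightarrow> real"
  assumes [measurable]: "v \<in> borel_measurable borel" "g \<in> borel_measurable borel"
    and en: "energy \<alpha> v \<le> ennreal E" "energy \<alpha> g \<le> ennreal e" "0 \<le> E" "0 \<le> e" and \<eta>: "\<eta> > 0"
  shows "\<bar>\<integral>p. (v (fst p) - v (snd p)) * (g (fst p) - g (snd p)) * riesz_kernel \<alpha> (fst p - snd p) \<partial>(lborel \<Otimes>\<^sub>M lborel)\<bar> \<le> \<eta> * E + e / \<eta>"
proof -
  let ?M = "(lborel \<Otimes>\<^sub>M lborel) :: ('a \<times> 'a) measure"
  have int: "integrable ?M (\<lambda>p. (v (fst p) - v (snd p)) * (g (fst p) - g (snd p)) * riesz_kernel \<alpha> (fst p - snd p))"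
    by (rule integrable_energy_product) (use le_less_trans[OF en(1) ennreal_less_top] le_less_trans[OF en(2) ennreal_less_top] in auto)
  have "ennreal (norm (\<integral>p. (v (fst p) - v (snd p)) * (g (fst p) - g (snd p)) * riesz_kernel \<alpha> (fst p - snd p) \<partial>?M))
    \<le> (\<integral>\<^sup>+p. ennreal (norm ((v (fst p) - v (snd p)) * (g (fst p) - g (snd p)) * riesz_kernel \<alpha> (fst p - snd p))) \<partial>?M)"
    by (rule integral_norm_bound_ennreal[OF int])
  also have "\<dots> \<le> (\<integral>\<^sup>+p. ennreal \<eta> * ennreal ((v (fst p) - v (snd p))\<^sup>2 * riesz_kernel \<alpha> (fst p - snd p))
      + ennreal (1/\<eta>) * ennreal ((g (fst p) - g (snd p))\<^sup>2 * riesz_kernel \<alpha> (fst p - snd p)) \<partial>?M)"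
  proof (rule nn_integral_mono)
    fix p :: "'a \<times> 'a"
    have "\<bar>g (fst p) - g (snd p)\<bar> * \<bar>v (fst p) - v (snd p)\<bar> * riesz_kernel \<alpha> (fst p - snd p)
      \<le> ((g (fst p) - g (snd p))\<^sup>2 / \<eta> + \<eta> * (v (fst p) - v (snd p))\<^sup>2) * riesz_kernel \<alpha> (fst p - snd p)"
      by (intro mult_right_mono mult_le_weighted_squares \<eta>) simp
    moreover have "norm ((v (fst p) - v (snd p)) * (g (fst p) - g (snd p)) * riesz_kernel \<alpha> (fst p - snd p))
      = \<bar>g (fst p) - g (snd p)\<bar> * \<bar>v (fst p) - v (snd p)\<bar> * riesz_kernel \<alpha> (fst p - snd p)"
      by (simp add: abs_mult mult_ac)
    ultimately have "norm ((v (fst p) - v (snd p)) * (g (fst p) - g (snd p)) * riesz_kernel \<alpha> (fst p - snd p))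
      \<le> \<eta> * ((v (fst p) - v (snd p))\<^sup>2 * riesz_kernel \<alpha> (fst p - snd p)) + 1/\<eta> * ((g (fst p) - g (snd p))\<^sup>2 * riesz_kernel \<alpha> (fst p - snd p))"
      by (simp only: distrib_right) (simp add: mult_ac)
    then show "ennreal (norm ((v (fst p) - v (snd p)) * (g (fst p) - g (snd p)) * riesz_kernel \<alpha> (fst p - snd p)))
      \<le> ennreal \<eta> * ennreal ((v (fst p) - v (snd p))\<^sup>2 * riesz_kernel \<alpha> (fst p - snd p))
      + ennreal (1/\<eta>) * ennreal ((g (fst p) - g (snd p))\<^sup>2 * riesz_kernel \<alpha> (fst p - snd p))"
      using ennreal_leI[of _ "\<eta> * ((v (fst p) - v (snd p))\<^sup>2 * riesz_kernel \<alpha> (fst p - snd p)) + 1/\<eta> * ((g (fst p) - g (snd p))\<^sup>2 * riesz_kernel \<alpha> (fst p - snd p))"] \<eta>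
      by (simp add: ennreal_mult[symmetric] ennreal_plus[symmetric] del: ennreal_plus)
  qed
  also have "\<dots> = ennreal \<eta> * energy \<alpha> v + ennreal (1/\<eta>) * energy \<alpha> g"
    by (subst nn_integral_add, measurable) (simp add: nn_integral_cmult energy_pair)
  also have "\<dots> \<le> ennreal \<eta> * ennreal E + ennreal (1/\<eta>) * ennreal e" by (intro add_mono mult_left_mono en) auto
  also have "\<dots> = ennreal (\<eta> * E + e / \<eta>)"
    using \<eta> en by (simp add: ennreal_mult[symmetric] ennreal_plus[symmetric] del: ennreal_plus)
  finally show ?thesis using \<eta> en by (subst (asm) ennreal_le_iff) auto
qed

lemma abs_integral_product_le:
  fixes h f :: "'a::euclidean_space \<Rightarrow> real"
  assumes [measurable]: "h \<in> borel_measurable borel" "f \<in> borel_measurable borel"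
    and en: "(\<integral>\<^sup>+x. ennreal ((h x)\<^sup>2) \<partial>lborel) \<le> ennreal H" "(\<integral>\<^sup>+x. ennreal ((f x)\<^sup>2) \<partial>lborel) \<le> ennreal l" "0 \<le> H" "0 \<le> l" and \<eta>: "\<eta> > 0"
  shows "integrable lborel (\<lambda>x. h x * f x)" "\<bar>\<integral>x. h x * f x \<partial>lborel\<bar> \<le> \<eta> * H + l / \<eta>"
proof -
  have le: "(\<integral>\<^sup>+x. ennreal (norm (h x * f x)) \<partial>lborel) \<le> ennreal (\<eta> * H + l / \<eta>)"
  proof -
    have "(\<integral>\<^sup>+x. ennreal (norm (h x * f x)) \<partial>lborel) \<le> (\<integral>\<^sup>+x. ennreal \<eta> * ennreal ((h x)\<^sup>2) + ennreal (1/\<eta>) * ennreal ((f x)\<^sup>2) \<partial>lborel)"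
    proof (rule nn_integral_mono)
      fix x
      have "norm (h x * f x) \<le> \<eta> * (h x)\<^sup>2 + 1/\<eta> * (f x)\<^sup>2"
        using mult_le_weighted_squares[OF \<eta>, of "f x" "h x"] by (simp add: abs_mult mult.commute add.commute)
      then show "ennreal (norm (h x * f x)) \<le> ennreal \<eta> * ennreal ((h x)\<^sup>2) + ennreal (1/\<eta>) * ennreal ((f x)\<^sup>2)"
        using ennreal_leI[of _ "\<eta> * (h x)\<^sup>2 + 1/\<eta> * (f x)\<^sup>2"] \<eta>
        by (simp add: ennreal_mult[symmetric] ennreal_plus[symmetric] del: ennreal_plus)
    qed
    also have "\<dots> = ennreal \<eta> * (\<integral>\<^sup>+x. ennreal ((h x)\<^sup>2) \<partial>lborel) + ennreal (1/\<eta>) * (\<integral>\<^sup>+x. ennreal ((f x)\<^sup>2) \<partial>lborel)"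
      by (subst nn_integral_add, measurable) (simp add: nn_integral_cmult)
    also have "\<dots> \<le> ennreal \<eta> * ennreal H + ennreal (1/\<eta>) * ennreal l" by (intro add_mono mult_left_mono en) auto
    also have "\<dots> = ennreal (\<eta> * H + l / \<eta>)"
      using \<eta> en by (simp add: ennreal_mult[symmetric] ennreal_plus[symmetric] del: ennreal_plus)
    finally show ?thesis .
  qed
  show int: "integrable lborel (\<lambda>x. h x * f x)"
    by (rule integrableI_bounded, measurable) (rule le_less_trans[OF le], simp)
  have "ennreal (norm (\<integral>x. h x * f x \<partial>lborel)) \<le> ennreal (\<eta> * H + l / \<eta>)"
    by (rule order_trans[OF integral_norm_bound_ennreal[OF int] le])
  then show "\<bar>\<integral>x. h x * f x \<partial>lborel\<bar> \<le> \<eta> * H + l / \<eta>" using \<eta> en by (subst (asm) ennreal_le_iff) auto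
qed

text \<open>Both sides depend continuously on g in the norm of the space, in which test functions
  are dense by definition.\<close>

lemma weak_form_W0:
  fixes u g h :: "'a::euclidean_space \<Rightarrow> real"
  assumes D: "open D" "bounded D" and \<alpha>: "0 < \<alpha>" "\<alpha> < 2" and C2: "C_k 2 D u"
    and um[measurable]: "u \<in> borel_measurable borel" and M: "\<And>x. \<bar>u x\<bar> \<le> M" and en: "energy \<alpha> u < \<infinity>"
    and g: "g \<in> W0 \<alpha> D" and hm[measurable]: "h \<in> borel_measurable borel"
    and h: "(\<integral>\<^sup>+x. ennreal ((h x)\<^sup>2) \<partial>lborel) < \<infinity>"
    and eq: "\<And>x. x \<in> D \<Longrightarrow> has_nonlocal_op \<alpha> (\<lambda>_ _. \<kappa>) u x (h x)"
    and g2: "(\<integral>\<^sup>+x. ennreal ((g x)\<^sup>2) \<partial>lborel) < \<infinity>"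
  shows "\<kappa> * (\<integral>p. (u (fst p) - u (snd p)) * (g (fst p) - g (snd p)) * riesz_kernel \<alpha> (fst p - snd p) \<partial>(lborel \<Otimes>\<^sub>M lborel))
    = - 2 * (\<integral>x. h x * g x \<partial>lborel)"
proof -
  let ?M = "(lborel \<Otimes>\<^sub>M lborel) :: ('a \<times> 'a) measure"
  let ?B = "\<lambda>g. \<integral>p. (u (fst p) - u (snd p)) * (g (fst p) - g (snd p)) * riesz_kernel \<alpha> (fst p - snd p) \<partial>?M"
  have gm[measurable]: "g \<in> borel_measurable borel" by (rule W0_borel[OF g])
  obtain \<phi> where \<phi>: "\<And>n. \<phi> n \<in> Cc2 D"
    "(\<lambda>n. energy \<alpha> (\<lambda>x. \<phi> n x - g x)) \<longlonglongrightarrow> 0"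
    "(\<lambda>n. \<integral>\<^sup>+x. ennreal ((\<phi> n x - g x)\<^sup>2) \<partial>lborel) \<longlonglongrightarrow> 0"
    by (rule W0_approx[OF g]) (rule that)
  have [measurable]: "\<phi> n \<in> borel_measurable borel" for n by (rule Cc2_borel[OF \<phi>(1)])
  define E H G where "E = enn2real (energy \<alpha> u)" and "H = enn2real (\<integral>\<^sup>+x. ennreal ((h x)\<^sup>2) \<partial>lborel)"
    and "G = enn2real (\<integral>\<^sup>+x. ennreal ((g x)\<^sup>2) \<partial>lborel)"
  have EH: "energy \<alpha> u = ennreal E" "(\<integral>\<^sup>+x. ennreal ((h x)\<^sup>2) \<partial>lborel) = ennreal H" "(\<integral>\<^sup>+x. ennreal ((g x)\<^sup>2) \<partial>lborel) = ennreal G"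
    "0 \<le> E" "0 \<le> H" "0 \<le> G"
    using en h g2 by (auto simp: E_def H_def G_def less_top)
  define \<Delta> where "\<Delta> = \<kappa> * ?B g + 2 * (\<integral>x. h x * g x \<partial>lborel)"
  have intg: "integrable ?M (\<lambda>p. (u (fst p) - u (snd p)) * (g (fst p) - g (snd p)) * riesz_kernel \<alpha> (fst p - snd p))"
    by (rule integrable_energy_product[OF um gm en W0_energy_finite[OF D \<alpha> g]])
  have bound: "\<bar>\<Delta>\<bar> \<le> \<eta> * (\<bar>\<kappa>\<bar> * (E + 1) + 2 * (H + 1))" if \<eta>: "\<eta> > 0" for \<eta>
  proof -
    \<comment> \<open>The squared errors are taken below \<eta>^2, so that the weighted means with
      weight \<eta> come out of order \<eta>.\<close>
    have "\<forall>\<^sub>F n in sequentially. energy \<alpha> (\<lambda>x. \<phi> n x - g x) < ennreal (\<eta>\<^sup>2) \<and> (\<integral>\<^sup>+x. ennreal ((\<phi> n x - g x)\<^sup>2) \<partial>lborel) < ennreal (\<eta>\<^sup>2)"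
      using \<eta> by (intro eventually_conj ennreal_tendsto_0_less \<phi>) auto
    then obtain n where n: "energy \<alpha> (\<lambda>x. \<phi> n x - g x) \<le> ennreal (\<eta>\<^sup>2)" "(\<integral>\<^sup>+x. ennreal ((\<phi> n x - g x)\<^sup>2) \<partial>lborel) \<le> ennreal (\<eta>\<^sup>2)"
      by (metis (mono_tags, lifting) eventually_happens trivial_limit_sequentially less_imp_le)
    define f where "f x = \<phi> n x - g x" for x
    have fm[measurable]: "f \<in> borel_measurable borel" unfolding f_def[abs_def] by measurable
    have 1: "\<bar>?B f\<bar> \<le> \<eta> * E + \<eta>\<^sup>2 / \<eta>"
      by (rule abs_energy_product_le) (use EH n \<eta> in \<open>auto simp: f_def[abs_def]\<close>)
    have 2: "integrable lborel (\<lambda>x. h x * f x)" "\<bar>\<integral>x. h x * f x \<partial>lborel\<bar> \<le> \<eta> * H + \<eta>\<^sup>2 / \<eta>"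
      by (rule abs_integral_product_le[where H = H and l = "\<eta>\<^sup>2" and \<eta> = \<eta>]; use EH n \<eta> in \<open>auto simp: f_def[abs_def]\<close>)+
    have 3: "integrable lborel (\<lambda>x. h x * g x)"
      by (rule abs_integral_product_le(1)[where H = H and l = G and \<eta> = 1]) (use EH in auto)
    have "\<kappa> * ?B (\<phi> n) = - 2 * (\<integral>x. h x * \<phi> n x \<partial>lborel)"
      by (rule weak_form_Cc2[OF D \<alpha> C2 um M en \<phi>(1) hm eq])
    moreover have "?B (\<phi> n) = ?B g + ?B f"
    proof -
      have "integrable ?M (\<lambda>p. (u (fst p) - u (snd p)) * (f (fst p) - f (snd p)) * riesz_kernel \<alpha> (fst p - snd p))"
        by (rule integrable_energy_product[OF um fm en]) (use le_less_trans[OF n(1) ennreal_less_top] in \<open>auto simp: f_def[abs_def]\<close>)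
      from Bochner_Integration.integral_add[OF intg this]
      have "?B g + ?B f = (\<integral>p. (u (fst p) - u (snd p)) * (g (fst p) - g (snd p)) * riesz_kernel \<alpha> (fst p - snd p)
           + (u (fst p) - u (snd p)) * (f (fst p) - f (snd p)) * riesz_kernel \<alpha> (fst p - snd p) \<partial>?M)" by simp
      also have "\<dots> = ?B (\<phi> n)"
        by (rule Bochner_Integration.integral_cong) (auto simp: f_def algebra_simps)
      finally show ?thesis by simp
    qed
    moreover have "(\<integral>x. h x * \<phi> n x \<partial>lborel) = (\<integral>x. h x * g x \<partial>lborel) + (\<integral>x. h x * f x \<partial>lborel)"
      by (subst Bochner_Integration.integral_add[OF 3 2(1), symmetric]) (simp add: f_def algebra_simps)
    ultimately have "\<Delta> = - \<kappa> * ?B f - 2 * (\<integral>x. h x * f x \<partial>lborel)" unfolding \<Delta>_def by (simp add: algebra_simps)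
    then have "\<bar>\<Delta>\<bar> \<le> \<bar>\<kappa>\<bar> * \<bar>?B f\<bar> + 2 * \<bar>\<integral>x. h x * f x \<partial>lborel\<bar>"
      by (simp only: abs_mult[symmetric])
    also have "\<dots> \<le> \<bar>\<kappa>\<bar> * (\<eta> * E + \<eta>\<^sup>2 / \<eta>) + 2 * (\<eta> * H + \<eta>\<^sup>2 / \<eta>)"
      using 1 2 by (intro add_mono mult_left_mono) auto
    also have "\<dots> = \<eta> * (\<bar>\<kappa>\<bar> * (E + 1) + 2 * (H + 1))" using \<eta> by (simp add: power2_eq_square algebra_simps)
    finally show ?thesis .
  qed
  have "\<bar>\<Delta>\<bar> \<le> 0"
  proof (rule field_le_epsilon)
    fix e :: real assume e: "e > 0"
    define K where "K = \<bar>\<kappa>\<bar> * (E + 1) + 2 * (H + 1)"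
    have K: "K > 0" using EH by (simp add: K_def add_nonneg_pos)
    show "\<bar>\<Delta>\<bar> \<le> 0 + e" using bound[of "e / K", folded K_def] e K by simp
  qed
  then show ?thesis by (simp add: \<Delta>_def)
qed

section \<open>Rates\<close>

lemma W0_L2_finite:
  fixes u :: "'a::euclidean_space \<Rightarrow> real"
  assumes D: "open D" "bounded D" and u: "u \<in> W0 \<alpha> D"
  shows "(\<integral>\<^sup>+x. ennreal ((u x)\<^sup>2) \<partial>lborel) < \<infinity>"
proof -
  obtain \<phi> where \<phi>: "\<And>n. \<phi> n \<in> Cc2 D" "(\<lambda>n. \<integral>\<^sup>+x. ennreal ((\<phi> n x - u x)\<^sup>2) \<partial>lborel) \<longlonglongrightarrow> 0"
    by (rule W0_approx[OF u]) (rule that)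
  have [measurable]: "u \<in> borel_measurable borel" "\<phi> n \<in> borel_measurable borel" "D \<in> sets borel" for n
    using W0_borel[OF u] Cc2_borel[OF \<phi>(1)] D by auto
  obtain n where n: "(\<integral>\<^sup>+x. ennreal ((\<phi> n x - u x)\<^sup>2) \<partial>lborel) < 1"
    using eventually_happens[OF ennreal_tendsto_0_less[OF \<phi>(2), of 1]] by auto
  obtain M where M: "M \<ge> 0" "\<And>x. \<bar>\<phi> n x\<bar> \<le> M" by (rule Cc2_bounded[OF \<phi>(1)]) (rule that)
  have "(\<integral>\<^sup>+x. ennreal ((u x)\<^sup>2) \<partial>lborel) \<le> (\<integral>\<^sup>+x. ennreal (2 * M\<^sup>2) * indicator D x + ennreal 2 * ennreal ((\<phi> n x - u x)\<^sup>2) \<partial>lborel)"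
  proof (rule nn_integral_mono)
    fix x
    have "(u x)\<^sup>2 \<le> 2 * (\<phi> n x)\<^sup>2 + 2 * (\<phi> n x - u x)\<^sup>2" using square_diff_le[of "\<phi> n x" "\<phi> n x - u x"] by simp
    moreover have "(\<phi> n x)\<^sup>2 \<le> M\<^sup>2 * indicator D x"
      using M(2)[of x] Cc2_zero[OF \<phi>(1), of x n] by (cases "x \<in> D") (auto simp: abs_le_square_iff[symmetric] M(1))
    ultimately have "(u x)\<^sup>2 \<le> 2 * M\<^sup>2 * indicator D x + 2 * (\<phi> n x - u x)\<^sup>2" by linarith
    then have "ennreal ((u x)\<^sup>2) \<le> ennreal (2 * M\<^sup>2 * indicator D x + 2 * (\<phi> n x - u x)\<^sup>2)" by (rule ennreal_leI)
    then show "ennreal ((u x)\<^sup>2) \<le> ennreal (2 * M\<^sup>2) * indicator D x + ennreal 2 * ennreal ((\<phi> n x - u x)\<^sup>2)"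
      by (cases "x \<in> D") (simp_all add: ennreal_mult'[symmetric] ennreal_plus[symmetric] del: ennreal_plus ennreal_numeral)
  qed
  also have "\<dots> = ennreal (2 * M\<^sup>2) * emeasure lborel D + ennreal 2 * (\<integral>\<^sup>+x. ennreal ((\<phi> n x - u x)\<^sup>2) \<partial>lborel)"
    by (subst nn_integral_add, measurable) (simp add: nn_integral_cmult nn_integral_cmult_indicator del: ennreal_numeral)
  also have "\<dots> < \<infinity>"
    using emeasure_bounded_finite[OF D(2)] less_trans[OF n ennreal_one_less_top] by (auto simp: ennreal_mult_less_top)
  finally show ?thesis .
qed

text \<open>A ball disjoint from \<open>D\<close> but at bounded distance interacts with every point
  of \<open>D\<close>, and w vanishes on it. This interaction alone already bounds the square
  integral of w.\<close>

lemma fractional_poincare: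
  fixes D :: "'a::euclidean_space set"
  assumes D: "bounded D" "D \<in> sets borel" and \<alpha>: "0 < (\<alpha>::real)"
  shows "\<exists>k>0. \<forall>w \<in> borel_measurable borel. (\<forall>x. x \<notin> D \<longrightarrow> w x = (0::real)) \<longrightarrow>
    ennreal k * (\<integral>\<^sup>+x. ennreal ((w x)\<^sup>2) \<partial>lborel) \<le> energy \<alpha> w"
proof -
  let ?d = "real DIM('a)"
  obtain R where R: "R > 0" "D \<subseteq> ball 0 R" using D(1) by (metis bounded_subset_ballD)
  obtain b :: 'a where b: "b \<in> Basis" using nonempty_Basis by blast
  \<comment> \<open>With centre at distance 3R from the origin the points of this ball have norm
    between 2R and 4R. They are thus outside \<open>D\<close> and at distance at most 5R from its
    points, which gives the lower bound c for the kernel.\<close>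
  define B where "B = ball ((3 * R) *\<^sub>R b) R"
  have B: "norm y > 2 * R" "norm y < 4 * R" if "y \<in> B" for y
  proof -
    have n: "norm ((3 * R) *\<^sub>R b) = 3 * R" using R b by simp
    have d: "norm ((3 * R) *\<^sub>R b - y) < R" using that by (simp add: B_def dist_norm)
    show "norm y > 2 * R" using norm_triangle_ineq2[of "(3 * R) *\<^sub>R b" y] n d by linarith
    show "norm y < 4 * R" using norm_triangle_ineq2[of y "(3 * R) *\<^sub>R b"] n d by (simp add: norm_minus_commute)
  qed
  define m where "m = measure lborel B"
  have m: "emeasure lborel B = ennreal m" "m > 0"
  proof -
    show "emeasure lborel B = ennreal m" using emeasure_lborel_ball_finite[of "(3 * R) *\<^sub>R b" R]
      unfolding m_def B_def by (simp add: emeasure_eq_ennreal_measure less_top)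
    show "m > 0" using R unfolding m_def B_def by (simp add: content_ball_pos)
  qed
  define c where "c = (5 * R) powr - (?d + \<alpha>)"
  have c: "c > 0" using R by (simp add: c_def)
  have [measurable]: "B \<in> sets borel" by (simp add: B_def)
  show ?thesis
  proof (intro exI[of _ "c * m"] conjI ballI impI)
    show "c * m > 0" using c m by simp
    fix w :: "'a \<Rightarrow> real" assume [measurable]: "w \<in> borel_measurable borel" and w: "\<forall>x. x \<notin> D \<longrightarrow> w x = 0"
    have "ennreal (c * m) * (\<integral>\<^sup>+x. ennreal ((w x)\<^sup>2) \<partial>lborel) = (\<integral>\<^sup>+x. ennreal (c * m) * ennreal ((w x)\<^sup>2) \<partial>lborel)"
      by (rule nn_integral_cmult[symmetric]) measurable
    also have "\<dots> \<le> energy \<alpha> w" unfolding energy_def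
    proof (rule nn_integral_mono)
      fix x
      show "ennreal (c * m) * ennreal ((w x)\<^sup>2) \<le> (\<integral>\<^sup>+y. ennreal ((w x - w y)\<^sup>2 * riesz_kernel \<alpha> (x - y)) \<partial>lborel)"
      proof (cases "x \<in> D")
        case True
        then have nx: "norm x < R" using R by auto
        have "ennreal (c * m) * ennreal ((w x)\<^sup>2) = (\<integral>\<^sup>+y. ennreal (c * (w x)\<^sup>2) * indicator B y \<partial>lborel)"
          using c m by (subst nn_integral_cmult_indicator) (auto simp: ennreal_mult[symmetric] mult_ac)
        also have "\<dots> \<le> (\<integral>\<^sup>+y. ennreal ((w x - w y)\<^sup>2 * riesz_kernel \<alpha> (x - y)) \<partial>lborel)"
        proof (rule nn_integral_mono)
          fix y
          show "ennreal (c * (w x)\<^sup>2) * indicator B y \<le> ennreal ((w x - w y)\<^sup>2 * riesz_kernel \<alpha> (x - y))"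
          proof (cases "y \<in> B")
            case True
            have "y \<notin> D" using B(1)[OF True] R by auto
            then have wy: "w y = 0" using w by blast
            have n0: "0 < norm (x - y)" using norm_triangle_ineq2[of y x] B(1)[OF True] nx R
              unfolding norm_minus_commute[of x y] by linarith
            have "norm (x - y) \<le> 5 * R" using norm_triangle_ineq4[of x y] B(2)[OF True] nx by linarith
            then have "c \<le> riesz_kernel \<alpha> (x - y)" unfolding c_def riesz_kernel_def
              by (intro powr_mono2') (use n0 \<alpha> in auto)
            then have "c * (w x)\<^sup>2 \<le> riesz_kernel \<alpha> (x - y) * (w x)\<^sup>2" by (rule mult_right_mono) simp
            then show ?thesis using True wy by (simp add: mult.commute ennreal_leI)
          qed simp
        qed
        finally show ?thesis .
      qed (use w in simp)
    qed
    finally show "ennreal (c * m) * (\<integral>\<^sup>+x. ennreal ((w x)\<^sup>2) \<partial>lborel) \<le> energy \<alpha> w" .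
  qed
qed

section \<open>Orders of the remainder terms\<close>

definition hom_rate :: "real \<Rightarrow> real \<Rightarrow> real" where
  "hom_rate \<alpha> \<epsilon> = (if \<alpha> < 1 then \<epsilon> powr (\<alpha> / 2)
                        else if \<alpha> = 1 then \<epsilon> powr (1 / 2) * (1 + \<bar>ln \<epsilon>\<bar>\<^sup>2)
                        else \<epsilon> powr ((2 - \<alpha>) / 2))"

lemma boundary_modulus_increment:
  assumes "boundary_modulus D (\<alpha>/2) v C0" "0 \<le> s" "s \<le> 2 - \<alpha>" "x \<notin> frontier D"
  shows "\<bar>v x - v y\<bar> \<le> (C0 * bdist D x powr -(s/2)) * norm (x - y) powr ((\<alpha> + s) / 2)"
proof -
  have "\<bar>v x - v y\<bar> \<le> C0 * norm (x - y) powr (\<alpha>/2 + s/2) * bdist D x powr -(s/2)"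
    using assms unfolding boundary_modulus_def by (elim allE[of _ x] allE[of _ y] allE[of _ "s/2"]) auto
  then show ?thesis by (simp add: add_divide_distrib mult_ac)
qed

lemma nn_integral_boundary_weight:
  fixes D :: "'a::euclidean_space set"
  assumes c: "(\<integral>\<^sup>+x\<in>D. ennreal (bdist D x powr -s) \<partial>lborel) \<le> ennreal c" "0 \<le> c" and [measurable]: "D \<in> sets borel"
  shows "(\<integral>\<^sup>+x\<in>D. ennreal ((C0 * bdist D x powr -(s/2))\<^sup>2) \<partial>lborel) \<le> ennreal (C0\<^sup>2 * c)"
proof -
  have "(C0 * bdist D x powr -(s/2))\<^sup>2 = C0\<^sup>2 * bdist D x powr -s" for x
    by (simp add: power_mult_distrib power2_eq_square powr_add[symmetric])
  then have "(\<integral>\<^sup>+x\<in>D. ennreal ((C0 * bdist D x powr -(s/2))\<^sup>2) \<partial>lborel) = (\<integral>\<^sup>+x. ennreal (C0\<^sup>2) * (ennreal (bdist D x powr -s) * indicator D x) \<partial>lborel)"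
    by (intro nn_integral_cong) (simp add: ennreal_mult mult.assoc)
  also have "\<dots> = ennreal (C0\<^sup>2) * (\<integral>\<^sup>+x\<in>D. ennreal (bdist D x powr -s) \<partial>lborel)" by (rule nn_integral_cmult) measurable
  also have "\<dots> \<le> ennreal (C0\<^sup>2) * ennreal c" by (intro mult_left_mono c) auto
  also have "\<dots> = ennreal (C0\<^sup>2 * c)" using c by (simp add: ennreal_mult)
  finally show ?thesis .
qed

text \<open>Two constraints limit s: the increments of the limit gain at most s = 2 - \<alpha>, and
  the weight with exponent -s is integrable only for s < 1. The first is the binding one for
  \<alpha> > 1, the second for \<alpha> < 1, and at \<alpha> = 1 both meet, so that s approaches 1
  at a logarithmic cost.\<close>

lemma rate_bound:
  fixes v :: "'a::euclidean_space \<Rightarrow> real" and \<alpha> C0 :: real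
  assumes D: "bounded D" "C11_domain D" and vm: "v \<in> borel_measurable borel" and v0: "\<And>x. x \<notin> D \<Longrightarrow> v x = 0"
    and mod: "boundary_modulus D (\<alpha>/2) v C0" "C0 \<ge> 0" and \<alpha>: "0 < \<alpha>" "\<alpha> < 2" and bd: "\<And>x. \<bar>v x\<bar> \<le> Mv"
    and B: "B \<in> sets borel" "bounded B" "D \<subseteq> B"
  shows "\<exists>A\<ge>0. \<forall>\<epsilon>. 0 < \<epsilon> \<longrightarrow> \<epsilon> < 1 \<longrightarrow> (\<exists>y x. 0 \<le> y \<and> 0 \<le> x \<and> cut_energy \<epsilon> \<alpha> v \<le> ennreal y \<and>
      (\<integral>\<^sup>+x\<in>B. (reg_op \<epsilon> \<alpha> v x)\<^sup>2 \<partial>lborel) \<le> ennreal x \<and> y + \<epsilon> powr \<alpha> * x \<le> A * (hom_rate \<alpha> \<epsilon>)\<^sup>2)"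
proof -
  let ?d = "real DIM('a)" and ?V = "unit_ball_vol DIM('a)"
  have op: "open D" by (rule C11_domain_open[OF D(2)])
  have Dm: "D \<in> sets borel" using op by auto
  have Dfr: "x \<notin> frontier D" if "x \<in> D" for x
    using op that by (metis disjoint_iff frontier_disjoint_eq)
  obtain Cb where Cb: "Cb > 0" "\<And>s. 0 < s \<Longrightarrow> s < 1 \<Longrightarrow>
      (\<integral>\<^sup>+x\<in>B - frontier D. ennreal (bdist D x powr -s) \<partial>lborel) \<le> ennreal (Cb / (1 - s))"
    using nn_integral_bdist_powr_le[OF D B(1,2)] by blast
  have CD: "(\<integral>\<^sup>+x\<in>D. ennreal (bdist D x powr -s) \<partial>lborel) \<le> ennreal (Cb / (1 - s))" if "0 < s" "s < 1" for s
    by (rule order_trans[OF _ Cb(2)[OF that]], rule nn_integral_mono) (use Dfr B(3) in \<open>auto simp: indicator_def\<close>)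
  have Y: "cut_energy \<epsilon> \<alpha> v \<le> ennreal (2 * ?V * (?d / s + 2 + ?d) * (C0\<^sup>2 * (Cb / (1 - s))) * \<epsilon> powr s)"
    if "\<epsilon> > 0" "0 < s" "s < 1" "s \<le> 2 - \<alpha>" for \<epsilon> s
    by (rule cut_energy_increment_le[OF op vm v0, where w = "\<lambda>x. C0 * bdist D x powr -(s/2)"])
       (use that \<alpha> Cb(1) boundary_modulus_increment[OF mod(1)] Dfr
          nn_integral_boundary_weight[OF CD[OF that(2,3)] _ Dm] in auto)
  have X: "(\<integral>\<^sup>+x\<in>B. (reg_op \<epsilon> \<alpha> v x)\<^sup>2 \<partial>lborel)
    \<le> ennreal ((C0 * (?V * (1 + (?d + (\<alpha> - s) / 2) / ((\<alpha> - s) / 2))))\<^sup>2 * \<epsilon> powr (s - \<alpha>) * (Cb / (1 - s)))"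
    if "\<epsilon> > 0" "0 < s" "s < 1" "s \<le> 2 - \<alpha>" "s < \<alpha>" for \<epsilon> s
    by (rule square_integral_reg_op_le[OF D vm mod that(1,2,5,4) B(1) Cb(2)[OF that(2,3)]]) (use that Cb(1) in auto)
  have sq: "(z powr a)\<^sup>2 = z powr (2 * a)" for z a :: real
    by (simp add: power2_eq_square powr_add[symmetric])
  consider "\<alpha> < 1" | "\<alpha> = 1" | "\<alpha> > 1" by linarith
  then show ?thesis
  proof cases
    case 1
    \<comment> \<open>Any s strictly between \<alpha> and 1 works. Then \<epsilon>^s \<le>
      \<epsilon>^\<alpha>, and the truncated operator contributes \<epsilon>^\<alpha> times a
      constant, which decides the rate.\<close>
    define s where "s = (1 + \<alpha>) / 2"
    have s: "0 < s" "s < 1" "s \<le> 2 - \<alpha>" "\<alpha> < s" using 1 \<alpha> by (auto simp: s_def)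
    obtain X0 where X0: "X0 \<ge> 0" "\<And>\<epsilon>. \<epsilon> > 0 \<Longrightarrow> (\<integral>\<^sup>+x\<in>B. (reg_op \<epsilon> \<alpha> v x)\<^sup>2 \<partial>lborel) \<le> ennreal X0"
      using square_integral_reg_op_le_uniform[OF D vm mod \<alpha>(1) bd s(4,2,3) B(1,2) Cb(2)[OF s(1,2)]] Cb(1) s by auto
    define K where "K = 2 * ?V * (?d / s + 2 + ?d) * (C0\<^sup>2 * (Cb / (1 - s)))"
    have K: "K \<ge> 0" using s Cb(1) by (simp add: K_def)
    show ?thesis
    proof (rule exI[of _ "K + X0"], intro conjI allI impI)
      show "0 \<le> K + X0" using K X0 by simp
      fix \<epsilon> :: real assume \<epsilon>: "0 < \<epsilon>" "\<epsilon> < 1"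
      have "\<epsilon> powr s \<le> \<epsilon> powr \<alpha>" by (rule powr_mono') (use \<epsilon> s in auto)
      then have "K * \<epsilon> powr s + \<epsilon> powr \<alpha> * X0 \<le> (K + X0) * \<epsilon> powr \<alpha>"
        using K by (simp add: algebra_simps mult_left_mono)
      moreover have "(hom_rate \<alpha> \<epsilon>)\<^sup>2 = \<epsilon> powr \<alpha>" using 1 by (simp add: hom_rate_def sq)
      ultimately have "K * \<epsilon> powr s + \<epsilon> powr \<alpha> * X0 \<le> (K + X0) * (hom_rate \<alpha> \<epsilon>)\<^sup>2" by simp
      moreover have "0 \<le> K * \<epsilon> powr s" "0 \<le> X0" using K X0(1) by auto
      ultimately show "\<exists>y x. 0 \<le> y \<and> 0 \<le> x \<and> cut_energy \<epsilon> \<alpha> v \<le> ennreal y \<and>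
        (\<integral>\<^sup>+x\<in>B. (reg_op \<epsilon> \<alpha> v x)\<^sup>2 \<partial>lborel) \<le> ennreal x \<and> y + \<epsilon> powr \<alpha> * x \<le> (K + X0) * (hom_rate \<alpha> \<epsilon>)\<^sup>2"
        using Y[OF \<epsilon>(1) s(1-3), folded K_def] X0(2)[OF \<epsilon>(1)] by blast
    qed
  next
    case 3
    \<comment> \<open>The largest exponent that the modulus allows; it is below 1 and below \<alpha>
      precisely because \<alpha> > 1. Both remainders are then of order \<epsilon>^s.\<close>
    define s where "s = 2 - \<alpha>"
    have s: "0 < s" "s < 1" "s \<le> 2 - \<alpha>" "s < \<alpha>" using 3 \<alpha> by (auto simp: s_def)
    define K where "K = 2 * ?V * (?d / s + 2 + ?d) * (C0\<^sup>2 * (Cb / (1 - s)))"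
    define K' where "K' = (C0 * (?V * (1 + (?d + (\<alpha> - s) / 2) / ((\<alpha> - s) / 2))))\<^sup>2 * (Cb / (1 - s))"
    have K: "K \<ge> 0" "K' \<ge> 0" using s Cb(1) by (auto simp: K_def K'_def)
    show ?thesis
    proof (rule exI[of _ "K + K'"], intro conjI allI impI)
      show "0 \<le> K + K'" using K by simp
      fix \<epsilon> :: real assume \<epsilon>: "0 < \<epsilon>" "\<epsilon> < 1"
      have e: "\<epsilon> powr \<alpha> * \<epsilon> powr (s - \<alpha>) = \<epsilon> powr s" by (simp add: powr_add[symmetric])
      have X': "(\<integral>\<^sup>+x\<in>B. (reg_op \<epsilon> \<alpha> v x)\<^sup>2 \<partial>lborel) \<le> ennreal (K' * \<epsilon> powr (s - \<alpha>))"
        by (rule order_trans[OF X[OF \<epsilon>(1) s]]) (simp add: K'_def mult_ac)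
      have h: "2 * ((2 - \<alpha>) / 2) = s" by (simp add: s_def)
      have "(\<epsilon> powr ((2 - \<alpha>) / 2))\<^sup>2 = \<epsilon> powr s" by (simp only: sq h)
      then have "(hom_rate \<alpha> \<epsilon>)\<^sup>2 = \<epsilon> powr s" using 3 by (simp add: hom_rate_def)
      moreover have "K * \<epsilon> powr s + \<epsilon> powr \<alpha> * (K' * \<epsilon> powr (s - \<alpha>)) = (K + K') * \<epsilon> powr s"
        unfolding e[symmetric] by (simp add: algebra_simps)
      ultimately have "K * \<epsilon> powr s + \<epsilon> powr \<alpha> * (K' * \<epsilon> powr (s - \<alpha>)) \<le> (K + K') * (hom_rate \<alpha> \<epsilon>)\<^sup>2" by simp
      moreover have "0 \<le> K * \<epsilon> powr s" "0 \<le> (K' * \<epsilon> powr (s - \<alpha>))" using K  by auto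
      ultimately show "\<exists>y x. 0 \<le> y \<and> 0 \<le> x \<and> cut_energy \<epsilon> \<alpha> v \<le> ennreal y \<and>
        (\<integral>\<^sup>+x\<in>B. (reg_op \<epsilon> \<alpha> v x)\<^sup>2 \<partial>lborel) \<le> ennreal x \<and> y + \<epsilon> powr \<alpha> * x \<le> (K + K') * (hom_rate \<alpha> \<epsilon>)\<^sup>2"
        using Y[OF \<epsilon>(1) s(1-3), folded K_def] X' by blast
    qed
  next
    case 2
    define K where "K = 2 * ?V * (3 * ?d + 2) * (C0\<^sup>2 * Cb)"
    define K' where "K' = (C0 * (?V * (2 + 2 * ?d)))\<^sup>2 * Cb"
    have K: "K \<ge> 0" "K' \<ge> 0" using Cb(1) by (auto simp: K_def K'_def)
    \<comment> \<open>192 is the product of the 3 lost in \<epsilon>^s and the 64 lost in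
      L^4.\<close>
    show ?thesis
    proof (rule exI[of _ "(K + K') * 192"], intro conjI allI impI)
      show "0 \<le> (K + K') * 192" using K by simp
      fix \<epsilon> :: real assume \<epsilon>: "0 < \<epsilon>" "\<epsilon> < 1"
      define l where "l = \<bar>ln \<epsilon>\<bar>"
      \<comment> \<open>The 2 keeps s \<ge> 1/2, so that 1/s stays bounded also when \<epsilon> is
        near 1.\<close>
      define L where "L = 2 + l"
      have l: "l \<ge> 0" "ln \<epsilon> = - l" using \<epsilon> by (auto simp: l_def)
      have L: "L \<ge> 2" using l by (simp add: L_def)
      define s where "s = 1 - 1 / L"
      have "1 / L \<le> 1 / 2" using L by (intro divide_left_mono) auto
      then have s: "1 / 2 \<le> s" "s < 1" "1 - s = 1 / L" using L by (auto simp: s_def)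
      then have s': "0 < s" "s < 1" "s \<le> 2 - \<alpha>" "s < \<alpha>" using 2 by auto
      \<comment> \<open>The factor lost against \<epsilon> is \<epsilon>^(-1/L) = exp (l / L) \<le>
        exp 1; this is why 1 - s is taken inversely proportional to the logarithm.\<close>
      have es: "\<epsilon> powr s \<le> 3 * \<epsilon>"
      proof -
        have "\<epsilon> powr s = exp (- l * (1 - 1 / L))" using \<epsilon> l by (simp add: powr_def s_def mult.commute)
        also have "- l * (1 - 1 / L) = - l + l / L" by (simp add: algebra_simps)
        also have "exp (- l + l / L) = \<epsilon> * exp (l / L)" using \<epsilon> l by (simp add: exp_add flip: l(2))
        also have "exp (l / L) \<le> exp 1" using L l by (simp add: L_def)
        also have "exp 1 \<le> (3::real)" by (rule exp_le)
        finally show ?thesis using \<epsilon> by (simp add: mult.commute)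
      qed
      \<comment> \<open>The losses are L in y, and L^3 in x: twice 1/q from the squared tail
        constant and once 1 / (1 - s). Both are rounded up to L^4, which compares with the square of
        1 + l^2.\<close>
      have L4: "L ^ 4 \<le> 64 * (1 + l\<^sup>2)\<^sup>2"
      proof -
        have "L\<^sup>2 \<le> 8 + 2 * l\<^sup>2" using square_diff_le[of 2 "-l"] by (simp add: L_def)
        also have "\<dots> \<le> 8 + 8 * l\<^sup>2" by (intro add_left_mono mult_right_mono) auto
        also have "\<dots> = 8 * (1 + l\<^sup>2)" by simp
        finally have "(L\<^sup>2)\<^sup>2 \<le> (8 * (1 + l\<^sup>2))\<^sup>2" by (intro power_mono) auto
        moreover have "(L\<^sup>2)\<^sup>2 = L ^ 4" by (simp flip: power_mult)
        moreover have "(8 * (1 + l\<^sup>2))\<^sup>2 = 64 * (1 + l\<^sup>2)\<^sup>2" by (simp only: power_mult_distrib) simp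
        ultimately show ?thesis by (simp only:)
      qed
      have L1: "L \<le> L ^ 4" "L ^ 3 \<le> L ^ 4" using L power_increasing[of 1 4 L] power_increasing[of 3 4 L] by auto
      define y x where "y = 2 * ?V * (?d / s + 2 + ?d) * (C0\<^sup>2 * (Cb / (1 - s))) * \<epsilon> powr s"
        and "x = (C0 * (?V * (1 + (?d + (\<alpha> - s) / 2) / ((\<alpha> - s) / 2))))\<^sup>2 * \<epsilon> powr (s - \<alpha>) * (Cb / (1 - s))"
      have pos: "0 \<le> y" "0 \<le> x" using s' Cb(1) by (auto simp: y_def x_def)
      have y: "y \<le> K * (L ^ 4 * (3 * \<epsilon>))"
      proof -
        have "?d / s \<le> ?d / (1 / 2)" using s s' by (intro divide_left_mono) auto
        then have a: "2 * ?V * (?d / s + 2 + ?d) \<le> 2 * ?V * (3 * ?d + 2)" by (intro mult_left_mono) auto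
        have q: "C0\<^sup>2 * (Cb / (1 - s)) = C0\<^sup>2 * Cb * L" by (simp add: s(3))
        have q0: "0 \<le> C0\<^sup>2 * Cb * L" using Cb(1) L by simp
        have "y \<le> 2 * ?V * (3 * ?d + 2) * (C0\<^sup>2 * Cb * L) * (3 * \<epsilon>)"
          unfolding y_def q by (rule mult_mono[OF mult_right_mono[OF a q0] es]) (use q0 in auto)
        also have "\<dots> = K * (L * (3 * \<epsilon>))" by (simp add: K_def mult_ac)
        also have "\<dots> \<le> K * (L ^ 4 * (3 * \<epsilon>))" using K L1 \<epsilon> by (intro mult_left_mono mult_right_mono) auto
        finally show ?thesis .
      qed
      have x: "\<epsilon> powr \<alpha> * x \<le> K' * (L ^ 4 * (3 * \<epsilon>))"
      proof -
        \<comment> \<open>Since \<alpha> = 1, the deficit is half of 1 - s, and the tail constant (d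
          + q) / q grows linearly in L.\<close>
        have q: "(\<alpha> - s) / 2 = 1 / (2 * L)" using 2 s(3) by (simp add: field_simps)
        have "1 + (?d + (\<alpha> - s) / 2) / ((\<alpha> - s) / 2) = 2 + 2 * ?d * L" unfolding q using L by (simp add: field_simps)
        also have "\<dots> \<le> (2 + 2 * ?d) * L" using L by (simp add: algebra_simps)
        finally have a: "1 + (?d + (\<alpha> - s) / 2) / ((\<alpha> - s) / 2) \<le> (2 + 2 * ?d) * L" .
        have a0: "0 \<le> 1 + (?d + (\<alpha> - s) / 2) / ((\<alpha> - s) / 2)" using s' by simp
        have "(C0 * (?V * (1 + (?d + (\<alpha> - s) / 2) / ((\<alpha> - s) / 2))))\<^sup>2 \<le> (C0 * (?V * ((2 + 2 * ?d) * L)))\<^sup>2"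
          using mod(2) a a0 by (intro power_mono mult_left_mono mult_nonneg_nonneg) auto
        also have "\<dots> = (C0 * (?V * (2 + 2 * ?d)))\<^sup>2 * L\<^sup>2" by (simp add: power_mult_distrib)
        finally have b: "(C0 * (?V * (1 + (?d + (\<alpha> - s) / 2) / ((\<alpha> - s) / 2))))\<^sup>2 \<le> (C0 * (?V * (2 + 2 * ?d)))\<^sup>2 * L\<^sup>2" .
        have e: "\<epsilon> powr \<alpha> * \<epsilon> powr (s - \<alpha>) = \<epsilon> powr s" by (simp add: powr_add[symmetric])
        have "\<epsilon> powr \<alpha> * x = (C0 * (?V * (1 + (?d + (\<alpha> - s) / 2) / ((\<alpha> - s) / 2))))\<^sup>2 * (Cb * L) * \<epsilon> powr s"
          unfolding x_def s(3) e[symmetric] by (simp add: mult_ac)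
        also have "\<dots> \<le> (C0 * (?V * (2 + 2 * ?d)))\<^sup>2 * L\<^sup>2 * (Cb * L) * (3 * \<epsilon>)"
          by (rule mult_mono[OF mult_right_mono[OF b] es]) (use Cb(1) L in auto)
        also have "\<dots> = K' * (L ^ 3 * (3 * \<epsilon>))" by (simp add: K'_def power2_eq_square power3_eq_cube mult_ac)
        also have "\<dots> \<le> K' * (L ^ 4 * (3 * \<epsilon>))" using K L1 \<epsilon> by (intro mult_left_mono mult_right_mono) auto
        finally show ?thesis .
      qed
      have "y + \<epsilon> powr \<alpha> * x \<le> (K + K') * (3 * \<epsilon>) * L ^ 4" using y x by (simp add: algebra_simps)
      also have "\<dots> \<le> (K + K') * (3 * \<epsilon>) * (64 * (1 + l\<^sup>2)\<^sup>2)" using K \<epsilon> by (intro mult_left_mono L4) auto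
      also have "\<dots> = (K + K') * 192 * (hom_rate \<alpha> \<epsilon>)\<^sup>2"
        using 2 \<epsilon> by (simp add: hom_rate_def power_mult_distrib sq l_def)
      finally have "y + \<epsilon> powr \<alpha> * x \<le> (K + K') * 192 * (hom_rate \<alpha> \<epsilon>)\<^sup>2" .
      then show "\<exists>y x. 0 \<le> y \<and> 0 \<le> x \<and> cut_energy \<epsilon> \<alpha> v \<le> ennreal y \<and>
        (\<integral>\<^sup>+x\<in>B. (reg_op \<epsilon> \<alpha> v x)\<^sup>2 \<partial>lborel) \<le> ennreal x \<and> y + \<epsilon> powr \<alpha> * x \<le> (K + K') * 192 * (hom_rate \<alpha> \<epsilon>)\<^sup>2"
        using pos Y[OF \<epsilon>(1) s'(1-3)] X[OF \<epsilon>(1) s'] unfolding y_def[symmetric] x_def[symmetric] by blast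
    qed
  qed
qed

lemma integrable_energy_product_coeff:
  fixes v g :: "'a::euclidean_space \<Rightarrow> real" and F :: "'a \<times> 'a \<Rightarrow> real"
  assumes "v \<in> borel_measurable borel" "g \<in> borel_measurable borel"
    and "energy \<alpha> v < \<infinity>" "energy \<alpha> g < \<infinity>"
    and F[measurable]: "F \<in> borel_measurable borel" and M: "\<And>p. \<bar>F p\<bar> \<le> M"
  shows "integrable (lborel \<Otimes>\<^sub>M lborel) (\<lambda>p. (v (fst p) - v (snd p)) * (g (fst p) - g (snd p)) * riesz_kernel \<alpha> (fst p - snd p) * F p)"
proof -
  let ?M = "(lborel \<Otimes>\<^sub>M lborel) :: ('a \<times> 'a) measure"
  let ?H = "\<lambda>p. (v (fst p) - v (snd p)) * (g (fst p) - g (snd p)) * riesz_kernel \<alpha> (fst p - snd p)"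
  have H: "integrable ?M ?H" by (rule integrable_energy_product[OF assms(1-4)])
  have M0: "0 \<le> M" using M[of 0] by linarith
  show ?thesis
  proof (rule Bochner_Integration.integrable_bound[of _ "\<lambda>p. M * ?H p"])
    show "integrable ?M (\<lambda>p. M * ?H p)" using H by simp
    have [measurable]: "?H \<in> borel_measurable ?M" using H by simp
    have [measurable]: "F \<in> borel_measurable ?M" using F by (simp add: lborel_prod)
    show "(\<lambda>p. ?H p * F p) \<in> borel_measurable ?M" by measurable
    show "AE p in ?M. norm (?H p * F p) \<le> norm (M * ?H p)"
    proof (rule AE_I2)
      fix p
      have "\<bar>?H p\<bar> * \<bar>F p\<bar> \<le> \<bar>?H p\<bar> * M" by (intro mult_left_mono M) simp
      then show "norm (?H p * F p) \<le> norm (M * ?H p)"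
        unfolding real_norm_def abs_mult[of "?H p" "F p"] abs_mult[of M "?H p"] using M0 by (simp add: mult.commute)
    qed
  qed
qed

section \<open>The error equation\<close>

lemma dirichlet_form_eq:
  fixes u g :: "'a::euclidean_space \<Rightarrow> real"
  shows "dirichlet_form \<alpha> \<kappa> u g = 1/2 * (\<integral>p. (u (fst p) - u (snd p)) * (g (fst p) - g (snd p)) * riesz_kernel \<alpha> (fst p - snd p) * \<kappa> (fst p) (snd p) \<partial>(lborel \<Otimes>\<^sub>M lborel))"
proof -
  have "jump_kernel \<alpha> \<kappa> x y = riesz_kernel \<alpha> (x - y) * \<kappa> x y" for x y
    by (simp only: jump_kernel_def riesz_kernel_def powr_minus divide_inverse mult.commute)
  then show ?thesis unfolding dirichlet_form_def by (simp only: case_prod_unfold mult.assoc)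
qed

text \<open>The coefficient is regarded as one function on the product space. A unit vector there
  moves only one of the two arguments, so periodicity is used with the other lattice vector equal to
  0. It makes the mean vanish over every translate of the cube, not only over the cube
  itself.\<close>

lemma kernel_mean_zero:
  fixes K :: "'a::euclidean_space \<Rightarrow> 'a \<Rightarrow> real"
  assumes K: "C_k 2 UNIV (\<lambda>(x, y). K x y)"
    and per: "\<And>x y k l. k \<in> int_lattice \<Longrightarrow> l \<in> int_lattice \<Longrightarrow> K (x + k) (y + l) = K x y"
    and bd: "\<And>x y. \<bar>K x y\<bar> \<le> M"
  defines "F \<equiv> (\<lambda>p. K (fst p) (snd p) - torus_mean K)"
  shows "F \<in> borel_measurable borel" "(\<integral>q. indicator (cbox 0 One) q * F (q + p) \<partial>lborel) = 0"
proof -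
  let ?K = "\<lambda>p. K (fst p) (snd p)" and ?Q = "cbox 0 (One :: 'a \<times> 'a)"
  have "continuous_on UNIV ?K" using C_k_D(2)[OF K, of "[]"] by (simp add: case_prod_unfold)
  then have Km[measurable]: "?K \<in> borel_measurable borel" by (rule borel_measurable_continuous_onI)
  show Fm: "F \<in> borel_measurable borel" unfolding F_def by measurable
  have lat: "b \<in> int_lattice" if "b \<in> Basis" for b :: 'a
    using that by (auto simp: int_lattice_def inner_Basis)
  have lat0: "0 \<in> (int_lattice :: 'a set)" by (simp add: int_lattice_def)
  have perF: "F (p + e) = F p" if "e \<in> Basis" for p e
  proof -
    have "(\<exists>b\<in>Basis. e = (b, 0)) \<or> (\<exists>b\<in>Basis. e = (0, b))" using that by (auto simp: Basis_prod_def)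
    then show ?thesis unfolding F_def using per[OF lat lat0] per[OF lat0 lat] by auto
  qed
  have bdF: "\<bar>F p\<bar> \<le> M + \<bar>torus_mean K\<bar>" for p
    using bd[of "fst p" "snd p"] unfolding F_def by linarith
  have eQ: "emeasure lborel ?Q = 1" "measure lborel ?Q = 1" by (simp_all add: emeasure_lborel_cbox_eq measure_lborel_cbox_eq)
  have i1: "integrable lborel (\<lambda>q. indicator ?Q q * c :: real)" for c
    by (intro integrable_mult_left integrable_real_indicator) (auto simp: eQ)
  have i2: "integrable lborel (\<lambda>q. indicator ?Q q * ?K q)"
  proof (rule Bochner_Integration.integrable_bound[OF i1[of M]])
    show "AE q in lborel. norm (indicator ?Q q * ?K q) \<le> norm (indicator ?Q q * M)"
      by (rule AE_I2) (use bd in \<open>auto simp: indicator_def intro: order_trans[OF _ abs_ge_self]\<close>)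
  qed measurable
  have mean: "torus_mean K = (\<integral>q. indicator ?Q q * ?K q \<partial>lborel)"
    unfolding torus_mean_def set_lebesgue_integral_def cbox_pair_One lborel_prod by (simp add: case_prod_unfold)
  have "(\<integral>q. indicator ?Q q * F (q + p) \<partial>lborel) = (\<integral>q. indicator ?Q q * F q \<partial>lborel)"
    by (rule integral_unit_cube_periodic[OF Fm bdF perF])
  also have "\<dots> = (\<integral>q. indicator ?Q q * ?K q - indicator ?Q q * torus_mean K \<partial>lborel)"
    by (simp add: F_def right_diff_distrib)
  also have "\<dots> = torus_mean K - 1 * torus_mean K"
    using i1[of "torus_mean K"] i2 mean eQ by simp
  finally show "(\<integral>q. indicator (cbox 0 One) q * F (q + p) \<partial>lborel) = 0" by simp
qed

lemma hom_rate_pos: "\<epsilon> > 0 \<Longrightarrow> hom_rate \<alpha> \<epsilon> > 0"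
  by (auto simp: hom_rate_def add_pos_nonneg)

lemma energy_eq_integral:
  fixes d :: "'a::euclidean_space \<Rightarrow> real"
  assumes [measurable]: "d \<in> borel_measurable borel" and "energy \<alpha> d < \<infinity>"
  shows "energy \<alpha> d = ennreal (\<integral>p. (d (fst p) - d (snd p)) * (d (fst p) - d (snd p)) * riesz_kernel \<alpha> (fst p - snd p) \<partial>(lborel \<Otimes>\<^sub>M lborel))"
proof -
  have "energy \<alpha> d = (\<integral>\<^sup>+p. ennreal ((d (fst p) - d (snd p)) * (d (fst p) - d (snd p)) * riesz_kernel \<alpha> (fst p - snd p)) \<partial>(lborel \<Otimes>\<^sub>M lborel))"
    by (simp add: energy_pair[symmetric] power2_eq_square)
  also have "\<dots> = ennreal (\<integral>p. (d (fst p) - d (snd p)) * (d (fst p) - d (snd p)) * riesz_kernel \<alpha> (fst p - snd p) \<partial>(lborel \<Otimes>\<^sub>M lborel))"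
    by (rule nn_integral_eq_integral[OF integrable_energy_product]) (use assms in auto)
  finally show ?thesis .
qed

text \<open>The error \<open>d = u - v\<close> tested against itself: both weak equations have the same right-hand side,
  so only the form with the oscillating coefficient of mean zero remains.\<close>

lemma error_energy_identity:
  fixes u v :: "'a::euclidean_space \<Rightarrow> real" and \<kappa> :: "'a \<times> 'a \<Rightarrow> real" and c :: real
  assumes u[measurable]: "u \<in> borel_measurable borel" and v[measurable]: "v \<in> borel_measurable borel"
    and en: "energy \<alpha> u < \<infinity>" "energy \<alpha> v < \<infinity>"
    and \<kappa>[measurable]: "\<kappa> \<in> borel_measurable borel" and M: "\<And>p. \<bar>\<kappa> p\<bar> \<le> M"
  defines "B \<equiv> (\<lambda>f g. \<integral>p. (f (fst p) - f (snd p)) * (g (fst p) - g (snd p)) * riesz_kernel \<alpha> (fst p - snd p) * \<kappa> p \<partial>(lborel \<Otimes>\<^sub>M lborel))"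
    and "B0 \<equiv> (\<lambda>f g. \<integral>p. (f (fst p) - f (snd p)) * (g (fst p) - g (snd p)) * riesz_kernel \<alpha> (fst p - snd p) \<partial>(lborel \<Otimes>\<^sub>M lborel))"
    and "d \<equiv> (\<lambda>x. u x - v x)"
  assumes eq: "B u u = c * B0 v u" "B u v = c * B0 v v"
  shows "B d d = - (\<integral>p. (v (fst p) - v (snd p)) * (d (fst p) - d (snd p)) * riesz_kernel \<alpha> (fst p - snd p) * (\<kappa> p - c) \<partial>(lborel \<Otimes>\<^sub>M lborel))"
proof -
  let ?M = "(lborel \<Otimes>\<^sub>M lborel) :: ('a \<times> 'a) measure"
  let ?H = "\<lambda>f g p. (f (fst p) - f (snd p)) * (g (fst p) - g (snd p)) * riesz_kernel \<alpha> (fst p - snd p)"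
  have dm[measurable]: "d \<in> borel_measurable borel" unfolding d_def by measurable
  have d_fin: "energy \<alpha> d < \<infinity>"
    unfolding d_def by (rule le_less_trans[OF energy_diff_le[OF u v]]) (use en in \<open>auto simp: ennreal_mult_less_top\<close>)
  have iB: "integrable ?M (\<lambda>p. ?H f g p * \<kappa> p)" and iB0: "integrable ?M (?H f g)"
    if "f \<in> borel_measurable borel" "g \<in> borel_measurable borel" "energy \<alpha> f < \<infinity>" "energy \<alpha> g < \<infinity>" for f g
    using integrable_energy_product_coeff[OF that \<kappa> M] integrable_energy_product[OF that] by auto
  \<comment> \<open>Expanded so that u stands in the first place only against u and v, where its
    equation applies; the remaining term has v first and the error second.\<close>
  have "B d d = B u u - B u v - B v d"
  proof -
    have "B u u - B u v - B v d = (\<integral>p. ?H u u p * \<kappa> p - ?H u v p * \<kappa> p - ?H v d p * \<kappa> p \<partial>?M)"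
      unfolding B_def using iB[OF u u en(1,1)] iB[OF u v en(1,2)] iB[OF v dm en(2) d_fin] by simp
    also have "\<dots> = B d d" unfolding B_def
      by (rule Bochner_Integration.integral_cong) (auto simp: d_def algebra_simps)
    finally show ?thesis by simp
  qed
  also have "\<dots> = c * B0 v u - c * B0 v v - B v d" by (simp add: eq)
  also have "\<dots> = (\<integral>p. c * ?H v u p - c * ?H v v p - ?H v d p * \<kappa> p \<partial>?M)"
    unfolding B_def B0_def using iB0[OF v u en(2,1)] iB0[OF v v en(2,2)] iB[OF v dm en(2) d_fin] by simp
  also have "\<dots> = (\<integral>p. - (?H v d p * (\<kappa> p - c)) \<partial>?M)"
    by (rule Bochner_Integration.integral_cong) (auto simp: d_def algebra_simps)
  finally show ?thesis by simp
qed

theorem theorem1p1: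
  fixes \<alpha> \<beta> \<Lambda> :: real
    and K :: "real ^ 'd \<Rightarrow> real ^ 'd \<Rightarrow> real"
    and D :: "(real ^ 'd) set"
    and h ubar :: "real ^ 'd \<Rightarrow> real"
  assumes alpha: "0 < \<alpha>" "\<alpha> < 2"
    and K_C2: "C_k 2 UNIV (\<lambda>(x, y). K x y)"
    and K_periodic: "\<And>x y k l. k \<in> int_lattice \<Longrightarrow> l \<in> int_lattice \<Longrightarrow> K (x + k) (y + l) = K x y"
    and K_sym: "\<And>x y. K x y = K y x"
    and Lambda: "1 \<le> \<Lambda>"
    and K_bounds: "\<And>x y. inverse \<Lambda> \<le> K x y \<and> K x y \<le> \<Lambda>"
    and D: "bounded D" "C11_domain D"
    and beta: "4 < \<alpha> + \<beta>" "\<beta> \<notin> \<int>" "\<alpha> + \<beta> \<notin> \<int>"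
    and h: "h \<in> weighted_hoelder D \<beta> (\<alpha> / 2)"
    and ubar_space: "ubar \<in> weighted_hoelder D (\<alpha> + \<beta>) (- \<alpha> / 2)" "continuous_on (closure D) ubar"
    and ubar_eq: "\<And>x. x \<in> D \<Longrightarrow> has_nonlocal_op \<alpha> (\<lambda>_ _. torus_mean K) ubar x (h x)"
    and ubar_ext: "\<And>x. x \<notin> D \<Longrightarrow> ubar x = 0"
  shows "\<exists>C\<^sub>1>0. \<forall>\<epsilon>\<in>{0<..<1}. \<forall>u. (u, h) \<in> dirichlet_generator \<alpha> (osc \<epsilon> K) D \<longrightarrow>
    (\<integral>\<^sup>+x\<in>D. ennreal \<bar>u x - ubar x\<bar> \<partial>lborel)
      \<le> ennreal (C\<^sub>1 * (if \<alpha> < 1 then \<epsilon> powr (\<alpha> / 2)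
                        else if \<alpha> = 1 then \<epsilon> powr (1 / 2) * (1 + \<bar>ln \<epsilon>\<bar>\<^sup>2)
                        else \<epsilon> powr ((2 - \<alpha>) / 2)))"
proof -
  let ?M = "(lborel \<Otimes>\<^sub>M lborel) :: ((real^'d) \<times> (real^'d)) measure"
  define v where "v = ubar"
  have op: "open D" by (rule C11_domain_open[OF D(2)])
  have ne: "frontier D \<noteq> {}" by (rule frontier_ne[OF D])
  have Dm[measurable]: "D \<in> sets borel" using op by auto
  have cD: "compact (closure D)" using D(1) by (simp add: compact_closure)
  have out: "x \<notin> D" if "x \<notin> closure D" for x using that closure_subset by blast
  have v0: "v x = 0" if "x \<notin> D" for x using ubar_ext that by (simp add: v_def)
  have h0: "h x = 0" if "x \<notin> D" for x using h that by (auto simp: weighted_hoelder_def)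
  have vc: "continuous_on UNIV v" and hc: "continuous_on UNIV h"
    using ubar_space(1) h by (auto simp: weighted_hoelder_def v_def)
  have vm[measurable]: "v \<in> borel_measurable borel" and hm[measurable]: "h \<in> borel_measurable borel"
    using vc hc by (auto intro: borel_measurable_continuous_onI)
  obtain Mv where Mv: "Mv \<ge> 0" "\<And>x. \<bar>v x\<bar> \<le> Mv"
  proof (rule continuous_bounded_of_support[OF cD vc])
    show "v x = 0" if "x \<notin> closure D" for x using v0 out that by blast
  qed (rule that)
  obtain Mh where Mh: "Mh \<ge> 0" "\<And>x. \<bar>h x\<bar> \<le> Mh"
  proof (rule continuous_bounded_of_support[OF cD hc])
    show "h x = 0" if "x \<notin> closure D" for x using h0 out that by blast
  qed (rule that)
  have finD: "emeasure lborel D < \<infinity>" using emeasure_bounded_finite[OF D(1)] by simp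
  define mD where "mD = measure lborel D"
  have mD: "emeasure lborel D = ennreal mD" "0 \<le> mD"
    using finD by (auto simp: mD_def emeasure_eq_ennreal_measure less_top)
  have h2: "(\<integral>\<^sup>+x. ennreal ((h x)\<^sup>2) \<partial>lborel) < \<infinity>"
  proof (rule le_less_trans)
    show "(\<integral>\<^sup>+x. ennreal ((h x)\<^sup>2) \<partial>lborel) \<le> (\<integral>\<^sup>+x. ennreal (Mh\<^sup>2) * indicator D x \<partial>lborel)"
    proof (rule nn_integral_mono)
      fix x
      have "(h x)\<^sup>2 \<le> Mh\<^sup>2" using Mh by (simp add: abs_le_square_iff[symmetric])
      then show "ennreal ((h x)\<^sup>2) \<le> ennreal (Mh\<^sup>2) * indicator D x"
        using h0[of x] by (cases "x \<in> D") (auto intro: ennreal_leI)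
    qed
    show "(\<integral>\<^sup>+x. ennreal (Mh\<^sup>2) * indicator D x \<partial>lborel) < \<infinity>"
      using finD by (simp add: nn_integral_cmult_indicator ennreal_mult_less_top)
  qed
  have "nat \<lfloor>\<alpha> + \<beta>\<rfloor> \<ge> 2" using beta(1) by (simp add: le_nat_iff le_floor_iff)
  then have C2: "C_k 2 D v" using ubar_space(1) C_k_mono by (auto simp: weighted_hoelder_def v_def)
  have vspace: "v \<in> weighted_hoelder D (\<alpha> + \<beta>) (- (\<alpha> / 2))" using ubar_space(1) by (simp add: v_def)
  obtain C0 where C0: "C0 > 0" "boundary_modulus D (\<alpha> / 2) v C0"
    using weighted_hoelder_modulus[OF op vspace _ _ _ ne] beta(1) alpha unfolding boundary_modulus_def by auto
  have Dfr: "x \<notin> frontier D" if "x \<in> D" for x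
    using op that by (metis disjoint_iff frontier_disjoint_eq)
  have env: "energy \<alpha> v < \<infinity>"
  proof -
    \<comment> \<open>The modulus requires (\<alpha> + s) / 2 \<le> 1, and integrability of the
      weight with exponent -s requires s < 1.\<close>
    define s where "s = min (1/2) (2 - \<alpha>)"
    have s: "0 < s" "s < 1" "s \<le> 2 - \<alpha>" using alpha by (auto simp: s_def)
    obtain Cb where Cb: "Cb > 0" "(\<integral>\<^sup>+x\<in>D - frontier D. ennreal (bdist D x powr -s) \<partial>lborel) \<le> ennreal (Cb / (1 - s))"
      using nn_integral_bdist_powr_le[OF D Dm D(1)] s by blast
    have "D - frontier D = D" using Dfr by blast
    then have c: "(\<integral>\<^sup>+x\<in>D. ennreal (bdist D x powr -s) \<partial>lborel) \<le> ennreal (Cb / (1 - s))" "0 \<le> Cb / (1 - s)"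
      using Cb s by auto
    show ?thesis
      by (rule energy_increment_finite[OF op D(1) vm v0, where w = "\<lambda>x. C0 * bdist D x powr -(s/2)"
            and s = s and Mv = Mv and c = "C0\<^sup>2 * (Cb / (1 - s))"])
         (use s alpha Mv C0 c boundary_modulus_increment[OF C0(2)] Dfr nn_integral_boundary_weight[OF c Dm]
           mult_nonneg_nonneg[OF zero_le_power2[of C0] c(2)] in auto)
  qed
  \<comment> \<open>The identity for the error tests both equations with u and with v, so the limit
    has to be an admissible test function too.\<close>
  have vW: "v \<in> W0 \<alpha> D" by (rule truncated_in_W0[OF op D(1) C2 vc v0 Mv(2) env])
  have weak: "torus_mean K * (\<integral>p. (v (fst p) - v (snd p)) * (g (fst p) - g (snd p)) * riesz_kernel \<alpha> (fst p - snd p) \<partial>?M)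
      = - 2 * (\<integral>x. h x * g x \<partial>lborel)" if "g \<in> W0 \<alpha> D" for g
    by (rule weak_form_W0[OF op D(1) alpha C2 vm Mv(2) env that hm h2 _ W0_L2_finite[OF op D(1) that]])
       (use ubar_eq in \<open>simp add: v_def\<close>)
  have Kpos: "0 < inverse \<Lambda>" using Lambda by simp
  have Kabs: "\<bar>K x y\<bar> \<le> \<Lambda>" for x y using K_bounds[of x y] Kpos by linarith
  define F where "F = (\<lambda>p. K (fst p) (snd p) - torus_mean K)"
  have Fm: "F \<in> borel_measurable borel" and Fmean: "\<And>p. (\<integral>q. indicator (cbox 0 One) q * F (q + p) \<partial>lborel) = 0"
    unfolding F_def using kernel_mean_zero[OF K_C2 K_periodic Kabs] by auto
  define M where "M = \<Lambda> + \<bar>torus_mean K\<bar>"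
  have M: "M > 0" using Lambda by (simp add: M_def)
  have FM: "\<bar>F p\<bar> \<le> M" for p using Kabs[of "fst p" "snd p"] unfolding F_def M_def by linarith
  obtain R where R: "R > 0" "D \<subseteq> ball 0 R" using D(1) by (metis bounded_subset_ballD)
  \<comment> \<open>Translations by \<epsilon> q with \<epsilon> < 1 move points by at most d, so
    neither a point outside this ball nor any of its translates lies in the domain. The ball is the
    same for all \<epsilon>.\<close>
  define B where "B = ball (0 :: real^'d) (R + DIM(real^'d))"
  have B: "B \<in> sets borel" "bounded B" "D \<subseteq> B" using R by (auto simp: B_def)
  obtain A where A: "A \<ge> 0" "\<And>\<epsilon>. 0 < \<epsilon> \<Longrightarrow> \<epsilon> < 1 \<Longrightarrow> \<exists>y x. 0 \<le> y \<and> 0 \<le> x \<and> cut_energy \<epsilon> \<alpha> v \<le> ennreal y \<and>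
      (\<integral>\<^sup>+x\<in>B. (reg_op \<epsilon> \<alpha> v x)\<^sup>2 \<partial>lborel) \<le> ennreal x \<and> y + \<epsilon> powr \<alpha> * x \<le> A * (hom_rate \<alpha> \<epsilon>)\<^sup>2"
    using rate_bound[OF D vm v0 C0(2) less_imp_le[OF C0(1)] alpha Mv(2) B] by blast
  obtain C where C: "C > 0" and osc_le: "\<And>(\<epsilon>::real) (v :: real^'d \<Rightarrow> real) g F M B \<eta> x y e.
    \<lbrakk>0 < \<epsilon>; 0 < \<eta>; v \<in> borel_measurable borel; g \<in> borel_measurable borel;
    energy \<alpha> v < \<infinity>; cut_energy \<epsilon> \<alpha> v \<le> ennreal y; energy \<alpha> g \<le> ennreal e;
    B \<in> sets borel; (\<integral>\<^sup>+x\<in>B. (reg_op \<epsilon> \<alpha> v x)\<^sup>2 \<partial>lborel) \<le> ennreal x; 0 \<le> y; 0 \<le> e; 0 \<le> x;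
    \<forall>x. x \<notin> B \<longrightarrow> g x = 0 \<and> (\<forall>q\<in>cbox 0 One. g (x + \<epsilon> *\<^sub>R q) = 0);
    F \<in> borel_measurable borel; \<forall>p. \<bar>F p\<bar> \<le> M;
    \<forall>p. (\<integral>q. indicator (cbox 0 One) q * F (q + p) \<partial>lborel) = 0\<rbrakk> \<Longrightarrow>
    \<bar>\<integral>p. (v (fst p) - v (snd p)) * (g (fst p) - g (snd p)) * riesz_kernel \<alpha> (fst p - snd p) * F (p /\<^sub>R \<epsilon>) \<partial>?M\<bar>
      \<le> C * M * ((y + \<epsilon> powr \<alpha> * x) / \<eta> + \<eta> * e)"
    using oscillating_form_le[OF alpha(1), where 'a = "real^'d"] by (elim exE conjE) (rule that, assumption, simp)
  obtain k where k: "k > 0" and poincare: "\<And>w. w \<in> borel_measurable borel \<Longrightarrow> (\<And>x. x \<notin> D \<Longrightarrow> w x = (0::real)) \<Longrightarrow>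
    ennreal k * (\<integral>\<^sup>+x. ennreal ((w x)\<^sup>2) \<partial>lborel) \<le> energy \<alpha> w"
    using fractional_poincare[OF D(1) Dm alpha(1)] by blast
  \<comment> \<open>Once half of the energy is absorbed, the rest is at most 4 \<Lambda>^2 (C M)^2
    times the remainder, and that is at most A times the squared rate.\<close>
  define C2 where "C2 = 4 * \<Lambda>\<^sup>2 * (C * M)\<^sup>2 * A"
  have C2: "C2 \<ge> 0" using A(1) by (simp add: C2_def)
  \<comment> \<open>The summands belong to the two terms of the final splitting: the volume times
    \<rho>, and the integral of w^2 divided by \<rho>. The 1 makes the constant positive.\<close>
  define C1 where "C1 = mD + C2 / k + 1"
  have C1: "C1 > 0" using mD C2 k by (simp add: C1_def add_nonneg_pos)
  show ?thesis
    unfolding hom_rate_def[symmetric]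
  proof (intro exI[of _ C1] conjI ballI allI impI C1)
    fix \<epsilon> :: real and u assume "\<epsilon> \<in> {0<..<1}" and gen: "(u, h) \<in> dirichlet_generator \<alpha> (osc \<epsilon> K) D"
    then have \<epsilon>: "0 < \<epsilon>" "\<epsilon> < 1" by auto
    have uW: "u \<in> W0 \<alpha> D" and ueq: "\<And>g. g \<in> W0 \<alpha> D \<Longrightarrow> dirichlet_form \<alpha> (osc \<epsilon> K) u g = - (\<integral>x\<in>D. h x * g x \<partial>lborel)"
      using gen by (auto simp: dirichlet_generator_def)
    have um[measurable]: "u \<in> borel_measurable borel" by (rule W0_borel[OF uW])
    have enu: "energy \<alpha> u < \<infinity>" by (rule W0_energy_finite[OF op D(1) alpha uW])
    define \<kappa> where "\<kappa> p = K (fst p /\<^sub>R \<epsilon>) (snd p /\<^sub>R \<epsilon>)" for p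
    have \<kappa>F: "\<kappa> p = F (p /\<^sub>R \<epsilon>) + torus_mean K" for p by (simp add: \<kappa>_def F_def)
    have \<kappa>m[measurable]: "\<kappa> \<in> borel_measurable borel"
    proof -
      note Fm[measurable]
      show ?thesis unfolding \<kappa>F[abs_def] by measurable
    qed
    have \<kappa>b: "\<bar>\<kappa> p\<bar> \<le> \<Lambda>" "inverse \<Lambda> \<le> \<kappa> p" for p using Kabs K_bounds by (auto simp: \<kappa>_def)
    have hint: "(\<integral>x\<in>D. h x * g x \<partial>lborel) = (\<integral>x. h x * g x \<partial>lborel)" for g
      unfolding set_lebesgue_integral_def by (rule Bochner_Integration.integral_cong) (use h0 in \<open>auto simp: indicator_def\<close>)
    \<comment> \<open>\<open>dirichlet_form\<close> carries the factor 1/2, which is why the weak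
      form of the limit equation was stated with -2.\<close>
    have ueq': "(\<integral>p. (u (fst p) - u (snd p)) * (g (fst p) - g (snd p)) * riesz_kernel \<alpha> (fst p - snd p) * \<kappa> p \<partial>?M)
      = torus_mean K * (\<integral>p. (v (fst p) - v (snd p)) * (g (fst p) - g (snd p)) * riesz_kernel \<alpha> (fst p - snd p) \<partial>?M)"
      if "g \<in> W0 \<alpha> D" for g
      using ueq[OF that] weak[OF that] unfolding dirichlet_form_eq hint osc_def \<kappa>_def by simp
    define d where "d x = u x - v x" for x
    have dm[measurable]: "d \<in> borel_measurable borel" unfolding d_def[abs_def] by measurable
    have d_fin: "energy \<alpha> d < \<infinity>"
      unfolding d_def[abs_def] by (rule le_less_trans[OF energy_diff_le[OF um vm]]) (use enu env in \<open>auto simp: ennreal_mult_less_top\<close>)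
    \<comment> \<open>Members of \<open>W0\<close> vanish off \<open>D\<close> only almost
      everywhere, whereas the oscillation estimate and the Poincare inequality want it at every
      point. The modified error has the same energy.\<close>
    define w where "w x = indicator D x * d x" for x
    have wm[measurable]: "w \<in> borel_measurable borel" unfolding w_def[abs_def] by measurable
    have w0: "w x = 0" if "x \<notin> D" for x using that by (simp add: w_def)
    have dw: "AE x in lborel. d x = w x"
      using W0_zero_AE[OF op uW] by eventually_elim (auto simp: w_def d_def v0 indicator_def)
    define e where "e = (\<integral>p. (d (fst p) - d (snd p)) * (d (fst p) - d (snd p)) * riesz_kernel \<alpha> (fst p - snd p) \<partial>?M)"
    have e0: "0 \<le> e" unfolding e_def by (rule integral_nonneg_AE) simp
    have ed: "energy \<alpha> d = ennreal e" unfolding e_def by (rule energy_eq_integral[OF dm d_fin])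
    have ew: "energy \<alpha> w = ennreal e" using energy_cong_AE[OF dm wm dw] ed by simp
    define J where "J = (\<integral>p. (v (fst p) - v (snd p)) * (w (fst p) - w (snd p)) * riesz_kernel \<alpha> (fst p - snd p) * F (p /\<^sub>R \<epsilon>) \<partial>?M)"
    \<comment> \<open>Ellipticity: the coefficient is at least 1 / \<Lambda>, so the form of the
      error controls its energy. Replacing d by w alters the integrand on a null set only.\<close>
    have le: "inverse \<Lambda> * e \<le> \<bar>J\<bar>"
    proof -
      let ?H = "\<lambda>p. (d (fst p) - d (snd p)) * (d (fst p) - d (snd p)) * riesz_kernel \<alpha> (fst p - snd p)"
      have "inverse \<Lambda> * e = (\<integral>p. inverse \<Lambda> * ?H p \<partial>?M)" by (simp add: e_def)
      also have "\<dots> \<le> (\<integral>p. ?H p * \<kappa> p \<partial>?M)"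
      proof (rule integral_mono)
        show "integrable ?M (\<lambda>p. inverse \<Lambda> * ?H p)" using integrable_energy_product[OF dm dm d_fin d_fin] by simp
        show "integrable ?M (\<lambda>p. ?H p * \<kappa> p)" by (rule integrable_energy_product_coeff[OF dm dm d_fin d_fin \<kappa>m \<kappa>b(1)])
        fix p
        have "?H p * inverse \<Lambda> \<le> ?H p * \<kappa> p" by (rule mult_left_mono[OF \<kappa>b(2)]) simp
        then show "inverse \<Lambda> * ?H p \<le> ?H p * \<kappa> p" by (simp only: mult.commute[of "inverse \<Lambda>"])
      qed
      also have "\<dots> = - (\<integral>p. (v (fst p) - v (snd p)) * (d (fst p) - d (snd p)) * riesz_kernel \<alpha> (fst p - snd p) * (\<kappa> p - torus_mean K) \<partial>?M)"
        unfolding d_def[abs_def] by (rule error_energy_identity[OF um vm enu env \<kappa>m \<kappa>b(1) ueq'[OF uW] ueq'[OF vW]])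
      also have "(\<integral>p. (v (fst p) - v (snd p)) * (d (fst p) - d (snd p)) * riesz_kernel \<alpha> (fst p - snd p) * (\<kappa> p - torus_mean K) \<partial>?M) = J"
        unfolding J_def
      proof (rule integral_cong_AE)
        note Fm[measurable]
        have [measurable]: "\<kappa> \<in> borel_measurable ?M" "(\<lambda>p. F (p /\<^sub>R \<epsilon>)) \<in> borel_measurable ?M" by (simp_all add: lborel_prod)
        show "(\<lambda>p. (v (fst p) - v (snd p)) * (d (fst p) - d (snd p)) * riesz_kernel \<alpha> (fst p - snd p) * (\<kappa> p - torus_mean K)) \<in> borel_measurable ?M"
          "(\<lambda>p. (v (fst p) - v (snd p)) * (w (fst p) - w (snd p)) * riesz_kernel \<alpha> (fst p - snd p) * F (p /\<^sub>R \<epsilon>)) \<in> borel_measurable ?M"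
          by measurable
        show "AE p in ?M. (v (fst p) - v (snd p)) * (d (fst p) - d (snd p)) * riesz_kernel \<alpha> (fst p - snd p) * (\<kappa> p - torus_mean K)
          = (v (fst p) - v (snd p)) * (w (fst p) - w (snd p)) * riesz_kernel \<alpha> (fst p - snd p) * F (p /\<^sub>R \<epsilon>)"
          using AE_pair_eq[OF dm wm dw] by eventually_elim (simp add: \<kappa>F)
      qed
      finally show ?thesis by linarith
    qed
    obtain y x where yx: "0 \<le> y" "0 \<le> x" "cut_energy \<epsilon> \<alpha> v \<le> ennreal y"
      "(\<integral>\<^sup>+x\<in>B. (reg_op \<epsilon> \<alpha> v x)\<^sup>2 \<partial>lborel) \<le> ennreal x" "y + \<epsilon> powr \<alpha> * x \<le> A * (hom_rate \<alpha> \<epsilon>)\<^sup>2"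
      using A(2)[OF \<epsilon>] by blast
    \<comment> \<open>Chosen such that C M \<eta> e is one half of e / \<Lambda>, the left-hand
      side, and can be absorbed there.\<close>
    define \<eta> where "\<eta> = 1 / (2 * \<Lambda> * (C * M))"
    have \<eta>: "\<eta> > 0" using Lambda C M by (simp add: \<eta>_def)
    have wB: "w x = 0 \<and> (\<forall>q\<in>cbox 0 One. w (x + \<epsilon> *\<^sub>R q) = 0)" if x: "x \<notin> B" for x
    proof (intro conjI ballI)
      show "w x = 0" using x B(3) w0 by blast
      fix q :: "real^'d" assume q: "q \<in> cbox 0 One"
      have "norm (\<epsilon> *\<^sub>R q) \<le> DIM(real^'d)"
        using norm_unit_cube_le[OF q] \<epsilon> mult_left_le_one_le[of "norm q" \<epsilon>] by simp
      moreover have "norm x \<ge> R + DIM(real^'d)" using x by (simp add: B_def)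
      moreover have "norm x \<le> norm (x + \<epsilon> *\<^sub>R q) + norm (\<epsilon> *\<^sub>R q)"
        using norm_triangle_ineq4[of "x + \<epsilon> *\<^sub>R q" "\<epsilon> *\<^sub>R q"] by simp
      ultimately have "norm (x + \<epsilon> *\<^sub>R q) \<ge> R" by linarith
      then have "x + \<epsilon> *\<^sub>R q \<notin> D" using R(2) by force
      then show "w (x + \<epsilon> *\<^sub>R q) = 0" by (rule w0)
    qed
    have "\<bar>J\<bar> \<le> C * M * ((y + \<epsilon> powr \<alpha> * x) / \<eta> + \<eta> * e)"
      unfolding J_def
      by (rule osc_le[OF \<epsilon>(1) \<eta> vm wm env yx(3) _ B(1) yx(4) yx(1) e0 yx(2) _ Fm])
         (use ew wB FM Fmean in auto)
    then have "inverse \<Lambda> * e \<le> C * M * ((y + \<epsilon> powr \<alpha> * x) / \<eta> + \<eta> * e)" using le by linarith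
    also have "\<dots> = 2 * \<Lambda> * (C * M)\<^sup>2 * (y + \<epsilon> powr \<alpha> * x) + inverse \<Lambda> * e / 2"
      unfolding \<eta>_def using Lambda C M by (simp add: field_simps power2_eq_square)
    finally have "inverse \<Lambda> * e \<le> 4 * \<Lambda> * (C * M)\<^sup>2 * (y + \<epsilon> powr \<alpha> * x)" by simp
    then have "\<Lambda> * (inverse \<Lambda> * e) \<le> \<Lambda> * (4 * \<Lambda> * (C * M)\<^sup>2 * (y + \<epsilon> powr \<alpha> * x))"
      using Lambda by (intro mult_left_mono) auto
    moreover have "\<Lambda> * (inverse \<Lambda> * e) = e" using Lambda by simp
    moreover have "\<Lambda> * (4 * \<Lambda> * (C * M)\<^sup>2 * (y + \<epsilon> powr \<alpha> * x)) = 4 * \<Lambda>\<^sup>2 * (C * M)\<^sup>2 * (y + \<epsilon> powr \<alpha> * x)"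
      by (simp only: power2_eq_square[of \<Lambda>] mult_ac)
    ultimately have "e \<le> 4 * \<Lambda>\<^sup>2 * (C * M)\<^sup>2 * (y + \<epsilon> powr \<alpha> * x)" by (simp only:)
    also have "\<dots> \<le> 4 * \<Lambda>\<^sup>2 * (C * M)\<^sup>2 * (A * (hom_rate \<alpha> \<epsilon>)\<^sup>2)" by (intro mult_left_mono yx) auto
    finally have e_le: "e \<le> C2 * (hom_rate \<alpha> \<epsilon>)\<^sup>2" by (simp add: C2_def mult.assoc)
    \<comment> \<open>The rate itself is the weight in |w| \<le> w^2 / \<rho> + \<rho>: the energy
      is of order \<rho>^2 and the domain has finite volume, so both terms are of order
      \<rho>.\<close>
    define \<rho> where "\<rho> = hom_rate \<alpha> \<epsilon>"
    have \<rho>: "\<rho> > 0" unfolding \<rho>_def by (rule hom_rate_pos[OF \<epsilon>(1)])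
    have w2: "(\<integral>\<^sup>+x. ennreal ((w x)\<^sup>2) \<partial>lborel) \<le> ennreal (e / k)"
    proof -
      have "(\<integral>\<^sup>+x. ennreal ((w x)\<^sup>2) \<partial>lborel) = ennreal (1 / k) * (ennreal k * (\<integral>\<^sup>+x. ennreal ((w x)\<^sup>2) \<partial>lborel))"
        using k by (simp add: mult.assoc[symmetric] ennreal_mult[symmetric])
      also have "\<dots> \<le> ennreal (1 / k) * ennreal e"
        using poincare[OF wm w0] ew by (intro mult_left_mono) auto
      also have "\<dots> = ennreal (e / k)" using k e0 by (simp add: ennreal_mult[symmetric])
      finally show ?thesis .
    qed
    have "(\<integral>\<^sup>+x\<in>D. ennreal \<bar>u x - ubar x\<bar> \<partial>lborel) \<le> (\<integral>\<^sup>+x. ennreal (1 / \<rho>) * ennreal ((w x)\<^sup>2) + ennreal \<rho> * indicator D x \<partial>lborel)"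
    proof (rule nn_integral_mono)
      fix x
      show "ennreal \<bar>u x - ubar x\<bar> * indicator D x \<le> ennreal (1 / \<rho>) * ennreal ((w x)\<^sup>2) + ennreal \<rho> * indicator D x"
      proof (cases "x \<in> D")
        case True
        have "\<bar>w x\<bar> \<le> 1 / \<rho> * (w x)\<^sup>2 + \<rho>" using mult_le_weighted_squares[OF \<rho>, of "w x" 1] by simp
        moreover have "w x = u x - ubar x" using True by (simp add: w_def d_def v_def)
        ultimately show ?thesis using True \<rho> ennreal_leI[of "\<bar>w x\<bar>" "1 / \<rho> * (w x)\<^sup>2 + \<rho>"]
          by (simp add: ennreal_mult[symmetric] ennreal_plus[symmetric] del: ennreal_plus)
      qed simp
    qed
    also have "\<dots> = ennreal (1 / \<rho>) * (\<integral>\<^sup>+x. ennreal ((w x)\<^sup>2) \<partial>lborel) + ennreal \<rho> * emeasure lborel D"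
      by (subst nn_integral_add, measurable) (simp add: nn_integral_cmult nn_integral_cmult_indicator)
    also have "\<dots> \<le> ennreal (1 / \<rho>) * ennreal (e / k) + ennreal \<rho> * ennreal mD"
      by (intro add_mono mult_left_mono w2) (auto simp: mD)
    also have "\<dots> = ennreal (1 / \<rho> * (e / k) + \<rho> * mD)"
      using \<rho> e0 k mD by (simp add: ennreal_mult[symmetric] ennreal_plus[symmetric] del: ennreal_plus)
    also have "\<dots> \<le> ennreal (C1 * \<rho>)"
    proof (rule ennreal_leI)
      have "1 / \<rho> * (e / k) \<le> 1 / \<rho> * (C2 * \<rho>\<^sup>2 / k)"
        using e_le \<rho> k by (intro mult_left_mono divide_right_mono) (auto simp: \<rho>_def)
      also have "\<dots> = C2 / k * \<rho>" using \<rho> by (simp add: power2_eq_square)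
      finally show "1 / \<rho> * (e / k) + \<rho> * mD \<le> C1 * \<rho>" using \<rho> by (simp add: C1_def algebra_simps)
    qed
    finally show "(\<integral>\<^sup>+x\<in>D. ennreal \<bar>u x - ubar x\<bar> \<partial>lborel) \<le> ennreal (C1 * hom_rate \<alpha> \<epsilon>)" by (simp add: \<rho>_def)
  qed
qed

end
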